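(* Let $\alpha,\beta,\gamma$ be partitions with $\max\{|\beta|,|\gamma|\}\le|\alpha|\le|\beta|+|\gamma|$. If there is a matrix $A\in\mathcal{H}(\beta,\gamma)_\alpha$ which is H-additive, then $(\alpha,\beta,\gamma)$ is H-stable.
   Context: For a partition $\lambda$ of $n$ (written $\lambda\vdash n$, $|\lambda|=n$), $V_\lambda$ denotes the associated irreducible complex representation of the symmetric group $S_n$. Partitions are viewed as vectors (padded with trailing zeros), so addition of partitions and multiplication by nonnegative integers are coordinatewise. Heisenberg product: let $V$ be a representation of $S_n$ and $W$ a representation of $S_m$. For an integer $l$ with $\max\{m,n\}\le l\le m+n$, put $p=l-m$, $q=n+m-l$, $r=l-n$. Embed $S_p\times S_q\times S_r$ in $S_n\times S_m=S_{p+q}\times S_{q+r}$ as the composite of $\mathrm{id}\times\Delta_{S_q}\times \mathrm{id}: S_p\times S_q\times S_r\to (S_p\times S_q)\times (S_q\times S_r)$ (with $\Delta_{S_q}$ the diagonal) with the standard Young subgroup inclusions $S_p\times S_q\subset S_{p+q}$, $S_q\times S_r\subset S_{q+r}$; also embed $S_p\times S_q\times S_r$ in $S_l=S_{p+q+r}$ as a Young subgroup. Put $(V\#W)_l=\mathrm{Ind}_{S_p\times S_q\times S_r}^{S_l}\mathrm{Res}^{S_n\times S_m}_{S_p\times S_q\times S_r}(V\otimes W)$ and $V\#W=\bigoplus_{l=\max\{n,m\}}^{n+m}(V\#W)_l$. The Heisenberg coefficient $h_{\mu,\nu}^{\lambda}$ is the multiplicity of $V_\lambda$ in $V_\mu\#V_\nu$.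 An H-triple is a triple $(\alpha,\beta,\gamma)$ of partitions with $\max\{|\beta|,|\gamma|\}\le|\alpha|\le|\beta|+|\gamma|$ and $h_{\beta,\gamma}^{\alpha}>0$. An H-triple is H-stable if for every triple of partitions $(\lambda,\mu,\nu)$ with $\max\{|\mu|,|\nu|\}\le|\lambda|\le|\mu|+|\nu|$ the sequence $\{h_{\mu+n\beta,\nu+n\gamma}^{\lambda+n\alpha}\}_n$ is eventually constant. Matrices: for finite sequences $\beta=(\beta_1,\dots,\beta_p)$ and $\gamma=(\gamma_1,\dots,\gamma_q)$, $\mathcal{H}(\beta,\gamma)$ is the set of $(p+1)\times(q+1)$ integer matrices $A=(a_{i,j})$ with $a_{1,1}=0$, $\sum_{j=1}^{q+1}a_{i+1,j}=\beta_i$ for $1\le i\le p$, and $\sum_{i=1}^{p+1}a_{i,j+1}=\gamma_j$ for $1\le j\le q$ (the sums of the first row and of the first column are not prescribed). The $\pi$-sequence $\pi(A)$ is the list of all entries of $A$ arranged in weakly decreasing order; when compared with a partition, trailing zeros are disregarded. $\mathcal{H}(\beta,\gamma)_\alpha$ is the set of $A\in\mathcal{H}(\beta,\gamma)$ with $\pi(A)=\alpha$. A $(p+1)\times(q+1)$ matrix $A=(a_{i,j})$ with nonnegative integer entries and $a_{1,1}=0$ is H-additive if there exist real numbers $x_1=0,x_2,\dots,x_{p+1}$ and $y_1=0,y_2,\dots,y_{q+1}$ such that $a_{i,j}>a_{k,l}$ implies $x_i+y_j>x_k+y_l$ for all $(i,j),(k,l)\in\{1,\dots,p+1\}\times\{1,\dots,q+1\}\setminus\{(1,1)\}$.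 *)

theory Defs
  imports
    Complex_Main
    "HOL-Library.Function_Algebras"
    "HOL-Algebra.Sym_Groups"
    "Jordan_Normal_Form.Matrix"
begin

section \<open>Complex representations of finite groups\<close>

definition fscale :: "complex \<Rightarrow> ('x \<Rightarrow> complex) \<Rightarrow> 'x \<Rightarrow> complex" where
  "fscale c f = (\<lambda>x. c * f x)"

interpretation fun_vs: vector_space "fscale :: complex \<Rightarrow> ('x \<Rightarrow> complex) \<Rightarrow> 'x \<Rightarrow> complex"
  by unfold_locales (auto simp: fscale_def fun_eq_iff algebra_simps)

text \<open>
  The vector space of a representation is a subspace of a function space; the operators
  \<open>repr_act V g\<close> matter only on \<open>repr_space V\<close>. Being functions, vectors have coordinates, in which
  tensor products and induced representations can be written down without choosing bases.
\<close>

record ('g, 'x) repr =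
  repr_space :: "('x \<Rightarrow> complex) set"
  repr_act :: "'g \<Rightarrow> ('x \<Rightarrow> complex) \<Rightarrow> ('x \<Rightarrow> complex)"

definition is_repr :: "('g, 'm) monoid_scheme \<Rightarrow> ('g, 'x) repr \<Rightarrow> bool" where
  "is_repr G V \<longleftrightarrow>
     fun_vs.subspace (repr_space V) \<and>
     (\<exists>B. finite B \<and> repr_space V = fun_vs.span B) \<and>
     (\<forall>g\<in>carrier G. \<forall>v\<in>repr_space V. repr_act V g v \<in> repr_space V) \<and>
     (\<forall>g\<in>carrier G. \<forall>v\<in>repr_space V. \<forall>w\<in>repr_space V.
        repr_act V g (v + w) = repr_act V g v + repr_act V g w) \<and>
     (\<forall>g\<in>carrier G. \<forall>c. \<forall>v\<in>repr_space V. repr_act V g (fscale c v) = fscale c (repr_act V g v)) \<and>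
     (\<forall>v\<in>repr_space V. repr_act V \<one>\<^bsub>G\<^esub> v = v) \<and>
     (\<forall>g\<in>carrier G. \<forall>h\<in>carrier G. \<forall>v\<in>repr_space V.
        repr_act V (g \<otimes>\<^bsub>G\<^esub> h) v = repr_act V g (repr_act V h v))"

definition subrepr :: "('x \<Rightarrow> complex) set \<Rightarrow> ('g, 'x) repr \<Rightarrow> ('g, 'x) repr" where
  "subrepr U V = V\<lparr>repr_space := U\<rparr>"

definition invariant_subspace ::
    "('g, 'm) monoid_scheme \<Rightarrow> ('g, 'x) repr \<Rightarrow> ('x \<Rightarrow> complex) set \<Rightarrow> bool" where
  "invariant_subspace G V U \<longleftrightarrow>
     fun_vs.subspace U \<and> U \<subseteq> repr_space V \<and> (\<forall>g\<in>carrier G. \<forall>u\<in>U. repr_act V g u \<in> U)"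

definition irreducible_repr :: "('g, 'm) monoid_scheme \<Rightarrow> ('g, 'x) repr \<Rightarrow> bool" where
  "irreducible_repr G V \<longleftrightarrow>
     is_repr G V \<and> repr_space V \<noteq> {0} \<and>
     (\<forall>U. invariant_subspace G V U \<longrightarrow> U = {0} \<or> U = repr_space V)"

definition iso_repr :: "('g, 'm) monoid_scheme \<Rightarrow> ('g, 'x) repr \<Rightarrow> ('g, 'y) repr \<Rightarrow> bool" where
  "iso_repr G V W \<longleftrightarrow>
     (\<exists>T. bij_betw T (repr_space V) (repr_space W) \<and>
          (\<forall>v\<in>repr_space V. \<forall>w\<in>repr_space V. T (v + w) = T v + T w) \<and>
          (\<forall>c. \<forall>v\<in>repr_space V. T (fscale c v) = fscale c (T v)) \<and>
          (\<forall>g\<in>carrier G. \<forall>v\<in>repr_space V. T (repr_act V g v) = repr_act W g (T v)))"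

definition direct_decomposition ::
    "('x \<Rightarrow> complex) set \<Rightarrow> ('x \<Rightarrow> complex) set set \<Rightarrow> bool" where
  "direct_decomposition S \<U> \<longleftrightarrow>
     finite \<U> \<and> (\<forall>U\<in>\<U>. fun_vs.subspace U \<and> U \<subseteq> S) \<and>
     (\<forall>w\<in>S. \<exists>!f. f \<in> (\<Pi>\<^sub>E U\<in>\<U>. U) \<and> w = (\<Sum>U\<in>\<U>. f U))"

text \<open>
  The multiplicity of an irreducible \<open>V\<close> in \<open>W\<close>: the number of summands isomorphic to \<open>V\<close> in a
  decomposition of \<open>W\<close> into irreducibles. The irreducible summands are nonzero, hence
  pairwise distinct as subspaces, so counting the set \<open>\<U>\<close> counts with multiplicity.
\<close>

definition multiplicity_repr ::
    "('g, 'm) monoid_scheme \<Rightarrow> ('g, 'x) repr \<Rightarrow> ('g, 'y) repr \<Rightarrow> nat" where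
  "multiplicity_repr G V W =
     (THE k. \<exists>\<U>. direct_decomposition (repr_space W) \<U> \<and>
        (\<forall>U\<in>\<U>. invariant_subspace G W U \<and> irreducible_repr G (subrepr U W)) \<and>
        k = card {U \<in> \<U>. iso_repr G V (subrepr U W)})"

text \<open>
  \<open>V \<otimes> W\<close> as a representation of \<open>G \<times> H\<close>. The space is spanned by the pure tensors
  \<open>(x, y) \<mapsto> v x * w y\<close>. For \<open>F\<close> in it, all slices \<open>F (\<cdot>, y)\<close> lie in \<open>repr_space V\<close> and all
  slices \<open>F (x, \<cdot>)\<close> in \<open>repr_space W\<close>; \<open>g\<close> acts on the former and \<open>h\<close> on the latter, so that a
  pure tensor \<open>v \<otimes> w\<close> goes to \<open>g v \<otimes> h w\<close>.
\<close>

definition tensor_repr :: "('g, 'x) repr \<Rightarrow> ('h, 'y) repr \<Rightarrow> ('g \<times> 'h, 'x \<times> 'y) repr" where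
  "tensor_repr V W =
     \<lparr>repr_space = fun_vs.span {(\<lambda>(x, y). v x * w y) | v w. v \<in> repr_space V \<and> w \<in> repr_space W},
      repr_act = (\<lambda>(g, h) F (x, y). repr_act W h (\<lambda>y'. repr_act V g (\<lambda>x'. F (x', y')) x) y)\<rparr>"

definition res_repr :: "('k \<Rightarrow> 'g) \<Rightarrow> ('g, 'x) repr \<Rightarrow> ('k, 'x) repr" where
  "res_repr \<phi> V = \<lparr>repr_space = repr_space V, repr_act = (\<lambda>k. repr_act V (\<phi> k))\<rparr>"

text \<open>
  Induction along an embedding \<open>\<phi>\<close> of a finite group \<open>K\<close> into a finite group \<open>G\<close>: the space of
  \<open>K\<close>-equivariant functions \<open>f : G \<rightarrow> V\<close>, \<open>f (\<phi> k * g) = k (f g)\<close>, on which \<open>G\<close> acts by right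
  translation. A function \<open>f\<close> into \<open>repr_space V\<close> is stored uncurried, extended by 0 outside \<open>G\<close>.
\<close>

definition ind_repr ::
    "('k, 'm) monoid_scheme \<Rightarrow> ('g, 'n) monoid_scheme \<Rightarrow> ('k \<Rightarrow> 'g) \<Rightarrow> ('k, 'x) repr
      \<Rightarrow> ('g, 'g \<times> 'x) repr" where
  "ind_repr K G \<phi> V =
     \<lparr>repr_space = {F. (\<forall>g\<in>carrier G. curry F g \<in> repr_space V) \<and>
                  (\<forall>g. g \<notin> carrier G \<longrightarrow> curry F g = 0) \<and>
                  (\<forall>k\<in>carrier K. \<forall>g\<in>carrier G.
                     curry F (\<phi> k \<otimes>\<^bsub>G\<^esub> g) = repr_act V k (curry F g))},
      repr_act = (\<lambda>g F (x, v). if x \<in> carrier G then F (x \<otimes>\<^bsub>G\<^esub> g, v) else 0)\<rparr>"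


section \<open>Partitions and Specht modules\<close>

text \<open>Partitions are infinite sequences with trailing zeros; the parts are \<open>\<kappa> 0, \<kappa> 1, \<dots>\<close>.\<close>

definition is_partition :: "(nat \<Rightarrow> nat) \<Rightarrow> bool" where
  "is_partition \<kappa> \<longleftrightarrow> antimono \<kappa> \<and> finite {i. \<kappa> i \<noteq> 0}"

definition psize :: "(nat \<Rightarrow> nat) \<Rightarrow> nat" where
  "psize \<kappa> = (\<Sum>i | \<kappa> i \<noteq> 0. \<kappa> i)"

text \<open>
  The cells (row, column) of the Young diagram, in reading order. The canonical tableau has the
  number \<open>k\<close>, \<open>1 \<le> k \<le> |\<kappa>|\<close>, in the \<open>k\<close>-th cell.
\<close>

definition cells :: "(nat \<Rightarrow> nat) \<Rightarrow> (nat \<times> nat) list" where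
  "cells \<kappa> = [(i, j). i \<leftarrow> [0..<card {i. \<kappa> i \<noteq> 0}], j \<leftarrow> [0..<\<kappa> i]]"

definition row_of :: "(nat \<Rightarrow> nat) \<Rightarrow> nat \<Rightarrow> nat" where
  "row_of \<kappa> k = (if k \<in> {1..psize \<kappa>} then fst (cells \<kappa> ! (k - 1)) else 0)"

definition col_of :: "(nat \<Rightarrow> nat) \<Rightarrow> nat \<Rightarrow> nat" where
  "col_of \<kappa> k = (if k \<in> {1..psize \<kappa>} then snd (cells \<kappa> ! (k - 1)) else 0)"

definition col_stabilizer :: "(nat \<Rightarrow> nat) \<Rightarrow> (nat \<Rightarrow> nat) set" where
  "col_stabilizer \<kappa> =
     {q \<in> carrier (sym_group (psize \<kappa>)). \<forall>k\<in>{1..psize \<kappa>}. col_of \<kappa> (q k) = col_of \<kappa> k}"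

text \<open>
  A permutation \<open>g\<close> stands for the tableau having \<open>g k\<close> in the \<open>k\<close>-th cell, and a tabloid is
  the function sending each number to its row. The column stabilizer of the tableau \<open>g\<close> consists
  of the \<open>g \<circ> q \<circ> inv g\<close>, which take it to the tableaux \<open>g \<circ> q\<close>, for \<open>q\<close> in the column stabilizer
  of the canonical tableau.
\<close>

definition tabloid :: "(nat \<Rightarrow> nat) \<Rightarrow> (nat \<Rightarrow> nat) \<Rightarrow> (nat \<Rightarrow> nat)" where
  "tabloid \<kappa> g = row_of \<kappa> \<circ> Hilbert_Choice.inv g"

definition polytabloid :: "(nat \<Rightarrow> nat) \<Rightarrow> (nat \<Rightarrow> nat) \<Rightarrow> (nat \<Rightarrow> nat) \<Rightarrow> complex" where
  "polytabloid \<kappa> g =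
     (\<lambda>t. \<Sum>q\<in>col_stabilizer \<kappa>. of_int (sign q) * (if t = tabloid \<kappa> (g \<circ> q) then 1 else 0))"

text \<open>
  The irreducible representation \<open>V\<^sub>\<kappa>\<close> of the symmetric group. A permutation \<open>g\<close> takes the
  tabloid \<open>t\<close> to \<open>t \<circ> inv g\<close>, hence the function \<open>f\<close> on tabloids to \<open>\<lambda>t. f (t \<circ> g)\<close>.
\<close>

definition specht :: "(nat \<Rightarrow> nat) \<Rightarrow> (nat \<Rightarrow> nat, nat \<Rightarrow> nat) repr" where
  "specht \<kappa> =
     \<lparr>repr_space = fun_vs.span (polytabloid \<kappa> ` carrier (sym_group (psize \<kappa>))),
      repr_act = (\<lambda>g f t. f (t \<circ> g))\<rparr>"


section \<open>Heisenberg product and Heisenberg coefficients\<close>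

text \<open>The Young subgroup inclusion \<open>S\<^sub>a \<times> S\<^sub>b \<subseteq> S\<^bsub>a+b\<^esub>\<close>.\<close>

definition young_embed :: "nat \<Rightarrow> (nat \<Rightarrow> nat) \<Rightarrow> (nat \<Rightarrow> nat) \<Rightarrow> (nat \<Rightarrow> nat)" where
  "young_embed a s t = (\<lambda>i. if i \<le> a then s i else a + t (i - a))"

text \<open>\<open>heisenberg_component n m l V W\<close> is \<open>(V # W)\<^sub>l\<close> for \<open>V\<close> over \<open>S\<^sub>n\<close> and \<open>W\<close> over \<open>S\<^sub>m\<close>.\<close>

definition heisenberg_component ::
    "nat \<Rightarrow> nat \<Rightarrow> nat \<Rightarrow> (nat \<Rightarrow> nat, 'x) repr \<Rightarrow> (nat \<Rightarrow> nat, 'y) repr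
      \<Rightarrow> (nat \<Rightarrow> nat, (nat \<Rightarrow> nat) \<times> 'x \<times> 'y) repr" where
  "heisenberg_component n m l V W =
     (let p = l - m; q = n + m - l; r = l - n in
      ind_repr (sym_group p \<times>\<times> sym_group q \<times>\<times> sym_group r) (sym_group l)
        (\<lambda>(s, t, u). young_embed (p + q) (young_embed p s t) u)
        (res_repr (\<lambda>(s, t, u). (young_embed p s t, young_embed q t u)) (tensor_repr V W)))"

definition admissible_sizes :: "(nat \<Rightarrow> nat) \<Rightarrow> (nat \<Rightarrow> nat) \<Rightarrow> (nat \<Rightarrow> nat) \<Rightarrow> bool" where
  "admissible_sizes \<kappa> \<mu> \<nu> \<longleftrightarrow>
     max (psize \<mu>) (psize \<nu>) \<le> psize \<kappa> \<and> psize \<kappa> \<le> psize \<mu> + psize \<nu>"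

text \<open>
  \<open>heisenberg_coeff \<kappa> \<mu> \<nu>\<close> is \<open>h\<^sup>\<kappa>\<close> with lower indices \<open>\<mu>, \<nu>\<close>. As \<open>V\<^sub>\<kappa>\<close> is a representation of
  \<open>S\<^sub>l\<close> for \<open>l = |\<kappa>|\<close>, it can only occur in the component of degree \<open>l\<close> of \<open>V\<^sub>\<mu> # V\<^sub>\<nu>\<close>.
\<close>

definition heisenberg_coeff :: "(nat \<Rightarrow> nat) \<Rightarrow> (nat \<Rightarrow> nat) \<Rightarrow> (nat \<Rightarrow> nat) \<Rightarrow> nat" where
  "heisenberg_coeff \<kappa> \<mu> \<nu> =
     (if admissible_sizes \<kappa> \<mu> \<nu>
      then multiplicity_repr (sym_group (psize \<kappa>)) (specht \<kappa>)
             (heisenberg_component (psize \<mu>) (psize \<nu>) (psize \<kappa>) (specht \<mu>) (specht \<nu>))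
      else 0)"

definition H_triple :: "(nat \<Rightarrow> nat) \<Rightarrow> (nat \<Rightarrow> nat) \<Rightarrow> (nat \<Rightarrow> nat) \<Rightarrow> bool" where
  "H_triple \<alpha> \<beta> \<gamma> \<longleftrightarrow>
     is_partition \<alpha> \<and> is_partition \<beta> \<and> is_partition \<gamma> \<and> admissible_sizes \<alpha> \<beta> \<gamma> \<and>
     heisenberg_coeff \<alpha> \<beta> \<gamma> > 0"

definition H_stable :: "(nat \<Rightarrow> nat) \<Rightarrow> (nat \<Rightarrow> nat) \<Rightarrow> (nat \<Rightarrow> nat) \<Rightarrow> bool" where
  "H_stable \<alpha> \<beta> \<gamma> \<longleftrightarrow>
     H_triple \<alpha> \<beta> \<gamma> \<and>
     (\<forall>\<kappa> \<mu> \<nu>. is_partition \<kappa> \<and> is_partition \<mu> \<and> is_partition \<nu> \<and> admissible_sizes \<kappa> \<mu> \<nu> \<longrightarrow>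
        (\<exists>c. \<forall>\<^sub>F n in sequentially.
           heisenberg_coeff (\<lambda>i. \<kappa> i + n * \<alpha> i) (\<lambda>i. \<mu> i + n * \<beta> i) (\<lambda>i. \<nu> i + n * \<gamma> i) = c))"


section \<open>Matrices\<close>

text \<open>
  Matrix indices start at 0, so the row and column with unprescribed sums have index 0. The
  sequences are the initial segments of lengths \<open>p\<close> and \<open>q\<close> of \<open>\<beta>\<close> and \<open>\<gamma>\<close>.
\<close>

definition H_matrices :: "nat \<Rightarrow> nat \<Rightarrow> (nat \<Rightarrow> nat) \<Rightarrow> (nat \<Rightarrow> nat) \<Rightarrow> int mat set" where
  "H_matrices p q \<beta> \<gamma> =
     {A \<in> carrier_mat (p + 1) (q + 1).
        A $$ (0, 0) = 0 \<and>
        (\<forall>i<p. (\<Sum>j\<le>q. A $$ (i + 1, j)) = int (\<beta> i)) \<and>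
        (\<forall>j<q. (\<Sum>i\<le>p. A $$ (i, j + 1)) = int (\<gamma> j))}"

definition pi_sequence :: "int mat \<Rightarrow> int list" where
  "pi_sequence A = rev (sort [A $$ (i, j). i \<leftarrow> [0..<dim_row A], j \<leftarrow> [0..<dim_col A]])"

definition pi_sequence_is :: "int mat \<Rightarrow> (nat \<Rightarrow> nat) \<Rightarrow> bool" where
  "pi_sequence_is A \<alpha> \<longleftrightarrow>
     (\<forall>k. (if k < length (pi_sequence A) then pi_sequence A ! k else 0) = int (\<alpha> k))"

definition H_matrices_pi ::
    "nat \<Rightarrow> nat \<Rightarrow> (nat \<Rightarrow> nat) \<Rightarrow> (nat \<Rightarrow> nat) \<Rightarrow> (nat \<Rightarrow> nat) \<Rightarrow> int mat set" where
  "H_matrices_pi p q \<beta> \<gamma> \<alpha> = {A \<in> H_matrices p q \<beta> \<gamma>. pi_sequence_is A \<alpha>}"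

definition H_additive :: "int mat \<Rightarrow> bool" where
  "H_additive A \<longleftrightarrow>
     (\<forall>i<dim_row A. \<forall>j<dim_col A. A $$ (i, j) \<ge> 0) \<and> A $$ (0, 0) = 0 \<and>
     (\<exists>x y :: nat \<Rightarrow> real. x 0 = 0 \<and> y 0 = 0 \<and>
        (\<forall>(i, j) \<in> {..<dim_row A} \<times> {..<dim_col A} - {(0, 0)}.
         \<forall>(k, l) \<in> {..<dim_row A} \<times> {..<dim_col A} - {(0, 0)}.
           A $$ (i, j) > A $$ (k, l) \<longrightarrow> x i + y j > x k + y l))"

end

theory Submission
  imports Defs
begin

text \<open>
  Young's rule, inverted, writes the character of \<open>V\<^sub>\<lambda>\<close> as the alternating sum over permutations
  \<open>\<sigma>\<close> of the permutation characters on colorings of content \<open>\<lambda> + \<delta> - \<sigma> \<delta>\<close>. Hence a Heisenberg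
  coefficient is an alternating sum, over pairs \<open>(\<sigma>, \<tau>)\<close> and over matrices \<open>B\<close> with \<open>B\<^sub>0\<^sub>0 = 0\<close> and
  with the row and column sums \<open>\<mu> + \<delta> - \<sigma> \<delta>\<close> and \<open>\<nu> + \<delta> - \<tau> \<delta>\<close>, of the Kostka numbers \<open>K\<^sub>\<lambda>\<^sub>,\<^sub>B\<close>,
  which vanish unless the entries of \<open>B\<close> are dominated by \<open>\<lambda>\<close>.

  The weights \<open>x\<^sub>i + y\<^sub>j\<close> of an additive matrix \<open>A\<close> sort its entries into \<open>\<alpha>\<close>; rows with equal sums
  are equal and larger rows have larger weights, so \<open>x\<close> and \<open>y\<close> may be taken decreasing. For the
  coefficient shifted by \<open>n (\<alpha>, \<beta>, \<gamma>)\<close> write \<open>B = n A + C\<close>. The row and column sums determine the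
  total weight of \<open>C\<close>, which therefore does not depend on \<open>n\<close>, and dominance bounds the sums of \<open>C\<close>
  over the cells of largest weight; by Abel summation only finitely many \<open>C\<close> occur. For each of
  them the Kostka number of content \<open>n \<alpha> + C\<close> is eventually constant in \<open>n\<close>, by the recursion that
  inverts the alternating sum. In the same way only \<open>C = 0\<close> and \<open>\<sigma> = \<tau> = id\<close> contribute to the
  coefficient of \<open>(\<alpha>, \<beta>, \<gamma>)\<close> itself, which is thus 1.
\<close>

section \<open>Colorings\<close>

text \<open>Young's rule is obtained by comparing norms. The alternating sum of permutation
  characters and the character of the Specht module are real, each has norm \<open>fact n\<close>
  over \<open>Sym n\<close>, and so has their scalar product; hence they agree. Both evaluations are
  triangular for the dominance order, one by cancelling matrices, the other by column
  antisymmetrizers. Multiplicities are counted by one element of the group algebra, the matrix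
  coefficient \<open>cf\<close> of the polytabloid \<open>e\<close>. It has rank one on the Specht
  module and kills every simple module not isomorphic to it, so its trace counts copies; averaged
  over conjugates it gives the character. The row and the column with unprescribed sums carry weight
  0. That is why the prescribed sums alone fix the weight of a matrix, although these two sums vary.
  Only indices from 1 on are sorted. To compare with arbitrary triples, the matrix is padded by zero
  rows and columns, whose weight \<open>- M\<close> is so low that additivity survives.\<close>

definition Sym :: "nat \<Rightarrow> (nat \<Rightarrow> nat) set" where
  "Sym n = {g. g permutes {1..n}}"

lemma SymD: "g \<in> Sym n \<Longrightarrow> g permutes {1..n}"
  by (simp add: Sym_def)

lemma carrier_sym_group: "carrier (sym_group n) = Sym n"
  by (simp add: sym_group_def Sym_def)

lemma finite_Sym [simp]: "finite (Sym n)"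
  by (simp add: finite_permutations Sym_def)

lemma card_Sym: "card (Sym n) = fact n"
  by (simp add: card_permutations Sym_def)

lemma Sym_id [simp]: "id \<in> Sym n"
  by (simp add: Sym_def permutes_id)

lemma Sym_comp [simp]: "g \<in> Sym n \<Longrightarrow> h \<in> Sym n \<Longrightarrow> g \<circ> h \<in> Sym n"
  by (simp add: permutes_compose Sym_def)

lemma Sym_inv [simp]: "g \<in> Sym n \<Longrightarrow> inv' g \<in> Sym n"
  by (simp add: permutes_inv Sym_def)

lemma Sym_inv_o [simp]: "g \<in> Sym n \<Longrightarrow> g \<circ> inv' g = id" "g \<in> Sym n \<Longrightarrow> inv' g \<circ> g = id"
  by (auto simp: Sym_def intro: permutes_inv_o)

lemma Sym_inv_o_o [simp]:
  "g \<in> Sym n \<Longrightarrow> g \<circ> (inv' g \<circ> f) = f" "g \<in> Sym n \<Longrightarrow> inv' g \<circ> (g \<circ> f) = f"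
  by (simp_all add: comp_assoc[symmetric])

lemma Sym_inv_inv [simp]: "g \<in> Sym n \<Longrightarrow> inv' (inv' g) = g"
  by (auto simp: Sym_def intro: permutes_inv_inv)

lemma Sym_bij: "g \<in> Sym n \<Longrightarrow> bij g"
  by (auto simp: Sym_def intro: permutes_bij)

lemma Sym_inv_comp: "g \<in> Sym n \<Longrightarrow> h \<in> Sym n \<Longrightarrow> inv' (g \<circ> h) = inv' h \<circ> inv' g"
  by (simp add: o_inv_distrib Sym_bij)

lemma Sym_permutation: "g \<in> Sym n \<Longrightarrow> permutation g"
  by (auto simp: Sym_def permutation_permutes)

lemma bij_betw_Sym_left: "h \<in> Sym n \<Longrightarrow> bij_betw (\<lambda>g. h \<circ> g) (Sym n) (Sym n)"
  by (rule bij_betw_byWitness[where f' = "\<lambda>g. inv' h \<circ> g"])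
     (auto simp: comp_assoc[symmetric])

text \<open>
  Contents are integer-valued, so that \<open>\<kappa> + \<delta> - \<sigma> \<delta>\<close> is a content as well; there are no colorings
  if one of its entries is negative.
\<close>

definition colorings :: "'c \<Rightarrow> nat \<Rightarrow> ('c \<Rightarrow> int) \<Rightarrow> (nat \<Rightarrow> 'c) set" where
  "colorings d n \<kappa> =
     {f. (\<forall>k. k \<notin> {1..n} \<longrightarrow> f k = d) \<and> (\<forall>c. int (card {k\<in>{1..n}. f k = c}) = \<kappa> c)}"

text \<open>The permutation character of the action on colorings, that is, of the module induced
  from the trivial module of a Young subgroup. It is 0 as soon as \<open>\<kappa>\<close> has a
  negative entry or a total different from \<open>n\<close>.\<close>

definition fix_count :: "'c \<Rightarrow> nat \<Rightarrow> ('c \<Rightarrow> int) \<Rightarrow> (nat \<Rightarrow> nat) \<Rightarrow> nat" where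
  "fix_count d n \<kappa> g = card {f \<in> colorings d n \<kappa>. f \<circ> g = f}"

lemma colorings_card: "f \<in> colorings d n \<kappa> \<Longrightarrow> int (card {k\<in>{1..n}. f k = c}) = \<kappa> c"
  unfolding colorings_def by blast

lemma colorings_default: "f \<in> colorings d n \<kappa> \<Longrightarrow> k \<notin> {1..n} \<Longrightarrow> f k = d"
  unfolding colorings_def by blast

lemma colorings_comp:
  assumes "f \<in> colorings d n \<kappa>" "g \<in> Sym n"
  shows "f \<circ> g \<in> colorings d n \<kappa>"
proof -
  have g: "g permutes {1..n}" using assms SymD by blast
  have "card {k\<in>{1..n}. f (g k) = c} = card {k\<in>{1..n}. f k = c}" for c
  proof (rule bij_betw_same_card[of g])
    show "bij_betw g {k\<in>{1..n}. f (g k) = c} {k\<in>{1..n}. f k = c}"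
      using permutes_in_image[OF g] permutes_in_image[OF permutes_inv[OF g]] permutes_inverses[OF g]
      by (intro bij_betw_byWitness[where f' = "inv' g"]) auto
  qed
  moreover have "f (g k) = d" if "k \<notin> {1..n}" for k
    using that assms(1) permutes_not_in[OF g that] by (simp add: colorings_def)
  ultimately show ?thesis using assms(1) by (auto simp: colorings_def)
qed

lemma colorings_comp_iff:
  assumes "g \<in> Sym n"
  shows "f \<circ> g \<in> colorings d n \<kappa> \<longleftrightarrow> f \<in> colorings d n \<kappa>"
  using colorings_comp[of "f \<circ> g" d n \<kappa> "inv' g"] colorings_comp[of f d n \<kappa> g] assms
  by (auto simp: comp_assoc)

lemma colorings_content_pos:
  assumes "f \<in> colorings d n \<kappa>" "k \<in> {1..n}"
  shows "\<kappa> (f k) > 0"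
proof -
  have "card {k'\<in>{1..n}. f k' = f k} > 0"
    using assms(2) by (auto simp: card_gt_0_iff)
  moreover have "\<kappa> (f k) = int (card {k'\<in>{1..n}. f k' = f k})"
    using assms(1) by (simp add: colorings_def)
  ultimately show ?thesis by simp
qed

lemma colorings_content_nonneg: "f \<in> colorings d n \<kappa> \<Longrightarrow> \<kappa> c \<ge> 0"
  by (metis colorings_card of_nat_0_le_iff)

lemma colorings_content_support:
  assumes "f \<in> colorings d n \<kappa>"
  shows "{c. \<kappa> c \<noteq> 0} = f ` {1..n}"
proof
  show "{c. \<kappa> c \<noteq> 0} \<subseteq> f ` {1..n}"
  proof
    fix c assume "c \<in> {c. \<kappa> c \<noteq> 0}"
    moreover have "int (card {k\<in>{1..n}. f k = c}) = \<kappa> c" using assms by (simp add: colorings_def)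
    ultimately have "card {k\<in>{1..n}. f k = c} \<noteq> card ({} :: nat set)" by (cases "card {k\<in>{1..n}. f k = c}") simp_all
    then have "{k\<in>{1..n}. f k = c} \<noteq> {}" by force
    then show "c \<in> f ` {1..n}" by blast
  qed
  show "f ` {1..n} \<subseteq> {c. \<kappa> c \<noteq> 0}" using colorings_content_pos[OF assms] by force
qed

text \<open>The color type may be infinite and \<open>\<kappa>\<close> is arbitrary, but a single
  coloring already exhibits the support of \<open>\<kappa>\<close> as its image, and all colorings
  take their values there.\<close>

lemma finite_colorings [simp]: "finite (colorings d n \<kappa>)"
proof (cases "colorings d n \<kappa> = {}")
  case False
  then obtain f where f: "f \<in> colorings d n \<kappa>" by blast
  define S where "S = {c. \<kappa> c \<noteq> 0}"
  have fin: "finite S" using colorings_content_support[OF f] S_def by simp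
  have "colorings d n \<kappa> \<subseteq> {f. \<forall>k. (k \<in> {1..n} \<longrightarrow> f k \<in> S) \<and> (k \<notin> {1..n} \<longrightarrow> f k = d)}"
  proof (intro subsetI CollectI allI conjI impI)
    fix f k assume f: "f \<in> colorings d n \<kappa>"
    show "f k \<in> S" if "k \<in> {1..n}" using colorings_content_pos[OF f that] by (simp add: S_def)
    show "f k = d" if "k \<notin> {1..n}" using f that unfolding colorings_def by blast
  qed
  then show ?thesis
    by (rule finite_subset) (intro finite_set_of_finite_funs fin finite_atLeastAtMost)
qed simp

lemma sum_content_card:
  assumes "f \<in> colorings d n \<kappa>" "finite J"
  shows "(\<Sum>c\<in>J. \<kappa> c) = int (card {k\<in>{1..n}. f k \<in> J})"
proof -
  have "{k\<in>{1..n}. f k \<in> J} = (\<Union>c\<in>J. {k\<in>{1..n}. f k = c})" by auto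
  then have "card {k\<in>{1..n}. f k \<in> J} = (\<Sum>c\<in>J. card {k\<in>{1..n}. f k = c})"
    using assms(2) by (simp only:) (subst card_UN_disjoint, auto)
  then show ?thesis using assms(1) by (simp add: colorings_def)
qed

lemma colorings_content_total:
  assumes "f \<in> colorings d n \<kappa>" "finite J" "\<And>c. c \<notin> J \<Longrightarrow> \<kappa> c = 0"
  shows "(\<Sum>c\<in>J. \<kappa> c) = int n"
proof -
  have "{k\<in>{1..n}. f k \<in> J} = {1..n}"
    using colorings_content_pos[OF assms(1)] assms(3) by force
  then show ?thesis using sum_content_card[OF assms(1,2)] by simp
qed

text \<open>Any listing of the multiset in which each color \<open>c\<close> has multiplicity
  \<open>\<kappa> c\<close> is such a coloring.\<close>

lemma colorings_nonempty:
  assumes "\<And>c. \<kappa> c \<ge> 0" "finite J" "\<And>c. c \<notin> J \<Longrightarrow> \<kappa> c = 0" "(\<Sum>c\<in>J. \<kappa> c) = int n"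
  shows "colorings d n \<kappa> \<noteq> {}"
proof -
  define M where "M = (\<Sum>c\<in>J. replicate_mset (nat (\<kappa> c)) c)"
  have cM: "count M c = nat (\<kappa> c)" for c
    using assms(2,3) by (auto simp: M_def count_sum if_distrib cong: if_cong)
  have "int (size M) = (\<Sum>c\<in>J. int (nat (\<kappa> c)))" unfolding M_def by (simp add: size_multiset_sum)
  also have "\<dots> = int n" using assms(1,4) by simp
  finally have sM: "size M = n" by simp
  obtain xs where xs: "mset xs = M" using ex_mset by blast
  have len: "length xs = n" using sM xs by (metis size_mset)
  define f where "f = (\<lambda>k. if k \<in> {1..n} then xs ! (k - 1) else d)"
  have "int (card {k\<in>{1..n}. f k = c}) = \<kappa> c" for c
  proof -
    have "card {k\<in>{1..n}. f k = c} = card {i. i < length xs \<and> xs ! i = c}"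
    proof (rule bij_betw_same_card[of "\<lambda>k. k - 1"])
      show "bij_betw (\<lambda>k. k - 1) {k\<in>{1..n}. f k = c} {i. i < length xs \<and> xs ! i = c}"
        by (rule bij_betw_byWitness[where f' = Suc]) (auto simp: f_def len)
    qed
    also have "\<dots> = count M c"
      unfolding xs[symmetric] count_mset count_list_eq_length_filter length_filter_conv_card by (rule arg_cong[of _ _ card]) auto
    finally show ?thesis using cM assms(1)[of c] by simp
  qed
  then have "f \<in> colorings d n \<kappa>" by (auto simp: colorings_def f_def)
  then show ?thesis by blast
qed

text \<open>The classes of a color in \<open>f\<close> and in \<open>f'\<close> have the same size;
  bijections between them, glued along \<open>f'\<close>, give \<open>h\<close>.\<close>

lemma colorings_transitive:
  assumes "f \<in> colorings d n \<kappa>" "f' \<in> colorings d n \<kappa>"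
  obtains h where "h \<in> Sym n" "f' = f \<circ> h"
proof -
  define X where "X = (\<lambda>f c. {k\<in>{1..n}. f k = (c::'a)})"
  have "\<exists>b. bij_betw b (X f' c) (X f c)" for c
  proof (rule finite_same_card_bij)
    show "card (X f' c) = card (X f c)"
      using colorings_card[OF assms(1), of c] colorings_card[OF assms(2), of c] unfolding X_def by linarith
  qed (auto simp: X_def)
  then obtain b where b: "\<And>c. bij_betw (b c) (X f' c) (X f c)" by metis
  define h where "h = (\<lambda>k. if k \<in> {1..n} then b (f' k) k else k)"
  have hX: "h k \<in> X f (f' k)" if "k \<in> {1..n}" for k
    using b[of "f' k"] that by (auto simp: h_def X_def bij_betw_def)
  have "inj_on h {1..n}"
  proof (rule inj_onI)
    fix k k' assume k: "k \<in> {1..n}" "k' \<in> {1..n}" "h k = h k'"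
    then have "f' k = f' k'" using hX[of k] hX[of k'] by (simp add: X_def)
    then show "k = k'" using k b[of "f' k"] by (auto simp: h_def bij_betw_def inj_on_def X_def)
  qed
  moreover have "h ` {1..n} \<subseteq> {1..n}" using hX by (auto simp: X_def)
  ultimately have "bij_betw h {1..n} {1..n}" by (simp add: bij_betw_def endo_inj_surj)
  then have "h \<in> Sym n" unfolding Sym_def by (auto intro!: bij_imp_permutes simp: h_def)
  moreover have "f' = f \<circ> h"
  proof
    fix k show "f' k = (f \<circ> h) k"
      using hX[of k] assms by (cases "k \<in> {1..n}") (auto simp: X_def h_def colorings_def)
  qed
  ultimately show ?thesis using that by blast
qed

text \<open>Burnside's lemma for the transitive action on colorings of a given content.\<close>

lemma sum_fix_count:
  assumes "colorings d n \<kappa> \<noteq> {}"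
  shows "(\<Sum>g\<in>Sym n. fix_count d n \<kappa> g) = fact n"
proof -
  let ?X = "colorings d n \<kappa>"
  obtain f0 where f0: "f0 \<in> ?X" using assms by blast
  \<comment> \<open>If \<open>f = f0 \<circ> h\<close>, left translation by \<open>h\<close> carries
    the stabilizer of \<open>f\<close> to the set of permutations taking \<open>f0\<close> to
    \<open>f\<close>. These sets partition \<open>Sym n\<close>.\<close>
  have *: "card {g\<in>Sym n. f \<circ> g = f} = card {h\<in>Sym n. f0 \<circ> h = f}" if "f \<in> ?X" for f
  proof -
    obtain h where h: "h \<in> Sym n" "f = f0 \<circ> h" using colorings_transitive[OF f0 \<open>f \<in> ?X\<close>] by blast
    have "bij_betw (\<lambda>g. h \<circ> g) {g\<in>Sym n. f \<circ> g = f} {h\<in>Sym n. f0 \<circ> h = f}"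
    proof (rule bij_betw_byWitness[where f' = "\<lambda>g. inv' h \<circ> g"])
      show "(\<lambda>g. inv' h \<circ> g) ` {h \<in> Sym n. f0 \<circ> h = f} \<subseteq> {g \<in> Sym n. f \<circ> g = f}"
      proof clarify
        fix x assume x: "x \<in> Sym n" "f = f0 \<circ> x"
        have "f0 \<circ> h \<circ> (inv' h \<circ> x) = f0 \<circ> x" using h(1) by (simp add: comp_assoc)
        then show "inv' h \<circ> x \<in> Sym n \<and> f0 \<circ> x \<circ> (inv' h \<circ> x) = f0 \<circ> x"
          using h x by simp
      qed
      show "(\<lambda>g. h \<circ> g) ` {g \<in> Sym n. f \<circ> g = f} \<subseteq> {h \<in> Sym n. f0 \<circ> h = f}"
        using h by (auto simp only: comp_assoc mem_Collect_eq Sym_comp image_iff)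
    qed (use h(1) in auto)
    then show ?thesis by (rule bij_betw_same_card)
  qed
  have "(\<Sum>g\<in>Sym n. fix_count d n \<kappa> g) = (\<Sum>g\<in>Sym n. \<Sum>f\<in>?X. if f \<circ> g = f then 1 else 0)"
    unfolding fix_count_def by (simp add: sum.If_cases Int_def)
  also have "\<dots> = (\<Sum>f\<in>?X. \<Sum>g\<in>Sym n. if f \<circ> g = f then 1 else 0)" by (rule sum.swap)
  also have "\<dots> = (\<Sum>f\<in>?X. card {g\<in>Sym n. f \<circ> g = f})" by (simp add: sum.If_cases Int_def)
  also have "\<dots> = (\<Sum>f\<in>?X. card {h\<in>Sym n. f0 \<circ> h = f})" using * by simp
  also have "\<dots> = card (\<Union>f\<in>?X. {h\<in>Sym n. f0 \<circ> h = f})"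
    by (subst card_UN_disjoint) auto
  also have "(\<Union>f\<in>?X. {h\<in>Sym n. f0 \<circ> h = f}) = Sym n" using colorings_comp[OF f0] by auto
  finally show ?thesis by (simp add: card_Sym)
qed

section \<open>Alternating counts of matrices\<close>

text \<open>Contingency tables with margins \<open>a\<close> and \<open>B\<close>. The number
  \<open>k\<close> of columns is separate from \<open>N\<close>, because the induction removes
  columns while permutations keep acting on the \<open>N\<close> rows.\<close>

definition matset :: "nat \<Rightarrow> nat \<Rightarrow> (nat \<Rightarrow> int) \<Rightarrow> (nat \<Rightarrow> int) \<Rightarrow> (nat \<times> nat \<Rightarrow> int) set" where
  "matset N k a B = {M. (\<forall>c. 0 \<le> M c) \<and> (\<forall>i j. i \<ge> N \<or> j \<ge> k \<longrightarrow> M (i, j) = 0) \<and>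
     (\<forall>i<N. (\<Sum>j<k. M (i, j)) = a i) \<and> (\<forall>j<k. (\<Sum>i<N. M (i, j)) = B j)}"

definition colvecs :: "nat \<Rightarrow> int \<Rightarrow> (nat \<Rightarrow> int) set" where
  "colvecs N b = {e. (\<forall>i. 0 \<le> e i) \<and> (\<forall>i\<ge>N. e i = 0) \<and> (\<Sum>i<N. e i) = b}"

definition ext_col :: "nat \<Rightarrow> (nat \<Rightarrow> int) \<Rightarrow> (nat \<times> nat \<Rightarrow> int) \<Rightarrow> nat \<times> nat \<Rightarrow> int" where
  "ext_col k e M = (\<lambda>(i, j). if j = k then e i else M (i, j))"

lemma finite_colvecs [simp]: "finite (colvecs N b)"
proof (rule finite_subset)
  show "colvecs N b \<subseteq> {e. \<forall>i. (i \<in> {..<N} \<longrightarrow> e i \<in> {0..b}) \<and> (i \<notin> {..<N} \<longrightarrow> e i = 0)}"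
  proof (clarsimp simp: colvecs_def)
    fix e :: "nat \<Rightarrow> int" and i
    assume "\<forall>i. 0 \<le> e i" "i < N"
    then show "e i \<le> sum e {..<N}" by (intro member_le_sum) auto
  qed
qed (intro finite_set_of_finite_funs finite_lessThan finite_atLeastAtMost_int)

lemma matset_0: "matset N 0 a B = (if \<forall>i<N. a i = 0 then {\<lambda>_. 0} else {})"
  by (auto simp: matset_def fun_eq_iff)

lemma matset_Suc:
  "matset N (Suc k) a B = (\<Union>e\<in>colvecs N (B k). ext_col k e ` matset N k (\<lambda>i. a i - e i) B)"
proof (intro equalityI subsetI)
  fix M assume M: "M \<in> matset N (Suc k) a B"
  define e where "e = (\<lambda>i. M (i, k))"
  define M' where "M' = (\<lambda>(i, j). if j = k then 0 else M (i, j))"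
  have "e \<in> colvecs N (B k)" using M by (auto simp: colvecs_def matset_def e_def)
  moreover have "M = ext_col k e M'" by (auto simp: ext_col_def M'_def e_def fun_eq_iff)
  moreover have "M' \<in> matset N k (\<lambda>i. a i - e i) B"
  proof -
    have "(\<Sum>j<k. M' (i, j)) = a i - e i" if "i < N" for i
    proof -
      have "(\<Sum>j<k. M' (i, j)) = (\<Sum>j<k. M (i, j))" by (intro sum.cong) (auto simp: M'_def)
      moreover have "(\<Sum>j<Suc k. M (i, j)) = a i" using M that by (simp add: matset_def del: sum.lessThan_Suc)
      ultimately show ?thesis by (simp add: e_def)
    qed
    moreover have "(\<Sum>i<N. M' (i, j)) = B j" if "j < k" for j
    proof -
      have "(\<Sum>i<N. M' (i, j)) = (\<Sum>i<N. M (i, j))" using that by (intro sum.cong) (auto simp: M'_def)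
      then show ?thesis using M that by (simp add: matset_def)
    qed
    ultimately show ?thesis using M by (auto simp: matset_def M'_def)
  qed
  ultimately show "M \<in> (\<Union>e\<in>colvecs N (B k). ext_col k e ` matset N k (\<lambda>i. a i - e i) B)" by blast
next
  fix M assume "M \<in> (\<Union>e\<in>colvecs N (B k). ext_col k e ` matset N k (\<lambda>i. a i - e i) B)"
  then obtain e M' where e: "e \<in> colvecs N (B k)" and M': "M' \<in> matset N k (\<lambda>i. a i - e i) B"
    and M: "M = ext_col k e M'" by blast
  have "(\<Sum>j<Suc k. M (i, j)) = a i" if "i < N" for i
  proof -
    have "(\<Sum>j<k. M (i, j)) = (\<Sum>j<k. M' (i, j))" by (intro sum.cong) (auto simp: M ext_col_def)
    then show ?thesis using M' that by (simp add: matset_def M ext_col_def)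
  qed
  moreover have "(\<Sum>i<N. M (i, j)) = B j" if "j < Suc k" for j
  proof (cases "j = k")
    case True
    then show ?thesis using e by (simp add: M ext_col_def colvecs_def)
  next
    case False
    then show ?thesis using M' that by (simp add: M ext_col_def matset_def)
  qed
  ultimately show "M \<in> matset N (Suc k) a B"
    using e M' by (auto simp: matset_def M ext_col_def colvecs_def simp del: sum.lessThan_Suc)
qed

lemma ext_col_inj: "inj_on (ext_col k e) (matset N k a B)"
proof (rule inj_onI)
  fix M M' assume M: "M \<in> matset N k a B" "M' \<in> matset N k a B" and eq: "ext_col k e M = ext_col k e M'"
  show "M = M'"
  proof
    fix c :: "nat \<times> nat" obtain i j where c: "c = (i, j)" by (cases c)
    show "M c = M' c"
      using M fun_cong[OF eq, of c] by (cases "j = k") (auto simp: c ext_col_def matset_def)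
  qed
qed

lemma finite_matset [simp]: "finite (matset N k a B)"
  by (induction k arbitrary: a) (auto simp: matset_0 matset_Suc)

lemma card_matset_Suc:
  "card (matset N (Suc k) a B) = (\<Sum>e\<in>colvecs N (B k). card (matset N k (\<lambda>i. a i - e i) B))"
proof -
  have "ext_col k e ` X \<inter> ext_col k e' ` Y = {}" if "e \<noteq> e'" for e e' X Y
  proof -
    have "ext_col k e M \<noteq> ext_col k e' M'" for M M'
    proof
      assume "ext_col k e M = ext_col k e' M'"
      then have "ext_col k e M (i, k) = ext_col k e' M' (i, k)" for i by simp
      then show False using that by (auto simp: ext_col_def)
    qed
    then show ?thesis by blast
  qed
  then have "card (matset N (Suc k) a B) =
      (\<Sum>e\<in>colvecs N (B k). card (ext_col k e ` matset N k (\<lambda>i. a i - e i) B))"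
    unfolding matset_Suc by (intro card_UN_disjoint) auto
  then show ?thesis by (simp add: card_image ext_col_inj)
qed

lemma matset_degree:
  assumes "matset N k a B \<noteq> {}"
  shows "(\<Sum>i<N. a i) = (\<Sum>j<k. B j)"
proof -
  obtain M where M: "M \<in> matset N k a B" using assms by blast
  have "(\<Sum>i<N. a i) = (\<Sum>i<N. \<Sum>j<k. M (i, j))" using M by (simp add: matset_def)
  also have "\<dots> = (\<Sum>j<k. \<Sum>i<N. M (i, j))" by (rule sum.swap)
  also have "\<dots> = (\<Sum>j<k. B j)" using M by (simp add: matset_def)
  finally show ?thesis .
qed

lemma card_matset_perm:
  assumes w: "w permutes {..<N}"
  shows "card (matset N k (\<lambda>i. a (w i)) B) = card (matset N k a B)"
proof -
  have *: "(\<lambda>(i, j). M (w i, j)) \<in> matset N k (\<lambda>i. a (w i)) B"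
    if M: "M \<in> matset N k a B" and w: "w permutes {..<N}" for M w a
  proof -
    have wi: "w i < N \<longleftrightarrow> i < N" for i using permutes_in_image[OF w, of i] by simp
    have "(\<Sum>i<N. M (w i, j)) = (\<Sum>i<N. M (i, j))" for j
      using sum.permute[OF w, of "\<lambda>i. M (i, j)"] by (simp add: comp_def)
    then show ?thesis using M wi by (auto simp: matset_def not_less[symmetric])
  qed
  have "bij_betw (\<lambda>M (i, j). M (w i, j)) (matset N k a B) (matset N k (\<lambda>i. a (w i)) B)"
  proof (rule bij_betw_byWitness[where f' = "\<lambda>M (i, j). M (inv' w i, j)"])
    show "(\<lambda>M (i, j). M (w i, j)) ` matset N k a B \<subseteq> matset N k (\<lambda>i. a (w i)) B" using * w by blast
    show "(\<lambda>M (i, j). M (inv' w i, j)) ` matset N k (\<lambda>i. a (w i)) B \<subseteq> matset N k a B"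
      using *[OF _ permutes_inv[OF w], of _ "\<lambda>i. a (w i)"] by (auto simp: permutes_inverses[OF w])
  qed (auto simp: permutes_inverses[OF w] fun_eq_iff)
  then show ?thesis by (simp add: bij_betw_same_card)
qed

text \<open>For a partition \<open>la\<close> with at most \<open>N\<close> parts and
  \<open>v i = la i - i\<close>, this is the Kostka number of shape \<open>la\<close> and content
  \<open>B\<close>, by the Jacobi-Trudi determinant. Leaving \<open>v\<close> arbitrary makes it an
  antisymmetric function of \<open>v\<close>, and the cancellations come from that.\<close>

definition alt_card :: "nat \<Rightarrow> nat \<Rightarrow> (nat \<Rightarrow> int) \<Rightarrow> (nat \<Rightarrow> int) \<Rightarrow> int" where
  "alt_card N k B v = (\<Sum>s | s permutes {..<N}. sign s * int (card (matset N k (\<lambda>i. v i + int (s i)) B)))"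

lemma alt_card_nonzeroE:
  assumes "alt_card N k B v \<noteq> 0"
  obtains s where "s permutes {..<N}" "matset N k (\<lambda>i. v i + int (s i)) B \<noteq> {}"
proof -
  have "\<exists>s\<in>{s. s permutes {..<N}}. sign s * int (card (matset N k (\<lambda>i. v i + int (s i)) B)) \<noteq> 0"
    using assms unfolding alt_card_def by (meson sum.neutral)
  then show ?thesis using that by fastforce
qed

lemma permutes_sum_id:
  assumes "s permutes {..<N}"
  shows "(\<Sum>i<N. int (s i)) = (\<Sum>i<N. int i)"
  using sum.permute[OF assms, of int] by (simp add: comp_def)

lemma alt_card_degree:
  assumes "alt_card N k B v \<noteq> 0"
  shows "(\<Sum>i<N. v i + int i) = (\<Sum>j<k. B j)"
proof -
  obtain s where s: "s permutes {..<N}" "matset N k (\<lambda>i. v i + int (s i)) B \<noteq> {}"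
    using alt_card_nonzeroE[OF assms] .
  show ?thesis using matset_degree[OF s(2)] permutes_sum_id[OF s(1)] by (simp add: sum.distrib)
qed

text \<open>The rows of a matrix may be permuted freely, so substituting \<open>s \<circ> w\<close>
  for \<open>s\<close> costs only the sign of \<open>w\<close>.\<close>

lemma alt_card_antisym:
  assumes w: "w permutes {..<N}"
  shows "alt_card N k B (\<lambda>i. v (w i)) = sign w * alt_card N k B v"
proof -
  have pw: "permutation w" using w by (auto simp: permutation_permutes)
  have "alt_card N k B (\<lambda>i. v (w i)) =
      (\<Sum>s | s permutes {..<N}. sign (s \<circ> w) * int (card (matset N k (\<lambda>i. v (w i) + int ((s \<circ> w) i)) B)))"
    unfolding alt_card_def
    by (rule sum.reindex_bij_witness[where i = "\<lambda>s. s \<circ> w" and j = "\<lambda>s. s \<circ> inv' w"])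
       (auto simp: permutes_compose w permutes_inv comp_assoc permutes_inv_o[OF w])
  also have "\<dots> = (\<Sum>s | s permutes {..<N}. sign w * (sign s * int (card (matset N k (\<lambda>i. v i + int (s i)) B))))"
  proof (rule sum.cong)
    fix s assume "s \<in> {s. s permutes {..<N}}"
    then have "permutation s" by (auto simp: permutation_permutes)
    then show "sign (s \<circ> w) * int (card (matset N k (\<lambda>i. v (w i) + int ((s \<circ> w) i)) B)) =
        sign w * (sign s * int (card (matset N k (\<lambda>i. v i + int (s i)) B)))"
      using card_matset_perm[OF w, of k "\<lambda>i. v i + int (s i)" B] sign_compose[of s w] pw
      by (simp add: o_apply)
  qed simp
  finally show ?thesis by (simp add: alt_card_def sum_distrib_left)
qed

lemma alt_card_Suc:
  "alt_card N (Suc k) B v = (\<Sum>e\<in>colvecs N (B k). alt_card N k B (\<lambda>i. v i - e i))"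
proof -
  have "alt_card N (Suc k) B v = (\<Sum>s | s permutes {..<N}. \<Sum>e\<in>colvecs N (B k).
      sign s * int (card (matset N k (\<lambda>i. v i - e i + int (s i)) B)))"
    unfolding alt_card_def card_matset_Suc by (simp add: sum_distrib_left algebra_simps)
  also have "\<dots> = (\<Sum>e\<in>colvecs N (B k). alt_card N k B (\<lambda>i. v i - e i))"
    unfolding alt_card_def by (rule sum.swap)
  finally show ?thesis .
qed

section \<open>Pieri's rule and triangularity\<close>

definition strict_dec :: "nat \<Rightarrow> (nat \<Rightarrow> int) \<Rightarrow> bool" where
  "strict_dec N v \<longleftrightarrow> (\<forall>i. Suc i < N \<longrightarrow> v (Suc i) < v i)"

text \<open>In terms of the shapes \<open>la i = v i + i\<close> and
  \<open>mu i = la i - e i\<close> the condition reads \<open>la (Suc i) \<le> mu i\<close>: no two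
  of the removed cells lie in one column.\<close>

definition horizontal :: "nat \<Rightarrow> (nat \<Rightarrow> int) \<Rightarrow> (nat \<Rightarrow> int) \<Rightarrow> bool" where
  "horizontal N v e \<longleftrightarrow> (\<forall>i. Suc i < N \<longrightarrow> v (Suc i) < v i - e i)"

text \<open>
  Pieri's rule. The vectors \<open>u = v - e\<close> for which \<open>e\<close> is not a horizontal strip cancel in pairs:
  exchange \<open>u i\<close> and \<open>u (i + 1)\<close> for the least \<open>i\<close> violating the condition.
\<close>

lemma alt_card_pieri:
  assumes v: "strict_dec N v"
  shows "alt_card N (Suc k) B v =
    (\<Sum>e | e \<in> colvecs N (B k) \<and> horizontal N v e. alt_card N k B (\<lambda>i. v i - e i))"
proof -
  let ?f = "\<lambda>e. alt_card N k B (\<lambda>i. v i - e i)"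
  define bad where "bad = (\<lambda>e i. Suc i < N \<and> v i - e i \<le> v (Suc i))"
  define l where "l = (\<lambda>e. LEAST i. bad e i)"
  define t where "t = (\<lambda>e. transpose (l e) (Suc (l e)))"
  \<comment> \<open>With \<open>u = v - e\<close>, this is the vector whose \<open>u\<close> is
    \<open>u \<circ> t e\<close>, written back in terms of \<open>e\<close>.\<close>
  define \<iota> where "\<iota> = (\<lambda>e j. v j - (v (t e j) - e (t e j)))"
  define X where "X = {e \<in> colvecs N (B k). \<not> horizontal N v e}"
  have ex: "\<exists>i. bad e i" if "e \<in> X" for e
    using that unfolding X_def bad_def horizontal_def by (simp add: not_less)
  have lb: "bad e (l e)" if "e \<in> X" for e
    unfolding l_def using ex[OF that] by (rule LeastI_ex)
  have tperm: "t e permutes {..<N}" if "e \<in> X" for e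
    using lb[OF that] unfolding t_def bad_def by (intro permutes_swap_id) auto
  have io_val: "\<iota> e j = (if j = l e then v j - (v (Suc j) - e (Suc j)) else
      if j = Suc (l e) then v j - (v (l e) - e (l e)) else e j)" for e j
    by (auto simp: \<iota>_def t_def transpose_def)
  have inX: "\<iota> e \<in> X" and lio: "l (\<iota> e) = l e" if e: "e \<in> X" for e
  proof -
    have ec: "e \<in> colvecs N (B k)" using e by (simp add: X_def)
    have b: "Suc (l e) < N" "v (l e) - e (l e) \<le> v (Suc (l e))" using lb[OF e] by (auto simp: bad_def)
    have sd: "v (Suc (l e)) < v (l e)" using v b(1) by (simp add: strict_dec_def)
    \<comment> \<open>The two changed entries are nonnegative for different reasons: the one at
      \<open>l e\<close> since \<open>v\<close> is strictly decreasing, the one at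
      \<open>Suc (l e)\<close> since the condition is violated at \<open>l e\<close>.\<close>
    have nn: "0 \<le> \<iota> e j" for j
    proof -
      have "0 \<le> e j" "0 \<le> e (Suc j)" using ec by (simp_all add: colvecs_def)
      then show ?thesis using b sd by (cases "j = l e") (simp_all add: io_val)
    qed
    have "(\<Sum>i<N. v (t e i) - e (t e i)) = (\<Sum>i<N. v i - e i)"
      using sum.permute[OF tperm[OF e], of "\<lambda>i. v i - e i"] by (simp add: comp_def)
    then have "(\<Sum>i<N. \<iota> e i) = (\<Sum>i<N. e i)"
      unfolding \<iota>_def sum_subtractf by linarith
    moreover have "\<iota> e j = 0" if "N \<le> j" for j
      using that b(1) ec by (simp add: io_val colvecs_def)
    ultimately have c: "\<iota> e \<in> colvecs N (B k)" using nn ec by (simp add: colvecs_def)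
    have bi: "bad (\<iota> e) (l e)"
      using b(1) ec by (simp add: bad_def io_val colvecs_def)
    then have "\<not> horizontal N v (\<iota> e)" unfolding bad_def horizontal_def by (meson not_less)
    then show "\<iota> e \<in> X" using c by (simp add: X_def)
    \<comment> \<open>Whether \<open>i\<close> violates the condition depends on \<open>e i\<close>
      alone, and the exchange leaves the entries before \<open>l e\<close> unchanged; so the least
      violation stays in place.\<close>
    show "l (\<iota> e) = l e"
      unfolding l_def[of] 
    proof (rule Least_equality)
      show "bad (\<iota> e) (LEAST i. bad e i)" using bi by (simp add: l_def)
      fix i assume i: "bad (\<iota> e) i"
      show "(LEAST i. bad e i) \<le> i"
      proof (rule ccontr)
        assume "\<not> ?thesis"
        then have "i < l e" by (simp add: l_def)
        then have "bad e i" using i by (auto simp: bad_def io_val)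
        then have "l e \<le> i" unfolding l_def by (rule Least_le)
        then show False using \<open>i < l e\<close> by simp
      qed
    qed
  qed
  have invol: "\<iota> (\<iota> e) = e" if "e \<in> X" for e
  proof
    fix j
    have te: "t (\<iota> e) = t e" using lio[OF that] by (simp add: t_def)
    have tt: "t e (t e j) = j" by (simp add: t_def)
    have "\<iota> (\<iota> e) j = v j - (v (t (\<iota> e) j) - \<iota> e (t (\<iota> e) j))" by (simp only: \<iota>_def)
    also have "\<dots> = v j - (v (t e j) - (v (t e j) - (v (t e (t e j)) - e (t e (t e j)))))"
      unfolding te by (simp only: \<iota>_def)
    finally show "\<iota> (\<iota> e) j = e j" unfolding tt by simp
  qed
  have neg: "?f (\<iota> e) = - ?f e" if "e \<in> X" for e
  proof -
    have "(\<lambda>i. v i - \<iota> e i) = (\<lambda>i. v (t e i) - e (t e i))" by (simp add: \<iota>_def)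
    then have "?f (\<iota> e) = alt_card N k B (\<lambda>i. v (t e i) - e (t e i))" by (simp only:)
    also have "\<dots> = sign (t e) * ?f e" using alt_card_antisym[OF tperm[OF that], of k B "\<lambda>i. v i - e i"] by simp
    also have "sign (t e) = -1" by (simp add: t_def sign_swap_id)
    finally show ?thesis by simp
  qed
  \<comment> \<open>The involution may fix some \<open>e\<close>; there \<open>?f e\<close> is its
    own negative, so no case distinction arises.\<close>
  have "(\<Sum>e\<in>X. ?f e) = (\<Sum>e\<in>X. - ?f e)"
    by (rule sum.reindex_bij_witness[where i = \<iota> and j = \<iota>]) (simp_all only: invol inX neg minus_minus)
  then have z: "(\<Sum>e\<in>X. ?f e) = 0" by (simp add: sum_negf)
  have "(\<Sum>e\<in>colvecs N (B k). ?f e) = (\<Sum>e\<in>colvecs N (B k) - X. ?f e) + (\<Sum>e\<in>X. ?f e)"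
    by (rule sum.subset_diff) (auto simp: X_def)
  also have "colvecs N (B k) - X = {e. e \<in> colvecs N (B k) \<and> horizontal N v e}"
    by (auto simp: X_def)
  finally show ?thesis unfolding alt_card_Suc z by simp
qed

lemma sum_lessThan_card_le:
  assumes "finite (A :: nat set)"
  shows "\<Sum>{..<card A} \<le> \<Sum>A"
  using assms
proof (induction A rule: finite_linorder_max_induct)
  case (insert b A)
  then have "card A \<le> card {..<b}" by (intro card_mono) auto
  moreover have "b \<notin> A" using insert by auto
  ultimately show ?case using insert by simp
qed simp

text \<open>The first \<open>j\<close> values of \<open>s\<close> are distinct naturals. As a
  consequence the contents \<open>jt la s\<close> lie above \<open>la\<close> in the dominance
  order.\<close>

lemma permutes_partial_sum:
  assumes "s permutes {..<N}"
  shows "(\<Sum>i<j. int i) \<le> (\<Sum>i<j. int (s i))"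
proof -
  have inj: "inj_on s {..<j}" using assms by (rule permutes_inj_on)
  have "\<Sum>{..<j} \<le> \<Sum>(s ` {..<j})"
    using sum_lessThan_card_le[of "s ` {..<j}"] by (simp add: card_image inj)
  also have "\<dots> = (\<Sum>i<j. s i)" using inj by (simp add: sum.reindex)
  finally have "int (\<Sum>{..<j}) \<le> int (\<Sum>i<j. s i)" by (rule zle_int[THEN iffD2])
  then show ?thesis by simp
qed

lemma permutes_dominated_id:
  assumes s: "s permutes {..<N}" and dom: "\<And>j. j \<le> N \<Longrightarrow> (\<Sum>i<j. int (s i)) \<le> (\<Sum>i<j. int i)"
  shows "s = id"
proof -
  have *: "i < N \<longrightarrow> s i = i" for i
  proof (induction i rule: less_induct)
    case (less i)
    show ?case
    proof
      assume i: "i < N"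
      have prev: "s i' = i'" if "i' < i" for i' using less that i by simp
      then have "(\<Sum>i'<i. int (s i')) = (\<Sum>i'<i. int i')" by simp
      then have "s i \<le> i" using dom[of "Suc i"] i by simp
      moreover have "\<not> s i < i"
      proof
        assume "s i < i"
        then have "s (s i) = s i" using prev by simp
        then show False using inj_eq[OF permutes_inj[OF s]] \<open>s i < i\<close> by simp
      qed
      ultimately show "s i = i" by simp
    qed
  qed
  show ?thesis
  proof
    fix i show "s i = id i" using * permutes_not_in[OF s, of i] by (cases "i < N") auto
  qed
qed

text \<open>A horizontal strip leaves \<open>la (Suc i) \<le> mu i\<close>, so each column of the
  matrix adds at most one row to the shape, and after \<open>k\<close> columns the rows from
  \<open>k\<close> on are empty. The inequality for \<open>j = k\<close> is then an equality of
  total sizes; the earlier ones are inherited from the smaller shape.\<close>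

lemma alt_card_dominance:
  assumes "strict_dec N v" "alt_card N k B v \<noteq> 0"
  shows "(\<forall>i. k \<le> i \<and> i < N \<longrightarrow> v i = - int i) \<and>
    (\<forall>j\<le>k. j \<le> N \<longrightarrow> (\<Sum>i<j. B i) \<le> (\<Sum>i<j. v i + int i))"
  using assms
proof (induction k arbitrary: v)
  case 0
  obtain s where s: "s permutes {..<N}" "matset N 0 (\<lambda>i. v i + int (s i)) B \<noteq> {}"
    using alt_card_nonzeroE[OF 0(2)] .
  have vs: "v i = - int (s i)" if "i < N" for i
    using s(2) that by (force simp: matset_0 split: if_splits)
  \<comment> \<open>A strictly decreasing \<open>v = - s\<close> forces \<open>s\<close> to be
    increasing, hence to be the identity.\<close>
  have mono: "s i < s (Suc i)" if "Suc i < N" for i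
    using 0(1) that vs[of i] vs[of "Suc i"] by (auto simp: strict_dec_def)
  have ge: "i < N \<longrightarrow> i \<le> s i" for i
  proof (induction i)
    case (Suc i) then show ?case using mono[of i] by auto
  qed simp
  have "int i = int (s i)" if "i < N" for i
    by (rule sum_mono_inv[of int "{..<N}" "\<lambda>i. int (s i)"]) (use permutes_sum_id[OF s(1)] ge that in auto)
  then show ?case using vs by simp
next
  case (Suc k)
  have "\<exists>e\<in>{e. e \<in> colvecs N (B k) \<and> horizontal N v e}. alt_card N k B (\<lambda>i. v i - e i) \<noteq> 0"
    using Suc.prems(2) unfolding alt_card_pieri[OF Suc.prems(1)] by (meson sum.neutral)
  then obtain e where e: "e \<in> colvecs N (B k)" "horizontal N v e"
    and nz: "alt_card N k B (\<lambda>i. v i - e i) \<noteq> 0" by blast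
  have enn: "0 \<le> e i" for i using e(1) by (simp add: colvecs_def)
  have sd: "strict_dec N (\<lambda>i. v i - e i)"
    unfolding strict_dec_def
  proof (intro allI impI)
    fix i assume "Suc i < N"
    then have "v (Suc i) < v i - e i" using e(2) by (simp add: horizontal_def)
    then show "v (Suc i) - e (Suc i) < v i - e i" using enn[of "Suc i"] by linarith
  qed
  note IH = Suc.IH[OF sd nz]
  have tail: "v i = - int i" if "Suc k \<le> i" "i < N" for i
  proof -
    obtain i' where i': "i = Suc i'" using \<open>Suc k \<le> i\<close> by (cases i) auto
    have "v i' - e i' = - int i'" "v i - e i = - int i" using IH that i' by auto
    moreover have "v i < v i' - e i'" using e(2) that i' by (simp add: horizontal_def)
    ultimately show ?thesis using enn[of i] i' by simp
  qed
  have "(\<Sum>i<j. B i) \<le> (\<Sum>i<j. v i + int i)" if j: "j \<le> Suc k" "j \<le> N" for j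
  proof (cases "j = Suc k")
    case True
    have "(\<Sum>i<N. v i + int i) = (\<Sum>i<j. v i + int i)"
      using j(2) tail True by (intro sum.mono_neutral_right) auto
    then show ?thesis using alt_card_degree[OF Suc.prems(2)] True by simp
  next
    case False
    then have "(\<Sum>i<j. B i) \<le> (\<Sum>i<j. v i - e i + int i)" using IH j by simp
    also have "\<dots> \<le> (\<Sum>i<j. v i + int i)" using enn by (intro sum_mono) simp
    finally show ?thesis .
  qed
  then show ?case using tail by blast
qed

text \<open>Cutting the shape to its first \<open>k\<close> rows makes this an induction. By
  dominance, the last Pieri step must empty row \<open>k\<close>, which uses up the whole size
  \<open>la k\<close> of the strip, so only the strip \<open>e0\<close> contributes.\<close>

lemma alt_card_self:
  assumes "antimono (la :: nat \<Rightarrow> nat)" "k \<le> N"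
  shows "alt_card N k (\<lambda>i. int (la i)) (\<lambda>i. (if i < k then int (la i) else 0) - int i) = 1"
  using assms(2)
proof (induction k)
  case 0
  have "alt_card N 0 (\<lambda>i. int (la i)) (\<lambda>i. 0 - int i) =
      (\<Sum>s | s permutes {..<N}. if s = id then 1 else 0)"
    unfolding alt_card_def
  proof (rule sum.cong)
    fix s assume "s \<in> {s. s permutes {..<N}}"
    then have s: "s permutes {..<N}" by simp
    show "sign s * int (card (matset N 0 (\<lambda>i. 0 - int i + int (s i)) (\<lambda>i. int (la i)))) =
        (if s = id then 1 else 0)"
    proof (cases "s = id")
      case False
      then obtain i where "s i \<noteq> i" by (auto simp: fun_eq_iff)
      moreover have "i < N" using permutes_not_in[OF s, of i] \<open>s i \<noteq> i\<close> by auto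
      ultimately have "\<not> (\<forall>i<N. 0 - int i + int (s i) = 0)" by fastforce
      then show ?thesis using False unfolding matset_0 by (simp only: if_False card.empty)
    qed (simp add: matset_0)
  qed simp
  also have "\<dots> = 1" by (simp add: permutes_id finite_permutations)
  finally show ?case by simp
next
  case (Suc k)
  let ?B = "\<lambda>i. int (la i)"
  define v where "v = (\<lambda>i. (if i < Suc k then int (la i) else 0) - int i)"
  define e0 where "e0 = (\<lambda>i. if i = k then int (la k) else 0)"
  have anti: "la (Suc i) \<le> la i" for i using assms(1) by (simp add: antimono_def)
  have anti': "int (la (Suc i)) - 1 < int (la i)" for i using anti[of i] by linarith
  have sd: "strict_dec N v"
    unfolding strict_dec_def v_def using anti' by (auto simp: less_Suc_eq)
  have e0: "e0 \<in> colvecs N (?B k)" "horizontal N v e0"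
    using Suc.prems anti' by (auto simp: colvecs_def horizontal_def e0_def v_def)
  have "alt_card N k ?B (\<lambda>i. v i - e i) = (if e = e0 then 1 else 0)"
    if e: "e \<in> colvecs N (?B k)" "horizontal N v e" for e
  proof (cases "e = e0")
    case True
    have "(\<lambda>i. v i - e i) = (\<lambda>i. (if i < k then int (la i) else 0) - int i)"
      by (auto simp: True v_def e0_def fun_eq_iff less_Suc_eq)
    then show ?thesis using Suc True by simp
  next
    case False
    have enn: "0 \<le> e i" for i using e(1) by (simp add: colvecs_def)
    have sd': "strict_dec N (\<lambda>i. v i - e i)"
      unfolding strict_dec_def
    proof (intro allI impI)
      fix i assume "Suc i < N"
      then have "v (Suc i) < v i - e i" using e(2) by (simp add: horizontal_def)
      then show "v (Suc i) - e (Suc i) < v i - e i" using enn[of "Suc i"] by linarith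
    qed
    have "alt_card N k ?B (\<lambda>i. v i - e i) = 0"
    proof (rule ccontr)
      assume "alt_card N k ?B (\<lambda>i. v i - e i) \<noteq> 0"
      then have tail: "v i - e i = - int i" if "k \<le> i" "i < N" for i
        using alt_card_dominance[OF sd'] that by blast
      have ek: "e k = int (la k)" using tail[of k] Suc.prems by (simp add: v_def)
      have "(\<Sum>i<N. e i) = int (la k)" using e(1) by (simp add: colvecs_def)
      moreover have "(\<Sum>i<N. e i) = e k + (\<Sum>i\<in>{..<N} - {k}. e i)"
        using Suc.prems by (intro sum.remove) auto
      ultimately have "(\<Sum>i\<in>{..<N} - {k}. e i) = 0" using ek by simp
      then have "\<forall>i\<in>{..<N} - {k}. e i = 0" using enn by (subst (asm) sum_nonneg_eq_0_iff) auto
      then have "e i = e0 i" for i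
        using ek e(1) by (cases "i < N") (auto simp: e0_def colvecs_def)
      then have "e = e0" by blast
      then show False using False by simp
    qed
    then show ?thesis using False by simp
  qed
  then have "alt_card N (Suc k) ?B v =
      (\<Sum>e | e \<in> colvecs N (?B k) \<and> horizontal N v e. if e = e0 then 1 else 0)"
    unfolding alt_card_pieri[OF sd] by (intro sum.cong) auto
  also have "\<dots> = 1" using e0 by simp
  finally show ?case by (simp add: v_def)
qed

text \<open>The content \<open>\<lambda> + \<delta> - \<sigma> \<delta>\<close>, as \<open>\<delta> i - \<delta> (\<sigma> i) = \<sigma> i - i\<close>.\<close>

definition jt :: "(nat \<Rightarrow> nat) \<Rightarrow> (nat \<Rightarrow> nat) \<Rightarrow> nat \<Rightarrow> int" where
  "jt la s = (\<lambda>i. int (la i) - int i + int (s i))"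

text \<open>The virtual character that the Jacobi-Trudi determinant attaches to \<open>la\<close>.
  That it is the character of the Specht module is the content of
  \<open>chr_S_eq_alt_count\<close>.\<close>

definition alt_count :: "nat \<Rightarrow> nat \<Rightarrow> (nat \<Rightarrow> nat) \<Rightarrow> (nat \<Rightarrow> nat) \<Rightarrow> int" where
  "alt_count N n la g = (\<Sum>s | s permutes {..<N}. sign s * int (fix_count 0 n (jt la s) g))"

lemma jt_support:
  assumes "s permutes {..<N}" "\<And>i. i \<ge> N \<Longrightarrow> la i = 0" "i \<ge> N"
  shows "jt la s i = 0"
  using assms permutes_not_in[OF assms(1), of i] by (simp add: jt_def)

lemma jt_sum:
  assumes "s permutes {..<N}"
  shows "(\<Sum>i<N. jt la s i) = (\<Sum>i<N. int (la i))"
  using permutes_sum_id[OF assms] by (simp add: jt_def sum.distrib sum_subtractf)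

section \<open>Scalar products of permutation characters\<close>

lemma sum_slice:
  "(\<Sum>c\<in>{i} \<times> A. M c) = (\<Sum>j\<in>A. M (i, j))" "(\<Sum>c\<in>A \<times> {i}. M c) = (\<Sum>j\<in>A. M (j, i))"
  by (rule sum.reindex_bij_witness[of _ "\<lambda>j. (i, j)" snd]; auto)
     (rule sum.reindex_bij_witness[of _ "\<lambda>j. (j, i)" fst]; auto)

text \<open>Two colorings together form a coloring by cells, and the cell counts are a matrix with
  margins \<open>a\<close> and \<open>b\<close>: Mackey's formula for the product of two permutation
  characters.\<close>

lemma fix_count_pairs:
  assumes a: "\<And>i. i \<ge> N \<Longrightarrow> a i = 0" and b: "\<And>i. i \<ge> N \<Longrightarrow> b i = 0"
  shows "fix_count d n a g * fix_count d' n b g =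
    (\<Sum>M\<in>{M\<in>matset N N a b. colorings (d, d') n M \<noteq> {}}. fix_count (d, d') n M g)"
proof -
  let ?X = "{M\<in>matset N N a b. colorings (d, d') n M \<noteq> {}}"
  define fx where "fx = (\<lambda>M. {F \<in> colorings (d, d') n M. F \<circ> g = F})"
  have cont: "F \<in> colorings (d, d') n M" "M \<in> matset N N a b"
    if "f \<in> colorings d n a" "f' \<in> colorings d' n b" "F = (\<lambda>k. (f k, f' k))"
      "M = (\<lambda>c. int (card {k\<in>{1..n}. F k = c}))" for f f' F M
  proof -
    show F: "F \<in> colorings (d, d') n M"
      unfolding that(4) colorings_def
      using colorings_default[OF that(1)] colorings_default[OF that(2)] that(3) by simp
    have lt: "f k < N" "f' k < N" if "k \<in> {1..n}" for k
      using colorings_content_pos[OF \<open>f \<in> colorings d n a\<close> that]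
        colorings_content_pos[OF \<open>f' \<in> colorings d' n b\<close> that] a[of "f k"] b[of "f' k"]
      by (auto simp: not_less[symmetric])
    have "(\<Sum>j<N. M (i, j)) = a i" for i
    proof -
      have "(\<Sum>j<N. M (i, j)) = (\<Sum>c\<in>{i} \<times> {..<N}. M c)"
        by (simp only: sum_slice)
      also have "\<dots> = int (card {k\<in>{1..n}. F k \<in> {i} \<times> {..<N}})"
        by (rule sum_content_card[OF F]) auto
      also have "{k\<in>{1..n}. F k \<in> {i} \<times> {..<N}} = {k\<in>{1..n}. f k = i}"
        using lt by (auto simp: that(3))
      finally show ?thesis using colorings_card[OF that(1)] by simp
    qed
    moreover have "(\<Sum>i<N. M (i, j)) = b j" for j
    proof -
      have "(\<Sum>i<N. M (i, j)) = (\<Sum>c\<in>{..<N} \<times> {j}. M c)"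
        by (simp only: sum_slice)
      also have "\<dots> = int (card {k\<in>{1..n}. F k \<in> {..<N} \<times> {j}})"
        by (rule sum_content_card[OF F]) auto
      also have "{k\<in>{1..n}. F k \<in> {..<N} \<times> {j}} = {k\<in>{1..n}. f' k = j}"
        using lt by (auto simp: that(3))
      finally show ?thesis using colorings_card[OF that(2)] by simp
    qed
    moreover have "M (i, j) = 0" if "i \<ge> N \<or> j \<ge> N" for i j
    proof -
      have "{k\<in>{1..n}. F k = (i, j)} = {}" using lt \<open>i \<ge> N \<or> j \<ge> N\<close> \<open>F = _\<close> by fastforce
      then show ?thesis unfolding \<open>M = _\<close> by (simp only: card.empty of_nat_0)
    qed
    moreover have "0 \<le> M c" for c by (simp add: that(4))
    ultimately show "M \<in> matset N N a b" by (simp add: matset_def)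
  qed
  have proj: "fst \<circ> F \<in> colorings d n a" "snd \<circ> F \<in> colorings d' n b"
    if M: "M \<in> matset N N a b" and F: "F \<in> colorings (d, d') n M" for M F
  proof -
    have lt: "fst (F k) < N" "snd (F k) < N" if "k \<in> {1..n}" for k
    proof -
      have "M (fst (F k), snd (F k)) \<noteq> 0" using colorings_content_pos[OF F that] by simp
      then have "\<not> (fst (F k) \<ge> N \<or> snd (F k) \<ge> N)" using M unfolding matset_def by blast
      then show "fst (F k) < N" "snd (F k) < N" by simp_all
    qed
    have "int (card {k\<in>{1..n}. fst (F k) = i}) = a i" for i
    proof -
      have "{k\<in>{1..n}. fst (F k) = i} = {k\<in>{1..n}. F k \<in> {i} \<times> {..<N}}"
        using lt by (auto simp: mem_Times_iff)
      then have "int (card {k\<in>{1..n}. fst (F k) = i}) = (\<Sum>c\<in>{i} \<times> {..<N}. M c)"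
        using sum_content_card[OF F, of "{i} \<times> {..<N}"] by simp
      also have "\<dots> = (\<Sum>j<N. M (i, j))" by (simp only: sum_slice)
      also have "\<dots> = a i" using M a[of i] by (cases "i < N") (auto simp: matset_def)
      finally show ?thesis .
    qed
    then show "fst \<circ> F \<in> colorings d n a"
      using colorings_default[OF F] by (simp add: colorings_def)
    have "int (card {k\<in>{1..n}. snd (F k) = j}) = b j" for j
    proof -
      have "{k\<in>{1..n}. snd (F k) = j} = {k\<in>{1..n}. F k \<in> {..<N} \<times> {j}}"
        using lt by (auto simp: mem_Times_iff)
      then have "int (card {k\<in>{1..n}. snd (F k) = j}) = (\<Sum>c\<in>{..<N} \<times> {j}. M c)"
        using sum_content_card[OF F, of "{..<N} \<times> {j}"] by simp
      also have "\<dots> = (\<Sum>i<N. M (i, j))" by (simp only: sum_slice)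
      also have "\<dots> = b j" using M b[of j] by (cases "j < N") (auto simp: matset_def)
      finally show ?thesis .
    qed
    then show "snd \<circ> F \<in> colorings d' n b"
      using colorings_default[OF F] by (simp add: colorings_def)
  qed
  have "fix_count d n a g * fix_count d' n b g =
      card ({f \<in> colorings d n a. f \<circ> g = f} \<times> {f \<in> colorings d' n b. f \<circ> g = f})"
    by (simp add: fix_count_def card_cartesian_product)
  also have "\<dots> = card (\<Union>M\<in>?X. fx M)"
  proof (rule bij_betw_same_card[of "\<lambda>(f, f') k. (f k, f' k)"],
      rule bij_betw_byWitness[where f' = "\<lambda>F. (fst \<circ> F, snd \<circ> F)"])
    show "(\<lambda>(f, f') k. (f k, f' k)) ` ({f \<in> colorings d n a. f \<circ> g = f} \<times> {f \<in> colorings d' n b. f \<circ> g = f})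
        \<subseteq> (\<Union>M\<in>?X. fx M)"
    proof clarify
      fix f f' assume f: "f \<in> colorings d n a" "f \<circ> g = f" "f' \<in> colorings d' n b" "f' \<circ> g = f'"
      have "(\<lambda>k. (f k, f' k)) \<circ> g = (\<lambda>k. (f k, f' k))"
        using f(2,4) by (simp add: fun_eq_iff)
      then have "(\<lambda>k. (f k, f' k)) \<in> fx (\<lambda>c. int (card {k\<in>{1..n}. (f k, f' k) = c}))"
        using cont(1)[OF f(1,3) refl refl] by (simp add: fx_def)
      then show "(\<lambda>k. (f k, f' k)) \<in> (\<Union>M\<in>?X. fx M)"
        using cont[OF f(1,3) refl refl] by blast
    qed
    show "(\<lambda>F. (fst \<circ> F, snd \<circ> F)) ` (\<Union>M\<in>?X. fx M)
        \<subseteq> {f \<in> colorings d n a. f \<circ> g = f} \<times> {f \<in> colorings d' n b. f \<circ> g = f}"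
    proof
      fix x assume "x \<in> (\<lambda>F. (fst \<circ> F, snd \<circ> F)) ` (\<Union>M\<in>?X. fx M)"
      then obtain M F where M: "M \<in> matset N N a b" and F: "F \<in> fx M" and x: "x = (fst \<circ> F, snd \<circ> F)"
        by blast
      have Fc: "F \<in> colorings (d, d') n M" "F \<circ> g = F" using F by (simp_all add: fx_def)
      have "fst \<circ> F \<circ> g = fst \<circ> F" "snd \<circ> F \<circ> g = snd \<circ> F" using Fc(2) by (simp_all add: comp_assoc)
      then show "x \<in> {f \<in> colorings d n a. f \<circ> g = f} \<times> {f \<in> colorings d' n b. f \<circ> g = f}"
        using proj[OF M Fc(1)] x by blast
    qed
  qed auto
  also have "\<dots> = (\<Sum>M\<in>?X. card (fx M))"
  proof (rule card_UN_disjoint)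
    show "\<forall>M\<in>?X. \<forall>M'\<in>?X. M \<noteq> M' \<longrightarrow> fx M \<inter> fx M' = {}"
    proof (intro ballI impI)
      fix M M' :: "nat \<times> nat \<Rightarrow> int" assume ne: "M \<noteq> M'"
      have "M = M'" if "F \<in> fx M" "F \<in> fx M'" for F
      proof
        fix c
        have "F \<in> colorings (d, d') n M" "F \<in> colorings (d, d') n M'" using that by (simp_all add: fx_def)
        from colorings_card[OF this(1), of c, symmetric] colorings_card[OF this(2), of c]
        show "M c = M' c" by (rule trans)
      qed
      then show "fx M \<inter> fx M' = {}" using ne by blast
    qed
  qed (auto simp: fx_def)
  finally show ?thesis by (simp add: fix_count_def fx_def)
qed

text \<open>The cell colorings with a given matrix as content form one orbit, so Burnside's lemma
  contributes \<open>fact n\<close> for each matrix.\<close>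

lemma sum_fix_count_pairs:
  assumes a: "\<And>i. i \<ge> N \<Longrightarrow> a i = 0" "(\<Sum>i<N. a i) = int n" and b: "\<And>i. i \<ge> N \<Longrightarrow> b i = 0"
  shows "(\<Sum>g\<in>Sym n. fix_count d n a g * fix_count d' n b g) = fact n * card (matset N N a b)"
proof -
  have ne: "colorings (d, d') n M \<noteq> {}" if M: "M \<in> matset N N a b" for M
  proof (rule colorings_nonempty)
    show "0 \<le> M c" for c using M unfolding matset_def by blast
    show "finite ({..<N} \<times> {..<N})" by simp
    show "M c = 0" if "c \<notin> {..<N} \<times> {..<N}" for c
      using M that by (cases c) (auto simp: matset_def not_less)
    have "(\<Sum>c\<in>{..<N} \<times> {..<N}. M c) = (\<Sum>i<N. \<Sum>j<N. M (i, j))"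
      by (simp add: sum.cartesian_product)
    also have "\<dots> = int n" using M a(2) by (simp add: matset_def)
    finally show "(\<Sum>c\<in>{..<N} \<times> {..<N}. M c) = int n" .
  qed
  have eq: "{M \<in> matset N N a b. colorings (d, d') n M \<noteq> {}} = matset N N a b" using ne by blast
  have "(\<Sum>g\<in>Sym n. fix_count d n a g * fix_count d' n b g) =
      (\<Sum>g\<in>Sym n. \<Sum>M\<in>{M \<in> matset N N a b. colorings (d, d') n M \<noteq> {}}. fix_count (d, d') n M g)"
    by (rule sum.cong[OF refl], rule fix_count_pairs) (use a b in auto)
  also have "\<dots> = (\<Sum>g\<in>Sym n. \<Sum>M\<in>matset N N a b. fix_count (d, d') n M g)"
    by (simp only: eq)
  also have "\<dots> = (\<Sum>M\<in>matset N N a b. \<Sum>g\<in>Sym n. fix_count (d, d') n M g)" by (rule sum.swap)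
  also have "\<dots> = (\<Sum>M\<in>matset N N a b. fact n)" by (rule sum.cong[OF refl], rule sum_fix_count, rule ne)
  finally show ?thesis by simp
qed

lemma sum_alt_count_fix_count:
  assumes la: "\<And>i. i \<ge> N \<Longrightarrow> la i = 0" "(\<Sum>i<N. int (la i)) = int n" and b: "\<And>i. i \<ge> N \<Longrightarrow> b i = 0"
  shows "(\<Sum>g\<in>Sym n. alt_count N n la g * int (fix_count 0 n b g)) =
    fact n * alt_card N N b (\<lambda>i. int (la i) - int i)"
proof -
  have "(\<Sum>g\<in>Sym n. alt_count N n la g * int (fix_count 0 n b g)) =
      (\<Sum>g\<in>Sym n. \<Sum>s | s permutes {..<N}. sign s * int (fix_count 0 n (jt la s) g * fix_count 0 n b g))"
    by (simp add: alt_count_def sum_distrib_right mult.assoc)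
  also have "\<dots> = (\<Sum>s | s permutes {..<N}. \<Sum>g\<in>Sym n. sign s * int (fix_count 0 n (jt la s) g * fix_count 0 n b g))"
    by (rule sum.swap)
  also have "\<dots> = (\<Sum>s | s permutes {..<N}. fact n * (sign s * int (card (matset N N (jt la s) b))))"
  proof (rule sum.cong)
    fix s assume "s \<in> {s. s permutes {..<N}}"
    then have s: "s permutes {..<N}" by simp
    have "(\<Sum>g\<in>Sym n. sign s * int (fix_count 0 n (jt la s) g * fix_count 0 n b g)) =
        sign s * int (\<Sum>g\<in>Sym n. fix_count 0 n (jt la s) g * fix_count 0 n b g)"
      by (simp add: sum_distrib_left)
    also have "(\<Sum>g\<in>Sym n. fix_count 0 n (jt la s) g * fix_count 0 n b g) =
        fact n * card (matset N N (jt la s) b)"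
      using jt_support[OF s la(1)] jt_sum[OF s, of la] la(2) b by (intro sum_fix_count_pairs) auto
    finally show "(\<Sum>g\<in>Sym n. sign s * int (fix_count 0 n (jt la s) g * fix_count 0 n b g)) =
        fact n * (sign s * int (card (matset N N (jt la s) b)))" by simp
  qed simp
  finally show ?thesis by (simp add: alt_card_def jt_def sum_distrib_left)
qed

text \<open>Expanding the second factor leaves Kostka numbers of shape \<open>la\<close> and content
  \<open>jt la s\<close>. Unless \<open>s = id\<close>, some partial sum of this content exceeds
  that of \<open>la\<close>, against dominance.\<close>

theorem alt_count_norm:
  assumes la: "antimono la" "\<And>i. i \<ge> N \<Longrightarrow> la i = 0" "(\<Sum>i<N. int (la i)) = int n"
  shows "(\<Sum>g\<in>Sym n. alt_count N n la g * alt_count N n la g) = fact n"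
proof -
  let ?v = "\<lambda>i. int (la i) - int i"
  have sd: "strict_dec N ?v"
    unfolding strict_dec_def
  proof (intro allI impI)
    fix i
    have "la (Suc i) \<le> la i" using la(1) by (simp add: antimono_def)
    then show "int (la (Suc i)) - int (Suc i) < int (la i) - int i" by simp
  qed
  have val: "alt_card N N (jt la s) ?v = (if s = id then 1 else 0)" if s: "s permutes {..<N}" for s
  proof (cases "s = id")
    case True
    have "(\<lambda>i. (if i < N then int (la i) else 0) - int i) = ?v" using la(2) by (auto simp: fun_eq_iff)
    then show ?thesis using alt_card_self[OF la(1), of N N] True by (simp add: jt_def)
  next
    case False
    have "alt_card N N (jt la s) ?v = 0"
    proof (rule ccontr)
      assume "alt_card N N (jt la s) ?v \<noteq> 0"
      then have dom: "(\<Sum>i<j. jt la s i) \<le> (\<Sum>i<j. ?v i + int i)" if "j \<le> N" for j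
        using alt_card_dominance[OF sd] that by blast
      have "s = id"
      proof (rule permutes_dominated_id[OF s])
        fix j assume "j \<le> N"
        then show "(\<Sum>i<j. int (s i)) \<le> (\<Sum>i<j. int i)"
          using dom[of j] by (simp add: jt_def sum.distrib sum_subtractf)
      qed
      then show False using False by simp
    qed
    then show ?thesis using False by simp
  qed
  have "(\<Sum>g\<in>Sym n. alt_count N n la g * alt_count N n la g) =
      (\<Sum>g\<in>Sym n. \<Sum>s | s permutes {..<N}. sign s * (alt_count N n la g * int (fix_count 0 n (jt la s) g)))"
    unfolding alt_count_def[of _ _ _ _] by (simp add: sum_distrib_left mult.left_commute)
  also have "\<dots> = (\<Sum>s | s permutes {..<N}. \<Sum>g\<in>Sym n. sign s * (alt_count N n la g * int (fix_count 0 n (jt la s) g)))"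
    by (rule sum.swap)
  also have "\<dots> = (\<Sum>s | s permutes {..<N}. sign s * (fact n * alt_card N N (jt la s) ?v))"
  proof (rule sum.cong)
    fix s assume "s \<in> {s. s permutes {..<N}}"
    then have s: "s permutes {..<N}" by simp
    show "(\<Sum>g\<in>Sym n. sign s * (alt_count N n la g * int (fix_count 0 n (jt la s) g))) =
        sign s * (fact n * alt_card N N (jt la s) ?v)"
      unfolding sum_distrib_left[symmetric]
      using sum_alt_count_fix_count[OF la(2,3), of "jt la s"] jt_support[OF s la(2)] by simp
  qed simp
  also have "\<dots> = (\<Sum>s | s permutes {..<N}. if s = id then fact n else 0)"
    using val by (intro sum.cong) auto
  also have "\<dots> = fact n" by (simp add: finite_permutations permutes_id)
  finally show ?thesis .
qed

section \<open>Characters of submodules of permutation modules\<close>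

lemma sum_fun_apply: "(\<Sum>i\<in>A. f i) x = (\<Sum>i\<in>A. f i x)" for f :: "'a \<Rightarrow> 'b \<Rightarrow> complex"
  by (induction A rule: infinite_finite_induct) auto

lemma fscale_apply [simp]: "fscale c f x = c * f x"
  by (simp add: fscale_def)

text \<open>The matrix of some projection from the functions on \<open>X\<close> onto
  \<open>W\<close>: its columns lie in \<open>W\<close> and it reproduces the vectors of
  \<open>W\<close>. Traces on \<open>W\<close> can then be read off in coordinates, without a basis
  of \<open>W\<close>.\<close>

definition kernel_on :: "'x set \<Rightarrow> ('x \<Rightarrow> complex) set \<Rightarrow> ('x \<Rightarrow> 'x \<Rightarrow> complex) \<Rightarrow> bool" where
  "kernel_on X W P \<longleftrightarrow>
     (\<forall>y\<in>X. (\<lambda>x. P x y) \<in> W) \<and> (\<forall>F\<in>W. \<forall>x. F x = (\<Sum>y\<in>X. P x y * F y))"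

definition supported :: "'x set \<Rightarrow> ('x \<Rightarrow> complex) set \<Rightarrow> bool" where
  "supported X W \<longleftrightarrow> fun_vs.subspace W \<and> (\<forall>F\<in>W. \<forall>x. x \<notin> X \<longrightarrow> F x = 0)"

definition delta :: "'x \<Rightarrow> 'x \<Rightarrow> complex" where
  "delta y = (\<lambda>x. if x = y then 1 else 0)"

lemma supported_expand:
  assumes "finite X" "\<And>x. x \<notin> X \<Longrightarrow> F x = 0"
  shows "F = (\<Sum>y\<in>X. fscale (F y) (delta y))"
proof
  fix x
  have "(\<Sum>y\<in>X. F y * (if x = y then 1 else 0)) = (\<Sum>y\<in>X. if x = y then F y else 0)"
    by (intro sum.cong) auto
  also have "\<dots> = F x" using assms by (auto simp: sum.delta')
  finally show "F x = (\<Sum>y\<in>X. fscale (F y) (delta y)) x"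
    by (simp add: sum_fun_apply delta_def)
qed

lemma supported_span:
  assumes "finite X" "supported X W"
  shows "W \<subseteq> fun_vs.span (delta ` X)"
proof
  fix F assume "F \<in> W"
  then have "F = (\<Sum>y\<in>X. fscale (F y) (delta y))"
    using assms by (intro supported_expand) (auto simp: supported_def)
  moreover have "(\<Sum>y\<in>X. fscale (F y) (delta y)) \<in> fun_vs.span (delta ` X)"
    by (intro fun_vs.span_sum fun_vs.span_scale fun_vs.span_base) auto
  ultimately show "F \<in> fun_vs.span (delta ` X)" by simp
qed

text \<open>A linear retraction onto \<open>W\<close>, applied to the indicator functions of the
  points, yields the columns.\<close>

lemma kernel_exists:
  assumes X: "finite X" and W: "supported X W"
  shows "\<exists>P. kernel_on X W P"
proof -
  interpret vp: vector_space_pair "fscale :: complex \<Rightarrow> ('x \<Rightarrow> complex) \<Rightarrow> _" "fscale :: complex \<Rightarrow> ('x \<Rightarrow> complex) \<Rightarrow> _"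
    by unfold_locales
  have W': "fun_vs.subspace W" using W by (simp add: supported_def)
  obtain g where g: "range g \<subseteq> W" "Vector_Spaces.linear fscale fscale g" "\<And>v. v \<in> W \<Longrightarrow> g v = v"
    using vp.linear_exists_left_inverse_on[OF fun_vs.linear_id W'] by auto
  have "kernel_on X W (\<lambda>x y. g (delta y) x)"
    unfolding kernel_on_def
  proof (intro conjI ballI allI)
    show "(\<lambda>x. g (delta y) x) \<in> W" for y using g(1) by auto
    fix F x assume F: "F \<in> W"
    have "F = g F" using g(3) F by simp
    also have "g F = g (\<Sum>y\<in>X. fscale (F y) (delta y))"
      using supported_expand[OF X, of F] W F by (simp add: supported_def)
    also have "\<dots> = (\<Sum>y\<in>X. fscale (F y) (g (delta y)))"
      by (simp add: vp.linear_sum[OF g(2)] vp.linear_scale[OF g(2)])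
    finally have "F x = (\<Sum>y\<in>X. fscale (F y) (g (delta y))) x" by simp
    then show "F x = (\<Sum>y\<in>X. g (delta y) x * F y)" by (simp add: sum_fun_apply mult.commute)
  qed
  then show ?thesis by blast
qed

text \<open>The ambient function space may have infinite dimension, so a basis of \<open>U\<close>
  is extended inside \<open>W\<close>, where the finitely many indicators of points of
  \<open>X\<close> bound its size.\<close>

lemma dim_psubset_supported:
  assumes X: "finite X" and U: "supported X U" and W: "supported X W" and UW: "U \<subset> W"
  shows "fun_vs.dim U < fun_vs.dim W"
proof -
  obtain B where B: "B \<subseteq> U" "fun_vs.independent B" "U \<subseteq> fun_vs.span B" "card B = fun_vs.dim U"
    using fun_vs.basis_exists[of U] by blast
  have "B \<subseteq> W" using B(1) UW by blast
  then obtain B' where B': "B \<subseteq> B'" "B' \<subseteq> W" "fun_vs.independent B'" "W \<subseteq> fun_vs.span B'"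
    using fun_vs.maximal_independent_subset_extend[OF _ B(2)] by blast
  have fin: "finite B'"
    using fun_vs.independent_span_bound[OF _ B'(3), of "delta ` X"] X B'(2) supported_span[OF X W] by blast
  have "fun_vs.subspace U" using U by (simp add: supported_def)
  then have "fun_vs.span B \<subseteq> U" using B(1) by (intro fun_vs.span_minimal)
  then have "B \<noteq> B'" using B'(4) UW by blast
  then have "card B < card B'" using B'(1) fin by (intro psubset_card_mono) auto
  moreover have "card B' = fun_vs.dim W" using B' by (intro fun_vs.basis_card_eq_dim)
  ultimately show ?thesis using B(4) by simp
qed

lemma supported_finite_span:
  assumes X: "finite X" and W: "supported X W"
  shows "\<exists>B. finite B \<and> W = fun_vs.span B"
proof -
  obtain B where B: "B \<subseteq> W" "fun_vs.independent B" "W \<subseteq> fun_vs.span B" "card B = fun_vs.dim W"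
    using fun_vs.basis_exists[of W] by blast
  have "finite B"
    using fun_vs.independent_span_bound[OF _ B(2), of "delta ` X"] X B(1) supported_span[OF X W]
    by (meson finite_imageI subset_trans)
  moreover have "fun_vs.span B \<subseteq> W"
    using B(1) W by (intro fun_vs.span_minimal) (auto simp: supported_def)
  ultimately show ?thesis using B(3) by (intro exI[of _ B] conjI equalityI)
qed

section \<open>Direct decompositions\<close>

lemma direct_decompositionI:
  assumes "finite \<U>" "\<And>U. U \<in> \<U> \<Longrightarrow> fun_vs.subspace U \<and> U \<subseteq> S"
    and ex: "\<And>w. w \<in> S \<Longrightarrow> \<exists>f. (\<forall>U\<in>\<U>. f U \<in> U) \<and> w = (\<Sum>U\<in>\<U>. f U)"
    and indep: "\<And>f. \<forall>U\<in>\<U>. f U \<in> U \<Longrightarrow> (\<Sum>U\<in>\<U>. f U) = 0 \<Longrightarrow> \<forall>U\<in>\<U>. f U = 0"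
  shows "direct_decomposition S \<U>"
  unfolding direct_decomposition_def
proof (intro conjI ballI)
  fix w assume "w \<in> S"
  then obtain f where f: "\<forall>U\<in>\<U>. f U \<in> U" "w = (\<Sum>U\<in>\<U>. f U)" using ex by blast
  show "\<exists>!f. f \<in> (\<Pi>\<^sub>E U\<in>\<U>. U) \<and> w = (\<Sum>U\<in>\<U>. f U)"
  proof (rule ex1I[of _ "restrict f \<U>"])
    have "(\<Sum>U\<in>\<U>. restrict f \<U> U) = (\<Sum>U\<in>\<U>. f U)" by (rule sum.cong) auto
    then show "restrict f \<U> \<in> (\<Pi>\<^sub>E U\<in>\<U>. U) \<and> w = (\<Sum>U\<in>\<U>. restrict f \<U> U)"
      using f by (simp only:) auto
    fix f' assume f': "f' \<in> (\<Pi>\<^sub>E U\<in>\<U>. U) \<and> w = (\<Sum>U\<in>\<U>. f' U)"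
    have "\<forall>U\<in>\<U>. f' U - f U \<in> U"
      using f' f(1) assms(2) by (auto intro!: fun_vs.subspace_diff)
    moreover have "(\<Sum>U\<in>\<U>. f' U - f U) = 0" using f' f(2) by (simp add: sum_subtractf)
    ultimately have "\<forall>U\<in>\<U>. f' U - f U = 0" by (rule indep)
    then have eq: "f' U = f U" if "U \<in> \<U>" for U using that by (metis eq_iff_diff_eq_0)
    show "f' = restrict f \<U>"
    proof
      fix U show "f' U = restrict f \<U> U"
        using eq f' by (cases "U \<in> \<U>") (auto simp: PiE_def extensional_def)
    qed
  qed
qed (use assms in auto)

lemma direct_decompositionD:
  assumes "direct_decomposition S \<U>"
  shows "finite \<U>" "\<And>U. U \<in> \<U> \<Longrightarrow> fun_vs.subspace U" "\<And>U. U \<in> \<U> \<Longrightarrow> U \<subseteq> S"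
    and "\<And>w. w \<in> S \<Longrightarrow> \<exists>f. (\<forall>U\<in>\<U>. f U \<in> U) \<and> w = (\<Sum>U\<in>\<U>. f U)"
    and "\<And>f f'. \<lbrakk>fun_vs.subspace S; \<forall>U\<in>\<U>. f U \<in> U; \<forall>U\<in>\<U>. f' U \<in> U; (\<Sum>U\<in>\<U>. f U) = (\<Sum>U\<in>\<U>. f' U)\<rbrakk>
      \<Longrightarrow> \<forall>U\<in>\<U>. f U = f' U"
proof -
  show "finite \<U>" "\<And>U. U \<in> \<U> \<Longrightarrow> fun_vs.subspace U" and sub: "\<And>U. U \<in> \<U> \<Longrightarrow> U \<subseteq> S"
    using assms by (auto simp: direct_decomposition_def)
  show "\<exists>f. (\<forall>U\<in>\<U>. f U \<in> U) \<and> w = (\<Sum>U\<in>\<U>. f U)" if "w \<in> S" for w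
  proof -
    have "\<exists>!f. f \<in> (\<Pi>\<^sub>E U\<in>\<U>. U) \<and> w = (\<Sum>U\<in>\<U>. f U)"
      using assms that by (simp add: direct_decomposition_def)
    then obtain f where "f \<in> (\<Pi>\<^sub>E U\<in>\<U>. U) \<and> w = (\<Sum>U\<in>\<U>. f U)" by (rule ex1E)
    then show ?thesis by (intro exI[of _ f]) auto
  qed
  fix f f' assume S: "fun_vs.subspace S" and f: "\<forall>U\<in>\<U>. f U \<in> U" "\<forall>U\<in>\<U>. f' U \<in> U"
    and eq: "(\<Sum>U\<in>\<U>. f U) = (\<Sum>U\<in>\<U>. f' U)"
  have s: "(\<Sum>U\<in>\<U>. restrict h \<U> U) = (\<Sum>U\<in>\<U>. h U)" for h :: "('a \<Rightarrow> complex) set \<Rightarrow> 'a \<Rightarrow> complex"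
    by (rule sum.cong) auto
  have "(\<Sum>U\<in>\<U>. f U) \<in> S" using f(1) sub S by (intro fun_vs.subspace_sum) auto
  then have "\<exists>!h. h \<in> (\<Pi>\<^sub>E U\<in>\<U>. U) \<and> (\<Sum>U\<in>\<U>. f U) = (\<Sum>U\<in>\<U>. h U)"
    using assms by (simp add: direct_decomposition_def)
  moreover have "restrict f \<U> \<in> (\<Pi>\<^sub>E U\<in>\<U>. U) \<and> (\<Sum>U\<in>\<U>. f U) = (\<Sum>U\<in>\<U>. restrict f \<U> U)"
    unfolding s using f by auto
  moreover have "restrict f' \<U> \<in> (\<Pi>\<^sub>E U\<in>\<U>. U) \<and> (\<Sum>U\<in>\<U>. f U) = (\<Sum>U\<in>\<U>. restrict f' \<U> U)"
    unfolding s using f eq by auto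
  ultimately have "restrict f \<U> = restrict f' \<U>" by blast
  then show "\<forall>U\<in>\<U>. f U = f' U" by (metis restrict_apply')
qed

lemma direct_decomposition_union:
  assumes 1: "direct_decomposition U \<U>1" and 2: "direct_decomposition V \<U>2"
    and sub: "fun_vs.subspace U" "fun_vs.subspace V" "U \<inter> V = {0}" "U \<subseteq> W" "V \<subseteq> W"
    and ex: "\<And>w. w \<in> W \<Longrightarrow> \<exists>u\<in>U. \<exists>v\<in>V. w = u + v"
    and nz: "\<And>X. X \<in> \<U>1 \<union> \<U>2 \<Longrightarrow> X \<noteq> {0}"
  shows "direct_decomposition W (\<U>1 \<union> \<U>2)"
proof (rule direct_decompositionI)
  note d1 = direct_decompositionD[OF 1] and d2 = direct_decompositionD[OF 2]
  \<comment> \<open>A common member would lie in the zero intersection of \<open>U\<close> and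
    \<open>V\<close>. Families are sets, so a subspace present in both would be counted once and the
    sum over the union would not split.\<close>
  have disj: "\<U>1 \<inter> \<U>2 = {}"
  proof (rule ccontr)
    assume "\<U>1 \<inter> \<U>2 \<noteq> {}"
    then obtain X where X: "X \<in> \<U>1" "X \<in> \<U>2" by blast
    then have "X \<subseteq> {0}" using d1(3)[OF X(1)] d2(3)[OF X(2)] sub(3) by blast
    moreover have "0 \<in> X" using d1(2)[OF X(1)] by (rule fun_vs.subspace_0)
    ultimately show False using nz[of X] X by blast
  qed
  have fin: "finite \<U>1" "finite \<U>2" using d1(1) d2(1) .
  show "finite (\<U>1 \<union> \<U>2)" using fin by simp
  show "fun_vs.subspace X \<and> X \<subseteq> W" if "X \<in> \<U>1 \<union> \<U>2" for X
    using that d1(2,3) d2(2,3) sub(4,5) by blast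
  have split: "(\<Sum>X\<in>\<U>1 \<union> \<U>2. f X) = (\<Sum>X\<in>\<U>1. f X) + (\<Sum>X\<in>\<U>2. f X)"
    for f :: "('a \<Rightarrow> complex) set \<Rightarrow> 'a \<Rightarrow> complex"
    using sum.union_disjoint[OF fin disj] .
  show "\<exists>f. (\<forall>X\<in>\<U>1 \<union> \<U>2. f X \<in> X) \<and> w = (\<Sum>X\<in>\<U>1 \<union> \<U>2. f X)" if "w \<in> W" for w
  proof -
    obtain u v where uv: "u \<in> U" "v \<in> V" "w = u + v" using ex[OF \<open>w \<in> W\<close>] by blast
    obtain f1 where f1: "\<forall>X\<in>\<U>1. f1 X \<in> X" "u = (\<Sum>X\<in>\<U>1. f1 X)" using d1(4)[OF uv(1)] by blast
    obtain f2 where f2: "\<forall>X\<in>\<U>2. f2 X \<in> X" "v = (\<Sum>X\<in>\<U>2. f2 X)" using d2(4)[OF uv(2)] by blast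
    define f where "f = (\<lambda>X. if X \<in> \<U>1 then f1 X else f2 X)"
    have "(\<Sum>X\<in>\<U>1. f X) = u" unfolding f1(2) by (rule sum.cong) (auto simp: f_def)
    moreover have "(\<Sum>X\<in>\<U>2. f X) = v" unfolding f2(2) using disj by (intro sum.cong) (auto simp: f_def)
    moreover have "\<forall>X\<in>\<U>1 \<union> \<U>2. f X \<in> X" using f1(1) f2(1) by (auto simp: f_def)
    ultimately show ?thesis using uv(3) split[of f] by (intro exI[of _ f]) simp
  qed
  fix f assume f: "\<forall>X\<in>\<U>1 \<union> \<U>2. f X \<in> X" and z: "(\<Sum>X\<in>\<U>1 \<union> \<U>2. f X) = 0"
  have a: "(\<Sum>X\<in>\<U>1. f X) \<in> U" using f d1(3) by (intro fun_vs.subspace_sum sub) blast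
  have b: "(\<Sum>X\<in>\<U>2. f X) \<in> V" using f d2(3) by (intro fun_vs.subspace_sum sub) blast
  have ab: "(\<Sum>X\<in>\<U>1. f X) = - (\<Sum>X\<in>\<U>2. f X)"
    using z unfolding split by (rule eq_neg_iff_add_eq_0[THEN iffD2])
  have "- (\<Sum>X\<in>\<U>2. f X) \<in> V" using b sub(2) by (rule fun_vs.subspace_neg[rotated])
  then have "(\<Sum>X\<in>\<U>1. f X) \<in> U \<inter> V" using a ab by simp
  then have z1: "(\<Sum>X\<in>\<U>1. f X) = 0" using sub(3) by blast
  then have z2: "(\<Sum>X\<in>\<U>2. f X) = 0" using ab by simp
  have "\<forall>X\<in>\<U>1. f X = (\<lambda>_. 0) X"
    using f z1 d1(2) fun_vs.subspace_0 by (intro d1(5) sub) auto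
  moreover have "\<forall>X\<in>\<U>2. f X = (\<lambda>_. 0) X"
    using f z2 d2(2) fun_vs.subspace_0 by (intro d2(5) sub) auto
  ultimately show "\<forall>X\<in>\<U>1 \<union> \<U>2. f X = 0" by auto
qed

section \<open>Modules of functions on a finite set with a group action\<close>

locale perm_action =
  fixes n :: nat and X :: "'x set" and \<rho> :: "(nat \<Rightarrow> nat) \<Rightarrow> 'x \<Rightarrow> 'x"
  assumes finite_X: "finite X"
    and rho_closed: "g \<in> Sym n \<Longrightarrow> x \<in> X \<Longrightarrow> \<rho> g x \<in> X"
    and rho_id: "\<rho> id x = x"
    and rho_comp: "g \<in> Sym n \<Longrightarrow> h \<in> Sym n \<Longrightarrow> \<rho> (g \<circ> h) x = \<rho> h (\<rho> g x)"
begin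

lemma rho_inv: "g \<in> Sym n \<Longrightarrow> \<rho> (inv' g) (\<rho> g x) = x" "g \<in> Sym n \<Longrightarrow> \<rho> g (\<rho> (inv' g) x) = x"
  using rho_comp[of g "inv' g" x] rho_comp[of "inv' g" g x] by (simp_all add: rho_id)

lemma bij_rho: "g \<in> Sym n \<Longrightarrow> bij_betw (\<rho> g) X X"
  by (rule bij_betw_byWitness[where f' = "\<rho> (inv' g)"]) (auto simp: rho_inv rho_closed)

lemma sum_rho: "g \<in> Sym n \<Longrightarrow> (\<Sum>x\<in>X. f (\<rho> g x)) = (\<Sum>x\<in>X. f x)"
  by (rule sum.reindex_bij_betw[OF bij_rho])

text \<open>Since \<open>\<rho>\<close> is a right action, as precomposition is, this is a left
  action on functions.\<close>

definition act :: "(nat \<Rightarrow> nat) \<Rightarrow> ('x \<Rightarrow> complex) \<Rightarrow> 'x \<Rightarrow> complex" where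
  "act g F = (\<lambda>x. F (\<rho> g x))"

lemma act_apply: "act g F x = F (\<rho> g x)"
  by (simp add: act_def)

lemma act_comp: "g \<in> Sym n \<Longrightarrow> h \<in> Sym n \<Longrightarrow> act (g \<circ> h) F = act g (act h F)"
  by (simp add: act_def rho_comp)

lemma act_id: "act id F = F"
  by (simp add: act_def rho_id)

lemma act_linear: "act g (F + F') = act g F + act g F'" "act g (fscale c F) = fscale c (act g F)"
  by (auto simp: act_def fun_eq_iff)

definition submod :: "('x \<Rightarrow> complex) set \<Rightarrow> bool" where
  "submod W \<longleftrightarrow> supported X W \<and> (\<forall>g\<in>Sym n. \<forall>F\<in>W. act g F \<in> W)"

lemma submodD:
  assumes "submod W"
  shows "supported X W" "fun_vs.subspace W" "\<And>F x. F \<in> W \<Longrightarrow> x \<notin> X \<Longrightarrow> F x = 0"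
    "\<And>g F. g \<in> Sym n \<Longrightarrow> F \<in> W \<Longrightarrow> act g F \<in> W"
  using assms by (auto simp: submod_def supported_def)

text \<open>The translate by \<open>g\<close> of the column \<open>P _ x\<close> of a projection has
  the entry \<open>P (\<rho> g x) x\<close> at \<open>x\<close>; the sum is the trace of
  \<open>g\<close> composed with the projection.\<close>

definition chr :: "('x \<Rightarrow> complex) set \<Rightarrow> (nat \<Rightarrow> nat) \<Rightarrow> complex" where
  "chr W g = (\<Sum>x\<in>X. (SOME P. kernel_on X W P) (\<rho> g x) x)"

text \<open>The trace does not depend on the projection: \<open>tr (g P) = tr (g Q P) = tr (P g Q) = tr (g Q)\<close>.\<close>

lemma chr_eq:
  assumes W: "submod W" and P: "kernel_on X W P" and g: "g \<in> Sym n"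
  shows "chr W g = (\<Sum>x\<in>X. P (\<rho> g x) x)"
proof -
  define Q where "Q = (SOME P. kernel_on X W P)"
  have Q: "kernel_on X W Q"
    unfolding Q_def using kernel_exists[OF finite_X submodD(1)[OF W]] by (rule someI_ex)
  have "(\<Sum>x\<in>X. P (\<rho> g x) x) = (\<Sum>x\<in>X. \<Sum>y\<in>X. Q x y * P (\<rho> g y) x)"
  proof (rule sum.cong[OF refl])
    fix x assume x: "x \<in> X"
    have "act g (\<lambda>x'. P x' x) \<in> W" using P x g by (auto simp: kernel_on_def intro!: submodD(4)[OF W])
    then have "act g (\<lambda>x'. P x' x) x = (\<Sum>y\<in>X. Q x y * act g (\<lambda>x'. P x' x) y)"
      using Q unfolding kernel_on_def by blast
    then show "P (\<rho> g x) x = (\<Sum>y\<in>X. Q x y * P (\<rho> g y) x)" by (simp add: act_apply)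
  qed
  also have "\<dots> = (\<Sum>y\<in>X. \<Sum>x\<in>X. P (\<rho> g y) x * Q x y)"
    by (subst sum.swap) (simp add: mult.commute)
  also have "\<dots> = (\<Sum>y\<in>X. Q (\<rho> g y) y)"
  proof (rule sum.cong[OF refl])
    fix y assume "y \<in> X"
    then have "(\<lambda>x. Q x y) \<in> W" using Q by (simp add: kernel_on_def)
    then show "(\<Sum>x\<in>X. P (\<rho> g y) x * Q x y) = Q (\<rho> g y) y"
      using P unfolding kernel_on_def by metis
  qed
  finally show ?thesis by (simp add: chr_def Q_def)
qed

lemma kernelE:
  assumes "submod W"
  obtains P where "kernel_on X W P"
  using kernel_exists[OF finite_X submodD(1)[OF assms]] by blast

text \<open>Moving both arguments of a kernel by \<open>h\<close> gives another kernel of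
  \<open>W\<close>, and the trace computed from it is that of the conjugate.\<close>

lemma chr_conj:
  assumes W: "submod W" and g: "g \<in> Sym n" and h: "h \<in> Sym n"
  shows "chr W (h \<circ> g \<circ> inv' h) = chr W g"
proof -
  obtain P where P: "kernel_on X W P" using kernelE[OF W] .
  let ?i = "\<rho> (inv' h)"
  have hi: "inv' h \<in> Sym n" using h by simp
  have P': "kernel_on X W (\<lambda>x y. P (?i x) (?i y))"
    unfolding kernel_on_def
  proof (intro conjI ballI allI)
    fix y assume "y \<in> X"
    then have "(\<lambda>x. P x (?i y)) \<in> W" using P rho_closed[OF hi] by (simp add: kernel_on_def)
    then show "(\<lambda>x. P (?i x) (?i y)) \<in> W" using submodD(4)[OF W hi] by (simp add: act_def)
  next
    fix F x assume "F \<in> W"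
    then have "act h F \<in> W" by (rule submodD(4)[OF W h])
    then have "act h F (?i x) = (\<Sum>y\<in>X. P (?i x) y * act h F y)"
      using P unfolding kernel_on_def by blast
    also have "\<dots> = (\<Sum>y\<in>X. P (?i x) (?i y) * act h F (?i y))"
      by (rule sum_rho[OF hi, symmetric])
    finally show "F x = (\<Sum>y\<in>X. P (?i x) (?i y) * F y)" using h by (simp add: act_apply rho_inv)
  qed
  have "chr W (h \<circ> g \<circ> inv' h) = (\<Sum>x\<in>X. P (\<rho> (h \<circ> g \<circ> inv' h) x) x)"
    using g h by (intro chr_eq[OF W P]) simp
  also have "\<dots> = (\<Sum>x\<in>X. P (?i (\<rho> g (\<rho> h x))) (?i (\<rho> h x)))"
    using g h hi by (simp add: rho_comp rho_inv)
  also have "\<dots> = (\<Sum>x\<in>X. P (?i (\<rho> g x)) (?i x))"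
    by (rule sum_rho[OF h, of "\<lambda>x. P (?i (\<rho> g x)) (?i x)"])
  also have "\<dots> = chr W g" using chr_eq[OF W P' g] by simp
  finally show ?thesis .
qed

text \<open>The action of the group algebra element with coefficients \<open>c\<close>.\<close>

definition avg :: "((nat \<Rightarrow> nat) \<Rightarrow> complex) \<Rightarrow> ('x \<Rightarrow> complex) \<Rightarrow> 'x \<Rightarrow> complex" where
  "avg c F = (\<Sum>h\<in>Sym n. fscale (c h) (act h F))"

lemma avg_apply: "avg c F x = (\<Sum>h\<in>Sym n. c h * F (\<rho> h x))"
  by (simp add: avg_def sum_fun_apply act_apply)

lemma avg_in: "submod W \<Longrightarrow> F \<in> W \<Longrightarrow> avg c F \<in> W"
  unfolding avg_def by (intro fun_vs.subspace_sum fun_vs.subspace_scale submodD)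

lemma sum_chr:
  assumes W: "submod W" and P: "kernel_on X W P"
  shows "(\<Sum>h\<in>Sym n. c h * chr W h) = (\<Sum>x\<in>X. avg c (\<lambda>x'. P x' x) x)"
proof -
  have "(\<Sum>h\<in>Sym n. c h * chr W h) = (\<Sum>h\<in>Sym n. \<Sum>x\<in>X. c h * P (\<rho> h x) x)"
    using chr_eq[OF W P] by (simp add: sum_distrib_left)
  also have "\<dots> = (\<Sum>x\<in>X. \<Sum>h\<in>Sym n. c h * P (\<rho> h x) x)" by (rule sum.swap)
  finally show ?thesis by (simp add: avg_apply)
qed

lemma sum_chr_zero:
  assumes W: "submod W" and z: "\<And>F. F \<in> W \<Longrightarrow> avg c F = 0"
  shows "(\<Sum>h\<in>Sym n. c h * chr W h) = 0"
proof -
  obtain P where P: "kernel_on X W P" using kernelE[OF W] .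
  have "avg c (\<lambda>x'. P x' x) = 0" if "x \<in> X" for x using P that by (intro z) (simp add: kernel_on_def)
  then show ?thesis using sum_chr[OF W P] by simp
qed

text \<open>The trace of an operator whose image lies on the line of \<open>u\<close> is its
  eigenvalue at \<open>u\<close>; the comparison is made at a point where \<open>u\<close> does not
  vanish.\<close>

lemma sum_chr_rank_one:
  assumes W: "submod W" and u: "u \<in> W" "u \<noteq> 0"
    and one: "\<And>F. F \<in> W \<Longrightarrow> \<exists>r. avg c F = fscale r u" and k: "avg c u = fscale k u"
  shows "(\<Sum>h\<in>Sym n. c h * chr W h) = k"
proof -
  obtain P where P: "kernel_on X W P" using kernelE[OF W] .
  have "\<forall>x\<in>X. \<exists>r. avg c (\<lambda>x'. P x' x) = fscale r u"
    using P by (intro ballI one) (simp add: kernel_on_def)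
  then obtain r where r: "\<And>x. x \<in> X \<Longrightarrow> avg c (\<lambda>x'. P x' x) = fscale (r x) u" by metis
  have tr: "(\<Sum>h\<in>Sym n. c h * chr W h) = (\<Sum>x\<in>X. r x * u x)"
    unfolding sum_chr[OF W P] using r by (intro sum.cong) auto
  obtain x0 where x0: "u x0 \<noteq> 0" using u(2) by (auto simp: fun_eq_iff)
  have "k * u x0 = avg c u x0" using k by simp
  also have "\<dots> = (\<Sum>h\<in>Sym n. c h * (\<Sum>x\<in>X. P (\<rho> h x0) x * u x))"
    unfolding avg_apply using P u(1) by (intro sum.cong) (auto simp: kernel_on_def)
  also have "\<dots> = (\<Sum>x\<in>X. (\<Sum>h\<in>Sym n. c h * P (\<rho> h x0) x) * u x)"
    unfolding sum_distrib_left sum_distrib_right by (subst sum.swap) (simp add: mult.assoc)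
  also have "\<dots> = (\<Sum>x\<in>X. avg c (\<lambda>x'. P x' x) x0 * u x)" by (simp add: avg_apply)
  also have "\<dots> = (\<Sum>x\<in>X. r x * u x) * u x0"
    unfolding sum_distrib_right using r by (intro sum.cong) auto
  finally show ?thesis using x0 tr by simp
qed

text \<open>Decomposing each column of a kernel of \<open>W\<close> into its components gives
  kernels of the summands.\<close>

lemma chr_direct_sum:
  assumes W: "submod W" and D: "direct_decomposition W \<U>" and U: "\<And>U. U \<in> \<U> \<Longrightarrow> submod U"
    and g: "g \<in> Sym n"
  shows "chr W g = (\<Sum>U\<in>\<U>. chr U g)"
proof -
  note d = direct_decompositionD[OF D]
  note uniq = d(5)[OF submodD(2)[OF W]]
  obtain P where P: "kernel_on X W P" using kernelE[OF W] .
  have PW: "(\<lambda>x. P x y) \<in> W" if "y \<in> X" for y using P that by (simp add: kernel_on_def)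
  then have "\<forall>y\<in>X. \<exists>f. (\<forall>U\<in>\<U>. f U \<in> U) \<and> (\<lambda>x. P x y) = (\<Sum>U\<in>\<U>. f U)" using d(4) by blast
  then obtain f where f: "\<And>y U. y \<in> X \<Longrightarrow> U \<in> \<U> \<Longrightarrow> f y U \<in> U"
    "\<And>y. y \<in> X \<Longrightarrow> (\<lambda>x. P x y) = (\<Sum>U\<in>\<U>. f y U)" by metis
  have ker: "kernel_on X V (\<lambda>x y. f y V x)" if V: "V \<in> \<U>" for V
    unfolding kernel_on_def
  proof (intro conjI ballI allI)
    show "(\<lambda>x. f y V x) \<in> V" if "y \<in> X" for y using f(1)[OF that V] .
    fix F x assume F: "F \<in> V"
    \<comment> \<open>Two decompositions of \<open>F\<close>: \<open>F\<close> itself as its only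
      component, and the components of the columns combined with coefficients \<open>F y\<close>.
      Uniqueness of components identifies them, which is the reproducing property on
      \<open>V\<close>.\<close>
    define h1 where "h1 = (\<lambda>U. if U = V then F else 0)"
    define h2 where "h2 = (\<lambda>U. \<Sum>y\<in>X. fscale (F y) (f y U))"
    have "\<forall>U\<in>\<U>. h1 U = h2 U"
    proof (rule uniq)
      show "\<forall>U\<in>\<U>. h1 U \<in> U" using F d(2) by (auto simp: h1_def fun_vs.subspace_0)
      show "\<forall>U\<in>\<U>. h2 U \<in> U"
        unfolding h2_def using f(1) d(2) by (auto intro!: fun_vs.subspace_sum fun_vs.subspace_scale)
      have "(\<Sum>U\<in>\<U>. h1 U) = F" using V d(1) by (simp add: h1_def)
      also have "F = (\<Sum>y\<in>X. fscale (F y) (\<lambda>x. P x y))"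
      proof
        fix x
        have "F x = (\<Sum>y\<in>X. P x y * F y)" using P F d(3)[OF V] unfolding kernel_on_def by blast
        then show "F x = (\<Sum>y\<in>X. fscale (F y) (\<lambda>x. P x y)) x" by (simp add: sum_fun_apply mult.commute)
      qed
      also have "\<dots> = (\<Sum>y\<in>X. \<Sum>U\<in>\<U>. fscale (F y) (f y U))"
        using f(2) by (simp add: fun_vs.scale_sum_right)
      also have "\<dots> = (\<Sum>U\<in>\<U>. h2 U)" unfolding h2_def by (rule sum.swap)
      finally show "(\<Sum>U\<in>\<U>. h1 U) = (\<Sum>U\<in>\<U>. h2 U)" .
    qed
    then have "h1 V = h2 V" using V by blast
    then have "F = h2 V" by (simp add: h1_def)
    then have "F x = h2 V x" by (rule fun_cong)
    then show "F x = (\<Sum>y\<in>X. f y V x * F y)" by (simp add: h2_def sum_fun_apply mult.commute)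
  qed
  have "chr W g = (\<Sum>x\<in>X. \<Sum>U\<in>\<U>. f x U (\<rho> g x))"
  proof -
    have "P (\<rho> g x) x = (\<Sum>U\<in>\<U>. f x U (\<rho> g x))" if "x \<in> X" for x
      using fun_cong[OF f(2)[OF that], of "\<rho> g x"] by (simp add: sum_fun_apply)
    then show ?thesis using chr_eq[OF W P g] by simp
  qed
  also have "\<dots> = (\<Sum>U\<in>\<U>. \<Sum>x\<in>X. f x U (\<rho> g x))" by (rule sum.swap)
  also have "\<dots> = (\<Sum>U\<in>\<U>. chr U g)" using chr_eq[OF U ker g] by simp
  finally show ?thesis .
qed

text \<open>The kernel of a projection onto \<open>U\<close> is averaged over the group, which in
  coordinates means moving both of its arguments. The averaged projection \<open>pr\<close> is
  equivariant and still fixes \<open>U\<close>, and its null space in \<open>W\<close> is the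
  complement.\<close>

lemma maschke:
  assumes W: "submod W" and U: "submod U" "U \<subseteq> W"
  obtains V where "submod V" "V \<subseteq> W" "U \<inter> V = {0}" "\<And>F. F \<in> W \<Longrightarrow> \<exists>a\<in>U. \<exists>b\<in>V. F = a + b"
proof -
  obtain P where P: "kernel_on X U P" using kernelE[OF U(1)] .
  define pr where "pr = (\<lambda>F x. (\<Sum>g\<in>Sym n. \<Sum>y\<in>X. P (\<rho> g x) (\<rho> g y) * F y) / fact n)"
  have lin: "pr (F - F') = pr F - pr F'" "pr (F + F') = pr F + pr F'" "pr (fscale c F) = fscale c (pr F)" for F F' c
    unfolding pr_def
    by (auto simp: fun_eq_iff algebra_simps sum_subtractf sum.distrib diff_divide_distrib
        add_divide_distrib sum_distrib_left)
  have in_U: "pr F \<in> U" for F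
  proof -
    have "pr F = fscale (1 / fact n) (\<Sum>g\<in>Sym n. \<Sum>y\<in>X. fscale (F y) (act g (\<lambda>x. P x (\<rho> g y))))"
      by (auto simp: pr_def fun_eq_iff sum_fun_apply act_apply mult.commute)
    also have "\<dots> \<in> U"
      using P rho_closed
      by (intro fun_vs.subspace_scale fun_vs.subspace_sum submodD(2,4)[OF U(1)]) (auto simp: kernel_on_def)
    finally show ?thesis .
  qed
  have fix_U: "pr F = F" if F: "F \<in> U" for F
  proof
    fix x
    have "(\<Sum>y\<in>X. P (\<rho> g x) (\<rho> g y) * F y) = F x" if g: "g \<in> Sym n" for g
    proof -
      let ?F' = "act (inv' g) F"
      have F': "?F' \<in> U" using F g by (intro submodD(4)[OF U(1)]) simp
      have "(\<Sum>y\<in>X. P (\<rho> g x) (\<rho> g y) * F y) = (\<Sum>y\<in>X. P (\<rho> g x) (\<rho> g y) * ?F' (\<rho> g y))"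
        using g by (simp add: act_apply rho_inv)
      also have "\<dots> = (\<Sum>y\<in>X. P (\<rho> g x) y * ?F' y)"
        by (rule sum_rho[OF g, of "\<lambda>y. P (\<rho> g x) y * ?F' y"])
      also have "\<dots> = ?F' (\<rho> g x)" using P F' unfolding kernel_on_def by metis
      finally show ?thesis using g by (simp add: act_apply rho_inv)
    qed
    then show "pr F x = F x" by (simp add: pr_def card_Sym)
  qed
  have equi: "pr (act h F) = act h (pr F)" if h: "h \<in> Sym n" for h F
  proof
    fix x
    have hi: "inv' h \<in> Sym n" using h by simp
    have "(\<Sum>g\<in>Sym n. \<Sum>y\<in>X. P (\<rho> g x) (\<rho> g y) * F (\<rho> h y)) =
        (\<Sum>g\<in>Sym n. \<Sum>y\<in>X. P (\<rho> (h \<circ> g) x) (\<rho> (h \<circ> g) y) * F (\<rho> h y))"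
      using sum.reindex_bij_betw[OF bij_betw_Sym_left[OF h],
          of "\<lambda>g. \<Sum>y\<in>X. P (\<rho> g x) (\<rho> g y) * F (\<rho> h y)"] by simp
    also have "\<dots> = (\<Sum>g\<in>Sym n. \<Sum>y\<in>X. P (\<rho> g (\<rho> h x)) (\<rho> g (\<rho> h y)) * F (\<rho> h y))"
      using h by (simp add: rho_comp)
    also have "\<dots> = (\<Sum>g\<in>Sym n. \<Sum>y\<in>X. P (\<rho> g (\<rho> h x)) (\<rho> g y) * F y)"
      using sum_rho[OF h] by (rule sum.cong[OF refl])
    finally show "pr (act h F) x = act h (pr F) x" by (simp add: pr_def act_apply)
  qed
  define V where "V = {F \<in> W. pr F = 0}"
  have pr0: "pr 0 = 0" by (simp add: pr_def fun_eq_iff)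
  have "submod V"
    unfolding submod_def supported_def fun_vs.subspace_def
  proof (intro conjI ballI allI impI)
    show "0 \<in> V" using submodD(2)[OF W] pr0 by (simp add: V_def fun_vs.subspace_0)
    show "F + F' \<in> V" if "F \<in> V" "F' \<in> V" for F F'
      using that submodD(2)[OF W] by (simp add: V_def lin fun_vs.subspace_add)
    show "fscale c F \<in> V" if "F \<in> V" for c F
      using that submodD(2)[OF W] by (auto simp: V_def lin fun_vs.subspace_scale)
    show "F x = 0" if "F \<in> V" "x \<notin> X" for F x using that submodD(3)[OF W] by (simp add: V_def)
    show "act g F \<in> V" if "g \<in> Sym n" "F \<in> V" for g F
      using that submodD(4)[OF W] equi by (auto simp: V_def act_def fun_eq_iff)
  qed
  moreover have "V \<subseteq> W" by (auto simp: V_def)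
  moreover have "U \<inter> V = {0}"
    using fix_U fun_vs.subspace_0[OF submodD(2)[OF U(1)]] fun_vs.subspace_0[OF submodD(2)[OF W]] pr0
    by (auto simp: V_def)
  moreover have "\<exists>a\<in>U. \<exists>b\<in>V. F = a + b" if "F \<in> W" for F
  proof (intro bexI)
    show "F = pr F + (F - pr F)" by simp
    show "pr F \<in> U" by (rule in_U)
    have "F - pr F \<in> W" using that in_U U(2) submodD(2)[OF W] by (intro fun_vs.subspace_diff) auto
    then show "F - pr F \<in> V" using fix_U[OF in_U] by (simp add: V_def lin)
  qed
  ultimately show ?thesis using that by blast
qed

definition simple :: "('x \<Rightarrow> complex) set \<Rightarrow> bool" where
  "simple U \<longleftrightarrow> submod U \<and> U \<noteq> {0} \<and> (\<forall>V. submod V \<and> V \<subseteq> U \<longrightarrow> V = {0} \<or> V = U)"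

text \<open>Induction on the dimension, splitting by \<open>maschke\<close>. The zero module has the
  empty decomposition, as \<open>{0}\<close> is not simple.\<close>

lemma decomposition_exists:
  assumes "submod W"
  shows "\<exists>\<U>. direct_decomposition W \<U> \<and> (\<forall>U\<in>\<U>. simple U)"
  using assms
proof (induction "fun_vs.dim W" arbitrary: W rule: less_induct)
  case less
  note W = less.prems
  consider "W = {0}" | "simple W" | "W \<noteq> {0}" "\<not> simple W" by blast
  then show ?case
  proof cases
    case 1
    have "direct_decomposition W {}" by (rule direct_decompositionI) (auto simp: 1)
    then show ?thesis by (intro exI[of _ "{}"]) simp
  next
    case 2
    have "direct_decomposition W {W}"
    proof (rule direct_decompositionI)
      show "\<exists>f. (\<forall>U\<in>{W}. f U \<in> U) \<and> w = (\<Sum>U\<in>{W}. f U)" if "w \<in> W" for w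
        using that by (intro exI[of _ "\<lambda>_. w"]) simp
    qed (use submodD(2)[OF W] in auto)
    then show ?thesis using 2 by (intro exI[of _ "{W}"]) simp
  next
    case 3
    then obtain U where U: "submod U" "U \<subseteq> W" "U \<noteq> {0}" "U \<noteq> W" using W by (auto simp: simple_def)
    obtain V where V: "submod V" "V \<subseteq> W" "U \<inter> V = {0}" "\<And>F. F \<in> W \<Longrightarrow> \<exists>a\<in>U. \<exists>b\<in>V. F = a + b"
      using maschke[OF W U(1,2)] by blast
    have "V \<noteq> W" using V(3) U(2,3) by blast
    then have "fun_vs.dim U < fun_vs.dim W" "fun_vs.dim V < fun_vs.dim W"
      using U V W by (auto intro!: dim_psubset_supported[OF finite_X] submodD(1))
    then obtain \<U>1 \<U>2 where D: "direct_decomposition U \<U>1" "\<forall>U\<in>\<U>1. simple U"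
      "direct_decomposition V \<U>2" "\<forall>U\<in>\<U>2. simple U"
      using less.hyps U(1) V(1) by metis
    have "direct_decomposition W (\<U>1 \<union> \<U>2)"
    proof (rule direct_decomposition_union[OF D(1,3)])
      show "Z \<noteq> {0}" if "Z \<in> \<U>1 \<union> \<U>2" for Z using that D(2,4) by (auto simp: simple_def)
    qed (use U V submodD(2) in auto)
    then show ?thesis using D by (intro exI[of _ "\<U>1 \<union> \<U>2"]) auto
  qed
qed

text \<open>The bridge from the records of the definitions to subspaces of functions on
  \<open>X\<close>. The operators have to agree with \<open>act\<close> only on \<open>W\<close>,
  which is all that the predicates on representations look at.\<close>

definition models :: "(nat \<Rightarrow> nat, 'x) repr \<Rightarrow> ('x \<Rightarrow> complex) set \<Rightarrow> bool" where
  "models R W \<longleftrightarrow> submod W \<and> repr_space R = W \<and> (\<forall>g\<in>Sym n. \<forall>v\<in>W. repr_act R g v = act g v)"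

lemma models_subrepr: "models R W \<Longrightarrow> submod U \<Longrightarrow> U \<subseteq> W \<Longrightarrow> models (subrepr U R) U"
  by (auto simp: models_def subrepr_def)

lemma models_is_repr:
  assumes "models R W"
  shows "is_repr (sym_group n) R"
proof -
  have W: "submod W" and R: "repr_space R = W" "\<And>g v. g \<in> Sym n \<Longrightarrow> v \<in> W \<Longrightarrow> repr_act R g v = act g v"
    using assms by (auto simp: models_def)
  note s = submodD[OF W]
  show ?thesis
    unfolding is_repr_def R(1) carrier_sym_group
  proof (intro conjI ballI allI)
    show "\<exists>B. finite B \<and> W = fun_vs.span B" using supported_finite_span[OF finite_X s(1)] .
    show "repr_act R (g \<otimes>\<^bsub>sym_group n\<^esub> h) v = repr_act R g (repr_act R h v)"
      if "g \<in> Sym n" "h \<in> Sym n" "v \<in> W" for g h v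
      using that s(4) by (simp add: R(2) sym_group_def act_comp)
    show "repr_act R \<one>\<^bsub>sym_group n\<^esub> v = v" if "v \<in> W" for v
      using that by (simp add: R(2) sym_group_def act_id)
    show "repr_act R g (v + w) = repr_act R g v + repr_act R g w"
      if "g \<in> Sym n" "v \<in> W" "w \<in> W" for g v w
      using that s(2) by (simp add: R(2) act_linear fun_vs.subspace_add)
    show "repr_act R g (fscale c v) = fscale c (repr_act R g v)"
      if "g \<in> Sym n" "v \<in> W" for g c v
      using that s(2) by (simp add: R(2) act_linear fun_vs.subspace_scale)
  qed (use s R(2) in auto)
qed

lemma models_invariant:
  assumes "models R W"
  shows "invariant_subspace (sym_group n) R U \<longleftrightarrow> submod U \<and> U \<subseteq> W"
proof
  assume "invariant_subspace (sym_group n) R U"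
  then show "submod U \<and> U \<subseteq> W"
    using assms unfolding invariant_subspace_def models_def submod_def supported_def carrier_sym_group
    by (metis subsetD)
next
  assume "submod U \<and> U \<subseteq> W"
  then show "invariant_subspace (sym_group n) R U"
    using assms unfolding invariant_subspace_def models_def submod_def supported_def carrier_sym_group
    by (metis subsetD)
qed

lemma models_irreducible:
  assumes "models R W"
  shows "irreducible_repr (sym_group n) R \<longleftrightarrow> simple W"
  using assms models_invariant[OF assms] models_is_repr[OF assms]
  unfolding irreducible_repr_def simple_def models_def by auto

end

section \<open>Characters of Specht modules\<close>

lemma psize_eq_sum:
  assumes "\<And>i. i \<ge> N \<Longrightarrow> \<kappa> i = 0"
  shows "psize \<kappa> = (\<Sum>i<N. \<kappa> i)"
proof -
  have "i < N" if "\<kappa> i \<noteq> 0" for i using assms that by (meson not_less)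
  then show ?thesis unfolding psize_def by (intro sum.mono_neutral_left) auto
qed

lemma partition_support:
  assumes "is_partition \<kappa>"
  shows "{i. \<kappa> i \<noteq> 0} = {..<card {i. \<kappa> i \<noteq> 0}}"
proof -
  have fin: "finite {i. \<kappa> i \<noteq> 0}" and anti: "antimono \<kappa>" using assms by (auto simp: is_partition_def)
  define L where "L = (LEAST i. \<kappa> i = 0)"
  have "{i. \<kappa> i \<noteq> 0} \<noteq> UNIV" using fin infinite_UNIV_nat by metis
  then have "\<exists>i. \<kappa> i = 0" by auto
  then have L0: "\<kappa> L = 0" unfolding L_def by (rule LeastI_ex)
  have "{i. \<kappa> i \<noteq> 0} = {..<L}"
  proof (intro equalityI subsetI)
    fix i assume "i \<in> {i. \<kappa> i \<noteq> 0}"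
    then show "i \<in> {..<L}" using antimonoD[OF anti, of L i] L0 by (auto simp: not_less[symmetric])
  next
    fix i assume "i \<in> {..<L}"
    then show "i \<in> {i. \<kappa> i \<noteq> 0}" using not_less_Least[of i "\<lambda>i. \<kappa> i = 0"] by (simp add: L_def)
  qed
  then show ?thesis by simp
qed

lemma set_cells:
  assumes "is_partition \<kappa>"
  shows "set (cells \<kappa>) = {(i, j). j < \<kappa> i}"
proof -
  define L where "L = card {i. \<kappa> i \<noteq> 0}"
  have "i < L" if "j < \<kappa> i" for i j
    using partition_support[OF assms] that unfolding L_def[symmetric]
    by (metis lessThan_iff mem_Collect_eq not_less_zero)
  moreover have "set (cells \<kappa>) = {(i, j). i < L \<and> j < \<kappa> i}"
    unfolding cells_def L_def[symmetric] by (auto simp: image_iff)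
  ultimately show ?thesis by auto
qed

lemma distinct_cells: "distinct (cells \<kappa>)"
proof -
  have "distinct (concat (map (\<lambda>i. map (Pair i) [0..<\<kappa> i]) [0..<m]))" for m
  proof (induction m)
    case (Suc m)
    have "distinct (map (Pair m) [0..<\<kappa> m])" by (simp add: distinct_map inj_on_def)
    then show ?case using Suc by auto
  qed simp
  then show ?thesis by (simp add: cells_def)
qed

lemma length_cells:
  assumes "is_partition \<kappa>"
  shows "length (cells \<kappa>) = psize \<kappa>"
proof -
  have "length (concat (map (\<lambda>i. map (Pair i) [0..<\<kappa> i]) [0..<m])) = (\<Sum>i<m. \<kappa> i)" for m
    by (induction m) auto
  then have "length (cells \<kappa>) = (\<Sum>i<card {i. \<kappa> i \<noteq> 0}. \<kappa> i)" by (simp add: cells_def)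
  then show ?thesis unfolding psize_def using partition_support[OF assms] by simp
qed

section \<open>The canonical tableau, its column stabilizer and polytabloids\<close>

locale young =
  fixes la :: "nat \<Rightarrow> nat"
  assumes partition: "is_partition la"
begin

abbreviation "n \<equiv> psize la"
abbreviation "rw \<equiv> row_of la"
abbreviation "cl \<equiv> col_of la"
abbreviation "Tabl \<equiv> colorings 0 n (\<lambda>i. int (la i))"
abbreviation "C \<equiv> col_stabilizer la"

lemma anti: "i \<le> j \<Longrightarrow> la j \<le> la i"
  using partition by (simp add: is_partition_def antimonoD)

lemma rw_out: "k \<notin> {1..n} \<Longrightarrow> rw k = 0" and cl_out: "k \<notin> {1..n} \<Longrightarrow> cl k = 0"
  by (auto simp: row_of_def col_of_def)

lemma bij_cells: "bij_betw (\<lambda>k. (rw k, cl k)) {1..n} {(i, j). j < la i}"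
proof -
  have "bij_betw (\<lambda>k. k - 1) {1..n} {..<n}"
    by (rule bij_betw_byWitness[where f' = Suc]) auto
  moreover have "bij_betw ((!) (cells la)) {..<n} {(i, j). j < la i}"
    using bij_betw_nth[OF distinct_cells] length_cells[OF partition] set_cells[OF partition] by metis
  ultimately have "bij_betw ((!) (cells la) \<circ> (\<lambda>k. k - 1)) {1..n} {(i, j). j < la i}"
    by (rule bij_betw_trans)
  then show ?thesis by (rule bij_betw_cong[THEN iffD1, rotated]) (auto simp: row_of_def col_of_def)
qed

lemma cell_inj: "k \<in> {1..n} \<Longrightarrow> k' \<in> {1..n} \<Longrightarrow> rw k = rw k' \<Longrightarrow> cl k = cl k' \<Longrightarrow> k = k'"
  by (rule inj_onD[OF bij_betw_imp_inj_on[OF bij_cells]]) simp_all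

lemma cell_in: "k \<in> {1..n} \<Longrightarrow> cl k < la (rw k)"
  using bij_cells by (auto simp: bij_betw_def)

lemma cell_ex: "j < la i \<Longrightarrow> \<exists>k\<in>{1..n}. rw k = i \<and> cl k = j"
proof -
  assume "j < la i"
  then have "(i, j) \<in> (\<lambda>k. (rw k, cl k)) ` {1..n}" using bij_cells by (simp add: bij_betw_def)
  then obtain k where "k \<in> {1..n}" "(i, j) = (rw k, cl k)" by (rule imageE)
  then show ?thesis by (intro bexI[of _ k]) simp_all
qed

lemma rw_Tabl: "rw \<in> Tabl"
proof -
  have "card {k\<in>{1..n}. rw k = i} = la i" for i
  proof -
    have "bij_betw cl {k\<in>{1..n}. rw k = i} {..<la i}"
    proof (rule bij_betw_imageI)
      show "inj_on cl {k\<in>{1..n}. rw k = i}" using cell_inj by (auto intro!: inj_onI)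
      show "cl ` {k\<in>{1..n}. rw k = i} = {..<la i}"
      proof (intro equalityI subsetI)
        fix j assume "j \<in> {..<la i}"
        then obtain k where "k \<in> {1..n}" "rw k = i" "cl k = j" using cell_ex[of j i] by blast
        then show "j \<in> cl ` {k\<in>{1..n}. rw k = i}" by blast
      qed (use cell_in in auto)
    qed
    then show ?thesis by (simp add: bij_betw_same_card)
  qed
  note * = this
  show ?thesis
    unfolding colorings_def
  proof (intro CollectI conjI allI impI)
    show "int (card {k\<in>{1..n}. rw k = i}) = int (la i)" for i by (simp only: *)
  qed (rule rw_out)
qed

lemma C_iff: "q \<in> C \<longleftrightarrow> q \<in> Sym n \<and> cl \<circ> q = cl"
proof -
  have "cl (q k) = cl k" if "q \<in> Sym n" "k \<notin> {1..n}" for k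
    using permutes_not_in[OF SymD[OF that(1)] that(2)] by simp
  then show ?thesis unfolding col_stabilizer_def carrier_sym_group fun_eq_iff comp_def by blast
qed

lemma C_Sym: "q \<in> C \<Longrightarrow> q \<in> Sym n" by (simp add: C_iff)

lemma finite_C [simp]: "finite C"
  by (rule finite_subset[of _ "Sym n"]) (auto simp: C_iff)

lemma C_id: "id \<in> C" by (simp add: C_iff)

lemma C_comp: "q \<in> C \<Longrightarrow> q' \<in> C \<Longrightarrow> q \<circ> q' \<in> C"
  by (simp add: C_iff comp_assoc[symmetric])

lemma C_inv: "q \<in> C \<Longrightarrow> inv' q \<in> C"
proof -
  assume q: "q \<in> C"
  then have "cl \<circ> inv' q = cl \<circ> q \<circ> inv' q" by (simp add: C_iff)
  also have "\<dots> = cl" using C_Sym[OF q] by (simp only: comp_assoc Sym_inv_o comp_id)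
  finally show "inv' q \<in> C" using q by (simp add: C_iff)
qed

lemma bij_C_left: "q \<in> C \<Longrightarrow> bij_betw (\<lambda>q'. q \<circ> q') C C"
  by (rule bij_betw_byWitness[where f' = "\<lambda>g. inv' q \<circ> g"])
     (auto simp: C_comp C_inv C_Sym comp_assoc[symmetric] Sym_inv_o[OF C_Sym])

lemma bij_C_inv: "bij_betw inv' C C"
  by (rule bij_betw_byWitness[where f' = inv']) (auto simp: C_inv Sym_inv_inv[OF C_Sym])

lemma sign_C: "q \<in> C \<Longrightarrow> q' \<in> C \<Longrightarrow> sign (q \<circ> q') = sign q * sign q'"
  by (simp add: sign_compose Sym_permutation[OF C_Sym])

lemma sign_C_inv: "q \<in> C \<Longrightarrow> sign (inv' q) = sign q"
  by (simp add: sign_inverse Sym_permutation[OF C_Sym])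

definition e :: "(nat \<Rightarrow> nat) \<Rightarrow> complex" where
  "e t = (\<Sum>q\<in>C. of_int (sign q) * (if t = rw \<circ> q then 1 else 0))"

text \<open>Tabloids are formed with inverse permutations, so \<open>inv' q\<close> appears where
  \<open>e\<close> has \<open>q\<close>. The substitution of inverses permutes \<open>C\<close> and
  keeps signs, so all polytabloids are translates of \<open>e\<close>.\<close>

lemma e_polytabloid:
  assumes g: "g \<in> Sym n"
  shows "polytabloid la g = (\<lambda>t. e (t \<circ> g))"
proof
  fix t
  have "polytabloid la g t = (\<Sum>q\<in>C. of_int (sign q) * (if t \<circ> g = rw \<circ> inv' q then 1 else 0))"
    unfolding polytabloid_def
  proof (rule sum.cong[OF refl])
    fix q assume q: "q \<in> C"
    have "t = tabloid la (g \<circ> q) \<longleftrightarrow> t \<circ> g = rw \<circ> inv' q"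
    proof
      assume "t = tabloid la (g \<circ> q)"
      then have "t \<circ> g = rw \<circ> inv' q \<circ> inv' g \<circ> g"
        unfolding tabloid_def Sym_inv_comp[OF g C_Sym[OF q]] by (simp only: comp_assoc)
      then show "t \<circ> g = rw \<circ> inv' q" using g by (simp only: comp_assoc Sym_inv_o comp_id)
    next
      assume "t \<circ> g = rw \<circ> inv' q"
      then have "t \<circ> g \<circ> inv' g = rw \<circ> inv' q \<circ> inv' g" by (simp only:)
      then show "t = tabloid la (g \<circ> q)"
        unfolding tabloid_def Sym_inv_comp[OF g C_Sym[OF q]]
        using g by (simp only: comp_assoc Sym_inv_o comp_id)
    qed
    then show "of_int (sign q) * (if t = tabloid la (g \<circ> q) then 1 else 0) =
        (of_int (sign q) * (if t \<circ> g = rw \<circ> inv' q then 1 else 0) :: complex)" by simp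
  qed
  also have "\<dots> = (\<Sum>q\<in>C. of_int (sign (inv' q)) * (if t \<circ> g = rw \<circ> inv' q then 1 else 0))"
    by (rule sum.cong) (simp_all add: sign_C_inv)
  also have "\<dots> = e (t \<circ> g)"
    unfolding e_def by (rule sum.reindex_bij_betw[OF bij_C_inv])
  finally show "polytabloid la g t = e (t \<circ> g)" .
qed

lemma e_comp:
  assumes q: "q \<in> C"
  shows "e (t \<circ> q) = of_int (sign q) * e t"
proof -
  have "e (t \<circ> q) = (\<Sum>q'\<in>C. of_int (sign (q' \<circ> q)) * (if t \<circ> q = rw \<circ> (q' \<circ> q) then 1 else 0))"
    unfolding e_def
  proof (rule sum.reindex_bij_betw[symmetric])
    show "bij_betw (\<lambda>q'. q' \<circ> q) C C"
      by (rule bij_betw_byWitness[where f' = "\<lambda>g. g \<circ> inv' q"])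
        (use q in \<open>auto simp: C_comp C_inv comp_assoc Sym_inv_o[OF C_Sym]\<close>)
  qed
  also have "\<dots> = (\<Sum>q'\<in>C. of_int (sign q) * (of_int (sign q') * (if t = rw \<circ> q' then 1 else 0)))"
  proof (rule sum.cong[OF refl])
    fix q' assume q': "q' \<in> C"
    have "t \<circ> q = rw \<circ> (q' \<circ> q) \<longleftrightarrow> t = rw \<circ> q'"
    proof
      assume "t \<circ> q = rw \<circ> (q' \<circ> q)"
      then have "t \<circ> q \<circ> inv' q = rw \<circ> (q' \<circ> q) \<circ> inv' q" by (simp only:)
      then show "t = rw \<circ> q'" using C_Sym[OF q] by (simp only: comp_assoc Sym_inv_o comp_id)
    qed (simp add: comp_assoc)
    then show "of_int (sign (q' \<circ> q)) * (if t \<circ> q = rw \<circ> (q' \<circ> q) then 1 else 0) =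
        (of_int (sign q) * (of_int (sign q') * (if t = rw \<circ> q' then 1 else 0)) :: complex)"
      by (simp add: sign_C q q')
  qed
  finally show ?thesis by (simp add: e_def sum_distrib_left)
qed

lemma e_support: "t \<notin> Tabl \<Longrightarrow> e t = 0"
  unfolding e_def using colorings_comp[OF rw_Tabl C_Sym] by (intro sum.neutral) auto

lemma e_real: "e t \<in> \<real>"
  unfolding e_def by (intro sum_in_Reals Reals_mult) auto

text \<open>A column permutation that also preserves rows fixes every cell, so only
  \<open>id\<close> contributes at the canonical tabloid.\<close>

lemma e_rw: "e rw = 1"
proof -
  have "q = id" if q: "q \<in> C" "rw = rw \<circ> q" for q
  proof
    fix k show "q k = id k"
    proof (cases "k \<in> {1..n}")
      case True
      have "rw (q k) = rw k" using fun_cong[OF q(2), of k] by simp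
      moreover have "cl (q k) = cl k" using q(1) unfolding C_iff by (metis comp_apply)
      moreover have "q k \<in> {1..n}" using permutes_in_image[OF SymD[OF C_Sym[OF q(1)]]] True by blast
      ultimately show ?thesis using cell_inj[OF _ True] by simp
    qed (simp add: permutes_not_in[OF SymD[OF C_Sym[OF q(1)]]])
  qed
  then have "e rw = (\<Sum>q\<in>C. if q = id then 1 else 0)"
    unfolding e_def by (intro sum.cong) auto
  then show ?thesis using C_id by simp
qed

section \<open>Colorings that are injective on columns\<close>

definition col_inj :: "(nat \<Rightarrow> 'c) \<Rightarrow> bool" where
  "col_inj t \<longleftrightarrow> (\<forall>k\<in>{1..n}. \<forall>k'\<in>{1..n}. cl k = cl k' \<and> t k = t k' \<longrightarrow> k = k')"

lemma not_col_injE: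
  assumes "\<not> col_inj t"
  obtains q where "q \<in> C" "sign q = -1" "t \<circ> q = t"
proof -
  obtain k k' where k: "k \<in> {1..n}" "k' \<in> {1..n}" "cl k = cl k'" "t k = t k'" "k \<noteq> k'"
    using assms by (auto simp: col_inj_def)
  let ?q = "transpose k k'"
  have "?q \<in> Sym n" unfolding Sym_def mem_Collect_eq by (rule permutes_swap_id[OF k(1,2)])
  moreover have "cl \<circ> ?q = cl" using k(3) by (auto simp: fun_eq_iff transpose_def)
  ultimately have "?q \<in> C" by (simp add: C_iff)
  moreover have "t \<circ> ?q = t" using k(4) by (auto simp: fun_eq_iff transpose_def)
  ultimately show ?thesis using that[of ?q] k(5) by (simp add: sign_swap_id)
qed

text \<open>If column \<open>j\<close> reaches row \<open>card J\<close> or below, it has a cell in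
  each of the first \<open>card J\<close> rows, while an injective \<open>t\<close> uses every color
  of \<open>J\<close> at most once. Otherwise all of its cells lie in those rows.\<close>

lemma col_bound:
  assumes t: "col_inj t" and J: "finite J"
  shows "card {k\<in>{1..n}. cl k = j \<and> t k \<in> J} \<le> card {k\<in>{1..n}. cl k = j \<and> rw k < card J}"
proof (cases "\<exists>k0\<in>{1..n}. cl k0 = j \<and> rw k0 \<ge> card J")
  case True
  then obtain k0 where k0: "k0 \<in> {1..n}" "cl k0 = j" "rw k0 \<ge> card J" by blast
  have "card {k\<in>{1..n}. cl k = j \<and> t k \<in> J} \<le> card J"
  proof (rule card_inj_on_le[of t])
    show "inj_on t {k\<in>{1..n}. cl k = j \<and> t k \<in> J}"
    proof (rule inj_onI)
      fix k k' assume "k \<in> {k\<in>{1..n}. cl k = j \<and> t k \<in> J}" "k' \<in> {k\<in>{1..n}. cl k = j \<and> t k \<in> J}" "t k = t k'"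
      then show "k = k'" using t unfolding col_inj_def by (metis (mono_tags, lifting) mem_Collect_eq)
    qed
  qed (use J in auto)
  also have "card J = card {..<card J}" by simp
  also have "\<dots> \<le> card {k\<in>{1..n}. cl k = j \<and> rw k < card J}"
  proof (rule surj_card_le[where f = rw])
    show "{..<card J} \<subseteq> rw ` {k\<in>{1..n}. cl k = j \<and> rw k < card J}"
    proof
      fix i assume i: "i \<in> {..<card J}"
      have "j < la i" using cell_in[OF k0(1)] anti[of i "rw k0"] k0 i by simp
      then obtain k where "k \<in> {1..n}" "rw k = i" "cl k = j" using cell_ex[OF \<open>j < la i\<close>] by blast
      then show "i \<in> rw ` {k\<in>{1..n}. cl k = j \<and> rw k < card J}" using i by force
    qed
  qed simp
  finally show ?thesis .
next
  case False
  then show ?thesis by (intro card_mono) (auto simp: not_le)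
qed

lemma card_by_cols: "card {k\<in>{1..n}. Q k} = (\<Sum>j\<in>cl ` {1..n}. card {k\<in>{1..n}. cl k = j \<and> Q k})"
proof -
  have "{k\<in>{1..n}. Q k} = (\<Union>j\<in>cl ` {1..n}. {k\<in>{1..n}. cl k = j \<and> Q k})" by auto
  then have "card {k\<in>{1..n}. Q k} = card (\<Union>j\<in>cl ` {1..n}. {k\<in>{1..n}. cl k = j \<and> Q k})"
    by (rule arg_cong)
  also have "\<dots> = (\<Sum>j\<in>cl ` {1..n}. card {k\<in>{1..n}. cl k = j \<and> Q k})"
    by (rule card_UN_disjoint) auto
  finally show ?thesis .
qed

lemma card_rw_less: "int (card {k\<in>{1..n}. rw k < m}) = (\<Sum>i<m. int (la i))"
  using sum_content_card[OF rw_Tabl, of "{..<m}"] by simp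

lemma col_inj_dominance:
  assumes t: "t \<in> colorings d n \<kappa>" "col_inj t" and J: "finite J"
  shows "(\<Sum>c\<in>J. \<kappa> c) \<le> (\<Sum>i<card J. int (la i))"
proof -
  have "card {k\<in>{1..n}. t k \<in> J} = (\<Sum>j\<in>cl ` {1..n}. card {k\<in>{1..n}. cl k = j \<and> t k \<in> J})"
    by (rule card_by_cols)
  also have "\<dots> \<le> (\<Sum>j\<in>cl ` {1..n}. card {k\<in>{1..n}. cl k = j \<and> rw k < card J})"
    by (rule sum_mono) (rule col_bound[OF t(2) J])
  also have "\<dots> = card {k\<in>{1..n}. rw k < card J}" by (rule card_by_cols[symmetric])
  finally show ?thesis using sum_content_card[OF t(1) J] card_rw_less[of "card J"] by simp
qed

text \<open>Equal contents turn the column bounds for the initial sets of colors into equalities. So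
  each column holds the same colors under \<open>t\<close> as under \<open>rw\<close>, and a
  permutation within the columns takes one to the other.\<close>

lemma col_inj_TablE:
  assumes t: "t \<in> Tabl" "col_inj t"
  obtains q where "q \<in> C" "t = rw \<circ> q"
proof -
  let ?f = "\<lambda>m j. card {k\<in>{1..n}. cl k = j \<and> t k < m}"
  let ?g = "\<lambda>m j. card {k\<in>{1..n}. cl k = j \<and> rw k < m}"
  have le: "?f m j \<le> ?g m j" for m j using col_bound[OF t(2), of "{..<m}" j] by simp
  have tot: "(\<Sum>j\<in>cl ` {1..n}. ?f m j) = (\<Sum>j\<in>cl ` {1..n}. ?g m j)" for m
  proof -
    have "int (card {k\<in>{1..n}. t k < m}) = int (card {k\<in>{1..n}. rw k < m})"
      using sum_content_card[OF t(1), of "{..<m}"] card_rw_less[of m] by simp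
    then show ?thesis using card_by_cols[of "\<lambda>k. t k < m"] card_by_cols[of "\<lambda>k. rw k < m"] by simp
  qed
  have eq: "?f m j = ?g m j" for m j
  proof (cases "j \<in> cl ` {1..n}")
    case True
    show ?thesis
      by (rule sum_mono_inv[OF tot[of m] _ True]) (use le in auto)
  next
    case False
    then have "{k\<in>{1..n}. cl k = j \<and> t k < m} = {}" "{k\<in>{1..n}. cl k = j \<and> rw k < m} = {}" by auto
    then show ?thesis by (simp only: card.empty)
  qed
  have cnt: "?f (Suc i) j = ?f i j + card {k\<in>{1..n}. (t k, cl k) = (i, j)}"
    "?g (Suc i) j = ?g i j + card {k\<in>{1..n}. (rw k, cl k) = (i, j)}" for i j
    by (subst card_Un_disjoint[symmetric]; (force intro: arg_cong[of _ _ card])?)+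
  \<comment> \<open>Paired with the column, \<open>t\<close> and \<open>rw\<close> become colorings
    of the same content \<open>K\<close>; transitivity on these yields a permutation that preserves
    columns.\<close>
  define K where "K = (\<lambda>(i, j). int (card {k\<in>{1..n}. (rw k, cl k) = (i, j)}))"
  have "card {k\<in>{1..n}. (t k, cl k) = (i, j)} = card {k\<in>{1..n}. (rw k, cl k) = (i, j)}" for i j
    using cnt(1)[of j i] cnt(2)[of j i] eq[of j "Suc i"] eq[of j i] by linarith
  then have K: "int (card {k\<in>{1..n}. (t k, cl k) = c}) = K c" "int (card {k\<in>{1..n}. (rw k, cl k) = c}) = K c" for c
    by (cases c; simp only: K_def prod.case)+
  have out: "(t k, cl k) = (0, 0)" "(rw k, cl k) = (0, 0)" if "k \<notin> {1..n}" for k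
    using colorings_default[OF t(1) that] rw_out[OF that] cl_out[OF that] by simp_all
  have A: "(\<lambda>k. (t k, cl k)) \<in> colorings (0, 0) n K"
    unfolding colorings_def by (intro CollectI conjI allI impI K out)
  have B: "(\<lambda>k. (rw k, cl k)) \<in> colorings (0, 0) n K"
    unfolding colorings_def by (intro CollectI conjI allI impI K out)
  obtain q where q: "q \<in> Sym n" "(\<lambda>k. (t k, cl k)) = (\<lambda>k. (rw k, cl k)) \<circ> q"
    by (rule colorings_transitive[OF B A])
  have "t = rw \<circ> q" "cl \<circ> q = cl" using q(2) by (auto simp: fun_eq_iff)
  then show ?thesis using that[of q] q(1) by (simp add: C_iff)
qed

end

section \<open>The tabloid module and the Specht module inside it\<close>

lemma perm_action_colorings: "perm_action n (colorings d n \<kappa>) (\<lambda>g t. t \<circ> g)"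
  by unfold_locales (auto simp: colorings_comp comp_assoc)

context perm_action
begin

definition full :: "('x \<Rightarrow> complex) set" where
  "full = {F. \<forall>x. x \<notin> X \<longrightarrow> F x = 0}"

lemma rho_not_in: "g \<in> Sym n \<Longrightarrow> x \<notin> X \<Longrightarrow> \<rho> g x \<notin> X"
  using rho_closed[of "inv' g" "\<rho> g x"] by (auto simp: rho_inv)

lemma submod_full: "submod full"
  unfolding submod_def supported_def fun_vs.subspace_def
  by (auto simp: full_def act_def rho_not_in)

lemma submod_le_full: "submod W \<Longrightarrow> W \<subseteq> full"
  using submodD(3) by (auto simp: full_def)

lemma chr_full:
  assumes "g \<in> Sym n"
  shows "chr full g = of_nat (card {x \<in> X. \<rho> g x = x})"
proof -
  let ?P = "\<lambda>x y. if x = y \<and> y \<in> X then 1 else 0 :: complex"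
  have "kernel_on X full ?P"
    unfolding kernel_on_def
  proof (intro conjI ballI allI)
    show "(\<lambda>x. ?P x y) \<in> full" for y by (simp add: full_def)
    fix F x assume F: "F \<in> full"
    have "(\<Sum>y\<in>X. ?P x y * F y) = (\<Sum>y\<in>X. if x = y then F y else 0)" by (rule sum.cong) auto
    also have "\<dots> = F x" using F finite_X by (simp add: full_def)
    finally show "F x = (\<Sum>y\<in>X. ?P x y * F y)" by simp
  qed
  then have "chr full g = (\<Sum>x\<in>X. ?P (\<rho> g x) x)" using chr_eq[OF submod_full _ assms] by blast
  also have "\<dots> = (\<Sum>x\<in>X. if \<rho> g x = x then 1 else 0)" by (rule sum.cong) auto
  also have "\<dots> = of_nat (card {x \<in> X. \<rho> g x = x})" by (simp add: sum.If_cases finite_X Int_def)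
  finally show ?thesis .
qed

end

context young
begin

sublocale T: perm_action n Tabl "\<lambda>g t. t \<circ> g"
  by (rule perm_action_colorings)

text \<open>Bilinear, without conjugation, so that pairing with \<open>e\<close> is linear. On real
  functions such as \<open>e\<close> and its translates it is still definite.\<close>

definition ip :: "((nat \<Rightarrow> nat) \<Rightarrow> complex) \<Rightarrow> ((nat \<Rightarrow> nat) \<Rightarrow> complex) \<Rightarrow> complex" where
  "ip F F' = (\<Sum>t\<in>Tabl. F t * F' t)"

lemma ip_sym: "ip F F' = ip F' F"
  by (simp add: ip_def mult.commute)

lemma ip_act: "g \<in> Sym n \<Longrightarrow> ip (T.act g F) F' = ip F (T.act (inv' g) F')"
proof -
  assume g: "g \<in> Sym n"
  have "ip F (T.act (inv' g) F') = (\<Sum>t\<in>Tabl. F (t \<circ> g) * F' (t \<circ> g \<circ> inv' g))"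
    unfolding ip_def T.act_def
    by (rule T.sum_rho[OF g, of "\<lambda>t. F t * F' (t \<circ> inv' g)", symmetric])
  then show ?thesis using g by (simp add: ip_def T.act_def comp_assoc)
qed

lemma ip_linear: "ip (F + G) F' = ip F F' + ip G F'" "ip (fscale r F) F' = r * ip F F'" "ip 0 F' = 0"
  by (simp_all add: ip_def sum.distrib algebra_simps sum_distrib_left)

lemma ip_sum: "ip (\<Sum>i\<in>I. F i) G = (\<Sum>i\<in>I. ip (F i) G)"
  by (induction I rule: infinite_finite_induct) (simp_all only: sum.infinite sum.empty sum.insert ip_linear not_False_eq_True)

lemma ip_real: "(\<And>t. F t \<in> \<real>) \<Longrightarrow> (\<And>t. F' t \<in> \<real>) \<Longrightarrow> ip F F' \<in> \<real>"
  unfolding ip_def by (intro sum_in_Reals Reals_mult) auto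

abbreviation "ee \<equiv> ip e e"

lemma ee_nonzero: "ee \<noteq> 0"
proof
  assume "ee = 0"
  have "e t * e t = of_real ((Re (e t))\<^sup>2)" for t
    using of_real_Re[OF e_real[of t]] by (metis of_real_mult power2_eq_square)
  then have "of_real (\<Sum>t\<in>Tabl. (Re (e t))\<^sup>2) = (0 :: complex)" using \<open>ee = 0\<close> by (simp add: ip_def)
  then have "(\<Sum>t\<in>Tabl. (Re (e t))\<^sup>2) = 0" by (simp only: of_real_eq_0_iff)
  then have "(Re (e rw))\<^sup>2 = 0" using rw_Tabl by (subst (asm) sum_nonneg_eq_0_iff) auto
  then show False by (simp add: e_rw)
qed

text \<open>Matrix coefficient of the Specht module at \<open>e\<close>. Expanding \<open>e\<close>
  twice, \<open>cf h\<close> is the signed number of ways to write \<open>h\<close> as a column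
  permutation times a row permutation times a column permutation, so it is a symmetrized form of the
  Young symmetrizer.\<close>

definition cf :: "(nat \<Rightarrow> nat) \<Rightarrow> complex" where
  "cf h = ip e (T.act h e)"

lemma cf_real: "cf h \<in> \<real>"
  unfolding cf_def by (intro ip_real) (auto simp: T.act_def e_real)

definition S :: "((nat \<Rightarrow> nat) \<Rightarrow> complex) set" where
  "S = fun_vs.span ((\<lambda>g. T.act g e) ` Sym n)"

lemma S_act_e: "g \<in> Sym n \<Longrightarrow> T.act g e \<in> S"
  unfolding S_def by (intro fun_vs.span_base) auto

lemma e_S: "e \<in> S"
  using S_act_e[of id] by (simp add: T.act_id)

lemma subspace_S: "fun_vs.subspace S"
  unfolding S_def by (rule fun_vs.subspace_span)

lemma S_induct:
  assumes "F \<in> S" "fun_vs.subspace Z" "\<And>g. g \<in> Sym n \<Longrightarrow> T.act g e \<in> Z"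
  shows "F \<in> Z"
proof -
  have "S \<subseteq> Z" unfolding S_def using assms(2,3) by (intro fun_vs.span_minimal) auto
  then show ?thesis using assms(1) by blast
qed

lemma submod_S: "T.submod S"
  unfolding T.submod_def supported_def
proof (intro conjI ballI allI impI)
  show "F t = 0" if "F \<in> S" "t \<notin> Tabl" for F t
  proof -
    have "F \<in> T.full"
      by (rule S_induct[OF that(1) T.submodD(2)[OF T.submod_full]])
        (auto simp: T.full_def T.act_def colorings_comp_iff e_support)
    then show ?thesis using that(2) by (simp add: T.full_def)
  qed
  show "T.act g F \<in> S" if g: "g \<in> Sym n" and F: "F \<in> S" for g F
  proof -
    have "fun_vs.subspace {F. T.act g F \<in> S}"
    proof (rule fun_vs.subspaceI)
      have "T.act g 0 = 0" by (simp add: T.act_def fun_eq_iff)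
      then show "0 \<in> {F. T.act g F \<in> S}" using fun_vs.subspace_0[OF subspace_S] by simp
    qed (auto simp: T.act_linear intro: fun_vs.subspace_add[OF subspace_S] fun_vs.subspace_scale[OF subspace_S])
    then have "F \<in> {F. T.act g F \<in> S}"
      by (rule S_induct[OF F]) (use g S_act_e in \<open>simp add: T.act_comp[symmetric]\<close>)
    then show ?thesis by simp
  qed
qed (rule subspace_S)

lemma models_specht: "T.models (specht la) S"
proof -
  have "polytabloid la ` Sym n = (\<lambda>g. T.act g e) ` Sym n"
    by (rule image_cong) (auto simp: e_polytabloid T.act_def)
  then show ?thesis
    using submod_S by (auto simp: T.models_def specht_def S_def carrier_sym_group T.act_def)
qed

end

section \<open>The column antisymmetrizer on arbitrary modules\<close>

locale young_action = young la + perm_action "psize la" X \<rho>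
  for la :: "nat \<Rightarrow> nat" and X :: "'x set" and \<rho> :: "(nat \<Rightarrow> nat) \<Rightarrow> 'x \<Rightarrow> 'x"
begin

definition bop :: "('x \<Rightarrow> complex) \<Rightarrow> 'x \<Rightarrow> complex" where
  "bop F = (\<Sum>q\<in>C. fscale (of_int (sign q)) (act q F))"

lemma bop_apply: "bop F x = (\<Sum>q\<in>C. of_int (sign q) * F (\<rho> q x))"
  by (simp add: bop_def sum_fun_apply act_apply)

lemma bop_in: "submod W \<Longrightarrow> F \<in> W \<Longrightarrow> bop F \<in> W"
  unfolding bop_def using C_Sym by (intro fun_vs.subspace_sum fun_vs.subspace_scale submodD) auto

lemma bop_fixed:
  assumes q: "q \<in> C" "sign q = -1" and x: "\<rho> q x = x"
  shows "bop F x = 0"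
proof -
  have "bop F x = (\<Sum>q'\<in>C. of_int (sign (q \<circ> q')) * F (\<rho> (q \<circ> q') x))"
    unfolding bop_apply by (rule sum.reindex_bij_betw[OF bij_C_left[OF q(1)], symmetric])
  also have "\<dots> = (\<Sum>q'\<in>C. - (of_int (sign q') * F (\<rho> q' x)))"
    using q x by (intro sum.cong) (auto simp: sign_C rho_comp C_Sym)
  also have "\<dots> = - bop F x" by (simp add: bop_apply sum_negf)
  finally show ?thesis by simp
qed

text \<open>The equivariant map from the tabloid module that takes \<open>e\<close> to \<open>avg cf w\<close>.\<close>

definition Tm :: "('x \<Rightarrow> complex) \<Rightarrow> ((nat \<Rightarrow> nat) \<Rightarrow> complex) \<Rightarrow> 'x \<Rightarrow> complex" where
  "Tm w F = (\<Sum>h\<in>Sym n. fscale (ip F (T.act h e)) (act h w))"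

lemma Tm_e: "Tm w e = avg cf w"
  by (simp add: Tm_def avg_def cf_def)

lemma Tm_linear: "Tm w (F + G) = Tm w F + Tm w G" "Tm w (fscale r F) = fscale r (Tm w F)" "Tm w 0 = 0"
  by (auto simp: Tm_def ip_linear fun_eq_iff sum_fun_apply algebra_simps sum.distrib sum_distrib_left)

lemma Tm_sum: "Tm w (\<Sum>i\<in>I. F i) = (\<Sum>i\<in>I. Tm w (F i))"
  by (induction I rule: infinite_finite_induct) (simp_all only: sum.infinite sum.empty sum.insert Tm_linear not_False_eq_True)

lemma act_sum: "act g (\<Sum>i\<in>I. F i) = (\<Sum>i\<in>I. act g (F i))"
  by (auto simp: fun_eq_iff sum_fun_apply act_apply)

lemma Tm_equivariant:
  assumes g: "g \<in> Sym n"
  shows "Tm w (T.act g F) = act g (Tm w F)"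
proof -
  have "Tm w (T.act g F) = (\<Sum>h\<in>Sym n. fscale (ip (T.act g F) (T.act (g \<circ> h) e)) (act (g \<circ> h) w))"
    unfolding Tm_def by (rule sum.reindex_bij_betw[OF bij_betw_Sym_left[OF g], symmetric])
  also have "\<dots> = (\<Sum>h\<in>Sym n. fscale (ip F (T.act h e)) (act g (act h w)))"
  proof (rule sum.cong[OF refl])
    fix h assume h: "h \<in> Sym n"
    have "T.act (inv' g) (T.act (g \<circ> h) e) = T.act h e"
      using g h by (simp add: T.act_comp[symmetric])
    then show "fscale (ip (T.act g F) (T.act (g \<circ> h) e)) (act (g \<circ> h) w) =
        fscale (ip F (T.act h e)) (act g (act h w))"
      using g h by (simp add: ip_act act_comp)
  qed
  also have "\<dots> = act g (Tm w F)" by (simp add: Tm_def act_sum act_linear)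
  finally show ?thesis .
qed

lemma Tm_in: "submod W \<Longrightarrow> w \<in> W \<Longrightarrow> Tm w F \<in> W"
  unfolding Tm_def by (intro fun_vs.subspace_sum fun_vs.subspace_scale submodD)

end

context young
begin

sublocale TA: young_action la Tabl "\<lambda>g t. t \<circ> g"
  by unfold_locales

text \<open>James's sign argument. At a tabloid with two entries of one column in the same row both
  sides vanish by a transposition; every other tabloid is \<open>rw \<circ> q\<close> with
  \<open>q\<close> in \<open>C\<close>, where the sums defining \<open>bop F\<close> and
  \<open>ip F e\<close> differ by a reindexing and the sign of \<open>q\<close>.\<close>

lemma bop_Tabl:
  assumes F: "F \<in> T.full"
  shows "TA.bop F = fscale (ip F e) e"
proof
  fix t
  have ipF: "ip F e = (\<Sum>q\<in>C. of_int (sign q) * F (rw \<circ> q))"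
  proof -
    have "ip F e = (\<Sum>t\<in>Tabl. \<Sum>q\<in>C. of_int (sign q) * (if t = rw \<circ> q then F t else 0))"
      unfolding ip_def e_def sum_distrib_left by (intro sum.cong refl) auto
    also have "\<dots> = (\<Sum>q\<in>C. \<Sum>t\<in>Tabl. of_int (sign q) * (if t = rw \<circ> q then F t else 0))"
      by (rule sum.swap)
    also have "\<dots> = (\<Sum>q\<in>C. of_int (sign q) * F (rw \<circ> q))"
      unfolding sum_distrib_left[symmetric] using colorings_comp[OF rw_Tabl C_Sym]
      by (intro sum.cong refl) auto
    finally show ?thesis .
  qed
  consider "t \<notin> Tabl" | "t \<in> Tabl" "\<not> col_inj t" | "t \<in> Tabl" "col_inj t" by blast
  then show "TA.bop F t = fscale (ip F e) e t"
  proof cases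
    case 1
    then have "TA.bop F t = 0"
      unfolding TA.bop_apply using F T.rho_not_in[OF C_Sym 1]
      by (intro sum.neutral) (auto simp: T.full_def)
    then show ?thesis using e_support[OF 1] by simp
  next
    case 2
    obtain q where q: "q \<in> C" "sign q = -1" "t \<circ> q = t" using not_col_injE[OF 2(2)] .
    have "e t = 0" using e_comp[OF q(1), of t] q by simp
    then show ?thesis using TA.bop_fixed[OF q(1,2), of t F] q(3) by simp
  next
    case 3
    obtain q where q: "q \<in> C" "t = rw \<circ> q" using col_inj_TablE[OF 3] .
    have "ip F e = (\<Sum>q'\<in>C. of_int (sign (q \<circ> q')) * F (rw \<circ> (q \<circ> q')))"
      unfolding ipF by (rule sum.reindex_bij_betw[OF bij_C_left[OF q(1)], symmetric])
    also have "\<dots> = of_int (sign q) * TA.bop F t"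
      unfolding TA.bop_apply sum_distrib_left using q by (intro sum.cong) (auto simp: sign_C comp_assoc)
    finally have "of_int (sign q) * ip F e = of_int (sign q) * (of_int (sign q) * TA.bop F t)" by (simp only:)
    also have "\<dots> = (of_int (sign q * sign q) :: complex) * TA.bop F t"
      by (simp only: of_int_mult mult.assoc)
    also have "(of_int (sign q * sign q) :: complex) = 1" by (simp only: sign_idempotent of_int_1)
    finally have X: "of_int (sign q) * ip F e = 1 * TA.bop F t" .
    have et: "e t = of_int (sign q)" using e_comp[OF q(1), of rw] q(2) e_rw by simp
    show ?thesis unfolding fscale_apply et using X by (simp add: mult.commute)
  qed
qed

lemma e_full: "e \<in> T.full"
  using e_support by (simp add: T.full_def)

end

context young_action
begin

lemma Tm_bop: "Tm w (TA.bop F) = bop (Tm w F)"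
  unfolding TA.bop_def bop_def Tm_sum Tm_linear
  by (intro sum.cong refl) (simp add: Tm_equivariant C_Sym)

text \<open>\<open>Tm w\<close> commutes with the antisymmetrizer, for which \<open>e\<close> is an
  eigenvector with eigenvalue \<open>ee\<close>. This is how vanishing of \<open>bop\<close> on a
  module passes to \<open>cf\<close>.\<close>

lemma avg_bop: "fscale ee (avg cf w) = bop (avg cf w)"
  using Tm_bop[of w e] unfolding bop_Tabl[OF e_full] Tm_linear Tm_e .

lemma avg_zero:
  assumes "submod W" "F \<in> W" "\<And>F. F \<in> W \<Longrightarrow> bop F = 0"
  shows "avg cf F = 0"
proof -
  have "fscale ee (avg cf F) = 0" unfolding avg_bop using assms by (simp add: avg_in)
  then show ?thesis using ee_nonzero fun_vs.scale_eq_0_iff by blast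
qed

end

context young
begin

text \<open>The scalar by which \<open>cf\<close> acts on \<open>e\<close>, read off by pairing with
  \<open>e\<close>.\<close>

definition kk :: complex where
  "kk = ip (T.avg cf e) e / ee"

lemma avg_rank_one:
  assumes "F \<in> T.full"
  shows "\<exists>r. T.avg cf F = fscale r e"
proof -
  have "T.avg cf F \<in> T.full" using assms by (intro T.avg_in T.submod_full)
  then have "fscale ee (T.avg cf F) = fscale (ip (T.avg cf F) e) e"
    using TA.avg_bop bop_Tabl by simp
  then have "fscale (1 / ee) (fscale ee (T.avg cf F)) = fscale (1 / ee) (fscale (ip (T.avg cf F) e) e)"
    by simp
  then show ?thesis using ee_nonzero by (auto simp: fun_vs.scale_scale)
qed

lemma avg_e: "T.avg cf e = fscale kk e"
proof -
  obtain r where r: "T.avg cf e = fscale r e" using avg_rank_one[OF e_full] by blast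
  then have "kk = r" using ee_nonzero by (simp add: kk_def ip_linear)
  then show ?thesis using r by simp
qed

lemma kk_formula: "kk = (\<Sum>h\<in>Sym n. cf h * cf h) / ee"
proof -
  have "ip (T.avg cf e) e = (\<Sum>h\<in>Sym n. ip (fscale (cf h) (T.act h e)) e)"
    unfolding T.avg_def by (rule ip_sum)
  also have "\<dots> = (\<Sum>h\<in>Sym n. cf h * cf h)"
  proof (rule sum.cong[OF refl])
    fix h
    have "ip (fscale (cf h) (T.act h e)) e = cf h * ip e (T.act h e)"
      by (simp only: ip_linear ip_sym[of "T.act h e" e])
    then show "ip (fscale (cf h) (T.act h e)) e = cf h * cf h" by (simp only: cf_def)
  qed
  finally show ?thesis by (simp only: kk_def)
qed

lemma kk_real: "kk \<in> \<real>"
  unfolding kk_formula by (intro Reals_divide sum_in_Reals Reals_mult cf_real ip_real e_real)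

text \<open>\<open>cf\<close> is real and \<open>cf id = ee\<close>, so \<open>kk\<close> is a sum
  of squares, not all zero, divided by \<open>ee\<close>.\<close>

lemma kk_nonzero: "kk \<noteq> 0"
proof
  assume "kk = 0"
  have "cf h * cf h = of_real ((Re (cf h))\<^sup>2)" for h
    using of_real_Re[OF cf_real[of h]] by (metis of_real_mult power2_eq_square)
  then have "of_real (\<Sum>h\<in>Sym n. (Re (cf h))\<^sup>2) = (0 :: complex)"
    using \<open>kk = 0\<close> ee_nonzero by (simp add: kk_formula)
  then have "(\<Sum>h\<in>Sym n. (Re (cf h))\<^sup>2) = 0" by (simp only: of_real_eq_0_iff)
  then have "(Re (cf id))\<^sup>2 = 0" by (subst (asm) sum_nonneg_eq_0_iff) auto
  then have "Re ee = 0" by (simp add: cf_def T.act_id)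
  moreover have "ee \<in> \<real>" by (intro ip_real e_real)
  ultimately show False using ee_nonzero by (metis of_real_0 of_real_Re)
qed

text \<open>James's submodule argument: if some vector of \<open>V\<close> is not orthogonal to a
  translate of \<open>e\<close>, the antisymmetrizer produces a nonzero multiple of \<open>e\<close>
  in \<open>V\<close>. Otherwise \<open>V\<close> is orthogonal to all of \<open>S\<close>, in
  particular to itself.\<close>

lemma simple_S: "T.simple S"
  unfolding T.simple_def
proof (intro conjI allI impI)
  show "T.submod S" by (rule submod_S)
  have "e \<noteq> 0" using e_rw by (metis zero_fun_apply zero_neq_one)
  then show "S \<noteq> {0}" using e_S by blast
  fix V assume V: "T.submod V \<and> V \<subseteq> S"
  then have sV: "T.submod V" by blast
  show "V = {0} \<or> V = S"
  proof (cases "\<exists>F\<in>V. \<exists>h\<in>Sym n. ip F (T.act h e) \<noteq> 0")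
    case True
    then obtain F h where F: "F \<in> V" "h \<in> Sym n" "ip F (T.act h e) \<noteq> 0" by blast
    let ?F = "T.act (inv' h) F"
    have F': "?F \<in> V" using F by (intro T.submodD(4)[OF sV]) auto
    have nz: "ip ?F e \<noteq> 0" using F by (simp add: ip_act)
    have "TA.bop ?F \<in> V" by (rule TA.bop_in[OF sV F'])
    moreover have "?F \<in> T.full" using F' T.submod_le_full[OF sV] by blast
    ultimately have "fscale (ip ?F e) e \<in> V" by (simp add: bop_Tabl)
    then have m: "fscale (1 / ip ?F e) (fscale (ip ?F e) e) \<in> V"
      by (rule fun_vs.subspace_scale[OF T.submodD(2)[OF sV]])
    have eq: "fscale (1 / ip ?F e) (fscale (ip ?F e) e) = e"
      unfolding fun_eq_iff fscale_apply using nz by simp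
    have "e \<in> V" using m unfolding eq .
    then have "S \<subseteq> V"
      using S_induct[OF _ T.submodD(2)[OF sV]] T.submodD(4)[OF sV] by blast
    then show ?thesis using V by blast
  next
    case False
    have "F = 0" if F: "F \<in> V" for F
    proof -
      \<comment> \<open>Definiteness over the complex numbers needs the Hermitian form. The
        translates of \<open>e\<close> are real, so orthogonality for \<open>ip\<close> carries over
        to them, then to their span \<open>S\<close>, and thus to \<open>F\<close> itself.\<close>
      have "fun_vs.subspace {G. (\<Sum>t\<in>Tabl. cnj (G t) * F t) = 0}"
        by (rule fun_vs.subspaceI)
           (auto simp: sum.distrib algebra_simps sum_distrib_left[symmetric])
      then have "F \<in> {G. (\<Sum>t\<in>Tabl. cnj (G t) * F t) = 0}"
      proof (rule S_induct[rotated])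
        show "F \<in> S" using F V by blast
        show "T.act g e \<in> {G. (\<Sum>t\<in>Tabl. cnj (G t) * F t) = 0}" if "g \<in> Sym n" for g
        proof -
          have "cnj (T.act g e t) = T.act g e t" for t
            using e_real[of "t \<circ> g"] by (simp add: T.act_def Reals_cnj_iff)
          then show ?thesis using False F that by (simp add: ip_def mult.commute)
        qed
      qed
      then have "(\<Sum>t\<in>Tabl. cnj (F t) * F t) = 0" by simp
      moreover have "cnj z * z = of_real ((cmod z)\<^sup>2)" for z
        by (metis complex_norm_square mult.commute)
      ultimately have "of_real (\<Sum>t\<in>Tabl. (cmod (F t))\<^sup>2) = (0 :: complex)" by simp
      then have "(\<Sum>t\<in>Tabl. (cmod (F t))\<^sup>2) = 0" by (simp only: of_real_eq_0_iff)
      then have "\<forall>t\<in>Tabl. F t = 0" by (subst (asm) sum_nonneg_eq_0_iff) auto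
      then show "F = 0" using T.submodD(3)[OF sV F] by (auto simp: fun_eq_iff)
    qed
    then show ?thesis using fun_vs.subspace_0[OF T.submodD(2)[OF sV]] by blast
  qed
qed

end

context young
begin

lemma e_nonzero: "e \<noteq> 0"
  using e_rw by (metis zero_fun_apply zero_neq_one)

lemma sum_cf_chr_S: "(\<Sum>h\<in>Sym n. cf h * T.chr S h) = kk"
proof (rule T.sum_chr_rank_one[OF submod_S e_S e_nonzero _ avg_e])
  show "\<exists>r. T.avg cf F = fscale r e" if "F \<in> S" for F
    using that T.submod_le_full[OF submod_S] by (intro avg_rank_one) blast
qed

text \<open>That the trace on the whole tabloid module is no larger than on \<open>S\<close> says
  that the Specht module occurs in it exactly once.\<close>

lemma sum_cf_chr_full: "(\<Sum>h\<in>Sym n. cf h * T.chr T.full h) = kk"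
  by (rule T.sum_chr_rank_one[OF T.submod_full e_full e_nonzero avg_rank_one avg_e])

text \<open>
  By Schur's lemma \<open>F \<mapsto> (\<Sum>h. \<langle>F, h e\<rangle> h e) / kk\<close> is the identity on \<open>S\<close>; this is an explicit
  projection onto \<open>S\<close>, and its trace against \<open>g\<close> expresses the character through \<open>cf\<close>.
\<close>

lemma Tm_e_S:
  assumes "F \<in> S"
  shows "TA.Tm e F = fscale kk F"
proof -
  have "fun_vs.subspace {F. TA.Tm e F = fscale kk F}"
    by (rule fun_vs.subspaceI)
       (simp_all only: mem_Collect_eq TA.Tm_linear fun_vs.scale_right_distrib fun_vs.scale_zero_right
         fun_vs.scale_left_commute)
  then have "F \<in> {F. TA.Tm e F = fscale kk F}"
  proof (rule S_induct[OF assms])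
    fix g assume g: "g \<in> Sym n"
    show "T.act g e \<in> {F. TA.Tm e F = fscale kk F}"
      unfolding mem_Collect_eq TA.Tm_equivariant[OF g] TA.Tm_e avg_e T.act_linear ..
  qed
  then show ?thesis by simp
qed

lemma chr_S_formula:
  assumes g: "g \<in> Sym n"
  shows "T.chr S g = (\<Sum>h\<in>Sym n. cf (inv' h \<circ> g \<circ> h)) / kk"
proof -
  let ?P = "\<lambda>t s. (\<Sum>h\<in>Sym n. e (t \<circ> h) * e (s \<circ> h)) / kk"
  have "kernel_on Tabl S ?P"
    unfolding kernel_on_def
  proof (intro conjI ballI allI)
    fix s
    have "(\<lambda>t. ?P t s) = fscale (1 / kk) (\<Sum>h\<in>Sym n. fscale (e (s \<circ> h)) (T.act h e))"
      by (auto simp: fun_eq_iff sum_fun_apply T.act_apply mult.commute)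
    then show "(\<lambda>t. ?P t s) \<in> S"
      by (simp only:) (intro fun_vs.subspace_scale fun_vs.subspace_sum subspace_S S_act_e)
  next
    fix F t assume F: "F \<in> S"
    have "kk * F t = TA.Tm e F t" using Tm_e_S[OF F] by simp
    also have "\<dots> = (\<Sum>h\<in>Sym n. \<Sum>s\<in>Tabl. F s * e (s \<circ> h) * e (t \<circ> h))"
      by (simp add: TA.Tm_def sum_fun_apply T.act_apply ip_def sum_distrib_right)
    also have "\<dots> = (\<Sum>s\<in>Tabl. (\<Sum>h\<in>Sym n. e (t \<circ> h) * e (s \<circ> h)) * F s)"
      by (subst sum.swap) (simp add: sum_distrib_left sum_distrib_right mult_ac)
    also have "\<dots> = kk * (\<Sum>s\<in>Tabl. ?P t s * F s)"
      using kk_nonzero by (simp add: sum_distrib_left)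
    finally show "F t = (\<Sum>s\<in>Tabl. ?P t s * F s)" using kk_nonzero by simp
  qed
  then have "T.chr S g = (\<Sum>t\<in>Tabl. ?P (t \<circ> g) t)" by (rule T.chr_eq[OF submod_S _ g])
  also have "\<dots> = (\<Sum>h\<in>Sym n. \<Sum>t\<in>Tabl. e (t \<circ> g \<circ> h) * e (t \<circ> h)) / kk"
    unfolding sum_divide_distrib[symmetric] by (subst sum.swap) (rule refl)
  also have "\<dots> = (\<Sum>h\<in>Sym n. cf (inv' h \<circ> g \<circ> h)) / kk"
  proof (intro arg_cong2[where f = "(/)"] sum.cong refl)
    fix h assume h: "h \<in> Sym n"
    have "(\<Sum>t\<in>Tabl. e (t \<circ> g \<circ> h) * e (t \<circ> h)) =
        (\<Sum>t\<in>Tabl. e (t \<circ> h \<circ> (inv' h \<circ> g \<circ> h)) * e (t \<circ> h))"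
      using h by (simp add: comp_assoc)
    also have "\<dots> = (\<Sum>t\<in>Tabl. e (t \<circ> (inv' h \<circ> g \<circ> h)) * e t)"
      by (rule T.sum_rho[OF h, of "\<lambda>t. e (t \<circ> (inv' h \<circ> g \<circ> h)) * e t"])
    finally show "(\<Sum>t\<in>Tabl. e (t \<circ> g \<circ> h) * e (t \<circ> h)) = cf (inv' h \<circ> g \<circ> h)"
      by (simp add: cf_def ip_def T.act_def mult.commute)
  qed
  finally show ?thesis .
qed

lemma chr_S_real: "g \<in> Sym n \<Longrightarrow> T.chr S g \<in> \<real>"
  unfolding chr_S_formula by (intro Reals_divide sum_in_Reals cf_real kk_real)

text \<open>Up to the factor \<open>fact n / kk\<close> the character is \<open>cf\<close> averaged
  over conjugates, and a class function does not notice the averaging. Traces of \<open>cf\<close>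
  thereby become scalar products with the character.\<close>

lemma sum_chr_S:
  assumes cls: "\<And>g h. g \<in> Sym n \<Longrightarrow> h \<in> Sym n \<Longrightarrow> Y (h \<circ> g \<circ> inv' h) = Y g"
  shows "(\<Sum>g\<in>Sym n. T.chr S g * Y g) = fact n / kk * (\<Sum>g\<in>Sym n. cf g * Y g)"
proof -
  have "(\<Sum>g\<in>Sym n. T.chr S g * Y g) = (\<Sum>g\<in>Sym n. \<Sum>h\<in>Sym n. cf (inv' h \<circ> g \<circ> h) * Y g) / kk"
    by (simp add: chr_S_formula sum_divide_distrib sum_distrib_right)
  also have "(\<Sum>g\<in>Sym n. \<Sum>h\<in>Sym n. cf (inv' h \<circ> g \<circ> h) * Y g) =
      (\<Sum>h\<in>Sym n. \<Sum>g\<in>Sym n. cf (inv' h \<circ> g \<circ> h) * Y g)" by (rule sum.swap)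
  also have "\<dots> = (\<Sum>h\<in>Sym n. \<Sum>g\<in>Sym n. cf g * Y g)"
  proof (rule sum.cong[OF refl])
    fix h assume h: "h \<in> Sym n"
    have "bij_betw (\<lambda>g. h \<circ> g \<circ> inv' h) (Sym n) (Sym n)"
      by (rule bij_betw_byWitness[where f' = "\<lambda>g. inv' h \<circ> g \<circ> h"]) (use h in \<open>auto simp: comp_assoc\<close>)
    then have "(\<Sum>g\<in>Sym n. cf (inv' h \<circ> g \<circ> h) * Y g) =
        (\<Sum>g\<in>Sym n. cf (inv' h \<circ> (h \<circ> g \<circ> inv' h) \<circ> h) * Y (h \<circ> g \<circ> inv' h))"
      by (rule sum.reindex_bij_betw[symmetric])
    also have "\<dots> = (\<Sum>g\<in>Sym n. cf g * Y g)"
      using h cls by (intro sum.cong refl) (simp add: comp_assoc)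
    finally show "(\<Sum>g\<in>Sym n. cf (inv' h \<circ> g \<circ> h) * Y g) = (\<Sum>g\<in>Sym n. cf g * Y g)" .
  qed
  also have "(\<Sum>h\<in>Sym n. \<Sum>g\<in>Sym n. cf g * Y g) / kk = fact n / kk * (\<Sum>g\<in>Sym n. cf g * Y g)"
    by (simp add: card_Sym)
  finally show ?thesis .
qed

lemma chr_S_norm: "(\<Sum>g\<in>Sym n. T.chr S g * T.chr S g) = fact n"
proof -
  have "(\<Sum>g\<in>Sym n. T.chr S g * T.chr S g) = fact n / kk * (\<Sum>g\<in>Sym n. cf g * T.chr S g)"
    by (rule sum_chr_S) (rule T.chr_conj[OF submod_S])
  then show ?thesis unfolding sum_cf_chr_S using kk_nonzero by (simp only: nonzero_divide_eq_eq times_divide_eq_left nonzero_mult_div_cancel_right not_False_eq_True)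
qed

lemma chr_S_fix_count_self:
  "(\<Sum>g\<in>Sym n. T.chr S g * of_nat (fix_count 0 n (\<lambda>i. int (la i)) g)) = fact n"
proof -
  have "of_nat (fix_count 0 n (\<lambda>i. int (la i)) g) = T.chr T.full g" if "g \<in> Sym n" for g
    using T.chr_full[OF that] by (simp add: fix_count_def)
  then have "(\<Sum>g\<in>Sym n. T.chr S g * of_nat (fix_count 0 n (\<lambda>i. int (la i)) g)) =
      (\<Sum>g\<in>Sym n. T.chr S g * T.chr T.full g)" by (simp only: cong: sum.cong)
  also have "\<dots> = fact n / kk * (\<Sum>g\<in>Sym n. cf g * T.chr T.full g)"
    by (rule sum_chr_S) (rule T.chr_conj[OF T.submod_full])
  finally show ?thesis unfolding sum_cf_chr_full using kk_nonzero by (simp only: nonzero_divide_eq_eq times_divide_eq_left nonzero_mult_div_cancel_right not_False_eq_True)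
qed

text \<open>No coloring whose content violates dominance is injective on columns, so the
  antisymmetrizer kills the permutation module, and \<open>cf\<close> does with it.\<close>

lemma chr_S_fix_count_zero:
  assumes J: "finite J" "(\<Sum>c\<in>J. \<kappa> c) > (\<Sum>i<card J. int (la i))"
  shows "(\<Sum>g\<in>Sym n. T.chr S g * of_nat (fix_count d n \<kappa> g)) = 0"
proof -
  interpret A: perm_action n "colorings d n \<kappa>" "\<lambda>g t. t \<circ> g" by (rule perm_action_colorings)
  interpret A: young_action la "colorings d n \<kappa>" "\<lambda>g t. t \<circ> g" by unfold_locales
  have chr: "of_nat (fix_count d n \<kappa> g) = A.chr A.full g" if "g \<in> Sym n" for g
    using A.chr_full[OF that] by (simp add: fix_count_def)
  have "A.bop F = 0" if F: "F \<in> A.full" for F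
  proof
    fix t
    show "A.bop F t = 0 t"
    proof (cases "t \<in> colorings d n \<kappa>")
      case True
      then have "\<not> col_inj t" using col_inj_dominance[of t d \<kappa> J] J by force
      then obtain q where "q \<in> C" "sign q = -1" "t \<circ> q = t" using not_col_injE by blast
      then show ?thesis using A.bop_fixed[of q t F] by simp
    next
      case False
      then show ?thesis using A.bop_in[OF A.submod_full F] by (simp add: A.full_def)
    qed
  qed
  then have "A.avg cf F = 0" if "F \<in> A.full" for F
    using A.avg_zero[OF A.submod_full that] by blast
  then have "(\<Sum>g\<in>Sym n. cf g * A.chr A.full g) = 0"
    using A.sum_chr_zero[OF A.submod_full] by blast
  moreover have "(\<Sum>g\<in>Sym n. T.chr S g * A.chr A.full g) = fact n / kk * (\<Sum>g\<in>Sym n. cf g * A.chr A.full g)"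
    by (rule sum_chr_S) (rule A.chr_conj[OF A.submod_full])
  moreover have "(\<Sum>g\<in>Sym n. T.chr S g * of_nat (fix_count d n \<kappa> g)) = (\<Sum>g\<in>Sym n. T.chr S g * A.chr A.full g)"
    by (intro sum.cong refl arg_cong2[where f = "(*)"] chr)
  ultimately show ?thesis by (simp only: mult_zero_right)
qed

text \<open>In the scalar product of the two functions the contents \<open>jt la s\<close> with
  \<open>s \<noteq> id\<close> violate dominance, so only the tabloid module remains, which contains
  the Specht module once.\<close>

theorem chr_S_eq_alt_count:
  assumes N: "\<And>i. i \<ge> N \<Longrightarrow> la i = 0" and g: "g \<in> Sym n"
  shows "T.chr S g = of_int (alt_count N n la g)"
proof -
  have sumla: "(\<Sum>i<N. int (la i)) = int n" using psize_eq_sum[OF N] by simp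
  let ?chi = "T.chr S" and ?psi = "\<lambda>g. of_int (alt_count N n la g) :: complex"
  have cross: "(\<Sum>g\<in>Sym n. ?chi g * ?psi g) = fact n"
  proof -
    have "(\<Sum>g\<in>Sym n. ?chi g * ?psi g) =
        (\<Sum>g\<in>Sym n. \<Sum>s | s permutes {..<N}. of_int (sign s) * (?chi g * of_nat (fix_count 0 n (jt la s) g)))"
      by (simp add: alt_count_def sum_distrib_left mult_ac)
    also have "\<dots> = (\<Sum>s | s permutes {..<N}. of_int (sign s) * (\<Sum>g\<in>Sym n. ?chi g * of_nat (fix_count 0 n (jt la s) g)))"
      unfolding sum_distrib_left by (rule sum.swap)
    also have "\<dots> = (\<Sum>s | s permutes {..<N}. if s = id then fact n else 0)"
    proof (rule sum.cong[OF refl])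
      fix s assume "s \<in> {s. s permutes {..<N}}"
      then have s: "s permutes {..<N}" by simp
      show "of_int (sign s) * (\<Sum>g\<in>Sym n. ?chi g * of_nat (fix_count 0 n (jt la s) g)) =
          (if s = id then fact n else 0)"
      proof (cases "s = id")
        case True
        then show ?thesis using chr_S_fix_count_self by (simp add: jt_def)
      next
        case False
        then obtain j where "j \<le> N" "(\<Sum>i<j. int i) < (\<Sum>i<j. int (s i))"
          using permutes_dominated_id[OF s] by (meson not_le)
        then have "(\<Sum>i<j. int (la i)) < (\<Sum>i<j. jt la s i)"
          by (simp add: jt_def sum.distrib sum_subtractf)
        then have "(\<Sum>g\<in>Sym n. ?chi g * of_nat (fix_count 0 n (jt la s) g)) = 0"
          by (intro chr_S_fix_count_zero[of "{..<j}"]) simp_all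
        then show ?thesis using False by simp
      qed
    qed
    also have "\<dots> = fact n" by (simp add: finite_permutations permutes_id)
    finally show ?thesis .
  qed
  have "(\<Sum>g\<in>Sym n. ?psi g * ?psi g) = of_int (\<Sum>g\<in>Sym n. alt_count N n la g * alt_count N n la g)" by simp
  also have "\<dots> = fact n"
    using partition N sumla by (subst alt_count_norm) (auto simp: is_partition_def)
  finally have psi: "(\<Sum>g\<in>Sym n. ?psi g * ?psi g) = fact n" .
  have "(\<Sum>g\<in>Sym n. (?chi g - ?psi g)\<^sup>2) =
      (\<Sum>g\<in>Sym n. ?chi g * ?chi g) - 2 * (\<Sum>g\<in>Sym n. ?chi g * ?psi g) + (\<Sum>g\<in>Sym n. ?psi g * ?psi g)"
    unfolding sum_distrib_left sum_subtractf[symmetric] sum.distrib[symmetric]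
    by (intro sum.cong refl) (simp add: power2_eq_square algebra_simps)
  also have "\<dots> = 0" unfolding chr_S_norm cross psi by simp
  finally have z: "(\<Sum>g\<in>Sym n. (?chi g - ?psi g)\<^sup>2) = 0" .
  \<comment> \<open>Reality turns the vanishing sum of complex squares into a sum of nonnegative
    terms.\<close>
  have re: "?chi g - ?psi g = of_real (Re (?chi g - ?psi g))" if "g \<in> Sym n" for g
    using chr_S_real[OF that] by (intro of_real_Re[symmetric] Reals_diff) auto
  have "of_real (\<Sum>g\<in>Sym n. (Re (?chi g - ?psi g))\<^sup>2) = (\<Sum>g\<in>Sym n. (?chi g - ?psi g)\<^sup>2)"
    unfolding of_real_sum of_real_power using re by (intro sum.cong refl) simp
  then have "(\<Sum>g\<in>Sym n. (Re (?chi g - ?psi g))\<^sup>2) = 0" using z by (simp only: of_real_eq_0_iff)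
  then have "\<forall>g\<in>Sym n. (Re (?chi g - ?psi g))\<^sup>2 = 0" by (subst (asm) sum_nonneg_eq_0_iff) auto
  then have "Re (?chi g - ?psi g) = 0" using g by simp
  then show ?thesis using re[OF g] by simp
qed

lemma sum_alt_count_fix_count_zero:
  assumes N: "\<And>i. i \<ge> N \<Longrightarrow> la i = 0"
    and J: "finite J" "(\<Sum>c\<in>J. \<kappa> c) > (\<Sum>i<card J. int (la i))"
  shows "(\<Sum>g\<in>Sym n. alt_count N n la g * int (fix_count d n \<kappa> g)) = 0"
proof -
  have "of_int (\<Sum>g\<in>Sym n. alt_count N n la g * int (fix_count d n \<kappa> g)) =
      (\<Sum>g\<in>Sym n. T.chr S g * of_nat (fix_count d n \<kappa> g))"
    using chr_S_eq_alt_count[OF N] by simp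
  also have "\<dots> = 0" by (rule chr_S_fix_count_zero[OF J])
  finally show ?thesis by (simp only: of_int_eq_0_iff)
qed

lemma sum_alt_count_fix_count_self:
  assumes N: "\<And>i. i \<ge> N \<Longrightarrow> la i = 0"
  shows "(\<Sum>g\<in>Sym n. alt_count N n la g * int (fix_count 0 n (\<lambda>i. int (la i)) g)) = fact n"
proof -
  have "(of_int (\<Sum>g\<in>Sym n. alt_count N n la g * int (fix_count 0 n (\<lambda>i. int (la i)) g)) :: complex) =
      (\<Sum>g\<in>Sym n. T.chr S g * of_nat (fix_count 0 n (\<lambda>i. int (la i)) g))"
    using chr_S_eq_alt_count[OF N] by simp
  also have "\<dots> = fact n" by (rule chr_S_fix_count_self)
  also have "\<dots> = of_int (fact n)" by simp
  finally show ?thesis by (simp only: of_int_eq_iff)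
qed

end

text \<open>If a partial sum of \<open>ka\<close> exceeds that of \<open>la\<close>, the same
  partial sum of every \<open>jt ka s\<close> does, since permutations only raise partial sums.
  Distinct partitions differ in some partial sum, and the claim is symmetric in them.\<close>

lemma sum_alt_count_orthogonal:
  assumes la: "is_partition la" "\<And>i. i \<ge> N \<Longrightarrow> la i = 0" and ka: "is_partition ka" "\<And>i. i \<ge> N \<Longrightarrow> ka i = 0"
    and eq: "psize la = n" "psize ka = n" and ne: "la \<noteq> ka"
  shows "(\<Sum>g\<in>Sym n. alt_count N n la g * alt_count N n ka g) = 0"
proof -
  have zero: "(\<Sum>g\<in>Sym n. alt_count N n la g * alt_count N n ka g) = 0"
    if la: "is_partition la" "\<And>i. i \<ge> N \<Longrightarrow> la i = 0" "psize la = n"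
      and j: "(\<Sum>i<j. int (la i)) < (\<Sum>i<j. int (ka i))" for la ka :: "nat \<Rightarrow> nat" and j
  proof -
    interpret young la by unfold_locales (rule la(1))
    have "(\<Sum>g\<in>Sym n. alt_count N n la g * alt_count N n ka g) =
        (\<Sum>g\<in>Sym n. \<Sum>s | s permutes {..<N}. sign s * (alt_count N n la g * int (fix_count 0 n (jt ka s) g)))"
      unfolding alt_count_def[of N _ ka] by (simp add: sum_distrib_left mult_ac)
    also have "\<dots> = (\<Sum>s | s permutes {..<N}. sign s * (\<Sum>g\<in>Sym n. alt_count N n la g * int (fix_count 0 n (jt ka s) g)))"
      unfolding sum_distrib_left by (rule sum.swap)
    also have "\<dots> = 0"
    proof (rule sum.neutral, rule ballI)
      fix s assume "s \<in> {s. s permutes {..<N}}"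
      then have "(\<Sum>i<j. int i) \<le> (\<Sum>i<j. int (s i))" by (intro permutes_partial_sum) simp
      then have "(\<Sum>i<j. int (la i)) < (\<Sum>i<j. jt ka s i)"
        using j by (simp add: jt_def sum.distrib sum_subtractf)
      then show "sign s * (\<Sum>g\<in>Sym n. alt_count N n la g * int (fix_count 0 n (jt ka s) g)) = 0"
        using sum_alt_count_fix_count_zero[where N = N and J = "{..<j}" and \<kappa> = "jt ka s" and d = 0] la(2,3) by simp
    qed
    finally show ?thesis .
  qed
  consider j where "(\<Sum>i<j. int (la i)) < (\<Sum>i<j. int (ka i))"
    | j where "(\<Sum>i<j. int (ka i)) < (\<Sum>i<j. int (la i))"
    | "\<And>j. (\<Sum>i<j. int (la i)) = (\<Sum>i<j. int (ka i))"
    by (meson linorder_neqE_linordered_idom)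
  then show ?thesis
  proof cases
    case 1
    show ?thesis by (rule zero[OF la eq(1) 1])
  next
    case 2
    show ?thesis using zero[OF ka eq(2) 2] by (simp add: mult.commute)
  next
    case 3
    have "la i = ka i" for i using 3[of "Suc i"] 3[of i] by simp
    then show ?thesis using ne by blast
  qed
qed

section \<open>Multiplicities of Specht modules\<close>

context young_action
begin

text \<open>On \<open>S\<close> the operator of \<open>cf\<close> has rank one with eigenvalue
  \<open>kk\<close> at \<open>e\<close>, and an isomorphism transports this to
  \<open>U\<close>.\<close>

lemma iso_sum:
  assumes R: "models R U" and iso: "iso_repr (sym_group n) (specht la) R"
  shows "(\<Sum>h\<in>Sym n. cf h * chr U h) = kk"
proof -
  have U: "submod U" and sp: "repr_space R = U" and ac: "\<And>g v. g \<in> Sym n \<Longrightarrow> v \<in> U \<Longrightarrow> repr_act R g v = act g v"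
    using R by (auto simp: models_def)
  have spS: "repr_space (specht la) = S" and acS: "\<And>g v. g \<in> Sym n \<Longrightarrow> v \<in> S \<Longrightarrow> repr_act (specht la) g v = T.act g v"
    using models_specht by (auto simp: T.models_def)
  obtain f where f: "bij_betw f S U" "\<And>v w. v \<in> S \<Longrightarrow> w \<in> S \<Longrightarrow> f (v + w) = f v + f w"
    "\<And>c v. v \<in> S \<Longrightarrow> f (fscale c v) = fscale c (f v)"
    "\<And>g v. g \<in> Sym n \<Longrightarrow> v \<in> S \<Longrightarrow> f (T.act g v) = act g (f v)"
  proof -
    obtain f where f: "bij_betw f S U" "\<forall>v\<in>S. \<forall>w\<in>S. f (v + w) = f v + f w"
      "\<forall>c. \<forall>v\<in>S. f (fscale c v) = fscale c (f v)"
      "\<forall>g\<in>Sym n. \<forall>v\<in>S. f (repr_act (specht la) g v) = repr_act R g (f v)"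
      using iso unfolding iso_repr_def spS sp carrier_sym_group by blast
    have "f (T.act g v) = act g (f v)" if "g \<in> Sym n" "v \<in> S" for g v
    proof -
      have "f v \<in> U" using f(1) that(2) by (rule bij_betwE[THEN bspec])
      then show ?thesis using f(4) that acS ac by metis
    qed
    then show ?thesis using that f(1-3) by blast
  qed
  have f0: "f 0 = 0"
    using f(3)[of 0 0] fun_vs.subspace_0[OF subspace_S] by (simp only: fun_vs.scale_zero_left)
  have fsum: "f (\<Sum>i\<in>I. v i) = (\<Sum>i\<in>I. f (v i))" if "finite I" "\<And>i. i \<in> I \<Longrightarrow> v i \<in> S" for I :: "(nat \<Rightarrow> nat) set" and v
    using that
  proof (induction I rule: finite_induct)
    case (insert x I)
    have "(\<Sum>i\<in>I. v i) \<in> S" using insert.prems by (intro fun_vs.subspace_sum subspace_S) auto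
    then show ?case using insert f(2)[of "v x" "sum v I"] by (simp only: sum.insert insert_iff simp_thms)
  qed (simp only: sum.empty f0)
  have avgf: "avg cf (f v) = f (T.avg cf v)" if v: "v \<in> S" for v
  proof -
    have "f (T.avg cf v) = (\<Sum>h\<in>Sym n. f (fscale (cf h) (T.act h v)))"
      unfolding T.avg_def using v
      by (intro fsum) (auto intro!: fun_vs.subspace_scale[OF subspace_S] T.submodD(4)[OF submod_S])
    also have "\<dots> = (\<Sum>h\<in>Sym n. fscale (cf h) (act h (f v)))"
      using v f(3,4) T.submodD(4)[OF submod_S] by (intro sum.cong refl) simp
    finally show ?thesis by (simp add: avg_def)
  qed
  show ?thesis
  proof (rule sum_chr_rank_one[OF U, of "f e"])
    show "f e \<in> U" using f(1) e_S by (rule bij_betwE[THEN bspec])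
    show "f e \<noteq> 0"
    proof
      assume "f e = 0"
      then have "e = 0"
        using f0 f(1) e_S fun_vs.subspace_0[OF subspace_S] by (metis bij_betw_imp_inj_on inj_onD)
      then show False using e_nonzero by blast
    qed
    show "avg cf (f e) = fscale kk (f e)" using avgf[OF e_S] avg_e f(3)[OF e_S] by simp
    show "\<exists>r. avg cf F = fscale r (f e)" if F: "F \<in> U" for F
    proof -
      obtain v where v: "v \<in> S" "F = f v" using F f(1) by (auto simp: bij_betw_def)
      obtain r where "T.avg cf v = fscale r e"
        using avg_rank_one v(1) T.submod_le_full[OF submod_S] by blast
      then show ?thesis using avgf[OF v(1)] f(3)[OF e_S] v(2) by auto
    qed
  qed
qed

text \<open>Schur's lemma: if \<open>avg cf F\<close> were nonzero, \<open>Tm F\<close> would be a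
  nonzero equivariant map from \<open>S\<close> to \<open>U\<close>; its null space and its image
  are submodules of simple modules, so it would be an isomorphism.\<close>

lemma not_iso_sum:
  assumes R: "models R U" and U: "simple U" and iso: "\<not> iso_repr (sym_group n) (specht la) R"
  shows "(\<Sum>h\<in>Sym n. cf h * chr U h) = 0"
proof (rule sum_chr_zero)
  show sU: "submod U" using U by (simp add: simple_def)
  have sp: "repr_space R = U" and ac: "\<And>g v. g \<in> Sym n \<Longrightarrow> v \<in> U \<Longrightarrow> repr_act R g v = act g v"
    using R by (auto simp: models_def)
  have spS: "repr_space (specht la) = S" and acS: "\<And>g v. g \<in> Sym n \<Longrightarrow> v \<in> S \<Longrightarrow> repr_act (specht la) g v = T.act g v"
    using models_specht by (auto simp: T.models_def)
  fix F assume F: "F \<in> U"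
  show "avg cf F = 0"
  proof (rule ccontr)
    assume nz: "avg cf F \<noteq> 0"
    let ?f = "Tm F"
    have fU: "?f v \<in> U" for v by (rule Tm_in[OF sU F])
    have fdiff: "?f (v - w) = ?f v - ?f w" for v w
      using Tm_linear(1)[of F "v - w" w] by simp
    define Z where "Z = {v \<in> S. ?f v = 0}"
    have "T.submod Z"
      unfolding T.submod_def supported_def
    proof (intro conjI ballI allI impI)
      show "fun_vs.subspace Z"
      proof (rule fun_vs.subspaceI)
        show "0 \<in> Z" using fun_vs.subspace_0[OF subspace_S] by (simp only: Z_def mem_Collect_eq Tm_linear)
        show "x + y \<in> Z" if "x \<in> Z" "y \<in> Z" for x y
          using that fun_vs.subspace_add[OF subspace_S] by (simp add: Z_def Tm_linear(1))
        show "fscale c x \<in> Z" if "x \<in> Z" for c x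
          using that fun_vs.subspace_scale[OF subspace_S] unfolding Z_def mem_Collect_eq Tm_linear(2)
          by (simp only: fun_vs.scale_zero_right)
      qed
      show "v t = 0" if "v \<in> Z" "t \<notin> Tabl" for v t
        using that T.submodD(3)[OF submod_S] by (simp add: Z_def)
      show "T.act g v \<in> Z" if "g \<in> Sym n" "v \<in> Z" for g v
        using that T.submodD(4)[OF submod_S] by (auto simp: Z_def Tm_equivariant act_def fun_eq_iff)
    qed
    moreover have "e \<notin> Z" using nz by (simp add: Z_def Tm_e)
    then have "Z \<noteq> S" using e_S by blast
    moreover have "Z \<subseteq> S" by (auto simp: Z_def)
    ultimately have Z: "Z = {0}" using simple_S by (auto simp: T.simple_def)
    have inj: "inj_on ?f S"
    proof (rule inj_onI)
      fix v w assume vw: "v \<in> S" "w \<in> S" "?f v = ?f w"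
      then have "v - w \<in> Z" using fun_vs.subspace_diff[OF subspace_S] by (simp add: Z_def fdiff)
      then show "v = w" using Z by simp
    qed
    have "submod (?f ` S)"
      unfolding submod_def supported_def
    proof (intro conjI ballI allI impI)
      show "fun_vs.subspace (?f ` S)"
      proof (rule fun_vs.subspaceI)
        show "0 \<in> ?f ` S" using imageI[OF fun_vs.subspace_0[OF subspace_S], of ?f] unfolding Tm_linear(3) .
        show "x + y \<in> ?f ` S" if "x \<in> ?f ` S" "y \<in> ?f ` S" for x y
          using that fun_vs.subspace_add[OF subspace_S] by (auto simp: Tm_linear(1)[symmetric])
        show "fscale c x \<in> ?f ` S" if "x \<in> ?f ` S" for c x
          using that fun_vs.subspace_scale[OF subspace_S] by (auto simp: Tm_linear(2)[symmetric])
      qed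
      show "v t = 0" if "v \<in> ?f ` S" "t \<notin> X" for v t
        using that fU submodD(3)[OF sU] by blast
      show "act g v \<in> ?f ` S" if "g \<in> Sym n" "v \<in> ?f ` S" for g v
        using that T.submodD(4)[OF submod_S] by (auto simp: Tm_equivariant[symmetric])
    qed
    moreover have "?f ` S \<subseteq> U" using fU by blast
    moreover have "avg cf F \<in> ?f ` S" using e_S Tm_e[of F] by (metis imageI)
    then have "?f ` S \<noteq> {0}" using nz by blast
    ultimately have "?f ` S = U" using U unfolding simple_def by blast
    then have "bij_betw ?f S U" using inj by (simp add: bij_betw_def)
    then have "iso_repr (sym_group n) (specht la) R"
      unfolding iso_repr_def spS sp carrier_sym_group
      by (intro exI[of _ ?f]) (simp add: Tm_linear Tm_equivariant acS ac fU)
    then show False using iso by blast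
  qed
qed

text \<open>\<open>cf\<close> has trace \<open>kk\<close> on each summand isomorphic to the Specht
  module and 0 on every other. The number of such summands is therefore the same for every
  decomposition, as the definite description in \<open>multiplicity_repr\<close> requires, and
  \<open>sum_chr_S\<close> rewrites it as a scalar product of characters.\<close>

theorem multiplicity_specht:
  assumes R: "models R W" and N: "\<And>i. i \<ge> N \<Longrightarrow> la i = 0"
  shows "fact n * of_nat (multiplicity_repr (sym_group n) (specht la) R) =
    (\<Sum>g\<in>Sym n. of_int (alt_count N n la g) * chr W g)"
proof -
  let ?I = "\<lambda>\<U>. card {U \<in> \<U>. iso_repr (sym_group n) (specht la) (subrepr U R)}"
  let ?V = "\<lambda>\<U>. direct_decomposition (repr_space R) \<U> \<and>
    (\<forall>U\<in>\<U>. invariant_subspace (sym_group n) R U \<and> irreducible_repr (sym_group n) (subrepr U R))"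
  have W: "submod W" "repr_space R = W" using R by (auto simp: models_def)
  have count: "of_nat (?I \<U>) * kk = (\<Sum>h\<in>Sym n. cf h * chr W h)" if V: "?V \<U>" for \<U>
  proof -
    have D: "direct_decomposition W \<U>" using V W(2) by simp
    have U: "submod U" "U \<subseteq> W" if "U \<in> \<U>" for U
      using V that models_invariant[OF R] by blast+
    have mU: "models (subrepr U R) U" if "U \<in> \<U>" for U
      using models_subrepr[OF R U(1)[OF that] U(2)[OF that]] .
    have sU: "simple U" if "U \<in> \<U>" for U
      using V that models_irreducible[OF mU[OF that]] by blast
    have fin: "finite \<U>" using direct_decompositionD(1)[OF D] .
    have "(\<Sum>h\<in>Sym n. cf h * chr W h) = (\<Sum>h\<in>Sym n. \<Sum>U\<in>\<U>. cf h * chr U h)"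
      using chr_direct_sum[OF W(1) D U(1)] by (simp add: sum_distrib_left)
    also have "\<dots> = (\<Sum>U\<in>\<U>. \<Sum>h\<in>Sym n. cf h * chr U h)" by (rule sum.swap)
    also have "\<dots> = (\<Sum>U\<in>\<U>. if iso_repr (sym_group n) (specht la) (subrepr U R) then kk else 0)"
      using iso_sum[OF mU] not_iso_sum[OF mU sU] by (intro sum.cong refl) simp
    also have "\<dots> = of_nat (?I \<U>) * kk" using fin by (simp add: sum.If_cases Int_def)
    finally show ?thesis by simp
  qed
  obtain \<U> where \<U>: "direct_decomposition W \<U>" "\<forall>U\<in>\<U>. simple U"
    using decomposition_exists[OF W(1)] by blast
  have V: "?V \<U>"
  proof (intro conjI ballI)
    show "direct_decomposition (repr_space R) \<U>" using \<U>(1) W(2) by simp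
    fix U assume U: "U \<in> \<U>"
    have s: "submod U" "U \<subseteq> W" using \<U>(2) U direct_decompositionD(3)[OF \<U>(1) U] by (auto simp: simple_def)
    then show "invariant_subspace (sym_group n) R U" using models_invariant[OF R] by blast
    show "irreducible_repr (sym_group n) (subrepr U R)"
      using models_irreducible[OF models_subrepr[OF R s]] \<U>(2) U by blast
  qed
  have uniq: "?I \<U>' = ?I \<U>" if "?V \<U>'" for \<U>'
  proof -
    have "of_nat (?I \<U>') * kk = of_nat (?I \<U>) * kk" using count[OF that] count[OF V] by simp
    then show ?thesis using kk_nonzero by (simp only: mult_cancel_right of_nat_eq_iff) blast
  qed
  have "multiplicity_repr (sym_group n) (specht la) R = ?I \<U>"
    unfolding multiplicity_repr_def
  proof (rule the_equality)
    show "\<exists>\<U>'. direct_decomposition (repr_space R) \<U>' \<and>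
        (\<forall>U\<in>\<U>'. invariant_subspace (sym_group n) R U \<and> irreducible_repr (sym_group n) (subrepr U R)) \<and>
        ?I \<U> = ?I \<U>'" using V by blast
    fix k assume "\<exists>\<U>'. direct_decomposition (repr_space R) \<U>' \<and>
        (\<forall>U\<in>\<U>'. invariant_subspace (sym_group n) R U \<and> irreducible_repr (sym_group n) (subrepr U R)) \<and>
        k = ?I \<U>'"
    then show "k = ?I \<U>" using uniq by blast
  qed
  then have "fact n * of_nat (multiplicity_repr (sym_group n) (specht la) R) =
      fact n / kk * (\<Sum>h\<in>Sym n. cf h * chr W h)"
    using count[OF V] kk_nonzero by (simp add: field_simps)
  also have "\<dots> = (\<Sum>g\<in>Sym n. T.chr S g * chr W g)"
    by (rule sum_chr_S[OF chr_conj[OF W(1)], symmetric])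
  also have "\<dots> = (\<Sum>g\<in>Sym n. of_int (alt_count N n la g) * chr W g)"
    using chr_S_eq_alt_count[OF N] by (intro sum.cong refl) simp
  finally show ?thesis .
qed

end

section \<open>Heisenberg coefficients as alternating sums of Kostka numbers\<close>

lemma young_embed_low: "i \<le> a \<Longrightarrow> young_embed a s t i = s i"
  by (simp add: young_embed_def)

lemma young_embed_high: "a < i \<Longrightarrow> young_embed a s t i = a + t (i - a)"
  by (simp add: young_embed_def)

lemma Sym_in: "g \<in> Sym n \<Longrightarrow> g i \<in> {1..n} \<longleftrightarrow> i \<in> {1..n}"
  using permutes_in_image[OF SymD] .

lemma Sym_out: "g \<in> Sym n \<Longrightarrow> i \<notin> {1..n} \<Longrightarrow> g i = i"
  using permutes_not_in[OF SymD] .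

lemma SymI:
  assumes "inj_on g {1..n}" "\<And>i. i \<in> {1..n} \<Longrightarrow> g i \<in> {1..n}" "\<And>i. i \<notin> {1..n} \<Longrightarrow> g i = i"
  shows "g \<in> Sym n"
  unfolding Sym_def mem_Collect_eq
proof (rule bij_imp_permutes)
  have "g ` {1..n} \<subseteq> {1..n}" using assms(2) by blast
  then show "bij_betw g {1..n} {1..n}" using assms(1) by (simp add: bij_betw_def endo_inj_surj)
qed (rule assms(3))

lemma Sym_le: "g \<in> Sym n \<Longrightarrow> i \<le> n \<Longrightarrow> g i \<le> n"
  using Sym_in[of g n i] Sym_out[of g n 0] by (cases "i = 0") auto

lemma Sym_pos: "g \<in> Sym n \<Longrightarrow> 0 < i \<Longrightarrow> 0 < g i"
  using Sym_in[of g n i] Sym_out[of g n i] by (cases "i \<in> {1..n}") auto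

lemma Sym_inj: "g \<in> Sym n \<Longrightarrow> g i = g j \<longleftrightarrow> i = j"
  using inj_eq[OF permutes_inj[OF SymD]] .

lemma young_embed_Sym:
  assumes s: "s \<in> Sym a" and t: "t \<in> Sym b"
  shows "young_embed a s t \<in> Sym (a + b)"
proof (rule SymI)
  show "inj_on (young_embed a s t) {1..a + b}"
  proof (rule inj_onI)
    fix i j assume eq: "young_embed a s t i = young_embed a s t j"
    have "s k < a + t (k' - a)" if "k \<le> a" "a < k'" for k k'
      using Sym_le[OF s that(1)] Sym_pos[OF t, of "k' - a"] that(2) by simp
    from this[of i j] this[of j i] show "i = j"
      using eq Sym_inj[OF s, of i j] Sym_inj[OF t, of "i - a" "j - a"]
      by (cases "i \<le> a"; cases "j \<le> a") (auto simp: young_embed_def)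
  qed
  show "young_embed a s t i \<in> {1..a + b}" if "i \<in> {1..a + b}" for i
  proof (cases "i \<le> a")
    case True
    then show ?thesis using Sym_in[OF s, of i] that by (auto simp: young_embed_def)
  next
    case False
    then show ?thesis using Sym_in[OF t, of "i - a"] that by (auto simp: young_embed_def)
  qed
  show "young_embed a s t i = i" if "i \<notin> {1..a + b}" for i
  proof (cases "i \<le> a")
    case True
    then have "i = 0" using that by auto
    then show ?thesis using Sym_out[OF s, of 0] by (simp add: young_embed_def)
  next
    case False
    then have "i - a \<notin> {1..b}" using that by auto
    then show ?thesis using Sym_out[OF t, of "i - a"] False by (simp add: young_embed_def)
  qed
qed

lemma young_embed_comp:
  assumes s: "s' \<in> Sym a" and t: "t' \<in> Sym b"
  shows "young_embed a (s \<circ> s') (t \<circ> t') = young_embed a s t \<circ> young_embed a s' t'"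
proof
  fix i show "young_embed a (s \<circ> s') (t \<circ> t') i = (young_embed a s t \<circ> young_embed a s' t') i"
    using Sym_le[OF s, of i] Sym_pos[OF t, of "i - a"] by (cases "i \<le> a") (auto simp: young_embed_def)
qed

lemma young_embed_inj:
  assumes "s \<in> Sym a" "s' \<in> Sym a" "t \<in> Sym b" "t' \<in> Sym b"
    and eq: "young_embed a s t = young_embed a s' t'"
  shows "s = s'" "t = t'"
proof -
  show "s = s'"
  proof
    fix i show "s i = s' i"
      using fun_cong[OF eq, of i] Sym_out[OF assms(1), of i] Sym_out[OF assms(2), of i]
      by (cases "i \<le> a") (auto simp: young_embed_def)
  qed
  show "t = t'"
  proof
    fix i show "t i = t' i"
      using fun_cong[OF eq, of "i + a"] Sym_out[OF assms(3), of i] Sym_out[OF assms(4), of i]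
      by (cases "i = 0") (auto simp: young_embed_def)
  qed
qed

text \<open>
  A map \<open>F\<close> in \<open>cell_maps l a b\<close> colors \<open>{1..l}\<close> by the cells of a matrix without the cell \<open>(0, 0)\<close>;
  the contents \<open>a\<close> and \<open>b\<close> prescribe how often each row and column of positive index occurs.
\<close>

definition cell_maps :: "nat \<Rightarrow> (nat \<Rightarrow> int) \<Rightarrow> (nat \<Rightarrow> int) \<Rightarrow> (nat \<Rightarrow> nat \<times> nat) set" where
  "cell_maps l a b = {F. (\<forall>k. k \<notin> {1..l} \<longrightarrow> F k = (0, 0)) \<and> (\<forall>k\<in>{1..l}. F k \<noteq> (0, 0)) \<and>
     (\<forall>i. int (card {k\<in>{1..l}. fst (F k) = Suc i}) = a i) \<and>
     (\<forall>j. int (card {k\<in>{1..l}. snd (F k) = Suc j}) = b j)}"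

lemma card_Sym_comp:
  assumes "x \<in> Sym l"
  shows "card {k\<in>{1..l}. Q (x k)} = card {k\<in>{1..l}. Q k}"
proof (rule bij_betw_same_card[of x])
  note x = SymD[OF assms]
  show "bij_betw x {k\<in>{1..l}. Q (x k)} {k\<in>{1..l}. Q k}"
    using permutes_in_image[OF x] permutes_in_image[OF permutes_inv[OF x]] permutes_inverses[OF x]
    by (intro bij_betw_byWitness[where f' = "inv' x"]) auto
qed

lemma cell_maps_comp:
  assumes F: "F \<in> cell_maps l a b" and x: "x \<in> Sym l"
  shows "F \<circ> x \<in> cell_maps l a b"
  using F card_Sym_comp[OF x, of "\<lambda>k. fst (F k) = Suc _"] card_Sym_comp[OF x, of "\<lambda>k. snd (F k) = Suc _"]
    Sym_in[OF x]
  unfolding cell_maps_def by (simp only: mem_Collect_eq comp_apply) blast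

text \<open>The nonnegative matrices with the margins of \<open>H_matrices\<close> and total
  \<open>l\<close>. The total constrains row 0 and column 0, whose sums are not prescribed.\<close>

definition cell_contents :: "nat \<Rightarrow> nat \<Rightarrow> (nat \<Rightarrow> int) \<Rightarrow> (nat \<Rightarrow> int) \<Rightarrow> (nat \<times> nat \<Rightarrow> int) set" where
  "cell_contents N l a b = {B. (\<forall>c. 0 \<le> B c) \<and> B (0, 0) = 0 \<and> (\<forall>i j. i > N \<or> j > N \<longrightarrow> B (i, j) = 0) \<and>
     (\<forall>i<N. (\<Sum>j\<le>N. B (Suc i, j)) = a i) \<and> (\<forall>j<N. (\<Sum>i\<le>N. B (i, Suc j)) = b j) \<and>
     (\<Sum>c\<in>{..N} \<times> {..N}. B c) = int l}"

lemma finite_cell_contents [simp]: "finite (cell_contents N l a b)"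
proof (rule finite_subset)
  show "cell_contents N l a b \<subseteq>
      {B. \<forall>c. (c \<in> {..N} \<times> {..N} \<longrightarrow> B c \<in> {0..int l}) \<and> (c \<notin> {..N} \<times> {..N} \<longrightarrow> B c = 0)}"
  proof (intro subsetI CollectI allI conjI impI)
    fix B c assume B: "B \<in> cell_contents N l a b"
    show "B c = 0" if "c \<notin> {..N} \<times> {..N}"
      using B that by (cases c) (auto simp: cell_contents_def not_le)
    show "B c \<in> {0..int l}" if "c \<in> {..N} \<times> {..N}"
    proof -
      have "B c \<le> (\<Sum>c\<in>{..N} \<times> {..N}. B c)"
        using B that by (intro member_le_sum) (auto simp: cell_contents_def)
      then show ?thesis using B by (cases c) (auto simp: cell_contents_def)
    qed
  qed
qed (intro finite_set_of_finite_funs finite_cartesian_product finite_atMost finite_atLeastAtMost_int)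

lemma cell_contents_colorings:
  assumes a: "\<And>i. i \<ge> N \<Longrightarrow> a i = 0" and b: "\<And>i. i \<ge> N \<Longrightarrow> b i = 0"
    and B: "B \<in> cell_contents N l a b" and F: "F \<in> colorings (0, 0) l B"
  shows "F \<in> cell_maps l a b"
  unfolding cell_maps_def
proof (intro CollectI conjI allI impI ballI)
  show "F k = (0, 0)" if "k \<notin> {1..l}" for k using colorings_default[OF F that] .
  show "F k \<noteq> (0, 0)" if "k \<in> {1..l}" for k
    using colorings_content_pos[OF F that] B by (auto simp: cell_contents_def)
  have lt: "fst (F k) \<le> N" "snd (F k) \<le> N" if "k \<in> {1..l}" for k
  proof -
    have "B (fst (F k), snd (F k)) \<noteq> 0" using colorings_content_pos[OF F that] by simp
    then have "\<not> (fst (F k) > N \<or> snd (F k) > N)" using B unfolding cell_contents_def by blast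
    then show "fst (F k) \<le> N" "snd (F k) \<le> N" by simp_all
  qed
  show "int (card {k\<in>{1..l}. fst (F k) = Suc i}) = a i" for i
  proof -
    have "{k\<in>{1..l}. fst (F k) = Suc i} = {k\<in>{1..l}. F k \<in> {Suc i} \<times> {..N}}"
      using lt by (auto simp: mem_Times_iff)
    then have "int (card {k\<in>{1..l}. fst (F k) = Suc i}) = (\<Sum>c\<in>{Suc i} \<times> {..N}. B c)"
      using sum_content_card[OF F, of "{Suc i} \<times> {..N}"] by simp
    also have "\<dots> = (\<Sum>j\<le>N. B (Suc i, j))" by (simp only: sum_slice)
    also have "\<dots> = a i" using B a[of i] by (cases "i < N") (auto simp: cell_contents_def)
    finally show ?thesis .
  qed
  show "int (card {k\<in>{1..l}. snd (F k) = Suc j}) = b j" for j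
  proof -
    have "{k\<in>{1..l}. snd (F k) = Suc j} = {k\<in>{1..l}. F k \<in> {..N} \<times> {Suc j}}"
      using lt by (auto simp: mem_Times_iff)
    then have "int (card {k\<in>{1..l}. snd (F k) = Suc j}) = (\<Sum>c\<in>{..N} \<times> {Suc j}. B c)"
      using sum_content_card[OF F, of "{..N} \<times> {Suc j}"] by simp
    also have "\<dots> = (\<Sum>i\<le>N. B (i, Suc j))" by (simp only: sum_slice)
    also have "\<dots> = b j" using B b[of j] by (cases "j < N") (auto simp: cell_contents_def)
    finally show ?thesis .
  qed
qed

lemma cell_maps_content:
  assumes a: "\<And>i. i \<ge> N \<Longrightarrow> a i = 0" and b: "\<And>i. i \<ge> N \<Longrightarrow> b i = 0"
    and F: "F \<in> cell_maps l a b" and B: "B = (\<lambda>c. int (card {k\<in>{1..l}. F k = c}))"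
  shows "F \<in> colorings (0, 0) l B" "B \<in> cell_contents N l a b"
proof -
  show FB: "F \<in> colorings (0, 0) l B"
    using F unfolding cell_maps_def colorings_def B by blast
  have F1: "int (card {k\<in>{1..l}. fst (F k) = Suc i}) = a i" "int (card {k\<in>{1..l}. snd (F k) = Suc i}) = b i"
    and F0: "k \<in> {1..l} \<Longrightarrow> F k \<noteq> (0, 0)" for i k
    using F unfolding cell_maps_def by blast+
  have lt1: "fst (F k) \<le> N" if "k \<in> {1..l}" for k
  proof (rule ccontr)
    assume "\<not> fst (F k) \<le> N"
    then obtain i where i: "fst (F k) = Suc i" "i \<ge> N" by (cases "fst (F k)") auto
    then have "card {k\<in>{1..l}. fst (F k) = Suc i} = 0" using F1(1)[of i] a by simp
    then have "{k\<in>{1..l}. fst (F k) = Suc i} = {}" by (subst (asm) card_0_eq) auto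
    then show False using i(1) that by blast
  qed
  have lt2: "snd (F k) \<le> N" if "k \<in> {1..l}" for k
  proof (rule ccontr)
    assume "\<not> snd (F k) \<le> N"
    then obtain i where i: "snd (F k) = Suc i" "i \<ge> N" by (cases "snd (F k)") auto
    then have "card {k\<in>{1..l}. snd (F k) = Suc i} = 0" using F1(2)[of i] b by simp
    then have "{k\<in>{1..l}. snd (F k) = Suc i} = {}" by (subst (asm) card_0_eq) auto
    then show False using i(1) that by blast
  qed
  have supp: "B (i, j) = 0" if "i > N \<or> j > N" for i j
  proof -
    have "{k\<in>{1..l}. F k = (i, j)} = {}" using lt1 lt2 that by fastforce
    then show ?thesis unfolding B by (simp only: card.empty of_nat_0)
  qed
  have "B (0, 0) = 0"
  proof -
    have "{k\<in>{1..l}. F k = (0, 0)} = {}" using F0 by blast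
    then show ?thesis unfolding B by (simp only: card.empty of_nat_0)
  qed
  moreover have "(\<Sum>j\<le>N. B (Suc i, j)) = a i" for i
  proof -
    have "{k\<in>{1..l}. fst (F k) = Suc i} = {k\<in>{1..l}. F k \<in> {Suc i} \<times> {..N}}"
      using lt2 by (auto simp: mem_Times_iff)
    then have "a i = (\<Sum>c\<in>{Suc i} \<times> {..N}. B c)"
      using sum_content_card[OF FB, of "{Suc i} \<times> {..N}"] F1(1)[of i] by simp
    then show ?thesis by (simp only: sum_slice)
  qed
  moreover have "(\<Sum>i\<le>N. B (i, Suc j)) = b j" for j
  proof -
    have "{k\<in>{1..l}. snd (F k) = Suc j} = {k\<in>{1..l}. F k \<in> {..N} \<times> {Suc j}}"
      using lt1 by (auto simp: mem_Times_iff)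
    then have "b j = (\<Sum>c\<in>{..N} \<times> {Suc j}. B c)"
      using sum_content_card[OF FB, of "{..N} \<times> {Suc j}"] F1(2)[of j] by simp
    then show ?thesis by (simp only: sum_slice)
  qed
  moreover have "(\<Sum>c\<in>{..N} \<times> {..N}. B c) = int l"
  proof (rule colorings_content_total[OF FB])
    show "B c = 0" if "c \<notin> {..N} \<times> {..N}" for c
      using that supp by (cases c) (auto simp: not_le)
  qed simp
  moreover have "0 \<le> B c" for c by (simp add: B)
  ultimately show "B \<in> cell_contents N l a b" using supp unfolding cell_contents_def by blast
qed

text \<open>Sorting cell maps by their content makes their permutation character a sum of
  permutation characters on colorings.\<close>

lemma card_cell_maps_fixed:
  assumes a: "\<And>i. i \<ge> N \<Longrightarrow> a i = 0" and b: "\<And>i. i \<ge> N \<Longrightarrow> b i = 0"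
  shows "card {F \<in> cell_maps l a b. F \<circ> g = F} = (\<Sum>B\<in>cell_contents N l a b. fix_count (0, 0) l B g)"
proof -
  define fx where "fx = (\<lambda>B. {F \<in> colorings (0 :: nat, 0 :: nat) l B. F \<circ> g = F})"
  have "{F \<in> cell_maps l a b. F \<circ> g = F} = (\<Union>B\<in>cell_contents N l a b. fx B)"
  proof (intro equalityI subsetI)
    fix F assume F: "F \<in> {F \<in> cell_maps l a b. F \<circ> g = F}"
    then have Fm: "F \<in> cell_maps l a b" by blast
    then show "F \<in> (\<Union>B\<in>cell_contents N l a b. fx B)"
      using cell_maps_content[of N a b F l, OF a b Fm refl] F unfolding fx_def by blast
  next
    fix F assume "F \<in> (\<Union>B\<in>cell_contents N l a b. fx B)"
    then obtain B where "B \<in> cell_contents N l a b" "F \<in> colorings (0, 0) l B" "F \<circ> g = F"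
      unfolding fx_def by blast
    then show "F \<in> {F \<in> cell_maps l a b. F \<circ> g = F}"
      using cell_contents_colorings[of N a b B l F] a b by blast
  qed
  also have "card \<dots> = (\<Sum>B\<in>cell_contents N l a b. card (fx B))"
  proof (rule card_UN_disjoint)
    show "\<forall>B\<in>cell_contents N l a b. \<forall>B'\<in>cell_contents N l a b. B \<noteq> B' \<longrightarrow> fx B \<inter> fx B' = {}"
    proof (intro ballI impI)
      fix B B' :: "nat \<times> nat \<Rightarrow> int" assume ne: "B \<noteq> B'"
      have "B = B'" if "F \<in> fx B" "F \<in> fx B'" for F
      proof
        fix c
        have "F \<in> colorings (0, 0) l B" "F \<in> colorings (0, 0) l B'" using that by (simp_all add: fx_def)
        from colorings_card[OF this(1), of c, symmetric] colorings_card[OF this(2), of c]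
        show "B c = B' c" by (rule trans)
      qed
      then show "fx B \<inter> fx B' = {}" using ne by blast
    qed
  qed (auto simp: fx_def)
  finally show ?thesis by (simp add: fix_count_def fx_def)
qed

lemma finite_cell_maps:
  assumes a: "\<And>i. i \<ge> N \<Longrightarrow> a i = 0" and b: "\<And>i. i \<ge> N \<Longrightarrow> b i = 0"
  shows "finite (cell_maps l a b)"
proof (rule finite_subset)
  show "cell_maps l a b \<subseteq> (\<Union>B\<in>cell_contents N l a b. colorings (0, 0) l B)"
    using cell_maps_content[of N a b _ l, OF a b _ refl] by blast
qed simp

section \<open>The three blocks and the induced permutation character\<close>

locale blocks =
  fixes n m l :: nat
  assumes nm: "n \<le> l" "m \<le> l" "l \<le> n + m"
begin

definition "p = l - m"
definition "q = n + m - l"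
definition "r = l - n"

lemma pqr: "p + q = n" "q + r = m" "p + q + r = l" "n + r = l" "p + m = l"
  using nm by (auto simp: p_def q_def r_def)

definition KK :: "((nat \<Rightarrow> nat) \<times> (nat \<Rightarrow> nat) \<times> (nat \<Rightarrow> nat)) set" where
  "KK = Sym p \<times> Sym q \<times> Sym r"

definition "r1 = (\<lambda>(s, t, u). young_embed p s t)" for s t u :: "nat \<Rightarrow> nat"
definition "r2 = (\<lambda>(s, t, u). young_embed q t u)" for s t u :: "nat \<Rightarrow> nat"
definition "phi = (\<lambda>(s, t, u). young_embed (p + q) (young_embed p s t) u)" for s t u :: "nat \<Rightarrow> nat"

lemma finite_KK: "finite KK" by (simp add: KK_def)

lemma r1_Sym: "k \<in> KK \<Longrightarrow> r1 k \<in> Sym n"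
  using young_embed_Sym[of _ p _ q] by (auto simp: KK_def r1_def pqr)

lemma r2_Sym: "k \<in> KK \<Longrightarrow> r2 k \<in> Sym m"
  using young_embed_Sym[of _ q _ r] by (auto simp: KK_def r2_def pqr)

lemma phi_eq: "phi (s, t, u) = young_embed n (r1 (s, t, u)) u"
  by (simp add: phi_def r1_def pqr)

lemma phi_Sym: "k \<in> KK \<Longrightarrow> phi k \<in> Sym l"
proof -
  assume k: "k \<in> KK"
  obtain s t u where stu: "k = (s, t, u)" by (cases k)
  have "young_embed n (r1 k) u \<in> Sym (n + r)"
    using r1_Sym[OF k] k stu by (intro young_embed_Sym) (auto simp: KK_def)
  then show ?thesis by (simp add: stu phi_eq pqr)
qed

lemma phi_low: "k \<in> KK \<Longrightarrow> i \<le> n \<Longrightarrow> phi k i = r1 k i"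
  by (cases k) (simp add: phi_eq young_embed_low)

text \<open>The intervals \<open>{1..n}\<close> and \<open>{p+1..l}\<close> overlap in the middle
  block. On the first, \<open>phi\<close> acts as \<open>r1\<close>, on the second as
  \<open>r2\<close> moved by \<open>p\<close>; that both hold on the overlap is the diagonal
  embedding.\<close>

lemma phi_high:
  assumes "k \<in> KK" "p < i"
  shows "phi k i = p + r2 k (i - p)"
proof -
  obtain s t u where stu: "k = (s, t, u)" by (cases k)
  show ?thesis
  proof (cases "i \<le> n")
    case True
    then have "i \<le> p + q" "i - p \<le> q" using pqr(1) by linarith+
    then show ?thesis using assms by (simp add: stu phi_def r2_def young_embed_def)
  next
    case False
    then have "\<not> i \<le> p + q" "\<not> i - p \<le> q" using pqr(1) by linarith+
    then show ?thesis using assms by (simp add: stu phi_def r2_def young_embed_def)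
  qed
qed

lemma inj_phi: "inj_on phi KK"
proof (rule inj_onI)
  fix k k' assume k: "k \<in> KK" "k' \<in> KK" "phi k = phi k'"
  obtain s t u where stu: "k = (s, t, u)" by (cases k)
  obtain s' t' u' where stu': "k' = (s', t', u')" by (cases k')
  have S: "s \<in> Sym p" "t \<in> Sym q" "u \<in> Sym r" "s' \<in> Sym p" "t' \<in> Sym q" "u' \<in> Sym r"
    using k stu stu' by (auto simp: KK_def)
  have "r1 k = r1 k'" "u = u'"
    using young_embed_inj[OF r1_Sym[OF k(1)] r1_Sym[OF k(2)] S(3,6)] k(3) by (simp_all add: stu stu' phi_eq)
  moreover from this(1) have "s = s'" "t = t'"
    using young_embed_inj[OF S(1,4) S(2,5)] by (simp_all add: stu stu' r1_def)
  ultimately show "k = k'" by (simp add: stu stu')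
qed

text \<open>Membership in \<open>{1..n}\<close> and in \<open>{p+1..l}\<close>; the middle block of
  length \<open>q\<close> lies in both. Read as a coloring, its stabilizer is the Young subgroup
  embedded by \<open>phi\<close>.\<close>

definition std :: "nat \<Rightarrow> bool \<times> bool" where
  "std i = (i \<in> {1..n}, p < i \<and> i \<le> l)"

lemma std_phi: "k \<in> KK \<Longrightarrow> std \<circ> phi k = std"
proof
  fix i assume k: "k \<in> KK"
  show "(std \<circ> phi k) i = std i"
  proof (cases "i \<le> p")
    case True
    obtain s t u where stu: "k = (s, t, u)" by (cases k)
    have s: "s \<in> Sym p" using k stu by (simp add: KK_def)
    have "phi k i = s i" using True phi_low[OF k, of i] pqr(1) by (simp add: stu r1_def young_embed_low)
    then show ?thesis using Sym_le[OF s True] True Sym_pos[OF s, of i] Sym_out[OF s, of 0] pqr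
      by (cases "i = 0") (auto simp: std_def)
  next
    case False
    then have i: "p < i" by simp
    have "phi k i = p + r2 k (i - p)" by (rule phi_high[OF k i])
    moreover have "0 < r2 k (i - p)" using Sym_pos[OF r2_Sym[OF k]] i by simp
    ultimately have "p < phi k i" by simp
    moreover have "phi k i \<in> {1..n} \<longleftrightarrow> i \<in> {1..n}"
    proof (cases "i \<le> n")
      case True
      then show ?thesis using Sym_in[OF r1_Sym[OF k], of i] phi_low[OF k True] by simp
    next
      case False
      obtain s t u where stu: "k = (s, t, u)" by (cases k)
      have u: "u \<in> Sym r" using k stu by (simp add: KK_def)
      have "phi k i = n + u (i - n)" using False by (simp add: stu phi_eq young_embed_high)
      then show ?thesis using False Sym_pos[OF u, of "i - n"] by simp
    qed
    moreover have "phi k i \<le> l \<longleftrightarrow> i \<le> l"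
    proof -
      have "phi k i \<in> {1..l} \<longleftrightarrow> i \<in> {1..l}" by (rule Sym_in[OF phi_Sym[OF k]])
      then show ?thesis using \<open>p < phi k i\<close> i by simp
    qed
    ultimately show ?thesis using i by (auto simp: std_def)
  qed
qed

lemma stabilizer_std: "{h \<in> Sym l. std \<circ> h = std} = phi ` KK"
proof (intro equalityI subsetI)
  fix h assume "h \<in> {h \<in> Sym l. std \<circ> h = std}"
  then have h: "h \<in> Sym l" and sh: "\<And>i. std (h i) = std i" by (auto simp: fun_eq_iff)
  have inl: "h i \<in> {1..l} \<longleftrightarrow> i \<in> {1..l}" for i by (rule Sym_in[OF h])
  have low: "h i \<in> {1..p} \<longleftrightarrow> i \<in> {1..p}" for i
    using sh[of i] inl[of i] pqr by (auto simp: std_def)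
  have mid: "h i \<in> {p+1..n} \<longleftrightarrow> i \<in> {p+1..n}" for i
    using sh[of i] inl[of i] pqr by (auto simp: std_def)
  have high: "h i \<in> {n+1..l} \<longleftrightarrow> i \<in> {n+1..l}" for i
    using sh[of i] inl[of i] pqr by (auto simp: std_def)
  define s where "s = (\<lambda>i. if i \<in> {1..p} then h i else i)"
  define t where "t = (\<lambda>i. if i \<in> {1..q} then h (i + p) - p else i)"
  define u where "u = (\<lambda>i. if i \<in> {1..r} then h (i + n) - n else i)"
  have s: "s \<in> Sym p"
  proof (rule SymI)
    show "inj_on s {1..p}" by (rule inj_onI) (simp add: s_def Sym_inj[OF h])
    show "s i \<in> {1..p}" if "i \<in> {1..p}" for i using low[of i] that by (simp add: s_def)
  qed (auto simp: s_def)
  have t: "t \<in> Sym q"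
  proof (rule SymI)
    have hi: "p < h (i + p) \<and> h (i + p) \<le> n" if "i \<in> {1..q}" for i
      using mid[of "i + p"] that pqr by auto
    show "inj_on t {1..q}"
    proof (rule inj_onI)
      fix i j assume ij: "i \<in> {1..q}" "j \<in> {1..q}" "t i = t j"
      then have "h (i + p) = h (j + p)" using hi[OF ij(1)] hi[OF ij(2)] by (simp add: t_def) arith
      then show "i = j" by (simp add: Sym_inj[OF h])
    qed
    show "t i \<in> {1..q}" if "i \<in> {1..q}" for i using hi[OF that] that pqr by (auto simp: t_def)
  qed (auto simp: t_def)
  have u: "u \<in> Sym r"
  proof (rule SymI)
    have hi: "n < h (i + n) \<and> h (i + n) \<le> l" if "i \<in> {1..r}" for i
      using high[of "i + n"] that pqr by auto
    show "inj_on u {1..r}"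
    proof (rule inj_onI)
      fix i j assume ij: "i \<in> {1..r}" "j \<in> {1..r}" "u i = u j"
      then have "h (i + n) = h (j + n)" using hi[OF ij(1)] hi[OF ij(2)] by (simp add: u_def) arith
      then show "i = j" by (simp add: Sym_inj[OF h])
    qed
    show "u i \<in> {1..r}" if "i \<in> {1..r}" for i using hi[OF that] that pqr by (auto simp: u_def)
  qed (auto simp: u_def)
  have k: "(s, t, u) \<in> KK" using s t u by (simp add: KK_def)
  have "h = phi (s, t, u)"
  proof
    fix i
    consider "i \<notin> {1..l}" | "i \<in> {1..p}" | "i \<in> {p+1..n}" | "i \<in> {n+1..l}"
      using pqr by force
    then show "h i = phi (s, t, u) i"
    proof cases
      case 1
      then show ?thesis using Sym_out[OF h] Sym_out[OF phi_Sym[OF k]] by simp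
    next
      case 2
      then show ?thesis using pqr by (simp add: phi_def young_embed_def s_def)
    next
      case 3
      then have "p < h i" using mid[of i] by simp
      then show ?thesis using 3 pqr by (auto simp: phi_def young_embed_def t_def)
    next
      case 4
      then have "n < h i" using high[of i] by simp
      have "i - n \<in> {1..r}" unfolding atLeastAtMost_iff using 4 pqr(4) by (simp; arith)
      then have "u (i - n) = h i - n" using 4 by (auto simp: u_def)
      then show ?thesis using 4 \<open>n < h i\<close> by (simp add: phi_eq young_embed_high)
    qed
  qed
  then show "h \<in> phi ` KK" using k by blast
qed (use phi_Sym std_phi in auto)

lemma card_stabilizer: "card {h \<in> Sym l. std \<circ> h = std} = card KK"
  unfolding stabilizer_std by (rule card_image[OF inj_phi])

definition block :: "(nat \<Rightarrow> nat \<times> nat) \<Rightarrow> nat \<Rightarrow> bool \<times> bool" where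
  "block F = (\<lambda>i. (fst (F i) \<noteq> 0, snd (F i) \<noteq> 0))"

lemma block_comp: "block (F \<circ> x) = block F \<circ> x"
  by (simp add: block_def comp_def)

text \<open>Index 0 marks positions outside \<open>{1..n}\<close> or outside
  \<open>{p+1..l}\<close>, and colors are raised by \<open>Suc\<close> to keep it free. Positions in
  the middle block receive both a row and a column of positive index.\<close>

definition comb :: "(nat \<Rightarrow> nat) \<Rightarrow> (nat \<Rightarrow> nat) \<Rightarrow> nat \<Rightarrow> nat \<times> nat" where
  "comb f1 f2 i = (if i \<in> {1..n} then Suc (f1 i) else 0, if p < i \<and> i \<le> l then Suc (f2 (i - p)) else 0)"

lemma block_comb: "block (comb f1 f2) = std"
  by (auto simp: block_def comb_def std_def)

lemma comb_phi:
  assumes k: "k \<in> KK"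
  shows "comb f1 f2 \<circ> phi k = comb (f1 \<circ> r1 k) (f2 \<circ> r2 k)"
proof
  fix i
  have st: "phi k i \<in> {1..n} \<longleftrightarrow> i \<in> {1..n}" "p < phi k i \<and> phi k i \<le> l \<longleftrightarrow> p < i \<and> i \<le> l"
    using fun_cong[OF std_phi[OF k], of i] by (auto simp: std_def)
  have "f1 (phi k i) = f1 (r1 k i)" if "i \<in> {1..n}" using phi_low[OF k, of i] that by simp
  moreover have "f2 (phi k i - p) = f2 (r2 k (i - p))" if "p < i \<and> i \<le> l" using phi_high[OF k, of i] that by simp
  ultimately show "(comb f1 f2 \<circ> phi k) i = comb (f1 \<circ> r1 k) (f2 \<circ> r2 k) i"
    using st unfolding comb_def comp_apply by (simp only: split: if_splits) auto
qed

definition "std_maps a b = {F \<in> cell_maps l a b. block F = std}"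

lemma comb_in:
  assumes f1: "f1 \<in> colorings 0 n a" and f2: "f2 \<in> colorings 0 m b"
  shows "comb f1 f2 \<in> std_maps a b"
proof -
  have "int (card {k\<in>{1..l}. fst (comb f1 f2 k) = Suc i}) = a i" for i
  proof -
    have "{k\<in>{1..l}. fst (comb f1 f2 k) = Suc i} = {k\<in>{1..n}. f1 k = i}"
      using nm by (auto simp: comb_def)
    then show ?thesis using colorings_card[OF f1, of i] by simp
  qed
  moreover have "int (card {k\<in>{1..l}. snd (comb f1 f2 k) = Suc j}) = b j" for j
  proof -
    have "bij_betw (\<lambda>k. k - p) {k\<in>{1..l}. snd (comb f1 f2 k) = Suc j} {k\<in>{1..m}. f2 k = j}"
      using pqr by (intro bij_betw_byWitness[where f' = "\<lambda>k. k + p"]) (auto simp: comb_def)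
    then show ?thesis using colorings_card[OF f2, of j] by (simp add: bij_betw_same_card)
  qed
  moreover have "comb f1 f2 k = (0, 0)" if "k \<notin> {1..l}" for k using that nm by (auto simp: comb_def)
  moreover have "comb f1 f2 k \<noteq> (0, 0)" if "k \<in> {1..l}" for k using that pqr by (auto simp: comb_def)
  ultimately show ?thesis using block_comb unfolding std_maps_def cell_maps_def by blast
qed

lemma comb_inj:
  assumes "f1 \<in> colorings 0 n a" "f2 \<in> colorings 0 m b" "f1' \<in> colorings 0 n a" "f2' \<in> colorings 0 m b"
    and eq: "comb f1 f2 = comb f1' f2'"
  shows "f1 = f1' \<and> f2 = f2'"
proof
  show "f1 = f1'"
  proof
    fix i show "f1 i = f1' i"
      using fun_cong[OF eq, of i] colorings_default[OF assms(1), of i] colorings_default[OF assms(3), of i]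
      by (cases "i \<in> {1..n}") (auto simp: comb_def split: if_splits)
  qed
  show "f2 = f2'"
  proof
    fix i show "f2 i = f2' i"
    proof (cases "i \<in> {1..m}")
      case True
      then have "p < i + p \<and> i + p \<le> l" using pqr by auto
      then show ?thesis using fun_cong[OF eq, of "i + p"] by (simp add: comb_def)
    next
      case False
      then show ?thesis using colorings_default[OF assms(2)] colorings_default[OF assms(4)] by simp
    qed
  qed
qed

lemma comb_surj:
  assumes F: "F \<in> std_maps a b"
  shows "\<exists>f1\<in>colorings 0 n a. \<exists>f2\<in>colorings 0 m b. F = comb f1 f2"
proof -
  have bF: "fst (F i) \<noteq> 0 \<longleftrightarrow> i \<in> {1..n}" "snd (F i) \<noteq> 0 \<longleftrightarrow> p < i \<and> i \<le> l" for i
    using F by (auto simp: std_maps_def block_def std_def fun_eq_iff)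
  have F1: "int (card {k\<in>{1..l}. fst (F k) = Suc i}) = a i" "int (card {k\<in>{1..l}. snd (F k) = Suc i}) = b i" for i
    using F unfolding std_maps_def cell_maps_def by blast+
  define f1 where "f1 = (\<lambda>i. if i \<in> {1..n} then fst (F i) - 1 else 0)"
  define f2 where "f2 = (\<lambda>i. if i \<in> {1..m} then snd (F (i + p)) - 1 else 0)"
  have "int (card {k\<in>{1..n}. f1 k = i}) = a i" for i
  proof -
    have "{k\<in>{1..l}. fst (F k) = Suc i} = {k\<in>{1..n}. f1 k = i}"
    proof (intro equalityI subsetI)
      fix k assume "k \<in> {k\<in>{1..l}. fst (F k) = Suc i}"
      then show "k \<in> {k\<in>{1..n}. f1 k = i}" using bF(1)[of k] by (simp add: f1_def)
    next
      fix k assume "k \<in> {k\<in>{1..n}. f1 k = i}"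
      then show "k \<in> {k\<in>{1..l}. fst (F k) = Suc i}" using bF(1)[of k] nm by (auto simp: f1_def)
    qed
    then show ?thesis using F1(1)[of i] by simp
  qed
  then have f1: "f1 \<in> colorings 0 n a" unfolding colorings_def by (auto simp: f1_def)
  have "int (card {k\<in>{1..m}. f2 k = j}) = b j" for j
  proof -
    have "bij_betw (\<lambda>k. k + p) {k\<in>{1..m}. f2 k = j} {k\<in>{1..l}. snd (F k) = Suc j}"
    proof (rule bij_betw_byWitness[where f' = "\<lambda>k. k - p"])
      show "\<forall>k\<in>{k\<in>{1..l}. snd (F k) = Suc j}. k - p + p = k"
      proof
        fix k assume "k \<in> {k\<in>{1..l}. snd (F k) = Suc j}"
        then have "p < k" using bF(2)[of k] by simp
        then show "k - p + p = k" by simp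
      qed
      show "(\<lambda>k. k + p) ` {k\<in>{1..m}. f2 k = j} \<subseteq> {k\<in>{1..l}. snd (F k) = Suc j}"
      proof
        fix x assume "x \<in> (\<lambda>k. k + p) ` {k\<in>{1..m}. f2 k = j}"
        then obtain k where k: "x = k + p" "k \<in> {1..m}" "f2 k = j" by blast
        then have "p < x \<and> x \<le> l" using pqr by auto
        then have "snd (F x) \<noteq> 0" using bF(2) by blast
        then show "x \<in> {k\<in>{1..l}. snd (F k) = Suc j}" using k \<open>p < x \<and> x \<le> l\<close> by (simp add: f2_def)
      qed
      show "(\<lambda>k. k - p) ` {k\<in>{1..l}. snd (F k) = Suc j} \<subseteq> {k\<in>{1..m}. f2 k = j}"
      proof
        fix x assume "x \<in> (\<lambda>k. k - p) ` {k\<in>{1..l}. snd (F k) = Suc j}"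
        then obtain k where k: "x = k - p" "k \<in> {1..l}" "snd (F k) = Suc j" by blast
        then have "p < k" using bF(2)[of k] by simp
        moreover have "k \<le> l" using k(2) by simp
        ultimately have "x \<in> {1..m}" unfolding k(1) atLeastAtMost_iff using pqr(5) by arith
        then show "x \<in> {k\<in>{1..m}. f2 k = j}" using k \<open>p < k\<close> by (simp add: f2_def)
      qed
    qed simp
    then show ?thesis using F1(2)[of j] by (simp add: bij_betw_same_card)
  qed
  then have f2: "f2 \<in> colorings 0 m b" unfolding colorings_def by (auto simp: f2_def)
  have "F = comb f1 f2"
  proof
    fix i
    have "i - p \<in> {1..m}" if "p < i \<and> i \<le> l" using that pqr by auto
    then show "F i = comb f1 f2 i"
      using bF(1)[of i] bF(2)[of i] by (intro prod_eqI) (auto simp: comb_def f1_def f2_def)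
  qed
  then show ?thesis using f1 f2 by blast
qed

text \<open>Under \<open>comb\<close>, a pair of colorings is a cell map with the standard block
  pattern, and the action of \<open>r1 k\<close> and \<open>r2 k\<close> on the pair is
  precomposition with \<open>phi k\<close>.\<close>

lemma fix_count_blocks:
  assumes k: "k \<in> KK"
  shows "fix_count 0 n a (r1 k) * fix_count 0 m b (r2 k) = card {F \<in> std_maps a b. F \<circ> phi k = F}"
proof -
  let ?A = "{f \<in> colorings 0 n a. f \<circ> r1 k = f}" and ?B = "{f \<in> colorings 0 m b. f \<circ> r2 k = f}"
  have "bij_betw (\<lambda>(f1, f2). comb f1 f2) (?A \<times> ?B) {F \<in> std_maps a b. F \<circ> phi k = F}"
  proof (rule bij_betw_imageI)
    show "inj_on (\<lambda>(f1, f2). comb f1 f2) (?A \<times> ?B)"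
    proof (rule inj_onI)
      fix z z' assume zz: "z \<in> ?A \<times> ?B" "z' \<in> ?A \<times> ?B"
        "(\<lambda>(f1, f2). comb f1 f2) z = (\<lambda>(f1, f2). comb f1 f2) z'"
      obtain f1 f2 where z: "z = (f1, f2)" by (cases z)
      obtain f1' f2' where z': "z' = (f1', f2')" by (cases z')
      have "f1 \<in> colorings 0 n a" "f2 \<in> colorings 0 m b" "f1' \<in> colorings 0 n a" "f2' \<in> colorings 0 m b"
        using zz(1,2) unfolding z z' by blast+
      moreover have "comb f1 f2 = comb f1' f2'" using zz(3) unfolding z z' by simp
      ultimately have "f1 = f1' \<and> f2 = f2'" by (rule comb_inj)
      then show "z = z'" by (simp add: z z')
    qed
    show "(\<lambda>(f1, f2). comb f1 f2) ` (?A \<times> ?B) = {F \<in> std_maps a b. F \<circ> phi k = F}"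
    proof (intro equalityI subsetI)
      fix F assume "F \<in> (\<lambda>(f1, f2). comb f1 f2) ` (?A \<times> ?B)"
      then obtain z where zz: "F = (\<lambda>(f1, f2). comb f1 f2) z" "z \<in> ?A \<times> ?B" by (rule imageE)
      obtain f1 f2 where z: "z = (f1, f2)" by (cases z)
      have f: "f1 \<in> ?A" "f2 \<in> ?B" using zz(2) unfolding z by blast+
      have f3: "F = comb f1 f2" using zz(1) unfolding z by simp
      have "comb f1 f2 \<in> std_maps a b" "comb f1 f2 \<circ> phi k = comb f1 f2"
        using f comb_in comb_phi[OF k, of f1 f2] by simp_all
      then show "F \<in> {F \<in> std_maps a b. F \<circ> phi k = F}" using f3 by blast
    next
      fix F assume "F \<in> {F \<in> std_maps a b. F \<circ> phi k = F}"
      then have F: "F \<in> std_maps a b" "F \<circ> phi k = F" by blast+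
      obtain f1 f2 where f: "f1 \<in> colorings 0 n a" "f2 \<in> colorings 0 m b" "F = comb f1 f2"
        using comb_surj[OF F(1)] by blast
      have "comb (f1 \<circ> r1 k) (f2 \<circ> r2 k) = comb f1 f2" using F(2) comb_phi[OF k] f(3) by simp
      then have "f1 \<circ> r1 k = f1 \<and> f2 \<circ> r2 k = f2"
        using f r1_Sym[OF k] r2_Sym[OF k] by (intro comb_inj) (auto intro: colorings_comp)
      then have "(f1, f2) \<in> ?A \<times> ?B" using f by simp
      then show "F \<in> (\<lambda>(f1, f2). comb f1 f2) ` (?A \<times> ?B)" using f(3) by (intro image_eqI[of _ _ "(f1, f2)"]) simp_all
    qed
  qed
  then show ?thesis by (simp add: fix_count_def card_cartesian_product[symmetric] bij_betw_same_card)
qed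

text \<open>Inclusion-exclusion determines the three block sizes from \<open>n\<close>,
  \<open>m\<close> and \<open>l\<close>. All block patterns thus have one content, and
  \<open>Sym l\<close> permutes them transitively.\<close>

lemma block_coloring_content:
  fixes f :: "nat \<Rightarrow> bool \<times> bool"
  assumes "\<And>k. k \<notin> {1..l} \<Longrightarrow> f k = (False, False)" "\<And>k. k \<in> {1..l} \<Longrightarrow> f k \<noteq> (False, False)"
    and c1: "card {k\<in>{1..l}. fst (f k)} = n" and c2: "card {k\<in>{1..l}. snd (f k)} = m"
  shows "f \<in> colorings (False, False) l
    (\<lambda>c. if c = (True, True) then int q else if c = (True, False) then int p else if c = (False, True) then int r else 0)"
proof -
  let ?c = "\<lambda>c. card {k\<in>{1..l}. f k = c}"
  have "{k\<in>{1..l}. fst (f k)} = {k\<in>{1..l}. f k = (True, True)} \<union> {k\<in>{1..l}. f k = (True, False)}"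
    by (auto simp: prod_eq_iff)
  then have 1: "n = ?c (True, True) + ?c (True, False)"
    unfolding c1[symmetric] by (simp only:) (rule card_Un_disjoint, auto)
  have "{k\<in>{1..l}. snd (f k)} = {k\<in>{1..l}. f k = (True, True)} \<union> {k\<in>{1..l}. f k = (False, True)}"
    by (auto simp: prod_eq_iff)
  then have 2: "m = ?c (True, True) + ?c (False, True)"
    unfolding c2[symmetric] by (simp only:) (rule card_Un_disjoint, auto)
  have "f k = (True, True) \<or> f k = (True, False) \<or> f k = (False, True)" if "k \<in> {1..l}" for k
    using assms(2)[OF that] by (cases "f k") auto
  then have "{1..l} = {k\<in>{1..l}. fst (f k)} \<union> {k\<in>{1..l}. f k = (False, True)}" by fastforce
  then have "card {1..l} = card ({k\<in>{1..l}. fst (f k)} \<union> {k\<in>{1..l}. f k = (False, True)})" by (rule arg_cong)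
  also have "\<dots> = card {k\<in>{1..l}. fst (f k)} + ?c (False, True)" by (rule card_Un_disjoint) auto
  finally have 3: "l = n + ?c (False, True)" using c1 by simp
  have 4: "?c (False, False) = 0" using assms(2) by (auto simp: card_eq_0_iff)
  have "?c (True, True) = q" "?c (True, False) = p" "?c (False, True) = r" using 1 2 3 pqr by linarith+
  then have "int (?c c) = (if c = (True, True) then int q else if c = (True, False) then int p else
      if c = (False, True) then int r else 0)" for c
    using 4 by (cases c) (auto split: if_splits)
  then show ?thesis using assms(1) unfolding colorings_def by blast
qed

lemma std_coloring:
  "std \<in> colorings (False, False) l
    (\<lambda>c. if c = (True, True) then int q else if c = (True, False) then int p else if c = (False, True) then int r else 0)"
proof (rule block_coloring_content)
  have "{k\<in>{1..l}. fst (std k)} = {1..n}" using nm by (auto simp: std_def)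
  then show "card {k\<in>{1..l}. fst (std k)} = n" by simp
  have "{k\<in>{1..l}. snd (std k)} = {p<..l}" by (auto simp: std_def)
  then show "card {k\<in>{1..l}. snd (std k)} = m" using pqr by simp
qed (use pqr nm in \<open>auto simp: std_def\<close>)

lemma block_coloring:
  assumes a: "\<And>i. i \<ge> N \<Longrightarrow> a i = 0" "(\<Sum>i<N. a i) = int n"
    and b: "\<And>i. i \<ge> N \<Longrightarrow> b i = 0" "(\<Sum>i<N. b i) = int m"
    and F: "F \<in> cell_maps l a b"
  shows "block F \<in> colorings (False, False) l
    (\<lambda>c. if c = (True, True) then int q else if c = (True, False) then int p else if c = (False, True) then int r else 0)"
proof (rule block_coloring_content)
  have F1: "int (card {k\<in>{1..l}. fst (F k) = Suc i}) = a i" "int (card {k\<in>{1..l}. snd (F k) = Suc i}) = b i"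
    and F0: "k \<in> {1..l} \<Longrightarrow> F k \<noteq> (0, 0)" "k \<notin> {1..l} \<Longrightarrow> F k = (0, 0)" for i k
    using F unfolding cell_maps_def by blast+
  have count: "int (card {k\<in>{1..l}. f k \<noteq> 0}) = (\<Sum>i<N. c i)"
    if f: "\<And>i. int (card {k\<in>{1..l}. f k = Suc i}) = c i" and c: "\<And>i. i \<ge> N \<Longrightarrow> c i = 0"
    for f :: "nat \<Rightarrow> nat" and c
  proof -
    have lt: "f k \<le> N" if k: "k \<in> {1..l}" for k
    proof (rule ccontr)
      assume "\<not> f k \<le> N"
      then obtain i where i: "f k = Suc i" "i \<ge> N" by (cases "f k") auto
      then have "card {k\<in>{1..l}. f k = Suc i} = 0" using f[of i] c by simp
      then have "{k\<in>{1..l}. f k = Suc i} = {}" by (subst (asm) card_0_eq) auto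
      then show False using i(1) k by blast
    qed
    have "{k\<in>{1..l}. f k \<noteq> 0} = (\<Union>i\<in>{..<N}. {k\<in>{1..l}. f k = Suc i})"
    proof (intro equalityI subsetI)
      fix k assume k: "k \<in> {k\<in>{1..l}. f k \<noteq> 0}"
      then obtain i where "f k = Suc i" by (cases "f k") auto
      then show "k \<in> (\<Union>i\<in>{..<N}. {k\<in>{1..l}. f k = Suc i})" using k lt[of k] by auto
    qed auto
    then have "card {k\<in>{1..l}. f k \<noteq> 0} = card (\<Union>i\<in>{..<N}. {k\<in>{1..l}. f k = Suc i})" by (rule arg_cong)
    also have "\<dots> = (\<Sum>i<N. card {k\<in>{1..l}. f k = Suc i})" by (rule card_UN_disjoint) auto
    finally show ?thesis using f by simp
  qed
  show "card {k\<in>{1..l}. fst (block F k)} = n"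
    using count[OF F1(1) a(1)] a(2) by (simp add: block_def)
  show "card {k\<in>{1..l}. snd (block F k)} = m"
    using count[OF F1(2) b(1)] b(2) by (simp add: block_def)
  show "block F k = (False, False)" if "k \<notin> {1..l}" for k using F0(2)[OF that] by (simp add: block_def)
  show "block F k \<noteq> (False, False)" if "k \<in> {1..l}" for k
    using F0(1)[OF that] by (auto simp: block_def prod_eq_iff)
qed

text \<open>Both sides count pairs of a permutation \<open>x\<close> and a \<open>g\<close>-fixed
  cell map \<open>F\<close> whose block pattern becomes \<open>std\<close> when moved by
  \<open>inv' x\<close>. For given \<open>x\<close> at most one \<open>k\<close> satisfies
  \<open>x \<circ> g = phi k \<circ> x\<close>, and its term counts the \<open>F\<close>; for given
  \<open>F\<close> the \<open>x\<close> form a coset of the stabilizer of \<open>std\<close>, which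
  has \<open>card KK\<close> elements.\<close>

theorem sum_fix_count_blocks:
  assumes a: "\<And>i. i \<ge> N \<Longrightarrow> a i = 0" "(\<Sum>i<N. a i) = int n"
    and b: "\<And>i. i \<ge> N \<Longrightarrow> b i = 0" "(\<Sum>i<N. b i) = int m" and g: "g \<in> Sym l"
  shows "(\<Sum>x\<in>Sym l. \<Sum>k\<in>KK. if x \<circ> g = phi k \<circ> x then fix_count 0 n a (r1 k) * fix_count 0 m b (r2 k) else 0) =
    card KK * card {F \<in> cell_maps l a b. F \<circ> g = F}"
proof -
  let ?Y = "{F \<in> cell_maps l a b. F \<circ> g = F}"
  have finY: "finite ?Y" using finite_cell_maps[of N a b l] a(1) b(1) by simp
  have inner: "(\<Sum>k\<in>KK. if x \<circ> g = phi k \<circ> x then fix_count 0 n a (r1 k) * fix_count 0 m b (r2 k) else 0) =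
      card {F \<in> ?Y. block F \<circ> inv' x = std}" if x: "x \<in> Sym l" for x
  proof -
    let ?h = "x \<circ> g \<circ> inv' x"
    have h: "?h \<in> Sym l" using x g by simp
    have eq: "x \<circ> g = k \<circ> x \<longleftrightarrow> k = ?h" for k
    proof
      assume "x \<circ> g = k \<circ> x"
      then have "?h = k \<circ> x \<circ> inv' x" by (simp only:)
      then show "k = ?h" using x by (simp only: comp_assoc Sym_inv_o comp_id)
    next
      assume "k = ?h"
      then show "x \<circ> g = k \<circ> x" using x by (simp only: comp_assoc Sym_inv_o comp_id)
    qed
    have "(\<Sum>k\<in>KK. if x \<circ> g = phi k \<circ> x then fix_count 0 n a (r1 k) * fix_count 0 m b (r2 k) else 0) =
        (\<Sum>k\<in>KK. if phi k = ?h then card {F \<in> std_maps a b. F \<circ> ?h = F} else 0)"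
      using fix_count_blocks[of _ a b] by (intro sum.cong refl) (auto simp: eq)
    also have "\<dots> = card {F \<in> std_maps a b. F \<circ> ?h = F}"
    proof (cases "?h \<in> phi ` KK")
      case True
      then obtain k0 where k0: "k0 \<in> KK" "?h = phi k0" by blast
      have "(\<Sum>k\<in>KK. if phi k = ?h then card {F \<in> std_maps a b. F \<circ> ?h = F} else 0) =
          (\<Sum>k\<in>KK. if k = k0 then card {F \<in> std_maps a b. F \<circ> ?h = F} else 0)"
        using inj_phi k0 by (intro sum.cong refl) (auto dest: inj_onD)
      then show ?thesis using k0(1) finite_KK by simp
    next
      case False
      \<comment> \<open>When no \<open>k\<close> matches, no standard cell map may be fixed either:
        its block pattern \<open>std\<close> would be fixed too, which would put \<open>?h\<close>
        into the stabilizer.\<close>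
      have "F \<circ> ?h \<noteq> F" if F: "F \<in> std_maps a b" for F
      proof
        assume "F \<circ> ?h = F"
        then have "block F \<circ> ?h = block F" using block_comp[of F ?h] by simp
        then have "?h \<in> {h \<in> Sym l. std \<circ> h = std}" using F h by (simp add: std_maps_def)
        then show False using False stabilizer_std by blast
      qed
      then have "{F \<in> std_maps a b. F \<circ> ?h = F} = {}" by blast
      moreover have "(\<Sum>k\<in>KK. if phi k = ?h then card {F \<in> std_maps a b. F \<circ> ?h = F} else 0) = 0"
      proof (rule sum.neutral, rule ballI)
        fix k assume "k \<in> KK"
        then have "phi k \<in> phi ` KK" by (rule imageI)
        then have "phi k \<noteq> ?h" using False by metis
        then show "(if phi k = ?h then card {F \<in> std_maps a b. F \<circ> ?h = F} else 0) = 0" by simp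
      qed
      ultimately show ?thesis by (simp only: card.empty)
    qed
    also have "\<dots> = card {F \<in> ?Y. block F \<circ> inv' x = std}"
    proof (rule bij_betw_same_card[of "\<lambda>F. F \<circ> x"], rule bij_betw_byWitness[where f' = "\<lambda>F. F \<circ> inv' x"])
      show "\<forall>F\<in>{F \<in> std_maps a b. F \<circ> ?h = F}. F \<circ> x \<circ> inv' x = F"
        using x by (simp only: comp_assoc Sym_inv_o comp_id) simp
      show "\<forall>F\<in>{F \<in> ?Y. block F \<circ> inv' x = std}. F \<circ> inv' x \<circ> x = F"
        using x by (simp only: comp_assoc Sym_inv_o comp_id) simp
      show "(\<lambda>F. F \<circ> x) ` {F \<in> std_maps a b. F \<circ> ?h = F} \<subseteq> {F \<in> ?Y. block F \<circ> inv' x = std}"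
      proof (rule image_subsetI)
        fix F assume "F \<in> {F \<in> std_maps a b. F \<circ> ?h = F}"
        then have F: "F \<in> std_maps a b" "F \<circ> ?h = F" by blast+
        have "F \<circ> x \<in> cell_maps l a b" using F(1) cell_maps_comp[OF _ x] by (simp add: std_maps_def)
        moreover have "F \<circ> x \<circ> g = F \<circ> x"
        proof -
          have "F \<circ> x \<circ> g = F \<circ> ?h \<circ> x" using x by (simp only: comp_assoc Sym_inv_o comp_id)
          then show ?thesis using F(2) by (simp only:)
        qed
        moreover have "block (F \<circ> x) \<circ> inv' x = std"
        proof -
          have "block (F \<circ> x) \<circ> inv' x = block F" using x by (simp only: block_comp comp_assoc Sym_inv_o comp_id)
          then show ?thesis using F(1) by (simp add: std_maps_def)
        qed
        ultimately show "F \<circ> x \<in> {F \<in> ?Y. block F \<circ> inv' x = std}" by blast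
      qed
      show "(\<lambda>F. F \<circ> inv' x) ` {F \<in> ?Y. block F \<circ> inv' x = std} \<subseteq> {F \<in> std_maps a b. F \<circ> ?h = F}"
      proof (rule image_subsetI)
        fix F assume "F \<in> {F \<in> ?Y. block F \<circ> inv' x = std}"
        then have F: "F \<in> cell_maps l a b" "F \<circ> g = F" "block F \<circ> inv' x = std" by blast+
        have "F \<circ> inv' x \<in> std_maps a b"
          using F(1,3) cell_maps_comp[OF _ Sym_inv[OF x]] by (simp add: std_maps_def block_comp)
        moreover have "F \<circ> inv' x \<circ> ?h = F \<circ> inv' x"
        proof -
          have "F \<circ> inv' x \<circ> ?h = F \<circ> g \<circ> inv' x" using x by (simp only: comp_assoc Sym_inv_o_o)
          then show ?thesis using F(2) by (simp only:)
        qed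
        ultimately show "F \<circ> inv' x \<in> {F \<in> std_maps a b. F \<circ> ?h = F}" by blast
      qed
    qed
    finally show ?thesis .
  qed
  have outer: "card {x \<in> Sym l. block F \<circ> inv' x = std} = card KK" if F: "F \<in> ?Y" for F
  proof -
    have Fm: "F \<in> cell_maps l a b" using F by blast
    have "block F \<in> colorings (False, False) l
      (\<lambda>c. if c = (True, True) then int q else if c = (True, False) then int p else if c = (False, True) then int r else 0)"
      by (rule block_coloring[where N = N and a = a and b = b]) (use a b Fm in auto)
    then obtain y where y: "y \<in> Sym l" "block F = std \<circ> y"
      by (rule colorings_transitive[OF std_coloring])
    have "bij_betw (\<lambda>x. y \<circ> inv' x) {x \<in> Sym l. block F \<circ> inv' x = std} {h \<in> Sym l. std \<circ> h = std}"
      by (rule bij_betw_byWitness[where f' = "\<lambda>h. inv' h \<circ> y"])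
         (use y in \<open>auto simp: Sym_inv_comp[where n = l] comp_assoc\<close>)
    then show ?thesis using card_stabilizer by (simp add: bij_betw_same_card)
  qed
  have "(\<Sum>x\<in>Sym l. \<Sum>k\<in>KK. if x \<circ> g = phi k \<circ> x then fix_count 0 n a (r1 k) * fix_count 0 m b (r2 k) else 0) =
      (\<Sum>x\<in>Sym l. \<Sum>F\<in>?Y. if block F \<circ> inv' x = std then 1 else 0)"
    using inner finY by (intro sum.cong refl) (simp add: sum.If_cases Int_def)
  also have "\<dots> = (\<Sum>F\<in>?Y. \<Sum>x\<in>Sym l. if block F \<circ> inv' x = std then 1 else 0)" by (rule sum.swap)
  also have "\<dots> = (\<Sum>F\<in>?Y. card {x \<in> Sym l. block F \<circ> inv' x = std})" by (simp add: sum.If_cases Int_def)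
  also have "\<dots> = (\<Sum>F\<in>?Y. card KK)" using outer by (intro sum.cong refl) blast
  finally show ?thesis by simp
qed

end

lemma sum_Times: "(\<Sum>z\<in>A \<times> D. f z) = (\<Sum>x\<in>A. \<Sum>y\<in>D. f (x, y))"
  using sum.cartesian_product[of "\<lambda>x y. f (x, y)" D A] by simp

section \<open>The Heisenberg component as a space of functions\<close>

locale heis = A: young mu + B: young nu for mu nu :: "nat \<Rightarrow> nat" +
  fixes l :: nat
  assumes sizes: "psize mu \<le> l" "psize nu \<le> l" "l \<le> psize mu + psize nu"
begin

sublocale blocks "psize mu" "psize nu" l
  by unfold_locales (rule sizes)+

definition TS :: "((nat \<Rightarrow> nat) \<times> (nat \<Rightarrow> nat) \<Rightarrow> complex) set" where
  "TS = fun_vs.span {(\<lambda>(x, y). v x * w y) | v w. v \<in> A.S \<and> w \<in> B.S}"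

lemma subspace_TS: "fun_vs.subspace TS"
  unfolding TS_def by (rule fun_vs.subspace_span)

lemma TS_pure: "v \<in> A.S \<Longrightarrow> w \<in> B.S \<Longrightarrow> (\<lambda>(x, y). v x * w y) \<in> TS"
  unfolding TS_def by (intro fun_vs.span_base) blast

lemma TS_induct:
  assumes "F \<in> TS" "fun_vs.subspace Z" "\<And>v w. v \<in> A.S \<Longrightarrow> w \<in> B.S \<Longrightarrow> (\<lambda>(x, y). v x * w y) \<in> Z"
  shows "F \<in> Z"
proof -
  have "TS \<subseteq> Z" unfolding TS_def using assms(2,3) by (intro fun_vs.span_minimal) auto
  then show ?thesis using assms(1) by blast
qed

lemma TS_support:
  assumes "F \<in> TS" "x \<notin> A.Tabl \<or> y \<notin> B.Tabl"
  shows "F (x, y) = 0"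
proof -
  have "F \<in> {F. F (x, y) = 0}"
  proof (rule TS_induct[OF assms(1)])
    show "fun_vs.subspace {F. F (x, y) = 0}" by (rule fun_vs.subspaceI) auto
    fix v w assume "v \<in> A.S" "w \<in> B.S"
    then show "(\<lambda>(x, y). v x * w y) \<in> {F. F (x, y) = 0}"
      using assms(2) A.T.submodD(3)[OF A.submod_S] B.T.submodD(3)[OF B.submod_S] by auto
  qed
  then show ?thesis by simp
qed

lemma TS_act:
  assumes "F \<in> TS" "g \<in> Sym (psize mu)" "h \<in> Sym (psize nu)"
  shows "(\<lambda>(x, y). F (x \<circ> g, y \<circ> h)) \<in> TS"
proof -
  have "F \<in> {F. (\<lambda>(x, y). F (x \<circ> g, y \<circ> h)) \<in> TS}"
  proof (rule TS_induct[OF assms(1)])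
    show "fun_vs.subspace {F. (\<lambda>(x, y). F (x \<circ> g, y \<circ> h)) \<in> TS}"
    proof (rule fun_vs.subspaceI)
      have "(\<lambda>(x, y). (0 :: (nat \<Rightarrow> nat) \<times> (nat \<Rightarrow> nat) \<Rightarrow> complex) (x \<circ> g, y \<circ> h)) = 0" by (auto simp: fun_eq_iff)
      then show "0 \<in> {F. (\<lambda>(x, y). F (x \<circ> g, y \<circ> h)) \<in> TS}"
        using fun_vs.subspace_0[OF subspace_TS] by simp
    next
      fix F G :: "(nat \<Rightarrow> nat) \<times> (nat \<Rightarrow> nat) \<Rightarrow> complex"
      have "(\<lambda>(x, y). (F + G) (x \<circ> g, y \<circ> h)) = (\<lambda>(x, y). F (x \<circ> g, y \<circ> h)) + (\<lambda>(x, y). G (x \<circ> g, y \<circ> h))"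
        by (auto simp: fun_eq_iff)
      then show "F + G \<in> {F. (\<lambda>(x, y). F (x \<circ> g, y \<circ> h)) \<in> TS}"
        if "F \<in> {F. (\<lambda>(x, y). F (x \<circ> g, y \<circ> h)) \<in> TS}" "G \<in> {F. (\<lambda>(x, y). F (x \<circ> g, y \<circ> h)) \<in> TS}"
        using that fun_vs.subspace_add[OF subspace_TS] by (simp only: mem_Collect_eq)
    next
      fix c and F :: "(nat \<Rightarrow> nat) \<times> (nat \<Rightarrow> nat) \<Rightarrow> complex"
      have "(\<lambda>(x, y). (fscale c F) (x \<circ> g, y \<circ> h)) = fscale c (\<lambda>(x, y). F (x \<circ> g, y \<circ> h))"
        by (auto simp: fun_eq_iff)
      then show "fscale c F \<in> {F. (\<lambda>(x, y). F (x \<circ> g, y \<circ> h)) \<in> TS}"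
        if "F \<in> {F. (\<lambda>(x, y). F (x \<circ> g, y \<circ> h)) \<in> TS}"
        using that fun_vs.subspace_scale[OF subspace_TS] by (simp only: mem_Collect_eq)
    qed
    fix v w assume vw: "v \<in> A.S" "w \<in> B.S"
    have "(\<lambda>(x, y). A.T.act g v x * B.T.act h w y) \<in> TS"
      by (intro TS_pure A.T.submodD(4)[OF A.submod_S] B.T.submodD(4)[OF B.submod_S] vw assms)
    then show "(\<lambda>(x, y). v x * w y) \<in> {F. (\<lambda>(x, y). F (x \<circ> g, y \<circ> h)) \<in> TS}"
      by (simp add: A.T.act_def B.T.act_def)
  qed
  then show ?thesis by simp
qed

text \<open>The product of two kernels reproduces pure tensors, and reproducing is a linear
  condition.\<close>

lemma TS_kernel:
  assumes P: "kernel_on A.Tabl A.S P" "kernel_on B.Tabl B.S Q" and F: "F \<in> TS"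
  shows "F (x, y) = (\<Sum>(x', y')\<in>A.Tabl \<times> B.Tabl. P x x' * Q y y' * F (x', y'))"
proof -
  let ?Z = "{F. F (x, y) = (\<Sum>(x', y')\<in>A.Tabl \<times> B.Tabl. P x x' * Q y y' * F (x', y'))}"
  have "F \<in> ?Z"
  proof (rule TS_induct[OF F])
    show "fun_vs.subspace ?Z"
      by (rule fun_vs.subspaceI)
         (auto simp: case_prod_beta algebra_simps sum.distrib sum_distrib_left)
    fix v w assume vw: "v \<in> A.S" "w \<in> B.S"
    have "v x * w y = (\<Sum>x'\<in>A.Tabl. P x x' * v x') * (\<Sum>y'\<in>B.Tabl. Q y y' * w y')"
      using P vw unfolding kernel_on_def by metis
    also have "\<dots> = (\<Sum>x'\<in>A.Tabl. \<Sum>y'\<in>B.Tabl. P x x' * Q y y' * (v x' * w y'))"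
      unfolding sum_product by (intro sum.cong refl) (simp add: mult_ac)
    also have "\<dots> = (\<Sum>(x', y')\<in>A.Tabl \<times> B.Tabl. P x x' * Q y y' * (v x' * w y'))"
      by (rule sum.cartesian_product)
    finally show "(\<lambda>(x, y). v x * w y) \<in> ?Z" by simp
  qed
  then show ?thesis by simp
qed

text \<open>The induced module written out as functions on \<open>XX\<close>, so that
  \<open>Sym l\<close> acts by moving the first coordinate only.\<close>

definition W :: "((nat \<Rightarrow> nat) \<times> (nat \<Rightarrow> nat) \<times> (nat \<Rightarrow> nat) \<Rightarrow> complex) set" where
  "W = {F. (\<forall>g\<in>Sym l. curry F g \<in> TS) \<and> (\<forall>g. g \<notin> Sym l \<longrightarrow> curry F g = 0) \<and>
     (\<forall>k\<in>KK. \<forall>g\<in>Sym l. curry F (phi k \<circ> g) = (\<lambda>(x, y). curry F g (x \<circ> r1 k, y \<circ> r2 k)))}"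

definition XX :: "((nat \<Rightarrow> nat) \<times> (nat \<Rightarrow> nat) \<times> (nat \<Rightarrow> nat)) set" where
  "XX = Sym l \<times> (A.Tabl \<times> B.Tabl)"

abbreviation "rr \<equiv> \<lambda>g (x, v). (x \<circ> g, v :: (nat \<Rightarrow> nat) \<times> (nat \<Rightarrow> nat))"

sublocale H: perm_action l XX rr
  by unfold_locales (auto simp: XX_def comp_assoc)

lemma W_D:
  assumes "F \<in> W"
  shows "g \<in> Sym l \<Longrightarrow> (\<lambda>v. F (g, v)) \<in> TS" "g \<notin> Sym l \<Longrightarrow> F (g, v) = 0"
    "k \<in> KK \<Longrightarrow> g \<in> Sym l \<Longrightarrow> F (phi k \<circ> g, x, y) = F (g, x \<circ> r1 k, y \<circ> r2 k)"
proof -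
  show "g \<in> Sym l \<Longrightarrow> (\<lambda>v. F (g, v)) \<in> TS" using assms unfolding W_def by (simp add: curry_def)
  show "F (g, v) = 0" if "g \<notin> Sym l"
  proof -
    have "curry F g = 0" using assms that unfolding W_def by blast
    from fun_cong[OF this, of v] show ?thesis by simp
  qed
  show "F (phi k \<circ> g, x, y) = F (g, x \<circ> r1 k, y \<circ> r2 k)" if "k \<in> KK" "g \<in> Sym l"
  proof -
    have "curry F (phi k \<circ> g) = (\<lambda>(x, y). curry F g (x \<circ> r1 k, y \<circ> r2 k))"
      using assms that unfolding W_def by blast
    from fun_cong[OF this, of "(x, y)"] show ?thesis by simp
  qed
qed

lemma W_I:
  assumes "\<And>g. g \<in> Sym l \<Longrightarrow> (\<lambda>v. F (g, v)) \<in> TS" "\<And>g v. g \<notin> Sym l \<Longrightarrow> F (g, v) = 0"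
    "\<And>k g x y. k \<in> KK \<Longrightarrow> g \<in> Sym l \<Longrightarrow> F (phi k \<circ> g, x, y) = F (g, x \<circ> r1 k, y \<circ> r2 k)"
  shows "F \<in> W"
  using assms unfolding W_def by (simp add: curry_def fun_eq_iff)

lemma Sym_comp_iff: "g \<in> Sym l \<Longrightarrow> x \<circ> g \<in> Sym l \<longleftrightarrow> x \<in> Sym l"
  using Sym_comp[of "x \<circ> g" l "inv' g"] by (auto simp: comp_assoc)

lemma submod_W: "H.submod W"
  unfolding H.submod_def supported_def
proof (intro conjI ballI allI impI)
  show "fun_vs.subspace W"
  proof (rule fun_vs.subspaceI)
    show "0 \<in> W"
    proof (rule W_I)
      fix g
      have "(\<lambda>v. (0 :: (nat \<Rightarrow> nat) \<times> (nat \<Rightarrow> nat) \<times> (nat \<Rightarrow> nat) \<Rightarrow> complex) (g, v)) = 0" by (auto simp: fun_eq_iff)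
      then show "(\<lambda>v. (0 :: (nat \<Rightarrow> nat) \<times> (nat \<Rightarrow> nat) \<times> (nat \<Rightarrow> nat) \<Rightarrow> complex) (g, v)) \<in> TS"
        using fun_vs.subspace_0[OF subspace_TS] by (simp only:)
    qed simp_all
    show "F + G \<in> W" if F: "F \<in> W" and G: "G \<in> W" for F G
    proof (rule W_I)
      show "(F + G) (g, v) = 0" if "g \<notin> Sym l" for g v
        using W_D(2)[OF F that] W_D(2)[OF G that] by simp
      show "(F + G) (phi k \<circ> g, x, y) = (F + G) (g, x \<circ> r1 k, y \<circ> r2 k)" if "k \<in> KK" "g \<in> Sym l" for k g x y
        using W_D(3)[OF F that] W_D(3)[OF G that] by simp
      fix g assume "g \<in> Sym l"
      then have "(\<lambda>v. F (g, v)) + (\<lambda>v. G (g, v)) \<in> TS"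
        by (intro fun_vs.subspace_add[OF subspace_TS] W_D(1) F G)
      moreover have "(\<lambda>v. F (g, v)) + (\<lambda>v. G (g, v)) = (\<lambda>v. (F + G) (g, v))" by (auto simp: fun_eq_iff)
      ultimately show "(\<lambda>v. (F + G) (g, v)) \<in> TS" by (simp only:)
    qed
    show "fscale c F \<in> W" if F: "F \<in> W" for c F
    proof (rule W_I)
      show "(fscale c F) (g, v) = 0" if "g \<notin> Sym l" for g v
        using W_D(2)[OF F that] by simp
      show "(fscale c F) (phi k \<circ> g, x, y) = (fscale c F) (g, x \<circ> r1 k, y \<circ> r2 k)" if "k \<in> KK" "g \<in> Sym l" for k g x y
        using W_D(3)[OF F that] by simp
      fix g assume "g \<in> Sym l"
      then have "fscale c (\<lambda>v. F (g, v)) \<in> TS"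
        by (intro fun_vs.subspace_scale[OF subspace_TS] W_D(1) F)
      moreover have "fscale c (\<lambda>v. F (g, v)) = (\<lambda>v. (fscale c F) (g, v))" by (auto simp: fun_eq_iff)
      ultimately show "(\<lambda>v. (fscale c F) (g, v)) \<in> TS" by (simp only:)
    qed
  qed
  show "F z = 0" if F: "F \<in> W" and z: "z \<notin> XX" for F z
  proof -
    obtain g x y where zz: "z = (g, x, y)" by (cases z)
    show ?thesis
    proof (cases "g \<in> Sym l")
      case True
      then have "x \<notin> A.Tabl \<or> y \<notin> B.Tabl" using z by (auto simp: zz XX_def)
      then show ?thesis using TS_support[OF W_D(1)[OF F True]] by (simp add: zz)
    next
      case False
      then show ?thesis using W_D(2)[OF F] by (simp add: zz)
    qed
  qed
  show "H.act g F \<in> W" if g: "g \<in> Sym l" and F: "F \<in> W" for g F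
  proof (rule W_I)
    show "(\<lambda>v. H.act g F (x, v)) \<in> TS" if "x \<in> Sym l" for x
      using W_D(1)[OF F, of "x \<circ> g"] that g by (simp add: H.act_def)
    show "H.act g F (x, v) = 0" if "x \<notin> Sym l" for x v
      using W_D(2)[OF F, of "x \<circ> g"] that g by (simp add: H.act_def Sym_comp_iff)
    show "H.act g F (phi k \<circ> x, s, t) = H.act g F (x, s \<circ> r1 k, t \<circ> r2 k)" if "k \<in> KK" "x \<in> Sym l" for k x s t
      using W_D(3)[OF F that(1), of "x \<circ> g" s t] that(2) g by (simp add: H.act_def comp_assoc)
  qed
qed

lemma models_W: "H.models (heisenberg_component (psize mu) (psize nu) l (specht mu) (specht nu)) W"
proof -
  have sp: "repr_space (specht mu) = A.S" "repr_space (specht nu) = B.S"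
    using A.models_specht B.models_specht by (auto simp: A.T.models_def B.T.models_def)
  have ac: "repr_act (specht mu) = (\<lambda>g f t. f (t \<circ> g))" "repr_act (specht nu) = (\<lambda>g f t. f (t \<circ> g))"
    by (simp_all add: specht_def)
  have carr: "carrier (sym_group (l - psize nu) \<times>\<times> sym_group (psize mu + psize nu - l) \<times>\<times> sym_group (l - psize mu)) = KK"
    by (simp add: carrier_sym_group KK_def p_def q_def r_def)
  have ph: "(\<lambda>(s, t, u). young_embed (l - psize nu + (psize mu + psize nu - l)) (young_embed (l - psize nu) s t) u) = phi"
    by (simp add: phi_def p_def q_def)
  have res: "repr_act (res_repr (\<lambda>(s, t, u). (young_embed (l - psize nu) s t, young_embed (psize mu + psize nu - l) t u))
      (tensor_repr (specht mu) (specht nu))) k F = (\<lambda>(x, y). F (x \<circ> r1 k, y \<circ> r2 k))" for k F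
    by (cases k) (simp add: res_repr_def tensor_repr_def ac r1_def r2_def p_def q_def)
  have ts: "repr_space (res_repr (\<lambda>(s, t, u). (young_embed (l - psize nu) s t, young_embed (psize mu + psize nu - l) t u))
      (tensor_repr (specht mu) (specht nu))) = TS"
    by (simp add: res_repr_def tensor_repr_def sp TS_def)
  have space: "repr_space (heisenberg_component (psize mu) (psize nu) l (specht mu) (specht nu)) = W"
    unfolding heisenberg_component_def Let_def ind_repr_def repr.simps res ts carr ph W_def
    by (simp add: carrier_sym_group sym_group_mult)
  show ?thesis
    unfolding H.models_def space
  proof (intro conjI ballI refl submod_W)
    fix g F assume g: "g \<in> Sym l" and F: "F \<in> W"
    show "repr_act (heisenberg_component (psize mu) (psize nu) l (specht mu) (specht nu)) g F = H.act g F"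
    proof
      fix z :: "(nat \<Rightarrow> nat) \<times> (nat \<Rightarrow> nat) \<times> (nat \<Rightarrow> nat)"
      obtain x v where z: "z = (x, v)" by (cases z)
      show "repr_act (heisenberg_component (psize mu) (psize nu) l (specht mu) (specht nu)) g F z = H.act g F z"
        unfolding heisenberg_component_def Let_def ind_repr_def z
        using W_D(2)[OF F, of "x \<circ> g"] g Sym_comp_iff[OF g, of x]
        by (simp add: carrier_sym_group sym_group_mult H.act_def)
    qed
  qed
qed

text \<open>The Frobenius formula for an induced character, with the division by the order of the
  subgroup cleared.\<close>

lemma chr_W:
  assumes g: "g \<in> Sym l"
  shows "of_nat (card KK) * H.chr W g = (\<Sum>x\<in>Sym l. \<Sum>k\<in>KK.
    if x \<circ> g = phi k \<circ> x then A.T.chr A.S (r1 k) * B.T.chr B.S (r2 k) else 0)"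
proof -
  obtain P where P: "kernel_on A.Tabl A.S P" using A.T.kernelE[OF A.submod_S] .
  obtain Q where Q: "kernel_on B.Tabl B.S Q" using B.T.kernelE[OF B.submod_S] .
  have KK0: "of_nat (card KK) \<noteq> (0 :: complex)"
    by (simp add: KK_def card_Sym)
  \<comment> \<open>Equivariance ties the values of a function in \<open>W\<close> at
    \<open>x = phi k \<circ> x'\<close> to those at \<open>x'\<close>. The kernel reproduces the
    value at \<open>x\<close> from each point \<open>x'\<close> of its coset, with the product
    kernel in the remaining coordinates, and takes the mean over the coset.\<close>
  define PP where "PP = (\<lambda>(x :: nat \<Rightarrow> nat, s, t) (x' :: nat \<Rightarrow> nat, s', t'). (\<Sum>k\<in>KK.
    if x = phi k \<circ> x' then P (s \<circ> r1 k) s' * Q (t \<circ> r2 k) t' else 0) / of_nat (card KK))"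
  have "kernel_on XX W PP"
    unfolding kernel_on_def
  proof (intro conjI ballI allI)
    fix z' assume "z' \<in> XX"
    then obtain x' s' t' where z': "z' = (x', s', t')" "x' \<in> Sym l" "s' \<in> A.Tabl" "t' \<in> B.Tabl"
      by (auto simp: XX_def)
    have PQ: "(\<lambda>(s, t). P s s' * Q t t') \<in> TS"
      using P Q z'(3,4) by (intro TS_pure) (auto simp: kernel_on_def)
    show "(\<lambda>z. PP z z') \<in> W"
    proof (rule W_I)
      fix x assume "x \<in> Sym l"
      have "(\<lambda>v. PP (x, v) z') = fscale (1 / of_nat (card KK)) (\<Sum>k\<in>KK.
          fscale (if x = phi k \<circ> x' then 1 else 0) (\<lambda>(s, t). (\<lambda>(s, t). P s s' * Q t t') (s \<circ> r1 k, t \<circ> r2 k)))"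
        unfolding PP_def z'(1)
        by (auto simp: fun_eq_iff sum_fun_apply intro!: arg_cong2[where f = "(/)"] sum.cong)
      also have "\<dots> \<in> TS"
        by (intro fun_vs.subspace_scale fun_vs.subspace_sum subspace_TS TS_act[OF PQ] r1_Sym r2_Sym)
      finally show "(\<lambda>v. PP (x, v) z') \<in> TS" .
    next
      fix x v assume x: "x \<notin> Sym l"
      have "x \<noteq> phi k \<circ> x'" if "k \<in> KK" for k using x phi_Sym[OF that] z'(2) by auto
      then show "PP (x, v) z' = 0" by (cases v) (simp add: PP_def z'(1))
    next
      fix k0 x s t assume k0: "k0 \<in> KK" and x: "x \<in> Sym l"
      obtain a b c where abc: "k0 = (a, b, c)" by (cases k0)
      have abcS: "a \<in> Sym p" "b \<in> Sym q" "c \<in> Sym r" using k0 by (simp_all add: abc KK_def)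
      define mm where "mm = (\<lambda>(a' :: nat \<Rightarrow> nat, b' :: nat \<Rightarrow> nat, c' :: nat \<Rightarrow> nat). (a \<circ> a', b \<circ> b', c \<circ> c'))"
      have mm: "phi (mm k) = phi k0 \<circ> phi k" "r1 (mm k) = r1 k0 \<circ> r1 k" "r2 (mm k) = r2 k0 \<circ> r2 k"
        if "k \<in> KK" for k
      proof -
        obtain a' b' c' where k: "k = (a', b', c')" by (cases k)
        have S: "a' \<in> Sym p" "b' \<in> Sym q" "c' \<in> Sym r" using that by (simp_all add: k KK_def)
        show "r1 (mm k) = r1 k0 \<circ> r1 k" "r2 (mm k) = r2 k0 \<circ> r2 k"
          using S by (simp_all add: k abc mm_def r1_def r2_def young_embed_comp)
        show "phi (mm k) = phi k0 \<circ> phi k"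
          using S young_embed_Sym[OF S(1,2)] by (simp add: k abc mm_def phi_def young_embed_comp)
      qed
      \<comment> \<open>Left multiplication by \<open>k0\<close> on \<open>KK\<close>, compatible
        with \<open>phi\<close>, \<open>r1\<close> and \<open>r2\<close> at once; reindexing by it
        shows that \<open>PP\<close> is equivariant in its first argument.\<close>
      have bij: "bij_betw mm KK KK"
        by (rule bij_betw_byWitness[where f' = "\<lambda>(a', b', c'). (inv' a \<circ> a', inv' b \<circ> b', inv' c \<circ> c')"])
           (use abcS in \<open>auto simp: mm_def KK_def\<close>)
      have ph: "phi k0 \<in> Sym l" by (rule phi_Sym[OF k0])
      have canc: "phi k0 \<circ> x = phi k0 \<circ> phi k \<circ> x' \<longleftrightarrow> x = phi k \<circ> x'" for k
      proof
        assume "phi k0 \<circ> x = phi k0 \<circ> phi k \<circ> x'"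
        then have "inv' (phi k0) \<circ> (phi k0 \<circ> x) = inv' (phi k0) \<circ> (phi k0 \<circ> (phi k \<circ> x'))"
          by (simp only: comp_assoc)
        then show "x = phi k \<circ> x'" using ph by simp
      qed (simp add: comp_assoc)
      have "(\<Sum>k\<in>KK. if phi k0 \<circ> x = phi k \<circ> x' then P (s \<circ> r1 k) s' * Q (t \<circ> r2 k) t' else 0) =
          (\<Sum>k\<in>KK. if phi k0 \<circ> x = phi (mm k) \<circ> x' then P (s \<circ> r1 (mm k)) s' * Q (t \<circ> r2 (mm k)) t' else 0)"
        by (rule sum.reindex_bij_betw[OF bij, symmetric])
      also have "\<dots> = (\<Sum>k\<in>KK. if x = phi k \<circ> x' then P (s \<circ> r1 k0 \<circ> r1 k) s' * Q (t \<circ> r2 k0 \<circ> r2 k) t' else 0)"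
        by (intro sum.cong refl) (simp only: mm canc comp_assoc[of s] comp_assoc[of t])
      finally show "PP (phi k0 \<circ> x, s, t) z' = PP (x, s \<circ> r1 k0, t \<circ> r2 k0) z'"
        by (simp add: PP_def z'(1))
    qed
  next
    fix F and z :: "(nat \<Rightarrow> nat) \<times> (nat \<Rightarrow> nat) \<times> (nat \<Rightarrow> nat)" assume F: "F \<in> W"
    obtain x s t where z: "z = (x, s, t)" by (cases z)
    have "(\<Sum>z'\<in>XX. PP z z' * F z') = (\<Sum>x'\<in>Sym l. \<Sum>(s', t')\<in>A.Tabl \<times> B.Tabl. PP z (x', s', t') * F (x', s', t'))"
      by (simp only: XX_def sum_Times prod.case)
    also have "\<dots> = (\<Sum>x'\<in>Sym l. \<Sum>k\<in>KK. if x = phi k \<circ> x' then F (x, s, t) / of_nat (card KK) else 0)"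
    proof (rule sum.cong[OF refl])
      fix x' assume x': "x' \<in> Sym l"
      have "(\<Sum>(s', t')\<in>A.Tabl \<times> B.Tabl. PP z (x', s', t') * F (x', s', t')) =
          (\<Sum>v\<in>A.Tabl \<times> B.Tabl. \<Sum>k\<in>KK. if x = phi k \<circ> x' then
            (case v of (s', t') \<Rightarrow> P (s \<circ> r1 k) s' * Q (t \<circ> r2 k) t' * F (x', s', t')) / of_nat (card KK) else 0)"
        unfolding PP_def z
        by (intro sum.cong refl) (auto simp: sum_divide_distrib sum_distrib_right intro!: sum.cong)
      also have "\<dots> = (\<Sum>k\<in>KK. \<Sum>v\<in>A.Tabl \<times> B.Tabl. if x = phi k \<circ> x' then
            (case v of (s', t') \<Rightarrow> P (s \<circ> r1 k) s' * Q (t \<circ> r2 k) t' * F (x', s', t')) / of_nat (card KK) else 0)"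
        by (rule sum.swap)
      also have "\<dots> = (\<Sum>k\<in>KK. if x = phi k \<circ> x' then F (x, s, t) / of_nat (card KK) else 0)"
      proof (rule sum.cong[OF refl])
        fix k assume k: "k \<in> KK"
        have "(\<Sum>(s', t')\<in>A.Tabl \<times> B.Tabl. P (s \<circ> r1 k) s' * Q (t \<circ> r2 k) t' * F (x', s', t')) =
            F (x', s \<circ> r1 k, t \<circ> r2 k)"
          by (rule TS_kernel[OF P Q W_D(1)[OF F x'], symmetric])
        also have "\<dots> = F (phi k \<circ> x', s, t)" using W_D(3)[OF F k x'] by simp
        finally show "(\<Sum>v\<in>A.Tabl \<times> B.Tabl. if x = phi k \<circ> x' then
            (case v of (s', t') \<Rightarrow> P (s \<circ> r1 k) s' * Q (t \<circ> r2 k) t' * F (x', s', t')) / of_nat (card KK) else 0) =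
            (if x = phi k \<circ> x' then F (x, s, t) / of_nat (card KK) else 0)"
          by (simp add: sum_divide_distrib[symmetric])
      qed
      finally show "(\<Sum>(s', t')\<in>A.Tabl \<times> B.Tabl. PP z (x', s', t') * F (x', s', t')) =
          (\<Sum>k\<in>KK. if x = phi k \<circ> x' then F (x, s, t) / of_nat (card KK) else 0)" .
    qed
    also have "\<dots> = (\<Sum>k\<in>KK. \<Sum>x'\<in>Sym l. if x = phi k \<circ> x' then F (x, s, t) / of_nat (card KK) else 0)"
      by (rule sum.swap)
    also have "\<dots> = (\<Sum>k\<in>KK. F (x, s, t) / of_nat (card KK))"
    proof (rule sum.cong[OF refl])
      fix k assume k: "k \<in> KK"
      note ph = phi_Sym[OF k]
      show "(\<Sum>x'\<in>Sym l. if x = phi k \<circ> x' then F (x, s, t) / of_nat (card KK) else 0) =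
          F (x, s, t) / of_nat (card KK)"
      proof (cases "x \<in> Sym l")
        case True
        have eq: "x = phi k \<circ> x' \<longleftrightarrow> x' = inv' (phi k) \<circ> x" for x' using ph by auto
        have "(\<Sum>x'\<in>Sym l. if x = phi k \<circ> x' then F (x, s, t) / of_nat (card KK) else 0) =
            (\<Sum>x'\<in>Sym l. if x' = inv' (phi k) \<circ> x then F (x, s, t) / of_nat (card KK) else 0)"
          by (simp only: eq)
        also have "\<dots> = F (x, s, t) / of_nat (card KK)"
          using True ph by (subst sum.delta) simp_all
        finally show ?thesis .
      next
        case False
        have "F (x, s, t) = 0" by (rule W_D(2)[OF F False])
        then show ?thesis by (simp only: div_0 if_cancel sum.neutral_const)
      qed
    qed
    also have "\<dots> = F z" using KK0 by (simp add: z)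
    finally show "F z = (\<Sum>z'\<in>XX. PP z z' * F z')" by simp
  qed
  then have "H.chr W g = (\<Sum>z\<in>XX. PP (rr g z) z)" by (rule H.chr_eq[OF submod_W _ g])
  also have "\<dots> = (\<Sum>x\<in>Sym l. \<Sum>(s, t)\<in>A.Tabl \<times> B.Tabl. PP (x \<circ> g, s, t) (x, s, t))"
    by (simp only: XX_def sum_Times prod.case)
  finally have "of_nat (card KK) * H.chr W g =
      (\<Sum>x\<in>Sym l. \<Sum>(s, t)\<in>A.Tabl \<times> B.Tabl. of_nat (card KK) * PP (x \<circ> g, s, t) (x, s, t))"
    by (simp add: sum_distrib_left case_prod_beta)
  also have "\<dots> = (\<Sum>x\<in>Sym l. \<Sum>k\<in>KK. if x \<circ> g = phi k \<circ> x then A.T.chr A.S (r1 k) * B.T.chr B.S (r2 k) else 0)"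
  proof (rule sum.cong[OF refl])
    fix x
    have "(\<Sum>(s, t)\<in>A.Tabl \<times> B.Tabl. of_nat (card KK) * PP (x \<circ> g, s, t) (x, s, t)) =
        (\<Sum>v\<in>A.Tabl \<times> B.Tabl. \<Sum>k\<in>KK. if x \<circ> g = phi k \<circ> x then
          (case v of (s, t) \<Rightarrow> P (s \<circ> r1 k) s * Q (t \<circ> r2 k) t) else 0)"
      using KK0 unfolding PP_def by (intro sum.cong refl) (auto intro!: sum.cong)
    also have "\<dots> = (\<Sum>k\<in>KK. \<Sum>v\<in>A.Tabl \<times> B.Tabl. if x \<circ> g = phi k \<circ> x then
          (case v of (s, t) \<Rightarrow> P (s \<circ> r1 k) s * Q (t \<circ> r2 k) t) else 0)"
      by (rule sum.swap)
    also have "\<dots> = (\<Sum>k\<in>KK. if x \<circ> g = phi k \<circ> x then A.T.chr A.S (r1 k) * B.T.chr B.S (r2 k) else 0)"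
    proof (rule sum.cong[OF refl])
      fix k assume k: "k \<in> KK"
      have "(\<Sum>(s, t)\<in>A.Tabl \<times> B.Tabl. P (s \<circ> r1 k) s * Q (t \<circ> r2 k) t) =
          (\<Sum>s\<in>A.Tabl. P (s \<circ> r1 k) s) * (\<Sum>t\<in>B.Tabl. Q (t \<circ> r2 k) t)"
        unfolding sum_product by (rule sum.cartesian_product[symmetric])
      also have "\<dots> = A.T.chr A.S (r1 k) * B.T.chr B.S (r2 k)"
        using A.T.chr_eq[OF A.submod_S P r1_Sym[OF k]] B.T.chr_eq[OF B.submod_S Q r2_Sym[OF k]] by (simp only:)
      finally have "(\<Sum>(s, t)\<in>A.Tabl \<times> B.Tabl. P (s \<circ> r1 k) s * Q (t \<circ> r2 k) t) =
          A.T.chr A.S (r1 k) * B.T.chr B.S (r2 k)" .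
      note pr = this
      show "(\<Sum>v\<in>A.Tabl \<times> B.Tabl. if x \<circ> g = phi k \<circ> x then
          (case v of (s, t) \<Rightarrow> P (s \<circ> r1 k) s * Q (t \<circ> r2 k) t) else 0) =
          (if x \<circ> g = phi k \<circ> x then A.T.chr A.S (r1 k) * B.T.chr B.S (r2 k) else 0)"
      proof (cases "x \<circ> g = phi k \<circ> x")
        case True
        show ?thesis unfolding if_P[OF True] by (rule pr)
      next
        case False
        show ?thesis unfolding if_not_P[OF False] by (rule sum.neutral_const)
      qed
    qed
    finally show "(\<Sum>(s, t)\<in>A.Tabl \<times> B.Tabl. of_nat (card KK) * PP (x \<circ> g, s, t) (x, s, t)) =
        (\<Sum>k\<in>KK. if x \<circ> g = phi k \<circ> x then A.T.chr A.S (r1 k) * B.T.chr B.S (r2 k) else 0)" .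
  qed
  finally show ?thesis .
qed

text \<open>Both Specht characters are expanded into permutation characters. For each pair of these
  \<open>sum_fix_count_blocks\<close> evaluates the Frobenius sum as a number of fixed cell maps,
  and the factor \<open>card KK\<close> cancels.\<close>

lemma chr_W_alt:
  assumes mu: "\<And>i. i \<ge> N \<Longrightarrow> mu i = 0" and nu: "\<And>i. i \<ge> N \<Longrightarrow> nu i = 0" and g: "g \<in> Sym l"
  shows "H.chr W g = of_int (\<Sum>s | s permutes {..<N}. \<Sum>t | t permutes {..<N}. sign s * sign t *
    (\<Sum>C\<in>cell_contents N l (jt mu s) (jt nu t). int (fix_count (0, 0) l C g)))"
proof -
  let ?P = "{s. s permutes {..<N}}"
  let ?f = "\<lambda>s k. int (fix_count 0 (psize mu) (jt mu s) (r1 k))"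
  let ?h = "\<lambda>t k. int (fix_count 0 (psize nu) (jt nu t) (r2 k))"
  have KK0: "card KK \<noteq> 0" by (simp add: KK_def card_Sym)
  have summu: "(\<Sum>i<N. int (mu i)) = int (psize mu)" using psize_eq_sum[OF mu] by simp
  have sumnu: "(\<Sum>i<N. int (nu i)) = int (psize nu)" using psize_eq_sum[OF nu] by simp
  have "of_nat (card KK) * H.chr W g = (\<Sum>x\<in>Sym l. \<Sum>k\<in>KK. of_int (if x \<circ> g = phi k \<circ> x then
      alt_count N (psize mu) mu (r1 k) * alt_count N (psize nu) nu (r2 k) else 0))"
    unfolding chr_W[OF g]
    using A.chr_S_eq_alt_count[OF mu r1_Sym] B.chr_S_eq_alt_count[OF nu r2_Sym]
    by (intro sum.cong refl) (simp only: of_int_mult of_int_0 split: if_splits, simp)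
  also have "\<dots> = of_int (\<Sum>x\<in>Sym l. \<Sum>k\<in>KK. if x \<circ> g = phi k \<circ> x then
      alt_count N (psize mu) mu (r1 k) * alt_count N (psize nu) nu (r2 k) else 0)"
    by (simp only: of_int_sum)
  also have "(\<Sum>x\<in>Sym l. \<Sum>k\<in>KK. if x \<circ> g = phi k \<circ> x then
      alt_count N (psize mu) mu (r1 k) * alt_count N (psize nu) nu (r2 k) else 0) =
      (\<Sum>x\<in>Sym l. \<Sum>k\<in>KK. \<Sum>s\<in>?P. \<Sum>t\<in>?P. sign s * sign t *
        (if x \<circ> g = phi k \<circ> x then ?f s k * ?h t k else 0))"
    unfolding alt_count_def sum_product by (intro sum.cong refl) (simp add: mult_ac)
  also have "\<dots> = (\<Sum>s\<in>?P. \<Sum>t\<in>?P. \<Sum>x\<in>Sym l. \<Sum>k\<in>KK. sign s * sign t *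
        (if x \<circ> g = phi k \<circ> x then ?f s k * ?h t k else 0))"
    by (simp only: sum.swap[of _ ?P KK] sum.swap[of _ ?P "Sym l"])
  also have "\<dots> = (\<Sum>s\<in>?P. \<Sum>t\<in>?P. int (card KK) * (sign s * sign t *
    (\<Sum>C\<in>cell_contents N l (jt mu s) (jt nu t). int (fix_count (0, 0) l C g))))"
  proof (intro sum.cong refl)
    fix s t assume "s \<in> ?P" "t \<in> ?P"
    then have s: "s permutes {..<N}" and t: "t permutes {..<N}" by auto
    have "(\<Sum>x\<in>Sym l. \<Sum>k\<in>KK. sign s * sign t * (if x \<circ> g = phi k \<circ> x then ?f s k * ?h t k else 0)) =
        sign s * sign t * int (\<Sum>x\<in>Sym l. \<Sum>k\<in>KK. if x \<circ> g = phi k \<circ> x then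
          fix_count 0 (psize mu) (jt mu s) (r1 k) * fix_count 0 (psize nu) (jt nu t) (r2 k) else 0)"
      unfolding of_nat_sum sum_distrib_left by (intro sum.cong refl) simp
    also have "(\<Sum>x\<in>Sym l. \<Sum>k\<in>KK. if x \<circ> g = phi k \<circ> x then
          fix_count 0 (psize mu) (jt mu s) (r1 k) * fix_count 0 (psize nu) (jt nu t) (r2 k) else 0) =
        card KK * card {F \<in> cell_maps l (jt mu s) (jt nu t). F \<circ> g = F}"
      by (rule sum_fix_count_blocks[where N = N])
         (use jt_support[OF s mu] jt_support[OF t nu] jt_sum[OF s, of mu] jt_sum[OF t, of nu] summu sumnu g in simp_all)
    also have "card {F \<in> cell_maps l (jt mu s) (jt nu t). F \<circ> g = F} =
        (\<Sum>C\<in>cell_contents N l (jt mu s) (jt nu t). fix_count (0, 0) l C g)"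
      by (rule card_cell_maps_fixed) (use jt_support[OF s mu] jt_support[OF t nu] in simp_all)
    finally show "(\<Sum>x\<in>Sym l. \<Sum>k\<in>KK. sign s * sign t * (if x \<circ> g = phi k \<circ> x then ?f s k * ?h t k else 0)) =
        int (card KK) * (sign s * sign t * (\<Sum>C\<in>cell_contents N l (jt mu s) (jt nu t). int (fix_count (0, 0) l C g)))"
      by (simp only: of_nat_mult of_nat_sum mult_ac)
  qed
  also have "\<dots> = int (card KK) * (\<Sum>s\<in>?P. \<Sum>t\<in>?P. sign s * sign t *
    (\<Sum>C\<in>cell_contents N l (jt mu s) (jt nu t). int (fix_count (0, 0) l C g)))"
    by (simp only: sum_distrib_left)
  finally have "of_nat (card KK) * H.chr W g = of_nat (card KK) * of_int (\<Sum>s\<in>?P. \<Sum>t\<in>?P. sign s * sign t *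
    (\<Sum>C\<in>cell_contents N l (jt mu s) (jt nu t). int (fix_count (0, 0) l C g)))"
    by (simp only: of_int_mult of_int_of_nat_eq)
  moreover have "of_nat (card KK) \<noteq> (0 :: complex)" using KK0 by simp
  ultimately show ?thesis by (rule mult_left_cancel[THEN iffD1, rotated])
qed

end

text \<open>\<open>fact (psize la)\<close> times the Kostka number, for contents over any color
  type. It stays undivided in order to remain an integer; \<open>kos\<close> is the
  quotient.\<close>

definition kostka :: "nat \<Rightarrow> (nat \<Rightarrow> nat) \<Rightarrow> 'c \<Rightarrow> ('c \<Rightarrow> int) \<Rightarrow> int" where
  "kostka N la d \<kappa> = (\<Sum>g\<in>Sym (psize la). alt_count N (psize la) la g * int (fix_count d (psize la) \<kappa> g))"

theorem heisenberg_coeff_formula: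
  assumes la: "is_partition la" "\<And>i. i \<ge> N \<Longrightarrow> la i = 0"
    and mu: "is_partition mu" "\<And>i. i \<ge> N \<Longrightarrow> mu i = 0"
    and nu: "is_partition nu" "\<And>i. i \<ge> N \<Longrightarrow> nu i = 0"
    and adm: "admissible_sizes la mu nu"
  shows "fact (psize la) * int (heisenberg_coeff la mu nu) =
    (\<Sum>s | s permutes {..<N}. \<Sum>t | t permutes {..<N}. sign s * sign t *
      (\<Sum>C\<in>cell_contents N (psize la) (jt mu s) (jt nu t). kostka N la (0, 0) C))"
proof -
  let ?P = "{s. s permutes {..<N}}"
  let ?l = "psize la"
  interpret heis mu nu ?l
    using adm mu(1) nu(1) by unfold_locales (auto simp: admissible_sizes_def)
  interpret L: young la by unfold_locales (rule la(1))
  interpret Y: young_action la XX rr by unfold_locales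
  have "(fact ?l :: complex) * of_nat (heisenberg_coeff la mu nu) =
      (\<Sum>g\<in>Sym ?l. of_int (alt_count N ?l la g) * H.chr W g)"
    using Y.multiplicity_specht[OF models_W la(2)] adm by (simp add: heisenberg_coeff_def)
  also have "\<dots> = of_int (\<Sum>g\<in>Sym ?l. alt_count N ?l la g * (\<Sum>s\<in>?P. \<Sum>t\<in>?P. sign s * sign t *
    (\<Sum>C\<in>cell_contents N ?l (jt mu s) (jt nu t). int (fix_count (0, 0) ?l C g))))"
    unfolding of_int_sum of_int_mult
    using chr_W_alt[OF mu(2) nu(2)] by (intro sum.cong refl arg_cong2[where f = "(*)"]) simp
  also have "(\<Sum>g\<in>Sym ?l. alt_count N ?l la g * (\<Sum>s\<in>?P. \<Sum>t\<in>?P. sign s * sign t *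
    (\<Sum>C\<in>cell_contents N ?l (jt mu s) (jt nu t). int (fix_count (0, 0) ?l C g)))) =
    (\<Sum>g\<in>Sym ?l. \<Sum>s\<in>?P. \<Sum>t\<in>?P. \<Sum>C\<in>cell_contents N ?l (jt mu s) (jt nu t).
      sign s * sign t * (alt_count N ?l la g * int (fix_count (0, 0) ?l C g)))"
    unfolding sum_distrib_left by (intro sum.cong refl) (simp only: mult_ac)
  also have "\<dots> = (\<Sum>s\<in>?P. \<Sum>t\<in>?P. \<Sum>C\<in>cell_contents N ?l (jt mu s) (jt nu t). \<Sum>g\<in>Sym ?l.
      sign s * sign t * (alt_count N ?l la g * int (fix_count (0, 0) ?l C g)))"
    by (subst sum.swap, rule sum.cong[OF refl], subst sum.swap, rule sum.cong[OF refl], rule sum.swap)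
  also have "\<dots> = (\<Sum>s\<in>?P. \<Sum>t\<in>?P. sign s * sign t *
      (\<Sum>C\<in>cell_contents N ?l (jt mu s) (jt nu t). kostka N la (0, 0) C))"
    unfolding kostka_def sum_distrib_left ..
  finally have "(of_int (fact ?l * int (heisenberg_coeff la mu nu)) :: complex) = of_int (\<Sum>s\<in>?P. \<Sum>t\<in>?P. sign s * sign t *
      (\<Sum>C\<in>cell_contents N ?l (jt mu s) (jt nu t). kostka N la (0, 0) C))"
    by simp
  then show ?thesis by (simp only: of_int_eq_iff)
qed

section \<open>Stability of Kostka numbers\<close>

definition kos :: "nat \<Rightarrow> (nat \<Rightarrow> nat) \<Rightarrow> 'c \<Rightarrow> ('c \<Rightarrow> int) \<Rightarrow> real" where
  "kos N la d \<kappa> = of_int (kostka N la d \<kappa>) / fact (psize la)"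

text \<open>For every bound on the number of parts, \<open>alt_count\<close> is the character of the
  same Specht module.\<close>

lemma kostka_indep:
  assumes la: "is_partition la" "\<And>i. i \<ge> N \<Longrightarrow> la i = 0" "\<And>i. i \<ge> N' \<Longrightarrow> la i = 0"
  shows "kostka N la d \<kappa> = kostka N' la d \<kappa>"
proof -
  interpret young la by unfold_locales (rule la(1))
  have "alt_count N (psize la) la g = alt_count N' (psize la) la g" if "g \<in> Sym (psize la)" for g
    using chr_S_eq_alt_count[OF la(2) that] chr_S_eq_alt_count[OF la(3) that] by (simp only: of_int_eq_iff)
  then show ?thesis unfolding kostka_def by (intro sum.cong refl) simp
qed

lemma kostka_dominance:
  assumes la: "is_partition la" "\<And>i. i \<ge> N \<Longrightarrow> la i = 0" and nz: "kostka N la d \<kappa> \<noteq> 0" and J: "finite J"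
  shows "(\<Sum>c\<in>J. \<kappa> c) \<le> (\<Sum>i<card J. int (la i))"
proof -
  interpret young la by unfold_locales (rule la(1))
  show ?thesis
    using sum_alt_count_fix_count_zero[where N = N and J = J and \<kappa> = \<kappa> and d = d] la(2) J nz
    unfolding kostka_def by (meson not_le)
qed

lemma kostka_no_coloring: "colorings d (psize la) \<kappa> = {} \<Longrightarrow> kostka N la d \<kappa> = 0"
  by (simp add: kostka_def fix_count_def)

lemma kostka_nonneg: "kostka N la d \<kappa> \<noteq> 0 \<Longrightarrow> 0 \<le> \<kappa> c"
  using kostka_no_coloring colorings_content_nonneg by fast

lemma kos_self:
  assumes la: "is_partition la" "\<And>i. i \<ge> N \<Longrightarrow> la i = 0"
  shows "kos N la 0 (\<lambda>i. int (la i)) = 1"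
proof -
  interpret young la by unfold_locales (rule la(1))
  show ?thesis using sum_alt_count_fix_count_self[OF la(2)] by (simp add: kos_def kostka_def)
qed

text \<open>Recoloring along an injection that covers the support commutes with permuting positions.
  It lets matrix cells be replaced by numbers as colors.\<close>

lemma fix_count_rename:
  fixes c :: "nat \<Rightarrow> 'c"
  assumes inj: "inj_on c {..<L}" and out: "\<And>z. z \<notin> c ` {..<L} \<Longrightarrow> \<kappa> z = 0" and g: "g \<in> Sym n"
  shows "fix_count d n \<kappa> g = fix_count 0 n (\<lambda>i. if i < L then \<kappa> (c i) else 0) g"
proof -
  let ?k = "\<lambda>i. if i < L then \<kappa> (c i) else 0"
  define ci where "ci = the_inv_into {..<L} c"
  have ci: "ci (c i) = i" if "i < L" for i using that inj by (simp add: ci_def the_inv_into_f_f)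
  \<comment> \<open>Outside \<open>{1..n}\<close> the defaults are set by hand, since
    \<open>c\<close> need not take 0 to \<open>d\<close>.\<close>
  define up where "up = (\<lambda>f k. if k \<in> {1..n} then c (f k) else d)"
  define dn where "dn = (\<lambda>f k. if k \<in> {1..n} then ci (f k) else (0 :: nat))"
  have lt: "f k < L" if "f \<in> colorings 0 n ?k" "k \<in> {1..n}" for f k
    using colorings_content_pos[OF that] by (auto split: if_splits)
  have im: "f k \<in> c ` {..<L}" if "f \<in> colorings d n \<kappa>" "k \<in> {1..n}" for f k
    using colorings_content_pos[OF that] out[of "f k"] by force
  have upin: "up f \<in> colorings d n \<kappa>" if f: "f \<in> colorings 0 n ?k" for f
    unfolding colorings_def
  proof (intro CollectI conjI allI impI)
    show "up f k = d" if "k \<notin> {1..n}" for k using that by (auto simp: up_def)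
    fix z show "int (card {k\<in>{1..n}. up f k = z}) = \<kappa> z"
    proof (cases "z \<in> c ` {..<L}")
      case True
      then obtain i where i: "i < L" "z = c i" by blast
      have "{k\<in>{1..n}. up f k = z} = {k\<in>{1..n}. f k = i}"
        using lt[OF f] i inj by (auto simp: up_def inj_on_def)
      then show ?thesis using colorings_card[OF f, of i] i by simp
    next
      case False
      then have "{k\<in>{1..n}. up f k = z} = {}" using lt[OF f] by (auto simp: up_def)
      then have "card {k\<in>{1..n}. up f k = z} = 0" by (simp only: card.empty)
      then show ?thesis using out[OF False] by simp
    qed
  qed
  have dnin: "dn f \<in> colorings 0 n ?k" if f: "f \<in> colorings d n \<kappa>" for f
    unfolding colorings_def
  proof (intro CollectI conjI allI impI)
    show "dn f k = 0" if "k \<notin> {1..n}" for k using that by (auto simp: dn_def)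
    fix i show "int (card {k\<in>{1..n}. dn f k = i}) = ?k i"
    proof (cases "i < L")
      case True
      have "dn f k = i \<longleftrightarrow> f k = c i" if k: "k \<in> {1..n}" for k
      proof -
        obtain i' where i': "i' < L" "f k = c i'" using im[OF f k] by blast
        have "dn f k = i'" using k i' ci by (simp add: dn_def)
        then show ?thesis using i' inj True by (auto simp: inj_on_def)
      qed
      then have "{k\<in>{1..n}. dn f k = i} = {k\<in>{1..n}. f k = c i}" by blast
      then show ?thesis using colorings_card[OF f, of "c i"] True by simp
    next
      case False
      have "dn f k \<noteq> i" if "k \<in> {1..n}" for k
        using im[OF f that] ci False that by (auto simp: dn_def)
      then have "{k\<in>{1..n}. dn f k = i} = {}" by blast
      then have "card {k\<in>{1..n}. dn f k = i} = 0" by (simp only: card.empty)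
      then show ?thesis using False by simp
    qed
  qed
  have dnup: "dn (up f) = f" if f: "f \<in> colorings 0 n ?k" for f
  proof
    fix k show "dn (up f) k = f k"
      using lt[OF f, of k] ci colorings_default[OF f, of k] by (cases "k \<in> {1..n}") (auto simp: dn_def up_def)
  qed
  have updn: "up (dn f) = f" if f: "f \<in> colorings d n \<kappa>" for f
  proof
    fix k show "up (dn f) k = f k"
    proof (cases "k \<in> {1..n}")
      case True
      then obtain i where "i < L" "f k = c i" using im[OF f True] by blast
      then show ?thesis using True ci by (simp add: dn_def up_def)
    next
      case False
      then show ?thesis using colorings_default[OF f False] by (auto simp: up_def)
    qed
  qed
  have comp: "up f \<circ> g = up (f \<circ> g)" "dn f' \<circ> g = dn (f' \<circ> g)" for f f'
    using Sym_in[OF g] by (auto simp: up_def dn_def fun_eq_iff)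
  have "bij_betw up {f \<in> colorings 0 n ?k. f \<circ> g = f} {f \<in> colorings d n \<kappa>. f \<circ> g = f}"
    by (rule bij_betw_byWitness[where f' = dn]) (use upin dnin dnup updn comp in auto)
  then show ?thesis by (simp add: fix_count_def bij_betw_same_card)
qed

lemma kostka_rename:
  fixes c :: "nat \<Rightarrow> 'c"
  assumes "inj_on c {..<L}" "\<And>z. z \<notin> c ` {..<L} \<Longrightarrow> \<kappa> z = 0"
  shows "kostka N la d \<kappa> = kostka N la 0 (\<lambda>i. if i < L then \<kappa> (c i) else 0)"
  unfolding kostka_def using fix_count_rename[where c = c and L = L and \<kappa> = \<kappa> and d = d] assms
  by (intro sum.cong refl) simp

section \<open>Inverting the Kostka matrix\<close>

definition window :: "nat \<Rightarrow> (nat \<Rightarrow> int) \<Rightarrow> nat \<Rightarrow> int" where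
  "window L v = (\<lambda>i. if i < L then v i else 0)"

lemma kostka_perm:
  assumes w: "w permutes {..<L}"
  shows "kostka N la 0 (window L (\<lambda>i. v (w i))) = kostka N la 0 (window L v)"
proof -
  have "kostka N la 0 (window L v) = kostka N la 0 (\<lambda>i. if i < L then window L v (w i) else 0)"
  proof (rule kostka_rename)
    show "inj_on w {..<L}" using w by (rule permutes_inj_on)
    show "window L v z = 0" if "z \<notin> w ` {..<L}" for z
      using that permutes_image[OF w] by (simp add: window_def)
  qed
  also have "(\<lambda>i. if i < L then window L v (w i) else 0) = window L (\<lambda>i. v (w i))"
    using permutes_in_image[OF w] by (auto simp: window_def fun_eq_iff)
  finally show ?thesis by simp
qed

text \<open>Here the alternation runs over the content, not the shape. For a partition
  \<open>ka\<close> and \<open>v i = ka i - i\<close> it is the scalar product of the characters of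
  \<open>la\<close> and \<open>ka\<close>, summed over the group; \<open>window\<close> keeps the
  content 0 outside the \<open>L\<close> permuted colors.\<close>

definition alt_kostka :: "nat \<Rightarrow> (nat \<Rightarrow> nat) \<Rightarrow> (nat \<Rightarrow> int) \<Rightarrow> int" where
  "alt_kostka L la v = (\<Sum>s | s permutes {..<L}. sign s * kostka L la 0 (window L (\<lambda>i. v i + int (s i))))"

lemma alt_kostka_antisym:
  assumes w: "w permutes {..<L}"
  shows "alt_kostka L la (\<lambda>i. v (w i)) = sign w * alt_kostka L la v"
proof -
  have pw: "permutation w" using w by (auto simp: permutation_permutes)
  have "alt_kostka L la (\<lambda>i. v (w i)) =
      (\<Sum>s | s permutes {..<L}. sign (s \<circ> w) * kostka L la 0 (window L (\<lambda>i. v (w i) + int ((s \<circ> w) i))))"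
    unfolding alt_kostka_def
    by (rule sum.reindex_bij_witness[where i = "\<lambda>s. s \<circ> w" and j = "\<lambda>s. s \<circ> inv' w"])
       (auto simp: permutes_compose w permutes_inv comp_assoc permutes_inv_o[OF w])
  also have "\<dots> = (\<Sum>s | s permutes {..<L}. sign w * (sign s * kostka L la 0 (window L (\<lambda>i. v i + int (s i)))))"
  proof (rule sum.cong)
    fix s assume "s \<in> {s. s permutes {..<L}}"
    then have "permutation s" by (auto simp: permutation_permutes)
    then show "sign (s \<circ> w) * kostka L la 0 (window L (\<lambda>i. v (w i) + int ((s \<circ> w) i))) =
        sign w * (sign s * kostka L la 0 (window L (\<lambda>i. v i + int (s i))))"
      using kostka_perm[OF w, of L la "\<lambda>i. v i + int (s i)"] sign_compose[of s w] pw
      by (simp add: o_apply)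
  qed simp
  finally show ?thesis by (simp add: alt_kostka_def sum_distrib_left)
qed

text \<open>What orthogonality predicts, up to the factor \<open>fact (psize la)\<close>: the sign
  of the rearrangement if \<open>v\<close> rearranges the numbers \<open>la i - i\<close>, and 0
  otherwise.\<close>

definition alt_delta :: "nat \<Rightarrow> (nat \<Rightarrow> nat) \<Rightarrow> (nat \<Rightarrow> int) \<Rightarrow> int" where
  "alt_delta L la v = (\<Sum>w | w permutes {..<L}. sign w *
    (if \<forall>i<L. v i = int (la (w i)) - int (w i) then 1 else 0))"

lemma alt_delta_antisym:
  assumes w: "w permutes {..<L}"
  shows "alt_delta L la (\<lambda>i. v (w i)) = sign w * alt_delta L la v"
proof -
  have pw: "permutation w" using w by (auto simp: permutation_permutes)
  have wi: "w i < L \<longleftrightarrow> i < L" for i using permutes_in_image[OF w, of i] by simp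
  have "alt_delta L la (\<lambda>i. v (w i)) = (\<Sum>s | s permutes {..<L}. sign (s \<circ> w) *
      (if \<forall>i<L. v (w i) = int (la ((s \<circ> w) i)) - int ((s \<circ> w) i) then 1 else 0))"
    unfolding alt_delta_def
    by (rule sum.reindex_bij_witness[where i = "\<lambda>s. s \<circ> w" and j = "\<lambda>s. s \<circ> inv' w"])
       (auto simp: permutes_compose w permutes_inv comp_assoc permutes_inv_o[OF w])
  also have "\<dots> = (\<Sum>s | s permutes {..<L}. sign w * (sign s *
      (if \<forall>i<L. v i = int (la (s i)) - int (s i) then 1 else 0)))"
  proof (rule sum.cong)
    fix s assume "s \<in> {s. s permutes {..<L}}"
    then have ps: "permutation s" by (auto simp: permutation_permutes)
    have "(\<forall>i<L. v (w i) = int (la ((s \<circ> w) i)) - int ((s \<circ> w) i)) \<longleftrightarrow>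
        (\<forall>i<L. v i = int (la (s i)) - int (s i))"
    proof
      assume A: "\<forall>i<L. v (w i) = int (la ((s \<circ> w) i)) - int ((s \<circ> w) i)"
      show "\<forall>i<L. v i = int (la (s i)) - int (s i)"
      proof (intro allI impI)
        fix i assume "i < L"
        then have "inv' w i < L" using permutes_in_image[OF permutes_inv[OF w], of i] by simp
        then show "v i = int (la (s i)) - int (s i)"
          using A permutes_inverses(1)[OF w, of i] by (metis comp_apply)
      qed
    qed (simp add: wi)
    then show "sign (s \<circ> w) * (if \<forall>i<L. v (w i) = int (la ((s \<circ> w) i)) - int ((s \<circ> w) i) then 1 else 0) =
        sign w * (sign s * (if \<forall>i<L. v i = int (la (s i)) - int (s i) then 1 else 0))"
      using sign_compose[OF ps pw] by simp
  qed simp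
  finally show ?thesis by (simp add: alt_delta_def sum_distrib_left)
qed

lemma strict_dec_less:
  assumes v: "strict_dec L v" and ij: "i < j" "j < L"
  shows "v j < v i"
  using ij
proof (induction j)
  case (Suc j)
  have "v (Suc j) < v j" using v Suc.prems by (simp add: strict_dec_def)
  then show ?case using Suc by (cases "i = j") auto
qed simp

lemma partition_strict_dec:
  assumes "is_partition la"
  shows "strict_dec L (\<lambda>i. int (la i) - int i)"
  unfolding strict_dec_def
proof (intro allI impI)
  fix i
  have "la (Suc i) \<le> la i" using assms by (simp add: is_partition_def antimono_def)
  then show "int (la (Suc i)) - int (Suc i) < int (la i) - int i" by simp
qed

lemma sort_decreasing:
  assumes inj: "inj_on v {..<L}"
  obtains w where "w permutes {..<L}" "strict_dec L (\<lambda>i. (v (w i) :: int))"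
proof -
  define xs where "xs = sort_key (\<lambda>i. - v i) [0..<L]"
  have len: "length xs = L" and dist: "distinct xs" and set: "set xs = {..<L}" by (auto simp: xs_def)
  have sorted: "sorted (map (\<lambda>i. - v i) xs)" by (simp add: xs_def)
  define w where "w = (\<lambda>i. if i < L then xs ! i else i)"
  have "bij_betw ((!) xs) {..<L} {..<L}" using bij_betw_nth[OF dist] len set by simp
  then have "bij_betw w {..<L} {..<L}" by (rule bij_betw_cong[THEN iffD1, rotated]) (simp add: w_def)
  then have "w permutes {..<L}" by (intro bij_imp_permutes) (auto simp: w_def)
  moreover have "strict_dec L (\<lambda>i. v (w i))"
    unfolding strict_dec_def
  proof (intro allI impI)
    fix i assume i: "Suc i < L"
    have "- v (xs ! i) \<le> - v (xs ! Suc i)"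
      using sorted_nth_mono[OF sorted, of i "Suc i"] i len by simp
    moreover have "v (xs ! i) \<noteq> v (xs ! Suc i)"
    proof
      assume eq: "v (xs ! i) = v (xs ! Suc i)"
      have "xs ! i \<in> {..<L}" "xs ! Suc i \<in> {..<L}" using i len set by (metis Suc_lessD nth_mem)+
      then have "xs ! i = xs ! Suc i" using inj eq by (auto dest: inj_onD)
      then show False using dist i len by (simp add: nth_eq_iff_index_eq)
    qed
    ultimately show "v (w (Suc i)) < v (w i)" using i by (simp add: w_def)
  qed
  ultimately show ?thesis using that by blast
qed

text \<open>\<open>v i + i\<close> is decreasing, so it is a partition \<open>ka\<close> unless its
  last entry is negative, in which case there are no colorings. For a partition of the right size
  the characters of \<open>la\<close> and \<open>ka\<close> are orthogonal or equal; for any other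
  size colorings are again missing.\<close>

lemma alt_kostka_strict:
  assumes la: "is_partition la" "\<And>i. i \<ge> L \<Longrightarrow> la i = 0" and v: "strict_dec L v"
  shows "alt_kostka L la v = fact (psize la) * (if \<forall>i<L. v i = int (la i) - int i then 1 else 0)"
proof -
  let ?n = "psize la"
  have suml: "(\<Sum>i<L. int (la i)) = int ?n" using psize_eq_sum[of L la] la(2) by simp
  show ?thesis
  proof (cases "\<forall>i<L. 0 \<le> v i + int i")
    case False
    then obtain i where i: "i < L" "v i + int i < 0" by (auto simp: not_le)
    have dec: "v j + int j \<le> v i + int i" if "i \<le> j" "j < L" for j
      using that
    proof (induction j)
      case (Suc j)
      have "v (Suc j) < v j" using v Suc.prems by (simp add: strict_dec_def)
      then show ?case using Suc by (cases "i = Suc j") auto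
    qed simp
    \<comment> \<open>As \<open>s (L - 1) \<le> L - 1\<close>, the last entry of the content stays
      negative for every \<open>s\<close>.\<close>
    have neg: "v (L - 1) + int (L - 1) < 0" using dec[of "L - 1"] i by linarith
    have "kostka L la 0 (window L (\<lambda>i. v i + int (s i))) = 0" if s: "s permutes {..<L}" for s
    proof (rule ccontr)
      assume "kostka L la 0 (window L (\<lambda>i. v i + int (s i))) \<noteq> 0"
      then have "0 \<le> window L (\<lambda>i. v i + int (s i)) (L - 1)" by (rule kostka_nonneg)
      moreover have "s (L - 1) < L" using permutes_in_image[OF s, of "L - 1"] i by simp
      ultimately show False using neg i by (simp add: window_def)
    qed
    then have "alt_kostka L la v = 0" by (simp add: alt_kostka_def)
    moreover have "\<not> (\<forall>i<L. v i = int (la i) - int i)" using i by fastforce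
    ultimately show ?thesis by simp
  next
    case True
    define ka where "ka = (\<lambda>i. if i < L then nat (v i + int i) else 0)"
    have vi: "v i = int (ka i) - int i" if "i < L" for i using True that by (simp add: ka_def)
    have ka0: "ka i = 0" if "i \<ge> L" for i using that by (simp add: ka_def)
    have ka_dec: "ka (Suc i) \<le> ka i" for i
    proof (cases "Suc i < L")
      case True
      then have "v (Suc i) < v i" using v by (simp add: strict_dec_def)
      then show ?thesis using vi[of i] vi[of "Suc i"] True by simp
    qed (simp add: ka_def)
    have "decseq ka" using ka_dec by (rule decseq_SucI)
    then have "antimono ka" by (simp add: decseq_def antimono_def)
    moreover have "{i. ka i \<noteq> 0} \<subseteq> {..<L}" by (auto simp: ka_def)
    ultimately have ka: "is_partition ka" by (simp add: is_partition_def finite_subset[of _ "{..<L}"])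
    have winjt: "window L (\<lambda>i. v i + int (s i)) = jt ka s" if s: "s permutes {..<L}" for s
    proof
      fix i show "window L (\<lambda>i. v i + int (s i)) i = jt ka s i"
        using vi[of i] ka0[of i] permutes_not_in[OF s, of i] by (cases "i < L") (auto simp: window_def jt_def)
    qed
    have "alt_kostka L la v = (\<Sum>s | s permutes {..<L}. \<Sum>g\<in>Sym ?n. alt_count L ?n la g * (sign s * int (fix_count 0 ?n (jt ka s) g)))"
      unfolding alt_kostka_def kostka_def using winjt
      by (intro sum.cong refl) (simp add: sum_distrib_left mult_ac)
    also have "\<dots> = (\<Sum>g\<in>Sym ?n. alt_count L ?n la g * alt_count L ?n ka g)"
      unfolding alt_count_def[of L ?n ka] sum_distrib_left by (rule sum.swap)
    finally have eq: "alt_kostka L la v = (\<Sum>g\<in>Sym ?n. alt_count L ?n la g * alt_count L ?n ka g)" .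
    have iff: "(\<forall>i<L. v i = int (la i) - int i) \<longleftrightarrow> ka = la"
    proof
      assume A: "\<forall>i<L. v i = int (la i) - int i"
      show "ka = la"
      proof
        fix i show "ka i = la i" using A vi[of i] ka0[of i] la(2)[of i] by (cases "i < L") auto
      qed
    qed (use vi in auto)
    show ?thesis
    proof (cases "(\<Sum>i<L. int (ka i)) = int ?n")
      case sz: True
      have pk: "psize ka = ?n" using psize_eq_sum[of L ka] ka0 sz by (simp flip: of_nat_sum)
      show ?thesis
      proof (cases "ka = la")
        case True
        then have "\<forall>i<L. v i = int (la i) - int i" using iff by simp
        moreover have "(\<Sum>g\<in>Sym ?n. alt_count L ?n la g * alt_count L ?n la g) = fact ?n"
          by (rule alt_count_norm) (use la suml in \<open>auto simp: is_partition_def\<close>)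
        ultimately show ?thesis using eq True by simp
      next
        case False
        then have "\<not> (\<forall>i<L. v i = int (la i) - int i)" using iff by simp
        moreover have "(\<Sum>g\<in>Sym ?n. alt_count L ?n la g * alt_count L ?n ka g) = 0"
          by (rule sum_alt_count_orthogonal) (use la ka ka0 pk False in auto)
        ultimately show ?thesis using eq by simp
      qed
    next
      case False
      have empty: "colorings 0 ?n (jt ka s) = {}" if s: "s permutes {..<L}" for s
      proof (rule ccontr)
        assume "colorings 0 ?n (jt ka s) \<noteq> {}"
        then obtain f where f: "f \<in> colorings 0 ?n (jt ka s)" by blast
        have "(\<Sum>i<L. jt ka s i) = int ?n"
          by (rule colorings_content_total[OF f]) (use jt_support[OF s ka0] in auto)
        then show False using False jt_sum[OF s, of ka] by simp
      qed
      have "alt_kostka L la v = 0"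
        unfolding alt_kostka_def
      proof (intro sum.neutral ballI)
        fix s assume "s \<in> {s. s permutes {..<L}}"
        then have s: "s permutes {..<L}" by simp
        have "kostka L la 0 (jt ka s) = 0" by (rule kostka_no_coloring[OF empty[OF s]])
        then show "sign s * kostka L la 0 (window L (\<lambda>i. v i + int (s i))) = 0" using winjt[OF s] by simp
      qed
      moreover have "ka \<noteq> la" using False suml by auto
      ultimately show ?thesis using iff by simp
    qed
  qed
qed

text \<open>The numbers \<open>la i - i\<close> decrease strictly already, so a strictly decreasing
  rearrangement of them is the trivial one.\<close>

lemma alt_delta_strict:
  assumes la: "is_partition la" and v: "strict_dec L v"
  shows "alt_delta L la v = (if \<forall>i<L. v i = int (la i) - int i then 1 else 0)"
proof -
  have *: "(\<forall>i<L. v i = int (la (w i)) - int (w i)) \<longleftrightarrow> w = id \<and> (\<forall>i<L. v i = int (la i) - int i)"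
    if w: "w permutes {..<L}" for w
  proof
    assume A: "\<forall>i<L. v i = int (la (w i)) - int (w i)"
    have wl: "w i < L" if "i < L" for i using permutes_in_image[OF w, of i] that by simp
    have mono: "w i < w (Suc i)" if i: "Suc i < L" for i
    proof (rule ccontr)
      assume "\<not> w i < w (Suc i)"
      moreover have "w i \<noteq> w (Suc i)" using inj_eq[OF permutes_inj[OF w], of i "Suc i"] by simp
      ultimately have "int (la (w i)) - int (w i) < int (la (w (Suc i))) - int (w (Suc i))"
        using strict_dec_less[OF partition_strict_dec[OF la], of "w (Suc i)" "w i" L] wl[of i] i by simp
      moreover have "v (Suc i) < v i" using v i by (simp add: strict_dec_def)
      ultimately show False using A i by simp
    qed
    have ge: "i < L \<longrightarrow> i \<le> w i" for i
    proof (induction i)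
      case (Suc i) then show ?case using mono[of i] by auto
    qed simp
    have "int i = int (w i)" if "i < L" for i
      by (rule sum_mono_inv[of int "{..<L}" "\<lambda>i. int (w i)"]) (use permutes_sum_id[OF w] ge that in auto)
    then have "w i = i" for i using permutes_not_in[OF w, of i] by (cases "i < L") auto
    then have "w = id" by auto
    then show "w = id \<and> (\<forall>i<L. v i = int (la i) - int i)" using A by simp
  qed simp
  have "alt_delta L la v = (\<Sum>w | w permutes {..<L}. if w = id then (if \<forall>i<L. v i = int (la i) - int i then 1 else 0) else 0)"
    unfolding alt_delta_def
  proof (rule sum.cong[OF refl])
    fix w assume "w \<in> {w. w permutes {..<L}}"
    then have "w permutes {..<L}" by simp
    from *[OF this] show "sign w * (if \<forall>i<L. v i = int (la (w i)) - int (w i) then 1 else 0) =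
        (if w = id then (if \<forall>i<L. v i = int (la i) - int i then 1 else 0) else 0)"
      by (cases "w = id") (simp_all only: if_True if_False simp_thms sign_id mult_1 mult_zero_right)
  qed
  then show ?thesis by (simp add: finite_permutations permutes_id)
qed

text \<open>Both sides are antisymmetric in \<open>v\<close>. They vanish if two entries agree;
  otherwise \<open>v\<close> can be sorted into strictly decreasing order.\<close>

theorem alt_kostka_eq:
  assumes la: "is_partition la" "\<And>i. i \<ge> L \<Longrightarrow> la i = 0"
  shows "alt_kostka L la v = fact (psize la) * alt_delta L la v"
proof (cases "inj_on v {..<L}")
  case True
  obtain w where w: "w permutes {..<L}" "strict_dec L (\<lambda>i. v (w i))" using sort_decreasing[OF True] .
  have "sign w * alt_kostka L la v = sign w * (fact (psize la) * alt_delta L la v)"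
    using alt_kostka_strict[OF la w(2)] alt_delta_strict[OF la(1) w(2)]
      alt_kostka_antisym[OF w(1), of la v] alt_delta_antisym[OF w(1), of la v] by simp
  then show ?thesis by simp
next
  case False
  then obtain i j where ij: "i < L" "j < L" "v i = v j" "i \<noteq> j" by (auto simp: inj_on_def)
  let ?t = "transpose i j"
  have t: "?t permutes {..<L}" using ij by (intro permutes_swap_id) auto
  have vt: "(\<lambda>k. v (?t k)) = v" using ij by (auto simp: fun_eq_iff transpose_def)
  have "sign ?t = -1" using ij by (simp add: sign_swap_id)
  then have "alt_kostka L la v = 0" "alt_delta L la v = 0"
    using alt_kostka_antisym[OF t, of la v] alt_delta_antisym[OF t, of la v] unfolding vt by simp_all
  then show ?thesis by simp
qed

section \<open>Eventually constant sequences\<close>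

definition ev_const :: "(nat \<Rightarrow> 'a) \<Rightarrow> bool" where
  "ev_const f \<longleftrightarrow> (\<exists>c. \<forall>\<^sub>F n in sequentially. f n = c)"

lemma ev_constI: "(\<And>n. f n = c) \<Longrightarrow> ev_const f"
  by (auto simp: ev_const_def)

lemma ev_const_comp2:
  assumes "ev_const f" "ev_const g"
  shows "ev_const (\<lambda>n. h (f n) (g n))"
proof -
  obtain c d where "\<forall>\<^sub>F n in sequentially. f n = c" "\<forall>\<^sub>F n in sequentially. g n = d"
    using assms by (auto simp: ev_const_def)
  then have "\<forall>\<^sub>F n in sequentially. h (f n) (g n) = h c d" by eventually_elim simp
  then show ?thesis by (auto simp: ev_const_def)
qed

lemma ev_const_add: "ev_const f \<Longrightarrow> ev_const g \<Longrightarrow> ev_const (\<lambda>n. f n + g n)"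
  and ev_const_diff: "ev_const f' \<Longrightarrow> ev_const g' \<Longrightarrow> ev_const (\<lambda>n. f' n - g' n)"
  and ev_const_conj: "ev_const P \<Longrightarrow> ev_const Q \<Longrightarrow> ev_const (\<lambda>n. P n \<and> Q n)"
  using ev_const_comp2[of f g "(+)"] ev_const_comp2[of f' g' "(-)"] ev_const_comp2[of P Q "(\<and>)"] by blast+

lemma ev_const_comp: "ev_const f \<Longrightarrow> ev_const (\<lambda>n. h (f n))"
  using ev_const_comp2[of f f "\<lambda>x y. h x"] by blast

lemma ev_const_cmult: "ev_const f \<Longrightarrow> ev_const (\<lambda>n. c * f n)"
  by (rule ev_const_comp[where h = "(*) c"])

lemma ev_const_if: "ev_const P \<Longrightarrow> ev_const (\<lambda>n. if P n then a else b)"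
  by (rule ev_const_comp[where h = "\<lambda>p. if p then a else b"])

lemma ev_const_sum:
  fixes f :: "'i \<Rightarrow> nat \<Rightarrow> 'b :: comm_monoid_add"
  assumes "\<And>i. i \<in> I \<Longrightarrow> ev_const (f i)"
  shows "ev_const (\<lambda>n. \<Sum>i\<in>I. f i n)"
  using assms
proof (induction I rule: infinite_finite_induct)
  case (insert x I)
  then have "ev_const (\<lambda>n. f x n + (\<Sum>i\<in>I. f i n))" by (intro ev_const_add) auto
  then show ?case using insert by simp
qed (auto intro: ev_constI)

lemma ev_const_all:
  fixes L :: nat
  assumes "\<And>i. i < L \<Longrightarrow> ev_const (P i)"
  shows "ev_const (\<lambda>n. \<forall>i<L. P i n)"
  using assms
proof (induction L)
  case (Suc L)
  then have "ev_const (\<lambda>n. (\<forall>i<L. P i n) \<and> P L n)" by (intro ev_const_conj) auto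
  then show ?case by (simp add: less_Suc_eq conj_comms ball_conj_distrib imp_disjL all_conj_distrib)
qed (auto intro: ev_constI)

lemma ev_const_linear: "ev_const (\<lambda>n. int n * a = b)"
proof (cases "a = 0")
  case True
  then show ?thesis by (intro ev_constI[of _ "0 = b"]) simp
next
  case False
  have "\<not> int n * a = b" if "n > nat \<bar>b\<bar>" for n
  proof
    assume "int n * a = b"
    then have "\<bar>b\<bar> = int n * \<bar>a\<bar>" by (simp add: abs_mult flip: \<open>int n * a = b\<close>)
    moreover have "int n * 1 \<le> int n * \<bar>a\<bar>" using False by (intro mult_left_mono) auto
    moreover have "\<bar>b\<bar> < int n" using that by linarith
    ultimately show False by linarith
  qed
  then have "\<forall>\<^sub>F n in sequentially. (int n * a = b) = False"
    unfolding eventually_sequentially by (metis Suc_le_lessD)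
  then show ?thesis unfolding ev_const_def by blast
qed

text \<open>Solving \<open>alt_kostka_eq\<close> for the term \<open>s = id\<close> expresses the
  Kostka number of the deviation \<open>C\<close> through those of the deviations
  \<open>C - id + s\<close>. These are higher in dominance order, so the recursion ends where
  dominance fails and the numbers vanish for all \<open>n\<close>.\<close>

theorem ev_const_kos:
  assumes la: "is_partition la" "\<And>i. i \<ge> L \<Longrightarrow> la i = 0"
    and al: "is_partition al" "\<And>i. i \<ge> L \<Longrightarrow> al i = 0"
  shows "ev_const (\<lambda>n. kos L (\<lambda>i. la i + n * al i) 0 (window L (\<lambda>i. int (n * al i) + C i)))"
proof -
  let ?la = "\<lambda>n i. la i + n * al i"
  have p: "is_partition (?la n)" for n
  proof -
    have "i < L" if "?la n i \<noteq> 0" for i using la(2)[of i] al(2)[of i] that by (cases "i < L") auto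
    then have "{i. ?la n i \<noteq> 0} \<subseteq> {..<L}" by blast
    then have "finite {i. ?la n i \<noteq> 0}" by (rule finite_subset) simp
    moreover have "antimono (?la n)"
      using la(1) al(1) by (auto simp: is_partition_def antimono_def intro!: add_mono)
    ultimately show ?thesis by (simp add: is_partition_def)
  qed
  have z: "?la n i = 0" if "i \<ge> L" for n i using that la(2) al(2) by simp
  define f where "f = (\<lambda>C n. kos L (?la n) 0 (window L (\<lambda>i. int (n * al i) + C i)))"
  \<comment> \<open>Total slack in the dominance inequalities. The multiples of \<open>al\<close>
    occur in shape and content alike and cancel, so the slack does not involve
    \<open>n\<close>.\<close>
  define D where "D = (\<lambda>C. \<Sum>j\<le>L. \<Sum>i<j. int (la i) - C i)"
  have "ev_const (f C)" for C
  \<comment> \<open>The \<open>+ 1\<close> makes the measure drop also when the slack falls from 0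
    to a negative value.\<close>
  proof (induction "nat (D C + 1)" arbitrary: C rule: less_induct)
    case less
    show ?case
    proof (cases "\<forall>j\<le>L. (\<Sum>i<j. C i) \<le> (\<Sum>i<j. int (la i))")
      case False
      then obtain j where j: "j \<le> L" "(\<Sum>i<j. int (la i)) < (\<Sum>i<j. C i)" by (auto simp: not_le)
      have "f C n = 0" for n
      proof -
        have "(\<Sum>i<j. window L (\<lambda>i. int (n * al i) + C i) i) = (\<Sum>i<j. int (n * al i) + C i)"
          using j(1) by (intro sum.cong refl) (simp add: window_def)
        also have "\<dots> > (\<Sum>i<card {..<j}. int (?la n i))"
          using j(2) by (simp add: sum.distrib)
        finally have "kostka L (?la n) 0 (window L (\<lambda>i. int (n * al i) + C i)) = 0"
          using kostka_dominance[where la = "?la n" and N = L and d = 0 and J = "{..<j}"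
              and \<kappa> = "window L (\<lambda>i. int (n * al i) + C i)"] p z by force
        then show ?thesis by (simp add: f_def kos_def)
      qed
      then show ?thesis by (rule ev_constI)
    next
      case True
      have D0: "0 \<le> D C" unfolding D_def by (rule sum_nonneg) (use True in \<open>simp add: sum_subtractf\<close>)
      let ?P = "{s. s permutes {..<L}}"
      let ?C = "\<lambda>s i. C i - int i + int (s i)"
      let ?E = "\<lambda>n. alt_delta L (?la n) (\<lambda>i. int (n * al i) + C i - int i)"
      have Dless: "D (?C s) < D C" if s: "s permutes {..<L}" "s \<noteq> id" for s
      proof -
        have le: "(\<Sum>i<j. int (la i) - ?C s i) \<le> (\<Sum>i<j. int (la i) - C i)" for j
          using permutes_partial_sum[OF s(1), of j] by (simp add: sum_subtractf sum.distrib)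
        obtain j where j: "j \<le> L" "(\<Sum>i<j. int i) < (\<Sum>i<j. int (s i))"
          using permutes_dominated_id[OF s(1)] s(2) by (meson not_le)
        then have "(\<Sum>i<j. int (la i) - ?C s i) < (\<Sum>i<j. int (la i) - C i)"
          by (simp add: sum_subtractf sum.distrib)
        then show ?thesis unfolding D_def using le j(1) by (intro sum_strict_mono_ex1) auto
      qed
      have rec: "f C n = of_int (?E n) - (\<Sum>s\<in>?P - {id}. of_int (sign s) * f (?C s) n)" for n
      proof -
        have "alt_kostka L (?la n) (\<lambda>i. int (n * al i) + C i - int i) = fact (psize (?la n)) * ?E n"
          by (rule alt_kostka_eq) (use p z in auto)
        then have "real_of_int (alt_kostka L (?la n) (\<lambda>i. int (n * al i) + C i - int i)) = fact (psize (?la n)) * of_int (?E n)"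
          by (simp only: of_int_mult of_int_fact)
        then have "real_of_int (?E n) = of_int (alt_kostka L (?la n) (\<lambda>i. int (n * al i) + C i - int i)) / fact (psize (?la n))"
          by (simp only: nonzero_mult_div_cancel_left[OF fact_nonzero])
        also have "\<dots> = (\<Sum>s\<in>?P. of_int (sign s) * f (?C s) n)"
          unfolding alt_kostka_def f_def kos_def
          by (simp add: sum_divide_distrib algebra_simps)
        also have "\<dots> = f (?C id) n + (\<Sum>s\<in>?P - {id}. of_int (sign s) * f (?C s) n)"
          by (subst sum.remove[of _ id]) (auto simp: finite_permutations permutes_id)
        finally show ?thesis by simp
      qed
      have "ev_const (\<lambda>n. \<Sum>s\<in>?P - {id}. of_int (sign s) * f (?C s) n)"
      proof (rule ev_const_sum)
        fix s assume "s \<in> ?P - {id}"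
        then have "D (?C s) < D C" using Dless by blast
        then have "nat (D (?C s) + 1) < nat (D C + 1)" using D0 by simp
        then have "ev_const (f (?C s))" by (rule less)
        then show "ev_const (\<lambda>n. of_int (sign s) * f (?C s) n)" by (rule ev_const_cmult)
      qed
      moreover have "ev_const (\<lambda>n. of_int (?E n) :: real)"
      proof (rule ev_const_comp[where h = of_int])
        show "ev_const ?E"
          unfolding alt_delta_def
        proof (rule ev_const_sum)
          fix w assume "w \<in> ?P"
          \<comment> \<open>For each \<open>i\<close> the condition is one linear equation in
            \<open>n\<close>, with slope \<open>al i - al (w i)\<close>: it holds always, never, or
            for a single \<open>n\<close>.\<close>
          have "ev_const (\<lambda>n. \<forall>i<L. int n * (int (al i) - int (al (w i))) = int (la (w i)) - int (w i) - C i + int i)"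
            by (intro ev_const_all ev_const_linear)
          moreover have "\<And>n i. int n * (int (al i) - int (al (w i))) = int (la (w i)) - int (w i) - C i + int i \<longleftrightarrow>
              int (n * al i) + C i - int i = int (?la n (w i)) - int (w i)"
            by (simp add: algebra_simps)
          ultimately have "ev_const (\<lambda>n. \<forall>i<L. int (n * al i) + C i - int i = int (?la n (w i)) - int (w i))"
            by simp
          then show "ev_const (\<lambda>n. sign w * (if \<forall>i<L. int (n * al i) + C i - int i = int (?la n (w i)) - int (w i) then 1 else 0))"
            by (intro ev_const_cmult ev_const_if)
        qed
      qed
      ultimately have "ev_const (\<lambda>n. of_int (?E n) - (\<Sum>s\<in>?P - {id}. of_int (sign s) * f (?C s) n))"
        by (intro ev_const_diff)
      then show ?thesis by (simp only: rec[symmetric])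
    qed
  qed
  then show ?thesis by (simp add: f_def)
qed

section \<open>Additive weights\<close>

lemma abel_sum:
  fixes w C :: "nat \<Rightarrow> real"
  shows "(\<Sum>i<Suc m. w i * C i) =
    (\<Sum>k<m. (w k - w (Suc k)) * (\<Sum>i<Suc k. C i)) + w m * (\<Sum>i<Suc m. C i)"
  by (induction m) (simp_all add: algebra_simps)

text \<open>Abel summation writes the right-hand side as a sum of nonnegative terms, a weight drop
  times the slack \<open>\<Lambda>\<close> minus partial sum, so it bounds each of them. By
  \<open>B\<close> the entry \<open>C i\<close> is at most the slack just before the weight level of
  \<open>i\<close>.\<close>

lemma weighted_defect:
  fixes w C :: "nat \<Rightarrow> real"
  assumes dec: "\<And>i j. i \<le> j \<Longrightarrow> j \<le> m \<Longrightarrow> w j \<le> w i"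
    and A: "\<And>k. k \<le> Suc m \<Longrightarrow> (\<Sum>j<k. C j) \<le> \<Lambda>"
    and B: "\<And>i k. i \<le> m \<Longrightarrow> k \<le> i \<Longrightarrow> w k = w i \<Longrightarrow> (\<Sum>j<k. C j) + C i \<le> \<Lambda>"
    and i: "i \<le> m"
  shows "C i \<le> \<Lambda> \<or> (\<exists>k<m. w (Suc k) < w k \<and>
    (w k - w (Suc k)) * C i \<le> \<Lambda> * (w 0 - w m) + w m * (\<Sum>j<Suc m. C j) - (\<Sum>j<Suc m. w j * C j))"
proof -
  \<comment> \<open>The first index of the weight level of \<open>i\<close>. If it is positive, the
    weight drops strictly just before it.\<close>
  define k0 where "k0 = (LEAST k. w k = w i)"
  have k0: "w k0 = w i" unfolding k0_def by (rule LeastI) (rule refl)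
  have k0i: "k0 \<le> i" unfolding k0_def by (rule Least_le) (rule refl)
  show ?thesis
  proof (cases k0)
    case 0
    then show ?thesis using B[OF i k0i k0] by simp
  next
    case (Suc k)
    have k: "k < m" using Suc k0i i by simp
    have "w k \<noteq> w i" using Suc not_less_Least[of k "\<lambda>k. w k = w i"] by (simp add: k0_def)
    then have gap: "w (Suc k) < w k" using dec[of k "Suc k"] k k0 Suc by simp
    let ?g = "\<lambda>k. (w k - w (Suc k)) * (\<Lambda> - (\<Sum>j<Suc k. C j))"
    have "?g k \<le> (\<Sum>k<m. ?g k)"
      by (rule member_le_sum) (use k dec A in \<open>auto intro!: mult_nonneg_nonneg simp del: sum.lessThan_Suc\<close>)
    also have "\<dots> = \<Lambda> * (\<Sum>k<m. w k - w (Suc k)) - (\<Sum>k<m. (w k - w (Suc k)) * (\<Sum>j<Suc k. C j))"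
      by (simp only: right_diff_distrib[of _ \<Lambda>] sum_subtractf[of "\<lambda>k. (w k - w (Suc k)) * \<Lambda>"]
        sum_distrib_right[of _ _ \<Lambda>] mult.commute[of \<Lambda>])
    also have "(\<Sum>k<m. w k - w (Suc k)) = w 0 - w m" by (rule sum_lessThan_telescope')
    also have "(\<Sum>k<m. (w k - w (Suc k)) * (\<Sum>j<Suc k. C j)) =
        (\<Sum>j<Suc m. w j * C j) - w m * (\<Sum>j<Suc m. C j)" using abel_sum[of w C m] by linarith
    finally have 1: "?g k \<le> \<Lambda> * (w 0 - w m) - ((\<Sum>j<Suc m. w j * C j) - w m * (\<Sum>j<Suc m. C j))" .
    have "C i \<le> \<Lambda> - (\<Sum>j<Suc k. C j)" using B[OF i k0i k0] unfolding Suc by linarith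
    then have "(w k - w (Suc k)) * C i \<le> ?g k" using gap by (intro mult_left_mono) auto
    with 1 gap k show ?thesis by (intro disjI2 exI[of _ k]) linarith
  qed
qed

text \<open>Upper bounds come from \<open>weighted_defect\<close>, whose right-hand side depends on
  \<open>C\<close> only through the fixed totals \<open>\<tau>\<close> and \<open>T\<close>. Lower
  bounds follow because the entries sum to \<open>\<tau>\<close>. The point is that \<open>M\<close>
  precedes \<open>C\<close>.\<close>

lemma weighted_bound:
  fixes w :: "nat \<Rightarrow> real"
  assumes dec: "\<And>i j. i \<le> j \<Longrightarrow> j \<le> m \<Longrightarrow> w j \<le> w i"
  obtains M where "\<And>C i. (\<And>k. k \<le> Suc m \<Longrightarrow> (\<Sum>j<k. C j) \<le> \<Lambda>) \<Longrightarrow>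
    (\<And>i k. i \<le> m \<Longrightarrow> k \<le> i \<Longrightarrow> w k = w i \<Longrightarrow> (\<Sum>j<k. C j) + C i \<le> \<Lambda>) \<Longrightarrow>
    (\<Sum>j<Suc m. C j) = \<tau> \<Longrightarrow> (\<Sum>j<Suc m. w j * C j) = T \<Longrightarrow> i \<le> m \<Longrightarrow> \<bar>C i\<bar> \<le> M"
proof -
  define D where "D = \<bar>\<Lambda> * (w 0 - w m) + w m * \<tau> - T\<bar>"
  \<comment> \<open>Summing over all positions avoids choosing the drop; where the weight stays
    level the term is \<open>D / 0 = 0\<close>.\<close>
  define U where "U = \<bar>\<Lambda>\<bar> + (\<Sum>k<m. D / \<bar>w k - w (Suc k)\<bar>)"
  have D0: "0 \<le> D" by (simp add: D_def)
  have U0: "0 \<le> U" unfolding U_def by (intro add_nonneg_nonneg sum_nonneg divide_nonneg_nonneg) (auto simp: D0)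
  have *: "C i \<le> U"
    if A: "\<And>k. k \<le> Suc m \<Longrightarrow> (\<Sum>j<k. C j) \<le> \<Lambda>"
      and B: "\<And>i k. i \<le> m \<Longrightarrow> k \<le> i \<Longrightarrow> w k = w i \<Longrightarrow> (\<Sum>j<k. C j) + C i \<le> \<Lambda>"
      and eq: "(\<Sum>j<Suc m. C j) = \<tau>" "(\<Sum>j<Suc m. w j * C j) = T" and i: "i \<le> m" for C i
  proof -
    have "C i \<le> \<Lambda> \<or> (\<exists>k<m. w (Suc k) < w k \<and>
        (w k - w (Suc k)) * C i \<le> \<Lambda> * (w 0 - w m) + w m * (\<Sum>j<Suc m. C j) - (\<Sum>j<Suc m. w j * C j))"
      by (rule weighted_defect) (use dec A B i in blast)+
    then show ?thesis
    proof (elim disjE exE conjE)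
      assume "C i \<le> \<Lambda>"
      moreover have "0 \<le> (\<Sum>k<m. D / \<bar>w k - w (Suc k)\<bar>)"
        by (intro sum_nonneg divide_nonneg_nonneg) (auto simp: D0)
      ultimately show ?thesis unfolding U_def by linarith
    next
      fix k assume k: "k < m" "w (Suc k) < w k" and
        le: "(w k - w (Suc k)) * C i \<le> \<Lambda> * (w 0 - w m) + w m * (\<Sum>j<Suc m. C j) - (\<Sum>j<Suc m. w j * C j)"
      have "(w k - w (Suc k)) * C i \<le> D" using le unfolding eq D_def by linarith
      then have "C i \<le> D / \<bar>w k - w (Suc k)\<bar>" using k by (simp add: field_simps)
      also have "\<dots> \<le> (\<Sum>k<m. D / \<bar>w k - w (Suc k)\<bar>)"
        by (rule member_le_sum) (use k D0 in auto)
      finally show ?thesis unfolding U_def by linarith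
    qed
  qed
  show ?thesis
  proof (rule that[of "real m * U + \<bar>\<tau>\<bar> + U"])
    fix C i
    assume A: "\<And>k. k \<le> Suc m \<Longrightarrow> (\<Sum>j<k. C j) \<le> \<Lambda>"
      and B: "\<And>i k. i \<le> m \<Longrightarrow> k \<le> i \<Longrightarrow> w k = w i \<Longrightarrow> (\<Sum>j<k. C j) + C i \<le> \<Lambda>"
      and eq: "(\<Sum>j<Suc m. C j) = \<tau>" "(\<Sum>j<Suc m. w j * C j) = T" and i: "i \<le> m"
    have u: "C j \<le> U" if "j \<le> m" for j by (rule *) (use A B eq that in blast)+
    have "\<tau> = C i + (\<Sum>j\<in>{..<Suc m} - {i}. C j)"
      unfolding eq(1)[symmetric] using i by (intro sum.remove) auto
    also have "(\<Sum>j\<in>{..<Suc m} - {i}. C j) \<le> (\<Sum>j\<in>{..<Suc m} - {i}. U)"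
      by (rule sum_mono) (use u in auto)
    also have "\<dots> = real m * U" using i by simp
    finally have "- (real m * U) + \<tau> \<le> C i" by simp
    moreover have "0 \<le> real m * U" using U0 by simp
    ultimately show "\<bar>C i\<bar> \<le> real m * U + \<bar>\<tau>\<bar> + U" using u[OF i] U0 by linarith
  qed
qed

text \<open>A rearrangement inequality: Abel summation with total 0, where the partial sums are
  nonnegative by \<open>permutes_partial_sum\<close>.\<close>

lemma decreasing_weights_perm_nonneg:
  fixes v :: "nat \<Rightarrow> real"
  assumes dec: "\<And>i j. i \<le> j \<Longrightarrow> v j \<le> v i" and s: "s permutes {..<N}"
  shows "0 \<le> (\<Sum>i<N. v i * (real (s i) - real i))"
proof (cases N)
  case (Suc m)
  have S: "0 \<le> (\<Sum>i<k. real (s i) - real i)" for k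
  proof -
    have "real_of_int (\<Sum>i<k. int i) \<le> real_of_int (\<Sum>i<k. int (s i))"
      using permutes_partial_sum[OF s] by (rule of_int_le_iff[THEN iffD2])
    then show ?thesis by (simp add: sum_subtractf)
  qed
  have "(\<Sum>i<N. int (s i)) = (\<Sum>i<N. int i)" using permutes_sum_id[OF s] by simp
  then have "real_of_int (\<Sum>i<N. int (s i)) = real_of_int (\<Sum>i<N. int i)" by simp
  then have tot: "(\<Sum>i<N. real (s i) - real i) = 0" by (simp add: sum_subtractf)
  have "0 \<le> (\<Sum>k<m. (v k - v (Suc k)) * (\<Sum>i<Suc k. real (s i) - real i))"
    by (intro sum_nonneg mult_nonneg_nonneg S) (simp add: dec)
  then show ?thesis unfolding Suc abel_sum using tot unfolding Suc by simp
qed simp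

text \<open>Within a column the total weights compare as \<open>x\<close> does, so a row of larger
  weight is entrywise at least as large. Coinciding rows may still have been given different
  weights; they all receive that of the first among them. \<open>y\<close> is left alone, so that
  the columns can be treated in a second application. Indices beyond \<open>p\<close> are
  padding.\<close>

lemma normalize_weights:
  fixes x y :: "nat \<Rightarrow> real" and A :: "nat \<Rightarrow> nat \<Rightarrow> nat" and \<beta> :: "nat \<Rightarrow> nat"
  assumes add: "\<And>i j k l. i \<le> p \<Longrightarrow> j \<le> q \<Longrightarrow> k \<le> p \<Longrightarrow> l \<le> q \<Longrightarrow> (i, j) \<noteq> (0, 0) \<Longrightarrow> (k, l) \<noteq> (0, 0) \<Longrightarrow>
      A k l < A i j \<Longrightarrow> x k + y l < x i + y j"
    and row: "\<And>i. i < p \<Longrightarrow> (\<Sum>j\<le>q. A (Suc i) j) = \<beta> i" and anti: "antimono \<beta>"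
    and x0: "x 0 = 0" and M: "(\<Sum>i\<le>p. \<bar>x i\<bar>) \<le> M"
  obtains X where "X 0 = 0" "\<And>i. i > p \<Longrightarrow> X i = - M" "\<And>i. i \<le> p \<Longrightarrow> \<bar>X i\<bar> \<le> (\<Sum>i\<le>p. \<bar>x i\<bar>)"
    "\<And>i j. i \<le> j \<Longrightarrow> X (Suc j) \<le> X (Suc i)"
    "\<And>i j k l. i \<le> p \<Longrightarrow> j \<le> q \<Longrightarrow> k \<le> p \<Longrightarrow> l \<le> q \<Longrightarrow> (i, j) \<noteq> (0, 0) \<Longrightarrow> (k, l) \<noteq> (0, 0) \<Longrightarrow>
      A k l < A i j \<Longrightarrow> X k + y l < X i + y j"
proof -
  have le: "A (Suc i) j \<le> A (Suc i') j" if "x (Suc i) \<le> x (Suc i')" "i < p" "i' < p" "j \<le> q" for i i' j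
    using add[of "Suc i" j "Suc i'" j] that by (force simp: not_less[symmetric])
  have strict: "x (Suc i') < x (Suc i)" if i: "i < p" "i' < p" "\<beta> i' < \<beta> i" for i i'
  proof (rule ccontr)
    assume "\<not> x (Suc i') < x (Suc i)"
    then have "(\<Sum>j\<le>q. A (Suc i) j) \<le> (\<Sum>j\<le>q. A (Suc i') j)" by (intro sum_mono le) (use i in auto)
    then show False using i row by simp
  qed
  have same: "A (Suc i) j = A (Suc i') j" if i: "i < p" "i' < p" "\<beta> i' = \<beta> i" "j \<le> q" for i i' j
  proof -
    have *: "A (Suc i) j = A (Suc i') j" if le': "x (Suc i) \<le> x (Suc i')" and i: "i < p" "i' < p" "\<beta> i' = \<beta> i" for i i'
    proof (rule ccontr)
      assume "A (Suc i) j \<noteq> A (Suc i') j"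
      then have "A (Suc i) j < A (Suc i') j" using le[OF le' i(1,2) \<open>j \<le> q\<close>] by simp
      then have "(\<Sum>j\<le>q. A (Suc i) j) < (\<Sum>j\<le>q. A (Suc i') j)"
        using le[OF le' i(1,2)] \<open>j \<le> q\<close> by (intro sum_strict_mono_ex1) auto
      then show False using i row by simp
    qed
    show ?thesis using *[of i i'] *[of i' i] i by (cases "x (Suc i) \<le> x (Suc i')") auto
  qed
  \<comment> \<open>The first index with the same sum is a common representative of coinciding rows,
    and being at most \<open>i\<close> it stays below \<open>p\<close>.\<close>
  define rep where "rep i = (LEAST i'. \<beta> i' = \<beta> i)" for i
  have rep: "\<beta> (rep i) = \<beta> i" "rep i \<le> i" for i
    unfolding rep_def by (rule LeastI Least_le, rule refl)+
  define X where "X i = (case i of 0 \<Rightarrow> 0 | Suc k \<Rightarrow> if k < p then x (Suc (rep k)) else - M)" for i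
  define r where "r i = (case i of 0 \<Rightarrow> 0 | Suc k \<Rightarrow> Suc (rep k))" for i
  have Xr: "X i = x (r i)" "r i \<le> p" "r i = 0 \<longleftrightarrow> i = 0" if "i \<le> p" for i
    using that x0 rep(2)[of "i - 1"] by (auto simp: X_def r_def split: nat.splits)
  have Ar: "A (r i) j = A i j" if "i \<le> p" "j \<le> q" for i j
  proof (cases i)
    case (Suc k)
    then show ?thesis using same[of k "rep k" j] that rep[of k] by (simp add: r_def)
  qed (simp add: r_def)
  have abs: "\<bar>X i\<bar> \<le> (\<Sum>i\<le>p. \<bar>x i\<bar>)" if "i \<le> p" for i
    unfolding Xr(1)[OF that] by (rule member_le_sum) (use Xr(2)[OF that] in auto)
  show thesis
  proof (rule that[of X])
    show "X 0 = 0" by (simp add: X_def)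
    show "X i = - M" if "i > p" for i using that by (auto simp: X_def split: nat.splits)
    show "\<bar>X i\<bar> \<le> (\<Sum>i\<le>p. \<bar>x i\<bar>)" if "i \<le> p" for i using abs[OF that] .
    show "X (Suc j) \<le> X (Suc i)" if "i \<le> j" for i j
    proof (cases "j < p")
      case True
      have "\<beta> j \<le> \<beta> i" using anti that by (rule antimonoD)
      then consider "\<beta> j = \<beta> i" | "\<beta> j < \<beta> i" by linarith
      then show ?thesis
      proof cases
        case 1 then show ?thesis using True that by (simp add: X_def rep_def)
      next
        case 2
        then have "x (Suc (rep j)) < x (Suc (rep i))"
          using True that rep[of i] rep[of j] by (intro strict) auto
        then show ?thesis using True that by (simp add: X_def)
      qed
    next
      case False
      then have "X (Suc j) = - M" by (simp add: X_def)
      moreover have "- M \<le> X (Suc i)" using abs[of "Suc i"] M by (cases "i < p") (auto simp: X_def)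
      ultimately show ?thesis by simp
    qed
    fix i j k l
    assume *: "i \<le> p" "j \<le> q" "k \<le> p" "l \<le> q" "(i, j) \<noteq> (0, 0)" "(k, l) \<noteq> (0, 0)" "A k l < A i j"
    show "X k + y l < X i + y j"
      unfolding Xr(1)[OF *(1)] Xr(1)[OF *(3)]
      by (rule add) (use * Xr Ar in auto)
  qed
qed

section \<open>Enumerating cells by weight\<close>

lemma finite_down_closed:
  fixes K :: "nat set"
  assumes "finite K" "\<And>i j. j \<in> K \<Longrightarrow> i \<le> j \<Longrightarrow> i \<in> K"
  shows "K = {..<card K}"
proof -
  have "\<exists>m. K = {..<m}"
  proof (cases "K = {}")
    case False
    then have "Max K \<in> K" using assms(1) by (rule Max_in[rotated])
    then have "K = {..<Suc (Max K)}"
      using assms(2)[of "Max K"] Max_ge[OF assms(1)] by (auto simp: less_Suc_eq_le)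
    then show ?thesis by blast
  qed auto
  then show ?thesis by auto
qed

text \<open>The level sets of a decreasing sequence are initial segments, hence known from their
  sizes. Level 0 is left out, being infinite.\<close>

lemma antimono_eq_if_levels:
  fixes a b :: "nat \<Rightarrow> nat"
  assumes a: "antimono a" "finite {i. a i \<noteq> 0}" and b: "antimono b" "finite {i. b i \<noteq> 0}"
    and eq: "\<And>t. 1 \<le> t \<Longrightarrow> card {i. t \<le> a i} = card {i. t \<le> b i}"
  shows "a = b"
proof
  fix i
  have *: "{i. t \<le> c i} = {..<card {i. t \<le> c i}}" if c: "antimono c" "finite {i. c i \<noteq> 0}" "1 \<le> t" for c :: "nat \<Rightarrow> nat" and t
  proof (rule finite_down_closed)
    show "finite {i. t \<le> c i}" by (rule finite_subset[OF _ c(2)]) (use c(3) in auto)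
    show "i \<in> {i. t \<le> c i}" if "j \<in> {i. t \<le> c i}" "i \<le> j" for i j
      using that antimonoD[OF c(1), of i j] by auto
  qed
  have "{i. t \<le> a i} = {i. t \<le> b i}" if "1 \<le> t" for t
    by (rule trans[OF *[OF a that] trans[OF arg_cong[OF eq[OF that], where f = lessThan] *[OF b that, symmetric]]])
  then have "t \<le> a i \<longleftrightarrow> t \<le> b i" if "1 \<le> t" for t using that by blast
  from this[of "a i"] this[of "b i"] show "a i = b i" by (cases "a i = 0"; cases "b i = 0") auto
qed

text \<open>Larger entries have larger weights, so sorting the cells by weight also sorts their
  entries, and a decreasing sequence with the level counts of \<open>\<alpha>\<close> is
  \<open>\<alpha>\<close>.\<close>

lemma decreasing_enumeration:
  fixes W :: "'c \<Rightarrow> real" and a :: "'c \<Rightarrow> nat"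
  assumes Z: "finite Z" and add: "\<And>c c'. c \<in> Z \<Longrightarrow> c' \<in> Z \<Longrightarrow> a c' < a c \<Longrightarrow> W c' < W c"
    and al: "is_partition \<alpha>"
    and lev: "\<And>t. 1 \<le> t \<Longrightarrow> card {c \<in> Z. t \<le> a c} = card {k. t \<le> \<alpha> k}"
  obtains e where "bij_betw e {..<card Z} Z" "\<And>i j. i \<le> j \<Longrightarrow> j < card Z \<Longrightarrow> W (e j) \<le> W (e i)"
    "\<And>i. i < card Z \<Longrightarrow> a (e i) = \<alpha> i" "\<And>i. i \<ge> card Z \<Longrightarrow> \<alpha> i = 0"
proof -
  obtain zs0 where zs0: "set zs0 = Z" "distinct zs0" using finite_distinct_list[OF Z] by blast
  define zs where "zs = sort_key (\<lambda>c. - W c) zs0"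
  have zs: "set zs = Z" "distinct zs" "sorted (map (\<lambda>c. - W c) zs)" using zs0 by (simp_all add: zs_def)
  have len: "length zs = card Z" using distinct_card[OF zs(2)] zs(1) by simp
  define e where "e i = zs ! i" for i
  have bij: "bij_betw e {..<card Z} Z"
    unfolding e_def len[symmetric] using bij_betw_nth[OF zs(2) refl zs(1)[symmetric]] .
  have dec: "W (e j) \<le> W (e i)" if "i \<le> j" "j < card Z" for i j
    using sorted_nth_mono[OF zs(3), of i j] that len by (simp add: e_def)
  have eZ: "e i \<in> Z" if "i < card Z" for i using bij that by (auto simp: bij_betw_def)
  define b where "b i = (if i < card Z then a (e i) else 0)" for i
  have "b = \<alpha>"
  proof (rule antimono_eq_if_levels)
    show "antimono b"
    proof (rule antimonoI)
      fix i j :: nat assume "i \<le> j"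
      then show "b j \<le> b i"
        using add[of "e j" "e i"] dec[of i j] eZ[of i] eZ[of j] by (force simp: b_def not_less[symmetric])
    qed
    have "{i. b i \<noteq> 0} \<subseteq> {..<card Z}" by (auto simp: b_def)
    then show "finite {i. b i \<noteq> 0}" by (rule finite_subset) simp
    show "antimono \<alpha>" "finite {i. \<alpha> i \<noteq> 0}" using al by (auto simp: is_partition_def)
    fix t :: nat assume t: "1 \<le> t"
    have inj: "inj_on e {..<card Z}" and img: "e ` {..<card Z} = Z" using bij by (auto simp: bij_betw_def)
    have "{c \<in> Z. t \<le> a c} = e ` {i. t \<le> b i}"
    proof (intro equalityI subsetI)
      fix c assume "c \<in> {c \<in> Z. t \<le> a c}"
      moreover then obtain i where "i < card Z" "c = e i" using img by blast
      ultimately show "c \<in> e ` {i. t \<le> b i}" by (auto simp: b_def)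
    next
      fix c assume "c \<in> e ` {i. t \<le> b i}"
      then show "c \<in> {c \<in> Z. t \<le> a c}" using t eZ by (auto simp: b_def split: if_splits)
    qed
    moreover have "inj_on e {i. t \<le> b i}"
      by (rule inj_on_subset[OF inj]) (use t in \<open>auto simp: b_def split: if_splits\<close>)
    ultimately have "card {i. t \<le> b i} = card {c \<in> Z. t \<le> a c}" by (simp add: card_image)
    then show "card {i. t \<le> b i} = card {k. t \<le> \<alpha> k}" using lev[OF t] by simp
  qed
  have "a (e i) = \<alpha> i" if "i < card Z" for i using that fun_cong[OF \<open>b = \<alpha>\<close>, of i] by (simp add: b_def)
  moreover have "\<alpha> i = 0" if "i \<ge> card Z" for i using fun_cong[OF \<open>b = \<alpha>\<close>, of i] that by (simp add: b_def)
  ultimately show thesis using that[OF bij dec] by blast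
qed

text \<open>Counts of levels from 1 on see neither the order of the entries nor trailing zeros, so
  both the sorting and the padding of the \<pi>-sequence disappear.\<close>

lemma pi_sequence_levels:
  assumes A: "A \<in> carrier_mat (p + 1) (q + 1)" and pi: "pi_sequence_is A \<alpha>" and t: "1 \<le> t"
  shows "card {(i, j) \<in> {..p} \<times> {..q}. int t \<le> A $$ (i, j)} = card {k. t \<le> \<alpha> k}"
proof -
  let ?P = "\<lambda>v. int t \<le> v"
  let ?prod = "List.product [0..<p + 1] [0..<q + 1]"
  let ?xs = "map (\<lambda>c. A $$ c) ?prod"
  have xs: "[A $$ (i, j). i \<leftarrow> [0..<dim_row A], j \<leftarrow> [0..<dim_col A]] = ?xs"
    using A by (simp only: carrier_matD product_concat_map map_concat map_map comp_def)
  let ?pi = "pi_sequence A"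
  have "{k. t \<le> \<alpha> k} = {k. k < length ?pi \<and> ?P (?pi ! k)}"
  proof (intro Collect_cong)
    fix k
    have "(if k < length ?pi then ?pi ! k else 0) = int (\<alpha> k)" using pi unfolding pi_sequence_is_def by blast
    then show "t \<le> \<alpha> k \<longleftrightarrow> k < length ?pi \<and> ?P (?pi ! k)" using t by (auto split: if_splits)
  qed
  then have "card {k. t \<le> \<alpha> k} = length (filter ?P ?pi)" by (simp only: length_filter_conv_card)
  also have "\<dots> = size (filter_mset ?P (mset ?pi))" by (simp only: mset_filter[symmetric] size_mset)
  also have "mset ?pi = mset ?xs" unfolding pi_sequence_def xs by simp
  also have "size (filter_mset ?P (mset ?xs)) = length (filter ?P ?xs)" by (simp only: mset_filter[symmetric] size_mset)
  also have "\<dots> = length (filter (\<lambda>c. ?P (A $$ c)) ?prod)" by (simp only: filter_map length_map comp_def)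
  also have "\<dots> = card (set (filter (\<lambda>c. ?P (A $$ c)) ?prod))"
    by (rule distinct_card[symmetric]) (simp add: distinct_product)
  also have "set (filter (\<lambda>c. ?P (A $$ c)) ?prod) = {(i, j) \<in> {..p} \<times> {..q}. ?P (A $$ (i, j))}"
    by auto
  finally show ?thesis by simp
qed

section \<open>Stability of Heisenberg coefficients\<close>

text \<open>The matrix padded to indices up to \<open>N\<close>, with normalized weights, and an
  enumeration \<open>e\<close> of all cells but \<open>(0, 0)\<close> by decreasing weight;
  \<open>m\<close> is its last position. Monotonicity of \<open>X\<close> and \<open>Y\<close>
  starts at index 1, since index 0 has weight 0 and no prescribed sum.\<close>

locale additive_cells =
  fixes N m :: nat and X Y :: "nat \<Rightarrow> real" and a :: "nat \<times> nat \<Rightarrow> nat" and e :: "nat \<Rightarrow> nat \<times> nat"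
    and \<alpha> \<beta> \<gamma> :: "nat \<Rightarrow> nat"
  assumes X0: "X 0 = 0" and Y0: "Y 0 = 0"
    and X_dec: "\<And>i j. i \<le> j \<Longrightarrow> X (Suc j) \<le> X (Suc i)" and Y_dec: "\<And>i j. i \<le> j \<Longrightarrow> Y (Suc j) \<le> Y (Suc i)"
    and a00: "a (0, 0) = 0" and a_out: "\<And>i j. i > N \<or> j > N \<Longrightarrow> a (i, j) = 0"
    and a_row: "\<And>i. i < N \<Longrightarrow> (\<Sum>j\<le>N. a (Suc i, j)) = \<beta> i"
    and a_col: "\<And>j. j < N \<Longrightarrow> (\<Sum>i\<le>N. a (i, Suc j)) = \<gamma> j"
    and e_bij: "bij_betw e {..<Suc m} ({..N} \<times> {..N} - {(0, 0)})"
    and e_dec: "\<And>i j. i \<le> j \<Longrightarrow> j \<le> m \<Longrightarrow> X (fst (e j)) + Y (snd (e j)) \<le> X (fst (e i)) + Y (snd (e i))"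
    and e_alpha: "\<And>i. i \<le> m \<Longrightarrow> a (e i) = \<alpha> i"
    and e_add: "\<And>i j. i \<le> m \<Longrightarrow> j \<le> m \<Longrightarrow> \<alpha> j < \<alpha> i \<Longrightarrow>
      X (fst (e j)) + Y (snd (e j)) < X (fst (e i)) + Y (snd (e i))"
    and alpha: "is_partition \<alpha>" "\<forall>i\<ge>N. \<alpha> i = 0"
    and beta: "is_partition \<beta>" "\<forall>i\<ge>N. \<beta> i = 0"
    and gamma: "is_partition \<gamma>" "\<forall>i\<ge>N. \<gamma> i = 0"
    and adm: "admissible_sizes \<alpha> \<beta> \<gamma>"
    and Nm: "N \<le> m"
begin

abbreviation w :: "nat \<Rightarrow> real" where
  "w i \<equiv> X (fst (e i)) + Y (snd (e i))"

abbreviation shift :: "(nat \<Rightarrow> nat) \<Rightarrow> nat \<Rightarrow> (nat \<Rightarrow> nat) \<Rightarrow> nat \<Rightarrow> nat" where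
  "shift la n al \<equiv> (\<lambda>i. la i + n * al i)"

lemma e_inj: "inj_on e {..<Suc m}" and e_image: "e ` {..<Suc m} = {..N} \<times> {..N} - {(0, 0)}"
  using e_bij by (auto simp: bij_betw_def)

lemma sum_cells:
  fixes f :: "nat \<times> nat \<Rightarrow> 'b :: comm_monoid_add"
  assumes "f (0, 0) = 0"
  shows "(\<Sum>c\<in>{..N} \<times> {..N}. f c) = (\<Sum>i<Suc m. f (e i))"
proof -
  have "(\<Sum>c\<in>{..N} \<times> {..N}. f c) = (\<Sum>c\<in>{..N} \<times> {..N} - {(0, 0)}. f c)"
    using assms by (intro sum.mono_neutral_right) auto
  also have "\<dots> = (\<Sum>i<Suc m. f (e i))" by (rule sum.reindex_bij_betw[OF e_bij, symmetric])
  finally show ?thesis .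
qed

lemma a_total: "(\<Sum>c\<in>{..N} \<times> {..N}. a c) = psize \<alpha>"
proof -
  have "(\<Sum>c\<in>{..N} \<times> {..N}. a c) = (\<Sum>i<Suc m. \<alpha> i)"
    unfolding sum_cells[of a, OF a00] by (intro sum.cong refl) (simp add: e_alpha)
  also have "\<dots> = psize \<alpha>" using Nm alpha(2) by (intro psize_eq_sum[symmetric]) auto
  finally show ?thesis .
qed

text \<open>Because \<open>X 0 = Y 0 = 0\<close>, the unprescribed sums of row 0 and column 0 do not
  enter: the total weight is a function of the prescribed margins.\<close>

lemma sum_weights:
  fixes C :: "nat \<times> nat \<Rightarrow> int"
  assumes "C (0, 0) = 0"
    and r: "\<And>i. i < N \<Longrightarrow> (\<Sum>j\<le>N. C (Suc i, j)) = b i" and c: "\<And>j. j < N \<Longrightarrow> (\<Sum>i\<le>N. C (i, Suc j)) = d j"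
  shows "(\<Sum>i<Suc m. w i * real_of_int (C (e i))) =
    (\<Sum>i<N. X (Suc i) * real_of_int (b i)) + (\<Sum>j<N. Y (Suc j) * real_of_int (d j))"
proof -
  have split0: "(\<Sum>i\<le>N. f i) = f 0 + (\<Sum>i<N. f (Suc i))" for f :: "nat \<Rightarrow> real"
    by (simp only: lessThan_Suc_atMost[symmetric] sum.lessThan_Suc_shift)
  let ?f = "\<lambda>c. (X (fst c) + Y (snd c)) * real_of_int (C c)"
  have "(\<Sum>i<Suc m. w i * real_of_int (C (e i))) = (\<Sum>c\<in>{..N} \<times> {..N}. ?f c)"
    by (rule sum_cells[symmetric]) (simp add: assms(1))
  also have "\<dots> = (\<Sum>i\<le>N. \<Sum>j\<le>N. X i * real_of_int (C (i, j))) + (\<Sum>i\<le>N. \<Sum>j\<le>N. Y j * real_of_int (C (i, j)))"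
    by (simp only: sum.cartesian_product' fst_conv snd_conv distrib_right sum.distrib)
  also have "(\<Sum>i\<le>N. \<Sum>j\<le>N. X i * real_of_int (C (i, j))) = (\<Sum>i\<le>N. X i * real_of_int (\<Sum>j\<le>N. C (i, j)))"
    by (simp add: sum_distrib_left)
  also have "\<dots> = (\<Sum>i<N. X (Suc i) * real_of_int (b i))"
    unfolding split0 using r X0 by simp
  also have "(\<Sum>i\<le>N. \<Sum>j\<le>N. Y j * real_of_int (C (i, j))) = (\<Sum>j\<le>N. Y j * real_of_int (\<Sum>i\<le>N. C (i, j)))"
    by (subst sum.swap) (simp add: sum_distrib_left)
  also have "\<dots> = (\<Sum>j<N. Y (Suc j) * real_of_int (d j))"
    unfolding split0 using c Y0 by simp
  finally show ?thesis .
qed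

lemma shift_partition:
  assumes "is_partition la" "\<forall>i\<ge>N. la i = 0" "is_partition al" "\<forall>i\<ge>N. al i = 0"
  shows "is_partition (shift la n al)" "\<forall>i\<ge>N. shift la n al i = 0"
    "psize (shift la n al) = psize la + n * psize al"
proof -
  have z: "shift la n al i = 0" if "i \<ge> N" for i using that assms by simp
  then show "\<forall>i\<ge>N. shift la n al i = 0" by blast
  have "i < N" if "shift la n al i \<noteq> 0" for i using z[of i] that by (cases "i < N") auto
  then have "{i. shift la n al i \<noteq> 0} \<subseteq> {..<N}" by blast
  then have "finite {i. shift la n al i \<noteq> 0}" by (rule finite_subset) simp
  moreover have "antimono (shift la n al)"
    using assms(1,3) by (auto simp: is_partition_def antimono_def intro!: add_mono)
  ultimately show "is_partition (shift la n al)" by (simp add: is_partition_def)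
  show "psize (shift la n al) = psize la + n * psize al"
    using psize_eq_sum[of N "shift la n al"] psize_eq_sum[of N la] psize_eq_sum[of N al] z assms(2,4)
    by (simp add: sum.distrib sum_distrib_left)
qed

text \<open>Dominance is applied to the first \<open>k\<close> cells, and to these together with a
  cell \<open>i\<close> of the same weight as the \<open>k\<close>-th. Along \<open>e\<close> the
  entries of the matrix are exactly the parts of \<open>\<alpha>\<close>, so the multiples of
  \<open>n\<close> cancel and leave partial sums of \<open>la\<close>.\<close>

lemma dominated:
  fixes C :: "nat \<times> nat \<Rightarrow> int"
  assumes la: "is_partition la" "\<forall>i\<ge>N. la i = 0"
    and nz: "kos N (shift la n \<alpha>) (0, 0) (\<lambda>c. int (n * a c) + C c) \<noteq> 0"
  shows "\<And>k. k \<le> Suc m \<Longrightarrow> (\<Sum>j<k. real_of_int (C (e j))) \<le> real (psize la)"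
    and "\<And>i k. i \<le> m \<Longrightarrow> k \<le> i \<Longrightarrow> w k = w i \<Longrightarrow>
      (\<Sum>j<k. real_of_int (C (e j))) + real_of_int (C (e i)) \<le> real (psize la)"
proof -
  have part: "(\<Sum>i<k. int (la i)) \<le> int (psize la)" for k
  proof -
    have "(\<Sum>i<k. la i) \<le> (\<Sum>i<max N k. la i)" by (rule sum_mono2) auto
    also have "\<dots> = psize la" using la(2) by (intro psize_eq_sum[symmetric]) auto
    finally show ?thesis by (simp only: of_nat_sum[symmetric] of_nat_le_iff)
  qed
  have dom: "(\<Sum>j\<in>J. int (n * \<alpha> j) + C (e j)) \<le> (\<Sum>i<card J. int (shift la n \<alpha> i))"
    if J: "J \<subseteq> {..<Suc m}" for J
  proof -
    have inj: "inj_on e J" using e_inj J by (rule inj_on_subset)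
    have fin: "finite (e ` J)" using J finite_subset by blast
    have nz': "kostka N (shift la n \<alpha>) (0, 0) (\<lambda>c. int (n * a c) + C c) \<noteq> 0" using nz by (auto simp: kos_def)
    have "(\<Sum>c\<in>e ` J. int (n * a c) + C c) \<le> (\<Sum>i<card (e ` J). int (shift la n \<alpha> i))"
      by (rule kostka_dominance[OF shift_partition(1)[OF la alpha] _ nz' fin]) (use la(2) alpha(2) in simp)
    moreover have "(\<Sum>c\<in>e ` J. int (n * a c) + C c) = (\<Sum>j\<in>J. int (n * \<alpha> j) + C (e j))"
      unfolding sum.reindex[OF inj] comp_def using J e_alpha by (intro sum.cong refl) (auto simp: subset_iff less_Suc_eq_le)
    ultimately show ?thesis by (simp only: card_image[OF inj])
  qed
  show "(\<Sum>j<k. real_of_int (C (e j))) \<le> real (psize la)" if "k \<le> Suc m" for k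
  proof -
    have "(\<Sum>j<k. C (e j)) \<le> int (psize la)"
      using dom[of "{..<k}"] part[of k] that by (simp add: sum.distrib)
    then have "real_of_int (\<Sum>j<k. C (e j)) \<le> real_of_int (int (psize la))" by (rule of_int_le_iff[THEN iffD2])
    then show ?thesis by simp
  qed
  show "(\<Sum>j<k. real_of_int (C (e j))) + real_of_int (C (e i)) \<le> real (psize la)"
    if ik: "i \<le> m" "k \<le> i" "w k = w i" for i k
  proof -
    \<comment> \<open>Additivity excludes a smaller entry at equal weight, so cell \<open>i\<close>
      can stand in for cell \<open>k\<close> without changing the sum of parts of
      \<open>\<alpha>\<close>.\<close>
    have "\<not> \<alpha> i < \<alpha> k" using e_add[of k i] ik by auto
    moreover have "\<alpha> i \<le> \<alpha> k" using alpha(1) ik by (auto simp: is_partition_def antimono_def)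
    ultimately have eq: "\<alpha> i = \<alpha> k" by simp
    have "(\<Sum>j\<in>insert i {..<k}. int (n * \<alpha> j) + C (e j)) \<le> (\<Sum>j<Suc k. int (shift la n \<alpha> j))"
      using dom[of "insert i {..<k}"] ik by simp
    then have "(\<Sum>j<k. C (e j)) + C (e i) \<le> (\<Sum>j<Suc k. int (la j))"
      using ik eq by (simp add: sum.distrib)
    then have "(\<Sum>j<k. C (e j)) + C (e i) \<le> int (psize la)" using part[of "Suc k"] by linarith
    then have "real_of_int ((\<Sum>j<k. C (e j)) + C (e i)) \<le> real_of_int (int (psize la))" by (rule of_int_le_iff[THEN iffD2])
    then show ?thesis by simp
  qed
qed

lemma heisenberg_coeff_kos:
  assumes "is_partition la" "\<forall>i\<ge>N. la i = 0"
    and "is_partition mu" "\<forall>i\<ge>N. mu i = 0"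
    and "is_partition nu" "\<forall>i\<ge>N. nu i = 0"
    and "admissible_sizes la mu nu"
  shows "real (heisenberg_coeff la mu nu) =
    (\<Sum>s | s permutes {..<N}. \<Sum>t | t permutes {..<N}. of_int (sign s * sign t) *
      (\<Sum>B\<in>cell_contents N (psize la) (jt mu s) (jt nu t). kos N la (0, 0) B))"
proof -
  have "fact (psize la) * int (heisenberg_coeff la mu nu) =
    (\<Sum>s | s permutes {..<N}. \<Sum>t | t permutes {..<N}. sign s * sign t *
      (\<Sum>C\<in>cell_contents N (psize la) (jt mu s) (jt nu t). kostka N la (0, 0) C))" (is "_ = ?R")
    by (rule heisenberg_coeff_formula) (use assms in auto)
  then have "real_of_int (fact (psize la) * int (heisenberg_coeff la mu nu)) = real_of_int ?R" by (rule arg_cong)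
  then have *: "fact (psize la) * real (heisenberg_coeff la mu nu) = real_of_int ?R"
    by (simp only: of_int_mult of_int_fact of_int_of_nat_eq)
  have "real (heisenberg_coeff la mu nu) = real_of_int ?R / fact (psize la)"
    unfolding *[symmetric] by simp
  then show ?thesis
    by (simp only: kos_def sum_divide_distrib[symmetric] times_divide_eq_right of_int_sum of_int_mult)
qed

text \<open>
  Subtracting \<open>n * a\<close> from the contents that contribute to the \<open>n\<close>-th coefficient leaves one
  finite set of deviations: their total weight does not depend on \<open>n\<close>, so they are bounded.
\<close>

lemma ev_const_heisenberg_coeff:
  assumes la: "is_partition la" "\<forall>i\<ge>N. la i = 0"
    and mu: "is_partition mu" "\<forall>i\<ge>N. mu i = 0"
    and nu: "is_partition nu" "\<forall>i\<ge>N. nu i = 0"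
    and adm': "admissible_sizes la mu nu"
  shows "ev_const (\<lambda>n. heisenberg_coeff (shift la n \<alpha>) (shift mu n \<beta>) (shift nu n \<gamma>))"
proof -
  let ?P = "{s. s permutes {..<N}}"
  let ?CC = "\<lambda>n s t. cell_contents N (psize (shift la n \<alpha>)) (jt (shift mu n \<beta>) s) (jt (shift nu n \<gamma>) t)"
  note sh = shift_partition[OF la alpha] shift_partition[OF mu beta] shift_partition[OF nu gamma]
  have adm_n: "admissible_sizes (shift la n \<alpha>) (shift mu n \<beta>) (shift nu n \<gamma>)" for n
  proof -
    have "n * psize \<beta> \<le> n * psize \<alpha>" "n * psize \<gamma> \<le> n * psize \<alpha>" "n * psize \<alpha> \<le> n * (psize \<beta> + psize \<gamma>)"
      using adm by (auto simp: admissible_sizes_def)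
    moreover have "psize mu \<le> psize la" "psize nu \<le> psize la" "psize la \<le> psize mu + psize nu"
      using adm' by (auto simp: admissible_sizes_def)
    ultimately show ?thesis unfolding admissible_sizes_def sh(3) sh(6) sh(9) distrib_left by linarith
  qed
  have inner: "ev_const (\<lambda>n. \<Sum>B\<in>?CC n s t. kos N (shift la n \<alpha>) (0, 0) B)" for s t
  proof -
    \<comment> \<open>By \<open>sum_weights\<close>, the weight of every deviation with these
      margins, for all \<open>n\<close>.\<close>
    define T where "T = (\<Sum>i<N. X (Suc i) * real_of_int (jt mu s i)) + (\<Sum>j<N. Y (Suc j) * real_of_int (jt nu t j))"
    obtain M where M: "\<And>C i. (\<And>k. k \<le> Suc m \<Longrightarrow> (\<Sum>j<k. C j) \<le> real (psize la)) \<Longrightarrow>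
      (\<And>i k. i \<le> m \<Longrightarrow> k \<le> i \<Longrightarrow> w k = w i \<Longrightarrow> (\<Sum>j<k. C j) + C i \<le> real (psize la)) \<Longrightarrow>
      (\<Sum>j<Suc m. C j) = real (psize la) \<Longrightarrow> (\<Sum>j<Suc m. w j * C j) = T \<Longrightarrow> i \<le> m \<Longrightarrow> \<bar>C i\<bar> \<le> M"
      by (rule weighted_bound[of m w "real (psize la)" "real (psize la)" T, OF e_dec]) blast+
    define \<D> where "\<D> = {C :: nat \<times> nat \<Rightarrow> int. (\<forall>c. (c \<in> {..N} \<times> {..N} \<longrightarrow> C c \<in> {- \<lceil>\<bar>M\<bar>\<rceil>..\<lceil>\<bar>M\<bar>\<rceil>}) \<and>
        (c \<notin> {..N} \<times> {..N} \<longrightarrow> C c = 0)) \<and> C (0, 0) = 0 \<and>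
      (\<forall>i<N. (\<Sum>j\<le>N. C (Suc i, j)) = jt mu s i) \<and> (\<forall>j<N. (\<Sum>i\<le>N. C (i, Suc j)) = jt nu t j) \<and>
      (\<Sum>c\<in>{..N} \<times> {..N}. C c) = int (psize la)}"
    let ?sh = "\<lambda>n C c. int (n * a c) + C c"
    have jts: "jt (shift mu n \<beta>) s i = int (n * \<beta> i) + jt mu s i" "jt (shift nu n \<gamma>) t i = int (n * \<gamma> i) + jt nu t i" for n i
      by (simp_all add: jt_def)
    have arow: "(\<Sum>j\<le>N. int (n * a (Suc i, j))) = int (n * \<beta> i)" if "i < N" for n i
      unfolding a_row[OF that, symmetric] by (simp add: sum_distrib_left)
    have acol: "(\<Sum>i\<le>N. int (n * a (i, Suc j))) = int (n * \<gamma> j)" if "j < N" for n j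
      unfolding a_col[OF that, symmetric] by (simp add: sum_distrib_left)
    have atot: "(\<Sum>c\<in>{..N} \<times> {..N}. int (n * a c)) = int (n * psize \<alpha>)" for n
      unfolding a_total[symmetric] by (simp add: sum_distrib_left)
    have to: "?sh n C \<in> ?CC n s t" if C: "C \<in> \<D>" and nz: "kos N (shift la n \<alpha>) (0, 0) (?sh n C) \<noteq> 0" for n C
    proof -
      have "kostka N (shift la n \<alpha>) (0, 0) (?sh n C) \<noteq> 0" using nz by (auto simp: kos_def)
      then have "0 \<le> ?sh n C c" for c by (rule kostka_nonneg)
      moreover have "?sh n C (i, j) = 0" if "i > N \<or> j > N" for i j
      proof -
        have "(i, j) \<notin> {..N} \<times> {..N}" using that by auto
        then have "C (i, j) = 0" using C unfolding \<D>_def by blast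
        then show ?thesis using a_out[OF that] by simp
      qed
      moreover have "C (0, 0) = 0" "\<forall>i<N. (\<Sum>j\<le>N. C (Suc i, j)) = jt mu s i" "\<forall>j<N. (\<Sum>i\<le>N. C (i, Suc j)) = jt nu t j"
        "(\<Sum>c\<in>{..N} \<times> {..N}. C c) = int (psize la)" using C unfolding \<D>_def by blast+
      ultimately show ?thesis
        unfolding cell_contents_def jts sh(3) using a00 arow acol atot by (auto simp only: mem_Collect_eq sum.distrib)
    qed
    have fro: "(\<lambda>c. B c - int (n * a c)) \<in> \<D>" if B: "B \<in> ?CC n s t" and nz: "kos N (shift la n \<alpha>) (0, 0) B \<noteq> 0" for n B
    proof -
      define C where "C = (\<lambda>c. B c - int (n * a c))"
      have BC: "B = (\<lambda>c. int (n * a c) + C c)" by (simp add: C_def)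
      note B' = B[unfolded cell_contents_def mem_Collect_eq]
      have C00: "C (0, 0) = 0" using B' a00 by (simp add: C_def)
      have row: "(\<Sum>j\<le>N. C (Suc i, j)) = jt mu s i" if "i < N" for i
        using B' that arow[OF that, of n] unfolding C_def sum_subtractf jts by auto
      have col: "(\<Sum>i\<le>N. C (i, Suc j)) = jt nu t j" if "j < N" for j
        using B' that acol[OF that, of n] unfolding C_def sum_subtractf jts by auto
      have tot: "(\<Sum>c\<in>{..N} \<times> {..N}. C c) = int (psize la)"
        using B' atot[of n] unfolding C_def sum_subtractf sh(3) by auto
      note dom = dominated[OF la nz[unfolded BC]]
      have out: "C c = 0" if "c \<notin> {..N} \<times> {..N}" for c
      proof (cases c)
        case (Pair i j)
        then have "i > N \<or> j > N" using that by auto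
        then show ?thesis using B' a_out[of i j] Pair by (auto simp: C_def)
      qed
      have e_tot: "(\<Sum>i<Suc m. real_of_int (C (e i))) = real (psize la)"
        using sum_cells[of C, OF C00] tot by (simp only: of_int_sum[symmetric] of_int_of_nat_eq)
      have e_T: "(\<Sum>i<Suc m. w i * real_of_int (C (e i))) = T"
        unfolding T_def by (rule sum_weights) (use C00 row col in auto)
      have bound: "\<bar>real_of_int (C (e i))\<bar> \<le> M" if "i \<le> m" for i
        by (rule M[of "\<lambda>i. real_of_int (C (e i))"]) (use dom e_tot e_T that in auto)
      have "C c \<in> {- \<lceil>\<bar>M\<bar>\<rceil>..\<lceil>\<bar>M\<bar>\<rceil>}" if "c \<in> {..N} \<times> {..N}" for c
      proof (cases "c = (0, 0)")
        case True
        then show ?thesis using C00 by simp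
      next
        case False
        then have "c \<in> e ` {..<Suc m}" unfolding e_image using that by simp
        then obtain i where i: "i < Suc m" "c = e i" by blast
        then have "\<bar>real_of_int (C c)\<bar> \<le> \<bar>M\<bar>" using bound[of i] by simp
        also have "\<dots> \<le> real_of_int \<lceil>\<bar>M\<bar>\<rceil>" by (rule le_of_int_ceiling)
        finally have "real_of_int \<bar>C c\<bar> \<le> of_int \<lceil>\<bar>M\<bar>\<rceil>" by (simp only: of_int_abs)
        then have "\<bar>C c\<bar> \<le> \<lceil>\<bar>M\<bar>\<rceil>" by (simp only: of_int_le_iff)
        then show ?thesis by auto
      qed
      then have "C \<in> \<D>" unfolding \<D>_def using C00 row col tot out by blast
      then show ?thesis by (simp only: C_def)
    qed
    \<comment> \<open>Only the nonzero terms correspond: an element of \<open>\<D>\<close> may lead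
      to a matrix with negative entries, whose Kostka number vanishes.\<close>
    have "(\<Sum>B\<in>?CC n s t. kos N (shift la n \<alpha>) (0, 0) B) = (\<Sum>C\<in>\<D>. kos N (shift la n \<alpha>) (0, 0) (?sh n C))" for n
    proof (rule sum.reindex_bij_witness_not_neutral[where j = "\<lambda>B c. B c - int (n * a c)" and i = "?sh n"
          and S' = "{B \<in> ?CC n s t. kos N (shift la n \<alpha>) (0, 0) B = 0}"
          and T' = "{C \<in> \<D>. kos N (shift la n \<alpha>) (0, 0) (?sh n C) = 0}"])
      have "\<D> \<subseteq> {C. \<forall>c. (c \<in> {..N} \<times> {..N} \<longrightarrow> C c \<in> {- \<lceil>\<bar>M\<bar>\<rceil>..\<lceil>\<bar>M\<bar>\<rceil>}) \<and> (c \<notin> {..N} \<times> {..N} \<longrightarrow> C c = 0)}"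
        by (auto simp: \<D>_def)
      then have "finite \<D>"
        by (rule finite_subset)
          (intro finite_set_of_finite_funs finite_cartesian_product finite_atMost finite_atLeastAtMost_int)
      then show "finite {C \<in> \<D>. kos N (shift la n \<alpha>) (0, 0) (?sh n C) = 0}" by simp
      show "finite {B \<in> ?CC n s t. kos N (shift la n \<alpha>) (0, 0) B = 0}" by simp
    qed (use to fro in auto)
    moreover have "ev_const (\<lambda>n. \<Sum>C\<in>\<D>. kos N (shift la n \<alpha>) (0, 0) (?sh n C))"
    proof (rule ev_const_sum)
      fix C assume C: "C \<in> \<D>"
      have "kos N (shift la n \<alpha>) (0, 0) (?sh n C) =
          kos (Suc m) (shift la n \<alpha>) 0 (window (Suc m) (\<lambda>i. int (n * \<alpha> i) + C (e i)))" for n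
      proof -
        have out: "?sh n C z = 0" if "z \<notin> e ` {..<Suc m}" for z
        proof (cases z)
          case (Pair i j)
          show ?thesis
          proof (cases "z = (0, 0)")
            case True
            then show ?thesis using a00 C by (simp add: \<D>_def)
          next
            case False
            then have z: "z \<notin> {..N} \<times> {..N}" using that e_image by blast
            then have "C z = 0" using C unfolding \<D>_def by blast
            then show ?thesis using z a_out[of i j] Pair by auto
          qed
        qed
        have "kostka N (shift la n \<alpha>) (0, 0) (?sh n C) =
            kostka N (shift la n \<alpha>) 0 (\<lambda>i. if i < Suc m then ?sh n C (e i) else 0)"
          by (rule kostka_rename[OF e_inj out])
        also have "(\<lambda>i. if i < Suc m then ?sh n C (e i) else 0) = window (Suc m) (\<lambda>i. int (n * \<alpha> i) + C (e i))"
          by (auto simp: window_def e_alpha fun_eq_iff less_Suc_eq_le)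
        \<comment> \<open>The recursion for contents works with one bound for parts and colors, so
          the bound on the parts is raised to the number of cells.\<close>
        also have "kostka N (shift la n \<alpha>) 0 \<dots> = kostka (Suc m) (shift la n \<alpha>) 0 \<dots>"
          by (rule kostka_indep) (use sh(1,2) Nm in auto)
        finally show ?thesis by (simp only: kos_def)
      qed
      moreover have "ev_const (\<lambda>n. kos (Suc m) (shift la n \<alpha>) 0 (window (Suc m) (\<lambda>i. int (n * \<alpha> i) + C (e i))))"
        by (rule ev_const_kos) (use la alpha Nm in auto)
      ultimately show "ev_const (\<lambda>n. kos N (shift la n \<alpha>) (0, 0) (?sh n C))" by (simp only:)
    qed
    ultimately show ?thesis by (simp only:)
  qed
  have "ev_const (\<lambda>n. \<Sum>s\<in>?P. \<Sum>t\<in>?P. of_int (sign s * sign t) * (\<Sum>B\<in>?CC n s t. kos N (shift la n \<alpha>) (0, 0) B))"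
    by (intro ev_const_sum ev_const_cmult inner)
  also have "(\<lambda>n. \<Sum>s\<in>?P. \<Sum>t\<in>?P. of_int (sign s * sign t) * (\<Sum>B\<in>?CC n s t. kos N (shift la n \<alpha>) (0, 0) B)) =
      (\<lambda>n. real (heisenberg_coeff (shift la n \<alpha>) (shift mu n \<beta>) (shift nu n \<gamma>)))"
    by (rule ext, rule heisenberg_coeff_kos[symmetric]) (use sh(1,2,4,5,7,8) adm_n in auto)
  finally have "ev_const (\<lambda>n. nat \<lfloor>real (heisenberg_coeff (shift la n \<alpha>) (shift mu n \<beta>) (shift nu n \<gamma>))\<rfloor>)"
    by (rule ev_const_comp[where h = "\<lambda>r. nat \<lfloor>r\<rfloor>"])
  then show ?thesis by simp
qed

lemma kos_a: "kos N \<alpha> (0, 0) (\<lambda>c. int (a c)) = 1"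
proof -
  have out: "int (a z) = 0" if "z \<notin> e ` {..<Suc m}" for z
  proof (cases z)
    case (Pair i j)
    have "z = (0, 0) \<or> i > N \<or> j > N" using that Pair unfolding e_image by auto
    then show ?thesis using a00 a_out[of i j] Pair by auto
  qed
  have "kostka N \<alpha> (0, 0) (\<lambda>c. int (a c)) = kostka N \<alpha> 0 (\<lambda>i. if i < Suc m then int (a (e i)) else 0)"
    by (rule kostka_rename[OF e_inj out])
  also have "(\<lambda>i. if i < Suc m then int (a (e i)) else 0) = (\<lambda>i. int (\<alpha> i))"
    using alpha(2) Nm by (auto simp: fun_eq_iff e_alpha)
  finally have "kos N \<alpha> (0, 0) (\<lambda>c. int (a c)) = kos N \<alpha> 0 (\<lambda>i. int (\<alpha> i))" by (simp only: kos_def)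
  then show ?thesis using kos_self[of \<alpha> N] alpha by simp
qed

text \<open>The deviation from \<open>a\<close> is treated as a shift by \<open>n = 1\<close> of the
  empty partition, so all bounds have \<open>\<Lambda> = 0\<close>. Its margins
  \<open>s - id\<close> and \<open>t - id\<close> have nonnegative weight, so
  \<open>weighted_defect\<close> leaves only nonpositive entries, and their total is 0.\<close>

lemma contributing_content:
  assumes s: "s permutes {..<N}" and t: "t permutes {..<N}"
    and B: "B \<in> cell_contents N (psize \<alpha>) (jt \<beta> s) (jt \<gamma> t)" and nz: "kos N \<alpha> (0, 0) B \<noteq> 0"
  shows "B = (\<lambda>c. int (a c))"
proof -
  define C where "C = (\<lambda>c. B c - int (a c))"
  note B' = B[unfolded cell_contents_def mem_Collect_eq]
  have BC: "B = (\<lambda>c. int (1 * a c) + C c)" by (simp add: C_def)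
  have C00: "C (0, 0) = 0" using B' a00 by (simp add: C_def)
  have row: "(\<Sum>j\<le>N. C (Suc i, j)) = int (s i) - int i" if "i < N" for i
    using B' that a_row[OF that, symmetric] unfolding C_def sum_subtractf by (simp add: jt_def)
  have col: "(\<Sum>i\<le>N. C (i, Suc j)) = int (t j) - int j" if "j < N" for j
    using B' that a_col[OF that, symmetric] unfolding C_def sum_subtractf by (simp add: jt_def)
  have tot: "(\<Sum>c\<in>{..N} \<times> {..N}. C c) = 0"
    using B' a_total[symmetric] unfolding C_def sum_subtractf by simp
  have zero: "is_partition (\<lambda>i. 0)" "psize (\<lambda>i. 0) = 0" by (simp_all add: is_partition_def psize_def antimono_def)
  have nz': "kos N (shift (\<lambda>i. 0) 1 \<alpha>) (0, 0) (\<lambda>c. int (1 * a c) + C c) \<noteq> 0" using nz unfolding BC by simp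
  have zero': "\<forall>i\<ge>N. (0 :: nat) = 0" by simp
  note dom = dominated[OF zero(1) zero' nz', unfolded zero(2) of_nat_0]
  have e_tot: "(\<Sum>i<Suc m. C (e i)) = 0" using sum_cells[of C, OF C00] tot by simp
  have "(\<Sum>i<Suc m. w i * real_of_int (C (e i))) =
      (\<Sum>i<N. X (Suc i) * real_of_int (int (s i) - int i)) + (\<Sum>j<N. Y (Suc j) * real_of_int (int (t j) - int j))"
    by (rule sum_weights) (use C00 row col in auto)
  also have "0 \<le> \<dots>"
    using decreasing_weights_perm_nonneg[of "\<lambda>i. X (Suc i)", OF X_dec s]
      decreasing_weights_perm_nonneg[of "\<lambda>i. Y (Suc i)", OF Y_dec t] by simp
  finally have T: "0 \<le> (\<Sum>i<Suc m. w i * real_of_int (C (e i)))" .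
  have e_tot': "(\<Sum>i<Suc m. real_of_int (C (e i))) = 0" using e_tot by (simp only: of_int_sum[symmetric] of_int_0)
  have le: "C (e i) \<le> 0" if i: "i \<le> m" for i
  proof -
    have "real_of_int (C (e i)) \<le> 0 \<or> (\<exists>k<m. w (Suc k) < w k \<and> (w k - w (Suc k)) * real_of_int (C (e i)) \<le>
        0 * (w 0 - w m) + w m * (\<Sum>j<Suc m. real_of_int (C (e j))) - (\<Sum>j<Suc m. w j * real_of_int (C (e j))))"
      by (rule weighted_defect) (use e_dec dom i in blast)+
    then show ?thesis
    proof (elim disjE exE conjE)
      fix k assume k: "w (Suc k) < w k" and "(w k - w (Suc k)) * real_of_int (C (e i)) \<le>
        0 * (w 0 - w m) + w m * (\<Sum>j<Suc m. real_of_int (C (e j))) - (\<Sum>j<Suc m. w j * real_of_int (C (e j)))"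
      then have "(w k - w (Suc k)) * real_of_int (C (e i)) \<le> 0" using T unfolding e_tot' by simp
      then show ?thesis using k by (simp add: mult_le_0_iff)
    qed simp
  qed
  have "(\<Sum>i<Suc m. - C (e i)) = 0" using e_tot by (simp only: sum_negf)
  then have "\<forall>i\<in>{..<Suc m}. - C (e i) = 0"
    by (subst (asm) sum_nonneg_eq_0_iff) (use le in auto)
  then have zeroC: "C c = 0" if "c \<in> e ` {..<Suc m}" for c using that by auto
  show ?thesis
  proof
    fix c show "B c = int (a c)"
    proof (cases "c \<in> e ` {..<Suc m}")
      case True
      then show ?thesis using zeroC by (simp add: C_def)
    next
      case False
      obtain i j where c: "c = (i, j)" by (cases c)
      have "c = (0, 0) \<or> i > N \<or> j > N" using False c unfolding e_image by auto
      then show ?thesis using B' a00 a_out[of i j] c by auto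
    qed
  qed
qed

text \<open>Only the matrix \<open>a\<close> contributes, with Kostka number 1. Its margins are
  \<open>\<beta>\<close> and \<open>\<gamma>\<close> themselves, which agree with
  \<open>jt \<beta> s\<close> and \<open>jt \<gamma> t\<close> for the identities alone, so the
  signs play no part.\<close>

lemma heisenberg_coeff_eq_1: "heisenberg_coeff \<alpha> \<beta> \<gamma> = 1"
proof -
  let ?P = "{s. s permutes {..<N}}"
  let ?CC = "\<lambda>s t. cell_contents N (psize \<alpha>) (jt \<beta> s) (jt \<gamma> t)"
  let ?a = "\<lambda>c. int (a c)"
  have mem: "?a \<in> ?CC s t \<longleftrightarrow> s = id \<and> t = id" if s: "s permutes {..<N}" and t: "t permutes {..<N}" for s t
  proof
    assume *: "?a \<in> ?CC s t"
    have "s i = i" if "i < N" for i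
    proof -
      have "(\<Sum>j\<le>N. ?a (Suc i, j)) = jt \<beta> s i" using * that unfolding cell_contents_def by blast
      then show ?thesis using a_row[OF that, symmetric] by (simp add: jt_def)
    qed
    moreover have "t j = j" if "j < N" for j
    proof -
      have "(\<Sum>i\<le>N. ?a (i, Suc j)) = jt \<gamma> t j" using * that unfolding cell_contents_def by blast
      then show ?thesis using a_col[OF that, symmetric] by (simp add: jt_def)
    qed
    moreover have "s i = i" "t i = i" if "\<not> i < N" for i
      using permutes_not_in[OF s, of i] permutes_not_in[OF t, of i] that by auto
    ultimately show "s = id \<and> t = id" by (metis eq_id_iff)
  next
    assume "s = id \<and> t = id"
    then show "?a \<in> ?CC s t"
      using a00 a_out a_row a_col a_total
      by (auto simp: cell_contents_def jt_def simp flip: of_nat_sum)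
  qed
  have inner: "(\<Sum>B\<in>?CC s t. kos N \<alpha> (0, 0) B) = (if s = id then if t = id then 1 else 0 else 0)"
    if s: "s permutes {..<N}" and t: "t permutes {..<N}" for s t
  proof -
    have "(\<Sum>B\<in>?CC s t. kos N \<alpha> (0, 0) B) = (\<Sum>B\<in>?CC s t. if B = ?a then 1 else 0)"
    proof (rule sum.cong[OF refl])
      fix B assume B: "B \<in> ?CC s t"
      show "kos N \<alpha> (0, 0) B = (if B = ?a then 1 else 0)"
      proof (cases "B = ?a")
        case True
        then show ?thesis using kos_a by simp
      next
        case False
        then have "kos N \<alpha> (0, 0) B = 0" using contributing_content[OF s t B] by blast
        then show ?thesis by (simp only: False if_False)
      qed
    qed
    also have "\<dots> = (if ?a \<in> ?CC s t then 1 else 0)" by (subst sum.delta) simp_all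
    finally show ?thesis using mem[OF s t] by simp
  qed
  have fin: "finite ?P" by (simp add: finite_permutations)
  have "real (heisenberg_coeff \<alpha> \<beta> \<gamma>) =
      (\<Sum>s\<in>?P. \<Sum>t\<in>?P. of_int (sign s * sign t) * (\<Sum>B\<in>?CC s t. kos N \<alpha> (0, 0) B))"
    by (rule heisenberg_coeff_kos) (use alpha beta gamma adm in auto)
  also have "\<dots> = (\<Sum>s\<in>?P. \<Sum>t\<in>?P. if t = id then if s = id then 1 else 0 else 0)"
    by (intro sum.cong refl) (simp add: inner sign_id)
  also have "\<dots> = (\<Sum>s\<in>?P. if s = id then 1 else 0)"
    by (intro sum.cong refl) (subst sum.delta, auto simp: fin permutes_id)
  also have "\<dots> = 1" by (subst sum.delta) (auto simp: fin permutes_id)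
  finally show ?thesis by simp
qed

end

theorem theorem4p7:
  fixes \<alpha> \<beta> \<gamma> :: "nat \<Rightarrow> nat" and p q :: nat
  assumes "is_partition \<alpha>" and "is_partition \<beta>" and "is_partition \<gamma>"
    and "admissible_sizes \<alpha> \<beta> \<gamma>"
    and "\<forall>i\<ge>p. \<beta> i = 0" and "\<forall>j\<ge>q. \<gamma> j = 0"
    and "\<exists>A \<in> H_matrices_pi p q \<beta> \<gamma> \<alpha>. H_additive A"
  shows "H_stable \<alpha> \<beta> \<gamma>"
proof -
  obtain A where A: "A \<in> H_matrices_pi p q \<beta> \<gamma> \<alpha>" and Aadd: "H_additive A" using assms(7) by blast
  have carrier: "A \<in> carrier_mat (p + 1) (q + 1)" and pi: "pi_sequence_is A \<alpha>"
    and rowA: "\<And>i. i < p \<Longrightarrow> (\<Sum>j\<le>q. A $$ (Suc i, j)) = int (\<beta> i)"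
    and colA: "\<And>j. j < q \<Longrightarrow> (\<Sum>i\<le>p. A $$ (i, Suc j)) = int (\<gamma> j)"
    using A by (auto simp: H_matrices_pi_def H_matrices_def)
  have dim: "dim_row A = p + 1" "dim_col A = q + 1" using carrier by auto
  obtain x y :: "nat \<Rightarrow> real" where xy: "x 0 = 0" "y 0 = 0"
    and addA: "\<forall>(i, j) \<in> {..<dim_row A} \<times> {..<dim_col A} - {(0, 0)}.
         \<forall>(k, l) \<in> {..<dim_row A} \<times> {..<dim_col A} - {(0, 0)}.
           A $$ (i, j) > A $$ (k, l) \<longrightarrow> x i + y j > x k + y l"
    using Aadd unfolding H_additive_def by blast
  have nonneg: "0 \<le> A $$ (i, j)" if "i \<le> p" "j \<le> q" for i j
    using Aadd that by (simp add: H_additive_def dim)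
  have A00: "A $$ (0, 0) = 0" using Aadd by (simp add: H_additive_def)
  define b where "b i j = nat (A $$ (i, j))" for i j
  have b: "int (b i j) = A $$ (i, j)" if "i \<le> p" "j \<le> q" for i j
    using nonneg[OF that] by (simp add: b_def)
  have b_add: "x k + y l < x i + y j"
    if "i \<le> p" "j \<le> q" "k \<le> p" "l \<le> q" "(i, j) \<noteq> (0, 0)" "(k, l) \<noteq> (0, 0)" "b k l < b i j" for i j k l
  proof -
    have "A $$ (k, l) < A $$ (i, j)" using b[of i j] b[of k l] that by linarith
    moreover have "(i, j) \<in> {..<dim_row A} \<times> {..<dim_col A} - {(0, 0)}"
      "(k, l) \<in> {..<dim_row A} \<times> {..<dim_col A} - {(0, 0)}" using that by (auto simp: dim)
    ultimately show ?thesis using addA by blast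
  qed
  have b_row: "(\<Sum>j\<le>q. b (Suc i) j) = \<beta> i" if "i < p" for i
  proof -
    have "int (\<Sum>j\<le>q. b (Suc i) j) = (\<Sum>j\<le>q. A $$ (Suc i, j))"
      unfolding of_nat_sum by (intro sum.cong refl b) (use that in auto)
    then show ?thesis using rowA[OF that] by linarith
  qed
  have b_col: "(\<Sum>i\<le>p. b i (Suc j)) = \<gamma> j" if "j < q" for j
  proof -
    have "int (\<Sum>i\<le>p. b i (Suc j)) = (\<Sum>i\<le>p. A $$ (i, Suc j))"
      unfolding of_nat_sum by (intro sum.cong refl b) (use that in auto)
    then show ?thesis using colA[OF that] by linarith
  qed
  have anti: "antimono \<beta>" "antimono \<gamma>" using assms(2,3) by (auto simp: is_partition_def)
  define Sx where "Sx = (\<Sum>i\<le>p. \<bar>x i\<bar>)"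
  define Sy where "Sy = (\<Sum>j\<le>q. \<bar>y j\<bar>)"
  \<comment> \<open>Cells of the matrix have weight at least \<open>- (Sx + Sy)\<close>, padded
    cells at most \<open>- M + (Sx + Sy)\<close>; this \<open>M\<close> puts the padding strictly
    below.\<close>
  define M where "M = 3 * (Sx + Sy) + 1"
  have S0: "0 \<le> Sx" "0 \<le> Sy" unfolding Sx_def Sy_def by (auto intro: sum_nonneg)
  obtain X where X: "X 0 = 0" "\<And>i. i > p \<Longrightarrow> X i = - M" "\<And>i. i \<le> p \<Longrightarrow> \<bar>X i\<bar> \<le> Sx"
      "\<And>i j. i \<le> j \<Longrightarrow> X (Suc j) \<le> X (Suc i)"
      "\<And>i j k l. i \<le> p \<Longrightarrow> j \<le> q \<Longrightarrow> k \<le> p \<Longrightarrow> l \<le> q \<Longrightarrow> (i, j) \<noteq> (0, 0) \<Longrightarrow> (k, l) \<noteq> (0, 0) \<Longrightarrow>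
        b k l < b i j \<Longrightarrow> X k + y l < X i + y j"
  proof (rule normalize_weights[of p q b x y \<beta> M])
    show "(\<Sum>i\<le>p. \<bar>x i\<bar>) \<le> M" using S0 by (simp add: M_def flip: Sx_def)
  qed (use b_add b_row anti xy in \<open>simp_all flip: Sx_def\<close>)
  obtain Y where Y: "Y 0 = 0" "\<And>i. i > q \<Longrightarrow> Y i = - M" "\<And>i. i \<le> q \<Longrightarrow> \<bar>Y i\<bar> \<le> Sy"
      "\<And>i j. i \<le> j \<Longrightarrow> Y (Suc j) \<le> Y (Suc i)"
      "\<And>j i l k. j \<le> q \<Longrightarrow> i \<le> p \<Longrightarrow> l \<le> q \<Longrightarrow> k \<le> p \<Longrightarrow> (j, i) \<noteq> (0, 0) \<Longrightarrow> (l, k) \<noteq> (0, 0) \<Longrightarrow>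
        b k l < b i j \<Longrightarrow> Y l + X k < Y j + X i"
  \<comment> \<open>The transpose is normalized against the row weights \<open>X\<close> just
    obtained, so that additivity holds for \<open>X\<close> and \<open>Y\<close> together.\<close>
  proof (rule normalize_weights[of q p "\<lambda>j i. b i j" y X \<gamma> M])
    show "(\<Sum>j\<le>q. \<bar>y j\<bar>) \<le> M" using S0 by (simp add: M_def flip: Sy_def)
    show "y l + X k < y j + X i" if "j \<le> q" "i \<le> p" "l \<le> q" "k \<le> p" "(j, i) \<noteq> (0, 0)" "(l, k) \<noteq> (0, 0)" "b k l < b i j" for j i l k
      using X(5)[of i j k l] that by (auto simp: add.commute)
  qed (use b_col anti xy in \<open>simp_all flip: Sy_def\<close>)
  define a where "a = (\<lambda>(i, j). if i \<le> p \<and> j \<le> q then b i j else 0)"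
  have a_add: "X (fst c') + Y (snd c') < X (fst c) + Y (snd c)"
    if c: "c \<noteq> (0, 0)" "c' \<noteq> (0, 0)" "a c' < a c" for c c'
  proof -
    obtain i j k l where ij: "c = (i, j)" "c' = (k, l)" by (cases c; cases c')
    have ir: "i \<le> p" "j \<le> q" using c ij by (auto simp: a_def split: if_splits)
    show ?thesis
    proof (cases "k \<le> p \<and> l \<le> q")
      case True
      then show ?thesis using Y(5)[of j i l k] ir c ij by (auto simp: a_def add.commute)
    next
      case False
      have up: "X k \<le> Sx" "Y l \<le> Sy"
        using X(2,3)[of k] Y(2,3)[of l] S0 by (cases "k \<le> p"; cases "l \<le> q"; auto simp: M_def)+
      have "X k = - M \<or> Y l = - M" using X(2)[of k] Y(2)[of l] False by (auto simp: not_le)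
      then have "X k + Y l \<le> - M + (Sx + Sy)" using up S0 by linarith
      moreover have "- (Sx + Sy) \<le> X i + Y j" using X(3)[OF ir(1)] Y(3)[OF ir(2)] by linarith
      ultimately show ?thesis using ij S0 by (simp add: M_def)
    qed
  qed
  have len: "\<exists>l. \<forall>i\<ge>l. \<kappa> i = 0" if "is_partition \<kappa>" for \<kappa>
    using partition_support[OF that] by (metis (mono_tags, lifting) lessThan_iff mem_Collect_eq not_less)
  have locale_at: "\<exists>m e. additive_cells N m X Y a e \<alpha> \<beta> \<gamma>"
    if N: "p \<le> N" "q \<le> N" "1 \<le> N" "\<forall>i\<ge>N. \<alpha> i = 0" for N
  proof -
    let ?Z = "{..N} \<times> {..N} - {(0, 0)}"
    \<comment> \<open>Of the cells with indices up to \<open>N\<close> all but \<open>(0, 0)\<close>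
      are enumerated; \<open>1 \<le> N\<close> makes their number positive, so that it is a
      successor.\<close>
    have cardZ: "card ?Z = Suc (N * N + 2 * N - 1)" using N(3) by (simp add: card_Diff_singleton)
    have lev: "card {c \<in> ?Z. t \<le> a c} = card {k. t \<le> \<alpha> k}" if t: "1 \<le> t" for t
    proof -
      \<comment> \<open>The padding and the cell \<open>(0, 0)\<close> carry 0, so they are
        invisible to levels from 1 on.\<close>
      have "{c \<in> ?Z. t \<le> a c} = {(i, j) \<in> {..p} \<times> {..q}. int t \<le> A $$ (i, j)}"
        using t N(1,2) A00 b by (auto simp: a_def b_def split: if_splits)
      then show ?thesis using pi_sequence_levels[OF carrier pi t] by simp
    qed
    obtain e where e: "bij_betw e {..<card ?Z} ?Z"
        "\<And>i j. i \<le> j \<Longrightarrow> j < card ?Z \<Longrightarrow> X (fst (e j)) + Y (snd (e j)) \<le> X (fst (e i)) + Y (snd (e i))"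
        "\<And>i. i < card ?Z \<Longrightarrow> a (e i) = \<alpha> i" "\<And>i. i \<ge> card ?Z \<Longrightarrow> \<alpha> i = 0"
    proof (rule decreasing_enumeration[of ?Z a "\<lambda>c. X (fst c) + Y (snd c)" \<alpha>])
      show "finite ?Z" by simp
      show "X (fst c') + Y (snd c') < X (fst c) + Y (snd c)" if "c \<in> ?Z" "c' \<in> ?Z" "a c' < a c" for c c'
        by (rule a_add) (use that in auto)
    qed (use assms(1) lev in auto)
    note e' = e[unfolded cardZ less_Suc_eq_le]
    have eZ: "e i \<noteq> (0, 0)" if "i \<le> N * N + 2 * N - 1" for i
      using bij_betwE[OF e'(1)] that by (auto simp: less_Suc_eq_le)
    have rowN: "(\<Sum>j\<le>N. a (Suc i, j)) = \<beta> i" if "i < N" for i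
    proof (cases "i < p")
      case True
      have "(\<Sum>j\<le>N. a (Suc i, j)) = (\<Sum>j\<le>q. a (Suc i, j))"
        by (rule sum.mono_neutral_right) (use N in \<open>auto simp: a_def\<close>)
      also have "\<dots> = (\<Sum>j\<le>q. b (Suc i) j)" using True by (simp add: a_def)
      finally show ?thesis using b_row[OF True] by simp
    next
      case False
      then show ?thesis using assms(5) by (simp add: a_def)
    qed
    have colN: "(\<Sum>i\<le>N. a (i, Suc j)) = \<gamma> j" if "j < N" for j
    proof (cases "j < q")
      case True
      have "(\<Sum>i\<le>N. a (i, Suc j)) = (\<Sum>i\<le>p. a (i, Suc j))"
        by (rule sum.mono_neutral_right) (use N in \<open>auto simp: a_def\<close>)
      also have "\<dots> = (\<Sum>i\<le>p. b i (Suc j))" using True by (simp add: a_def)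
      finally show ?thesis using b_col[OF True] by simp
    next
      case False
      then show ?thesis using assms(6) by (simp add: a_def)
    qed
    have "additive_cells N (N * N + 2 * N - 1) X Y a e \<alpha> \<beta> \<gamma>"
    proof
      show "X (fst (e j)) + Y (snd (e j)) < X (fst (e i)) + Y (snd (e i))"
        if "i \<le> N * N + 2 * N - 1" "j \<le> N * N + 2 * N - 1" "\<alpha> j < \<alpha> i" for i j
        by (rule a_add) (use that eZ e'(3) in auto)
      show "a (0, 0) = 0" using A00 by (simp add: a_def b_def)
      show "a (i, j) = 0" if "i > N \<or> j > N" for i j using that N by (auto simp: a_def)
      show "N \<le> N * N + 2 * N - 1" using N(3) by (cases N) auto
      show "\<forall>i\<ge>N. \<beta> i = 0" "\<forall>i\<ge>N. \<gamma> i = 0" using assms(5,6) N by auto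
    qed (use X(1,4) Y(1,4) rowN colN e' assms(1-4) N in auto)
    then show ?thesis by blast
  qed
  obtain l\<^sub>0 where l0: "\<forall>i\<ge>l\<^sub>0. \<alpha> i = 0" using len[OF assms(1)] by blast
  have "heisenberg_coeff \<alpha> \<beta> \<gamma> = 1"
  proof -
    obtain m e where "additive_cells (Suc (p + q + l\<^sub>0)) m X Y a e \<alpha> \<beta> \<gamma>"
      using locale_at[of "Suc (p + q + l\<^sub>0)"] l0 by auto
    then show ?thesis by (rule additive_cells.heisenberg_coeff_eq_1)
  qed
  moreover have "\<exists>c. \<forall>\<^sub>F n in sequentially.
      heisenberg_coeff (\<lambda>i. \<kappa> i + n * \<alpha> i) (\<lambda>i. \<mu> i + n * \<beta> i) (\<lambda>i. \<nu> i + n * \<gamma> i) = c"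
    if t: "is_partition \<kappa>" "is_partition \<mu>" "is_partition \<nu>" "admissible_sizes \<kappa> \<mu> \<nu>" for \<kappa> \<mu> \<nu>
  proof -
    obtain l\<^sub>1 l\<^sub>2 l\<^sub>3 where l: "\<forall>i\<ge>l\<^sub>1. \<kappa> i = 0" "\<forall>i\<ge>l\<^sub>2. \<mu> i = 0" "\<forall>i\<ge>l\<^sub>3. \<nu> i = 0"
      using len[OF t(1)] len[OF t(2)] len[OF t(3)] by blast
    \<comment> \<open>\<open>N\<close> must also exceed the lengths of the given triple.
      \<open>X\<close>, \<open>Y\<close> and \<open>a\<close> do not depend on it; only the
      enumeration is chosen anew.\<close>
    define N where "N = Suc (p + q + l\<^sub>0 + l\<^sub>1 + l\<^sub>2 + l\<^sub>3)"
    obtain m e where *: "additive_cells N m X Y a e \<alpha> \<beta> \<gamma>"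
      using locale_at[of N] l0 by (auto simp: N_def)
    have "ev_const (\<lambda>n. heisenberg_coeff (\<lambda>i. \<kappa> i + n * \<alpha> i) (\<lambda>i. \<mu> i + n * \<beta> i) (\<lambda>i. \<nu> i + n * \<gamma> i))"
      by (rule additive_cells.ev_const_heisenberg_coeff[OF *]) (use t l in \<open>auto simp: N_def\<close>)
    then show ?thesis by (simp only: ev_const_def)
  qed
  ultimately show ?thesis using assms(1-4) by (simp add: H_stable_def H_triple_def)
qed

end
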